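(* Each row of the following complex is an exact sequence: $$0\to\Sigma_0\xrightarrow{\operatorname{curl}}\mathbf V_0\xrightarrow{\operatorname{div}}Q_0\to0,$$ $$0\to\Sigma_I\xrightarrow{\operatorname{curl}}\mathbf V_I\xrightarrow{\operatorname{div}}Q_I\to0,$$ $$0\to\tilde\Sigma_E\xrightarrow{\operatorname{curl}}\tilde{\mathbf V}_E\xrightarrow{\operatorname{div}}\tilde Q_E\to0,$$ where the columns are direct sum decompositions: $\Sigma_0=\Sigma_I\oplus\tilde\Sigma_E$, $\mathbf V_0=\mathbf V_I\oplus\tilde{\mathbf V}_E$, $Q_0=Q_I\oplus\tilde Q_E$.
   Context: $\Omega\subset\mathbb R^2$ is a simply connected (bounded, open) polygon with boundary $\Gamma$. $\mathcal T$ is a partition of $\Omega$ into triangles such that the nonempty intersection of two distinct elements is a single common vertex or a single common edge of both, and $\rho_K\ge\kappa h_K$ for all $K\in\mathcal T$ ($h_K=\mathrm{diam}(K)$, $\rho_K$ the diameter of the largest inscribed circle, $\kappa>0$); $h=\max_Kh_K$. A corner vertex is an element vertex located at a vertex of the polygon $\Omega$; $\mathcal V_K$ is the set of vertices of $K$. $k\ge4$; $\mathcal P_m$ is the space of polynomials of total degree $\le m$. A piecewise polynomial is $C^r$ at a vertex if the derivatives of order $\le r$ of all its element restrictions at that vertex agree. $V=\{v\in H^1(\Omega): v|_K\in\mathcal P_k(K)\ \forall K,\ v\ C^1\text{ at noncorner vertices}\}$, $Q=\{q\in L^2(\Omega): q|_K\in\mathcal P_{k-1}(K)\ \forall K,\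 q\ C^0\text{ at noncorner vertices}\}$, $V_0=V\cap H^1_0(\Omega)$, $\mathbf V_0=V_0\times V_0$, $Q_0=Q\cap L^2_0(\Omega)$ ($L^2_0$: zero mean), $\Sigma_0=\{\phi\in H^2_0(\Omega):\phi|_K\in\mathcal P_{k+1}(K)\ \forall K,\ \phi\ C^2\text{ at noncorner vertices}\}$. $\operatorname{curl}\phi=(\partial_y\phi,-\partial_x\phi)^T$, $(\cdot,\cdot)$ is the $L^2(\Omega)$ inner product, $a(\mathbf u,\mathbf v)=(\nabla\mathbf u,\nabla\mathbf v)$. Interior spaces: $\Sigma_I=\{\phi\in\Sigma_0:\phi|_{\partial K}=\partial_n\phi|_{\partial K}=0\ \forall K\}$, $\mathbf V_I=\{\mathbf v\in\mathbf V_0:\mathbf v|_{\partial K}=\mathbf 0\ \forall K\}$, $Q_I=\{q\in Q_0:\int_Kq\,dx=0,\ q|_K(a)=0\ \forall a\in\mathcal V_K,\ \forall K\}$. Exterior spaces: $\tilde\Sigma_E=\{\phi\in\Sigma_0:a(\operatorname{curl}\phi,\operatorname{curl}\psi)=0\ \forall\psi\in\Sigma_I\}$, $\tilde Q_E=\{q\in Q_0:(q,r)=0\ \forall r\in Q_I\}$, $\tilde{\mathbf V}_E=\{\mathbf v\in\mathbf V_0:\operatorname{div}\mathbf v\in\tilde Q_E,\ a(\mathbf v,\operatorname{curl}\psi)=0\ \forall\psi\in\Sigma_I\}$. Standing assumption: the mesh is corner-split (roughly: every element has at most one edge on $\Gamma$), so that (known result) there is $\beta\in(0,1)$ such that for every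 $q\in Q_0$ there is $\mathbf v\in\mathbf V_0$ with $\operatorname{div}\mathbf v=q$ and $\|\mathbf v\|_{\mathbf H^1(\Omega)}\le\beta^{-1}\|q\|_{L^2(\Omega)}$. *)

theory Defs
  imports "HOL-Analysis.Analysis"
begin

section \<open>Lebesgue and Sobolev spaces\<close>

text \<open>
  Elements of function spaces are represented by functions on the whole plane, and two
  functions are identified when they agree almost everywhere on \<open>\<Omega>\<close>. The spaces below contain all
  representatives of their elements, and exactness and direct sums are formulated modulo this
  identification.
\<close>

type_synonym point = "real \<times> real"

definition ae_eq :: "point set \<Rightarrow> (point \<Rightarrow> 'a) \<Rightarrow> (point \<Rightarrow> 'a) \<Rightarrow> bool" where
  "ae_eq \<Omega> f g \<longleftrightarrow> (AE x in lebesgue_on \<Omega>. f x = g x)"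

definition L2 :: "point set \<Rightarrow> (point \<Rightarrow> real) set" where
  "L2 \<Omega> = {f. f \<in> borel_measurable (lebesgue_on \<Omega>) \<and> integrable (lebesgue_on \<Omega>) (\<lambda>x. (f x)\<^sup>2)}"

definition L2_inner :: "point set \<Rightarrow> (point \<Rightarrow> real) \<Rightarrow> (point \<Rightarrow> real) \<Rightarrow> real" where
  "L2_inner \<Omega> f g = (LINT x|lebesgue_on \<Omega>. f x * g x)"

definition L2_norm :: "point set \<Rightarrow> (point \<Rightarrow> real) \<Rightarrow> real" where
  "L2_norm \<Omega> f = sqrt (L2_inner \<Omega> f f)"

definition L2_zero_mean :: "point set \<Rightarrow> (point \<Rightarrow> real) set" where
  "L2_zero_mean \<Omega> = {q \<in> L2 \<Omega>. (LINT x|lebesgue_on \<Omega>. q x) = 0}"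

definition dir_deriv :: "point \<Rightarrow> (point \<Rightarrow> real) \<Rightarrow> point \<Rightarrow> real" where
  "dir_deriv e f x = frechet_derivative f (at x) e"

text \<open>A function is smooth iff all its iterated partial derivatives exist and are differentiable;
  \<open>Basis\<close> consists of the two coordinate directions \<open>(1, 0)\<close> and \<open>(0, 1)\<close>.\<close>

definition smooth :: "(point \<Rightarrow> real) \<Rightarrow> bool" where
  "smooth f \<longleftrightarrow> (\<forall>es. set es \<subseteq> Basis \<longrightarrow> foldr dir_deriv es f differentiable_on UNIV)"

definition test_functions :: "point set \<Rightarrow> (point \<Rightarrow> real) set" where
  "test_functions \<Omega> =
     {\<psi>. smooth \<psi> \<and> compact (closure {x. \<psi> x \<noteq> 0}) \<and> closure {x. \<psi> x \<noteq> 0} \<subseteq> \<Omega>}"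

definition has_weak_deriv ::
  "point set \<Rightarrow> point \<Rightarrow> (point \<Rightarrow> real) \<Rightarrow> (point \<Rightarrow> real) \<Rightarrow> bool" where
  "has_weak_deriv \<Omega> e f g \<longleftrightarrow> f \<in> L2 \<Omega> \<and> g \<in> L2 \<Omega> \<and>
     (\<forall>\<psi> \<in> test_functions \<Omega>. L2_inner \<Omega> f (dir_deriv e \<psi>) = - L2_inner \<Omega> g \<psi>)"

text \<open>The weak derivative is determined only up to a null set; an arbitrary representative is chosen.\<close>

definition weak_deriv :: "point set \<Rightarrow> point \<Rightarrow> (point \<Rightarrow> real) \<Rightarrow> point \<Rightarrow> real" where
  "weak_deriv \<Omega> e f = (SOME g. has_weak_deriv \<Omega> e f g)"

definition H1 :: "point set \<Rightarrow> (point \<Rightarrow> real) set" where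
  "H1 \<Omega> = {f \<in> L2 \<Omega>. \<forall>e \<in> Basis. \<exists>g. has_weak_deriv \<Omega> e f g}"

definition H2 :: "point set \<Rightarrow> (point \<Rightarrow> real) set" where
  "H2 \<Omega> = {f \<in> H1 \<Omega>. \<forall>e \<in> Basis. weak_deriv \<Omega> e f \<in> H1 \<Omega>}"

definition H1_norm :: "point set \<Rightarrow> (point \<Rightarrow> real) \<Rightarrow> real" where
  "H1_norm \<Omega> f = sqrt ((L2_norm \<Omega> f)\<^sup>2 + (\<Sum>e\<in>Basis. (L2_norm \<Omega> (weak_deriv \<Omega> e f))\<^sup>2))"

definition H2_norm :: "point set \<Rightarrow> (point \<Rightarrow> real) \<Rightarrow> real" where
  "H2_norm \<Omega> f = sqrt ((L2_norm \<Omega> f)\<^sup>2 + (\<Sum>e\<in>Basis. (H1_norm \<Omega> (weak_deriv \<Omega> e f))\<^sup>2))"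

definition H1_0 :: "point set \<Rightarrow> (point \<Rightarrow> real) set" where
  "H1_0 \<Omega> = {f \<in> H1 \<Omega>. \<forall>\<epsilon>>0. \<exists>\<psi> \<in> test_functions \<Omega>. H1_norm \<Omega> (\<lambda>x. f x - \<psi> x) < \<epsilon>}"

definition H2_0 :: "point set \<Rightarrow> (point \<Rightarrow> real) set" where
  "H2_0 \<Omega> = {f \<in> H2 \<Omega>. \<forall>\<epsilon>>0. \<exists>\<psi> \<in> test_functions \<Omega>. H2_norm \<Omega> (\<lambda>x. f x - \<psi> x) < \<epsilon>}"

definition curl :: "point set \<Rightarrow> (point \<Rightarrow> real) \<Rightarrow> point \<Rightarrow> point" where
  "curl \<Omega> \<phi> = (\<lambda>x. (weak_deriv \<Omega> (0, 1) \<phi> x, - weak_deriv \<Omega> (1, 0) \<phi> x))"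

definition divergence :: "point set \<Rightarrow> (point \<Rightarrow> point) \<Rightarrow> point \<Rightarrow> real" where
  "divergence \<Omega> v = (\<lambda>x. weak_deriv \<Omega> (1, 0) (fst \<circ> v) x + weak_deriv \<Omega> (0, 1) (snd \<circ> v) x)"

definition vec_H1_norm :: "point set \<Rightarrow> (point \<Rightarrow> point) \<Rightarrow> real" where
  "vec_H1_norm \<Omega> v = sqrt ((H1_norm \<Omega> (fst \<circ> v))\<^sup>2 + (H1_norm \<Omega> (snd \<circ> v))\<^sup>2)"

definition grad_inner :: "point set \<Rightarrow> (point \<Rightarrow> point) \<Rightarrow> (point \<Rightarrow> point) \<Rightarrow> real" where
  "grad_inner \<Omega> u v =
     (\<Sum>e\<in>Basis. L2_inner \<Omega> (weak_deriv \<Omega> e (fst \<circ> u)) (weak_deriv \<Omega> e (fst \<circ> v))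
              + L2_inner \<Omega> (weak_deriv \<Omega> e (snd \<circ> u)) (weak_deriv \<Omega> e (snd \<circ> v)))"


section \<open>Polygons and meshes\<close>

text \<open>\<open>vs\<close> lists the vertices of a simple closed polygonal curve in cyclic order; requiring
  consecutive triples not to be collinear makes each of them a genuine corner.\<close>

definition polygon_side :: "point list \<Rightarrow> nat \<Rightarrow> point set" where
  "polygon_side vs i = closed_segment (vs ! i) (vs ! (Suc i mod length vs))"

definition simple_closed_polygon :: "point list \<Rightarrow> bool" where
  "simple_closed_polygon vs \<longleftrightarrow> (let n = length vs in
     3 \<le> n \<and> distinct vs \<and>
     (\<forall>i<n. \<not> collinear {vs ! i, vs ! (Suc i mod n), vs ! ((i + 2) mod n)}) \<and>
     (\<forall>i<n. \<forall>j<n. i \<noteq> j \<longrightarrow> polygon_side vs i \<inter> polygon_side vs j =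
        {vs ! i, vs ! (Suc i mod n)} \<inter> {vs ! j, vs ! (Suc j mod n)}))"

definition polygon :: "point set \<Rightarrow> point list \<Rightarrow> bool" where
  "polygon \<Omega> vs \<longleftrightarrow> simple_closed_polygon vs \<and> open \<Omega> \<and> bounded \<Omega> \<and> \<Omega> \<noteq> {} \<and>
     frontier \<Omega> = (\<Union>i<length vs. polygon_side vs i)"

definition inscribed_diameter :: "point set \<Rightarrow> real" where
  "inscribed_diameter K = Sup {2 * r | r c. 0 \<le> r \<and> cball c r \<subseteq> K}"

text \<open>Elements are closed triangles.\<close>

definition mesh :: "point set \<Rightarrow> real \<Rightarrow> point set set \<Rightarrow> bool" where
  "mesh \<Omega> \<kappa> T \<longleftrightarrow> finite T \<and> (\<forall>K\<in>T. 2 simplex K) \<and> \<Union>T = closure \<Omega> \<and>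
     (\<forall>K\<in>T. \<forall>L\<in>T. K \<noteq> L \<longrightarrow> K \<inter> L \<noteq> {} \<longrightarrow>
        (\<exists>a. K \<inter> L = {a} \<and> a extreme_point_of K \<and> a extreme_point_of L) \<or>
        (K \<inter> L) edge_of K \<and> (K \<inter> L) edge_of L) \<and>
     (\<forall>K\<in>T. inscribed_diameter K \<ge> \<kappa> * diameter K)"

definition corner_split :: "point set \<Rightarrow> point set set \<Rightarrow> bool" where
  "corner_split \<Omega> T \<longleftrightarrow> (\<forall>K\<in>T. card {E. E edge_of K \<and> E \<subseteq> frontier \<Omega>} \<le> 1)"

definition noncorner_vertices :: "point list \<Rightarrow> point set set \<Rightarrow> point set" where
  "noncorner_vertices vs T = {a. \<exists>K\<in>T. a extreme_point_of K} - set vs"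


section \<open>Piecewise polynomials\<close>

definition polys :: "nat \<Rightarrow> (point \<Rightarrow> real) set" where
  "polys m = {p. \<exists>c :: nat \<Rightarrow> nat \<Rightarrow> real.
     p = (\<lambda>(x, y). \<Sum>i\<le>m. \<Sum>j\<le>m - i. c i j * x ^ i * y ^ j)}"

definition pw_poly :: "point set set \<Rightarrow> nat \<Rightarrow> (point \<Rightarrow> real) \<Rightarrow> bool" where
  "pw_poly T m f \<longleftrightarrow> (\<forall>K\<in>T. \<exists>p \<in> polys m. ae_eq K f p)"

text \<open>The element restriction of a piecewise polynomial, as the polynomial representing it on
  \<open>K\<close>; it can therefore be evaluated and differentiated at points of the boundary of \<open>K\<close>.\<close>

definition restr :: "point set \<Rightarrow> (point \<Rightarrow> real) \<Rightarrow> point \<Rightarrow> real" where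
  "restr K f = (THE p. p \<in> (\<Union>m. polys m) \<and> ae_eq K f p)"

definition partial :: "nat \<Rightarrow> nat \<Rightarrow> (point \<Rightarrow> real) \<Rightarrow> point \<Rightarrow> real" where
  "partial i j f = (dir_deriv (1, 0) ^^ i) ((dir_deriv (0, 1) ^^ j) f)"

definition C_at :: "nat \<Rightarrow> point set set \<Rightarrow> (point \<Rightarrow> real) \<Rightarrow> point \<Rightarrow> bool" where
  "C_at r T f a \<longleftrightarrow> (\<forall>K\<in>T. \<forall>L\<in>T. a extreme_point_of K \<longrightarrow> a extreme_point_of L \<longrightarrow>
     (\<forall>i j. i + j \<le> r \<longrightarrow> partial i j (restr K f) a = partial i j (restr L f) a))"


section \<open>Finite element spaces\<close>

definition V_space :: "point set \<Rightarrow> point list \<Rightarrow> point set set \<Rightarrow> nat \<Rightarrow> (point \<Rightarrow> real) set" where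
  "V_space \<Omega> vs T k =
     {v \<in> H1 \<Omega>. pw_poly T k v \<and> (\<forall>a \<in> noncorner_vertices vs T. C_at 1 T v a)}"

definition Q_space :: "point set \<Rightarrow> point list \<Rightarrow> point set set \<Rightarrow> nat \<Rightarrow> (point \<Rightarrow> real) set" where
  "Q_space \<Omega> vs T k =
     {q \<in> L2 \<Omega>. pw_poly T (k - 1) q \<and> (\<forall>a \<in> noncorner_vertices vs T. C_at 0 T q a)}"

definition V_0 :: "point set \<Rightarrow> point list \<Rightarrow> point set set \<Rightarrow> nat \<Rightarrow> (point \<Rightarrow> real) set" where
  "V_0 \<Omega> vs T k = V_space \<Omega> vs T k \<inter> H1_0 \<Omega>"

definition vec_V_0 :: "point set \<Rightarrow> point list \<Rightarrow> point set set \<Rightarrow> nat \<Rightarrow> (point \<Rightarrow> point) set" where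
  "vec_V_0 \<Omega> vs T k = {v. fst \<circ> v \<in> V_0 \<Omega> vs T k \<and> snd \<circ> v \<in> V_0 \<Omega> vs T k}"

definition Q_0 :: "point set \<Rightarrow> point list \<Rightarrow> point set set \<Rightarrow> nat \<Rightarrow> (point \<Rightarrow> real) set" where
  "Q_0 \<Omega> vs T k = Q_space \<Omega> vs T k \<inter> L2_zero_mean \<Omega>"

definition Sigma_0 :: "point set \<Rightarrow> point list \<Rightarrow> point set set \<Rightarrow> nat \<Rightarrow> (point \<Rightarrow> real) set" where
  "Sigma_0 \<Omega> vs T k =
     {\<phi> \<in> H2_0 \<Omega>. pw_poly T (k + 1) \<phi> \<and> (\<forall>a \<in> noncorner_vertices vs T. C_at 2 T \<phi> a)}"

text \<open>The orientation of the unit normal \<open>n\<close> to an edge \<open>E\<close> is immaterial below, since only the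
  vanishing of the normal derivative matters.\<close>

definition Sigma_I :: "point set \<Rightarrow> point list \<Rightarrow> point set set \<Rightarrow> nat \<Rightarrow> (point \<Rightarrow> real) set" where
  "Sigma_I \<Omega> vs T k = {\<phi> \<in> Sigma_0 \<Omega> vs T k. \<forall>K\<in>T.
     (\<forall>x \<in> frontier K. restr K \<phi> x = 0) \<and>
     (\<forall>E n. E edge_of K \<longrightarrow> norm n = 1 \<longrightarrow> (\<forall>y\<in>E. \<forall>z\<in>E. n \<bullet> (y - z) = 0) \<longrightarrow>
        (\<forall>x\<in>E. dir_deriv n (restr K \<phi>) x = 0))}"

definition V_I :: "point set \<Rightarrow> point list \<Rightarrow> point set set \<Rightarrow> nat \<Rightarrow> (point \<Rightarrow> point) set" where
  "V_I \<Omega> vs T k = {v \<in> vec_V_0 \<Omega> vs T k. \<forall>K\<in>T. \<forall>x \<in> frontier K.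
     restr K (fst \<circ> v) x = 0 \<and> restr K (snd \<circ> v) x = 0}"

definition Q_I :: "point set \<Rightarrow> point list \<Rightarrow> point set set \<Rightarrow> nat \<Rightarrow> (point \<Rightarrow> real) set" where
  "Q_I \<Omega> vs T k = {q \<in> Q_0 \<Omega> vs T k. \<forall>K\<in>T. (LINT x|lebesgue_on K. q x) = 0 \<and>
     (\<forall>a. a extreme_point_of K \<longrightarrow> restr K q a = 0)}"

definition Sigma_E :: "point set \<Rightarrow> point list \<Rightarrow> point set set \<Rightarrow> nat \<Rightarrow> (point \<Rightarrow> real) set" where
  "Sigma_E \<Omega> vs T k = {\<phi> \<in> Sigma_0 \<Omega> vs T k.
     \<forall>\<psi> \<in> Sigma_I \<Omega> vs T k. grad_inner \<Omega> (curl \<Omega> \<phi>) (curl \<Omega> \<psi>) = 0}"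

definition Q_E :: "point set \<Rightarrow> point list \<Rightarrow> point set set \<Rightarrow> nat \<Rightarrow> (point \<Rightarrow> real) set" where
  "Q_E \<Omega> vs T k = {q \<in> Q_0 \<Omega> vs T k. \<forall>r \<in> Q_I \<Omega> vs T k. L2_inner \<Omega> q r = 0}"

definition V_E :: "point set \<Rightarrow> point list \<Rightarrow> point set set \<Rightarrow> nat \<Rightarrow> (point \<Rightarrow> point) set" where
  "V_E \<Omega> vs T k = {v \<in> vec_V_0 \<Omega> vs T k. divergence \<Omega> v \<in> Q_E \<Omega> vs T k \<and>
     (\<forall>\<psi> \<in> Sigma_I \<Omega> vs T k. grad_inner \<Omega> v (curl \<Omega> \<psi>) = 0)}"


section \<open>Exact sequences and direct sums modulo null functions\<close>

definition fun_subspace :: "(point \<Rightarrow> 'a::real_vector) set \<Rightarrow> bool" where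
  "fun_subspace S \<longleftrightarrow> (\<lambda>x. 0) \<in> S \<and> (\<forall>f\<in>S. \<forall>g\<in>S. (\<lambda>x. f x + g x) \<in> S) \<and>
     (\<forall>c. \<forall>f\<in>S. (\<lambda>x. c *\<^sub>R f x) \<in> S)"

definition ae_linear :: "point set \<Rightarrow> (point \<Rightarrow> 'a::real_vector) set \<Rightarrow>
    ((point \<Rightarrow> 'a) \<Rightarrow> (point \<Rightarrow> 'b::real_vector)) \<Rightarrow> (point \<Rightarrow> 'b) set \<Rightarrow> bool" where
  "ae_linear \<Omega> A d B \<longleftrightarrow> (\<forall>f\<in>A. d f \<in> B) \<and>
     (\<forall>f\<in>A. \<forall>g\<in>A. ae_eq \<Omega> f g \<longrightarrow> ae_eq \<Omega> (d f) (d g)) \<and>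
     (\<forall>f\<in>A. \<forall>g\<in>A. ae_eq \<Omega> (d (\<lambda>x. f x + g x)) (\<lambda>x. d f x + d g x)) \<and>
     (\<forall>c. \<forall>f\<in>A. ae_eq \<Omega> (d (\<lambda>x. c *\<^sub>R f x)) (\<lambda>x. c *\<^sub>R d f x))"

text \<open>Exactness of \<open>0 \<rightarrow> A \<rightarrow> B \<rightarrow> C \<rightarrow> 0\<close> with maps \<open>d\<close> and \<open>d'\<close>; the last three conjuncts are
  injectivity of \<open>d\<close>, the kernel of \<open>d'\<close> being the image of \<open>d\<close>, and surjectivity of \<open>d'\<close>.\<close>

definition short_exact :: "point set \<Rightarrow>
    (point \<Rightarrow> 'a::real_vector) set \<Rightarrow> ((point \<Rightarrow> 'a) \<Rightarrow> (point \<Rightarrow> 'b)) \<Rightarrow>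
    (point \<Rightarrow> 'b::real_vector) set \<Rightarrow> ((point \<Rightarrow> 'b) \<Rightarrow> (point \<Rightarrow> 'c)) \<Rightarrow>
    (point \<Rightarrow> 'c::real_vector) set \<Rightarrow> bool" where
  "short_exact \<Omega> A d B d' C \<longleftrightarrow>
     fun_subspace A \<and> fun_subspace B \<and> fun_subspace C \<and>
     ae_linear \<Omega> A d B \<and> ae_linear \<Omega> B d' C \<and>
     (\<forall>a\<in>A. ae_eq \<Omega> (d a) (\<lambda>x. 0) \<longrightarrow> ae_eq \<Omega> a (\<lambda>x. 0)) \<and>
     (\<forall>b\<in>B. ae_eq \<Omega> (d' b) (\<lambda>x. 0) \<longleftrightarrow> (\<exists>a\<in>A. ae_eq \<Omega> (d a) b)) \<and>
     (\<forall>c\<in>C. \<exists>b\<in>B. ae_eq \<Omega> (d' b) c)"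

definition direct_sum :: "point set \<Rightarrow> (point \<Rightarrow> 'a::real_vector) set \<Rightarrow>
    (point \<Rightarrow> 'a) set \<Rightarrow> (point \<Rightarrow> 'a) set \<Rightarrow> bool" where
  "direct_sum \<Omega> S A B \<longleftrightarrow> fun_subspace S \<and> fun_subspace A \<and> fun_subspace B \<and>
     A \<subseteq> S \<and> B \<subseteq> S \<and>
     (\<forall>s\<in>S. \<exists>a\<in>A. \<exists>b\<in>B. ae_eq \<Omega> s (\<lambda>x. a x + b x)) \<and>
     (\<forall>a\<in>A. \<forall>b\<in>B. ae_eq \<Omega> a b \<longrightarrow> ae_eq \<Omega> a (\<lambda>x. 0))"

end

theory Submission
 imports Defs
begin

text \<open>
The proof rests on three facts about piecewise polynomials; the exterior sequence is what remains of
the full one after the interior one is split off. Surjectivity of the divergence onto the full space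
is the assumed inf-sup condition.

A divergence-free field has a potential. A piecewise polynomial in the closure of the test functions
extends by zero to a Lipschitz function on the plane (\<open>jump_estimate\<close>, \<open>hat_trace\<close>): a small bump
that slides across an edge changes its moment against the function at a bounded rate, so the function
has no jump there. The extended field has zero flux through every box, so integration along
horizontal lines gives a \<open>C\<^sup>1\<close> potential on the plane (\<open>plane_potential\<close>), and the potential is zero
outside the polygon because, by the Jordan curve theorem, the exterior is connected and has every
boundary point in its closure (\<open>polygon_exterior\<close>). Limits of test functions are recognised by an
explicit approximation (\<open>compatible_H1_0\<close>, \<open>compatible_H2_0\<close>): on the cells of a fine grid the function
is replaced by one of its own element polynomials, or by 0 if the cell leaves the domain, and the
pieces are blended by a partition of unity. At a point inside an element the approximation is
eventually exact, and its derivatives stay bounded, so dominated convergence applies.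

The divergence maps the bubbles of one triangle onto the polynomials of mean zero that vanish at the
vertices (\<open>local_surjectivity\<close>). A Bernstein polynomial of degree \<open>k\<close> that is zero on the boundary,
times the direction of an edge, has as divergence the difference of two neighbouring Bernstein
polynomials of degree \<open>k - 1\<close>. These differences connect all multi-indices except the vertices; the
vertex values exclude the remaining three, and the mean excludes the last constant.

Piecewise polynomials are finite-dimensional, so functionals on them are represented by semi-inner
products (\<open>riesz_representation\<close>). This gives the orthogonal complements of the interior spaces. A
field \<open>v\<close> is decomposed by decomposing its divergence, lifting the interior part of that by the
interior sequence, and projecting what remains on the curls of interior functions
(\<open>V_decomposition\<close>). The exterior sequence inherits its surjectivity from the full one, because the
interior part of a field whose divergence is exterior is divergence-free (\<open>exterior_row\<close>).
\<close>

(* Points are pairs; their components are addressed by fst and snd, so quantified points are not to be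
   split automatically. *)
declare split_paired_All [simp del] split_paired_Ex [simp del]

section \<open>Gradients\<close>

definition has_grad :: "(point => real) => real => real => point => bool" where
 "has_grad f a b z \<longleftrightarrow> (f has_derivative (%h. a * fst h + b * snd h)) (at z)"

lemma Basis_point: "(Basis :: point set) = {(1, 0), (0, 1)}"
 by (auto simp: Basis_prod_def)

lemma axis_directions: "(1, 0) \<in> (Basis :: point set)" "(0, 1) \<in> (Basis :: point set)"
 by (simp_all add: Basis_point)

text \<open>Short names for derivatives, in any direction and along the axes.\<close>

abbreviation "dd \<equiv> dir_deriv"
abbreviation "dx \<equiv> dir_deriv (1, 0)"
abbreviation "dy \<equiv> dir_deriv (0, 1)"

lemma has_grad_dir:
 assumes "has_grad f a b z"
 shows "dd e f z = a * fst e + b * snd e"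
 using frechet_derivative_at[OF assms[unfolded has_grad_def]]
 unfolding dir_deriv_def by metis

lemma has_grad_dir_fst: "has_grad f a b z ==> dx f z = a"
 and has_grad_dir_snd: "has_grad f a b z ==> dy f z = b"
 by (simp_all add: has_grad_dir)

lemma has_grad_const: "has_grad (%z. c) 0 0 z"
 unfolding has_grad_def by simp

lemma has_grad_fst: "has_grad fst 1 0 z"
 unfolding has_grad_def by (auto intro!: derivative_eq_intros)

lemma has_grad_snd: "has_grad snd 0 1 z"
 unfolding has_grad_def by (auto intro!: derivative_eq_intros)

lemma has_grad_add:
 "has_grad f a b z ==> has_grad g c d z ==> has_grad (%z. f z + g z) (a + c) (b + d) z"
 unfolding has_grad_def
 by (rule has_derivative_eq_rhs, erule (1) has_derivative_add) (auto simp: algebra_simps)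

lemma has_grad_mult:
 "has_grad f a b z ==> has_grad g c d z ==>
  has_grad (%z. f z * g z) (f z * c + a * g z) (f z * d + b * g z) z"
 unfolding has_grad_def
 by (rule has_derivative_eq_rhs, erule (1) has_derivative_mult) (auto simp: algebra_simps)

lemma has_grad_cmul: "has_grad f a b z ==> has_grad (%z. c * f z) (c * a) (c * b) z"
 using has_grad_mult[OF has_grad_const, of f a b z c] by simp

lemma has_grad_diff:
 "has_grad f a b z ==> has_grad g c d z ==> has_grad (%z. f z - g z) (a - c) (b - d) z"
 using has_grad_add[OF _ has_grad_cmul[of g c d z "-1"]] by simp

lemma has_grad_compose:
 assumes "has_grad f a b z" "(g has_real_derivative d) (at (f z))"
 shows "has_grad (%z. g (f z)) (d * a) (d * b) z"
 using has_derivative_compose[OF assms(1)[unfolded has_grad_def]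
   assms(2)[unfolded has_field_derivative_def]]
 unfolding has_grad_def by (simp add: algebra_simps)

lemma has_grad_local:
 assumes "has_grad f a b z" "open U" "z \<in> U" "\<And>w. w \<in> U ==> f w = g w"
 shows "has_grad g a b z"
 using assms unfolding has_grad_def
 by (meson has_derivative_transform_within_open)

lemma has_grad_continuous: "has_grad f a b z ==> isCont f z"
 unfolding has_grad_def by (rule has_derivative_continuous)

lemma has_grad_line:
 assumes "has_grad f a b (z + t *\<^sub>R d)"
 shows "((%s. f (z + s *\<^sub>R d)) has_real_derivative (a * fst d + b * snd d)) (at t)"
proof -
 have "((%s. z + s *\<^sub>R d) has_derivative (%s. s *\<^sub>R d)) (at t)"
  by (auto intro!: derivative_eq_intros)
 from has_derivative_compose[OF this assms[unfolded has_grad_def]]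
 show ?thesis unfolding has_field_derivative_def
  by (rule has_derivative_eq_rhs) (auto simp: algebra_simps fun_eq_iff)
qed

lemma has_grad_line_fst:
 assumes "has_grad f a b z"
 shows "((%s. f (s, snd z)) has_real_derivative a) (at (fst z))"
 using has_grad_line[of f a b "(0, snd z)" "fst z" "(1, 0)"] assms by simp

lemma has_grad_line_snd:
 assumes "has_grad f a b z"
 shows "((%s. f (fst z, s)) has_real_derivative b) (at (snd z))"
 using has_grad_line[of f a b "(fst z, 0)" "snd z" "(0, 1)"] assms by simp


section \<open>A class of smooth functions\<close>

text \<open>The functions \<open>exp (-1/t) / t\<^sup>m\<close>, extended by zero; a family closed under differentiation.\<close>

definition flat :: "nat => real => real" where
 "flat m t = (if t > 0 then exp (- (1 / t)) / t ^ m else 0)"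

lemma flat_nonneg: "0 \<le> flat m t"
 by (simp add: flat_def)

lemma flat_le:
 assumes t: "t > 0" shows "flat m t \<le> fact (m + 1) * t"
proof -
 have "(1 / t) ^ (m + 1) / fact (m + 1) \<le> (\<Sum>k<m + 2. (1 / t) ^ k / fact k)"
  using t by (intro member_le_sum) auto
 also have "\<dots> \<le> exp (1 / t)"
  unfolding exp_def scaleR_conv_of_real using t summable_exp[of "1 / t"]
  by (intro sum_le_suminf[THEN order_trans]) (auto simp: divide_inverse mult.commute)
 finally have "(1 / t) ^ (m + 1) \<le> fact (m + 1) * exp (1 / t)"
  by (simp only: pos_divide_le_eq[OF fact_gt_zero] mult.commute)
 then have "1 \<le> fact (m + 1) * exp (1 / t) * t ^ (m + 1)"
  using t by (simp add: power_one_over divide_le_eq del: power_Suc fact_Suc)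
 then have "exp (- (1 / t)) \<le> fact (m + 1) * t ^ (m + 1)"
  by (simp add: exp_minus inverse_eq_divide divide_le_eq mult_ac del: power_Suc fact_Suc)
 then show ?thesis using t by (simp add: flat_def field_simps)
qed

lemma flat_deriv: "(flat m has_real_derivative (flat (m + 2) t - real m * flat (m + 1) t)) (at t)"
proof (cases "t = 0")
 case False
 then consider "t > 0" | "t < 0" by linarith
 then show ?thesis
 proof cases
  case 1
  have "((%t. exp (- (1 / t)) / t ^ m) has_real_derivative
    (flat (m + 2) t - real m * flat (m + 1) t)) (at t)"
  proof -
   have "((%t. exp (- (1 / t)) / t ^ m) has_real_derivative
     ((exp (- (1 / t)) * (1 / t^2)) * t ^ m - exp (- (1 / t)) * (real m * t ^ (m - 1))) / (t ^ m * t ^ m)) (at t)"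
    using 1 by (auto intro!: derivative_eq_intros simp: power2_eq_square)
   also have "((exp (- (1 / t)) * (1 / t^2)) * t ^ m - exp (- (1 / t)) * (real m * t ^ (m - 1))) / (t ^ m * t ^ m)
     = flat (m + 2) t - real m * flat (m + 1) t"
    using 1 by (cases m) (auto simp: flat_def diff_divide_distrib power2_eq_square)
   finally show ?thesis .
  qed
  then show ?thesis
   by (rule has_field_derivative_transform_within_open[of _ _ _ "{0<..}"])
    (use 1 in \<open>auto simp: flat_def\<close>)
 next
  case 2
  have "((%t. 0) has_real_derivative (flat (m + 2) t - real m * flat (m + 1) t)) (at t)"
   using 2 by (simp add: flat_def)
  then show ?thesis
   by (rule has_field_derivative_transform_within_open[of _ _ _ "{..<0}"])
    (use 2 in \<open>auto simp: flat_def\<close>)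
 qed
next
 case True
 \<comment> \<open>The difference quotient of \<^term>\<open>flat m\<close> at 0 is \<^term>\<open>flat (m + 1)\<close>.\<close>
 have "((%s. fact (m + 2) * \<bar>s\<bar>) \<longlongrightarrow> 0) (at (0::real))"
  by (auto intro!: tendsto_eq_intros)
 then have "((%s. flat m s / s) \<longlongrightarrow> 0) (at 0)"
 proof (rule Lim_null_comparison[rotated])
  have "norm (flat m s / s) \<le> fact (m + 2) * \<bar>s\<bar>" for s
  proof (cases "s > 0")
   case True
   then have "flat m s / s = flat (m + 1) s" by (simp add: flat_def field_simps)
   then show ?thesis using flat_le[OF True, of "m + 1"] flat_nonneg[of "m + 1" s] True by auto
  next
   case False
   then show ?thesis by (simp only: flat_def if_False division_ring_divide_zero norm_zero div_0)
     (intro mult_nonneg_nonneg, auto simp del: fact_Suc)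
  qed
  then show "\<forall>\<^sub>F s in at 0. norm (flat m s / s) \<le> fact (m + 2) * \<bar>s\<bar>" by simp
 qed
 then show ?thesis using True by (simp add: has_field_derivative_iff flat_def)
qed

text \<open>Smoothness of all functions that occur below is checked by membership in this class, which has
induction and closure rules; smoothness itself has only a condition on all iterated derivatives.\<close>

inductive_set nice :: "(point => real) set" where
 nice_const: "(%z. c) \<in> nice"
| nice_fst: "fst \<in> nice"
| nice_snd: "snd \<in> nice"
| nice_add: "f \<in> nice ==> g \<in> nice ==> (%z. f z + g z) \<in> nice"
| nice_mult: "f \<in> nice ==> g \<in> nice ==> (%z. f z * g z) \<in> nice"
| nice_inverse: "f \<in> nice ==> (\<And>z. f z \<noteq> 0) ==> (%z. inverse (f z)) \<in> nice"
| nice_flat: "f \<in> nice ==> (%z. flat m (f z)) \<in> nice"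

lemma nice_cmul: "f \<in> nice ==> (%z. c * f z) \<in> nice"
 by (intro nice_mult nice_const)

lemma nice_diff: "f \<in> nice ==> g \<in> nice ==> (%z. f z - g z) \<in> nice"
 using nice_add[OF _ nice_cmul[of g "-1"]] by simp

lemma nice_sum: "(\<And>i. i \<in> I ==> f i \<in> nice) ==> (%z. \<Sum>i\<in>I. f i z) \<in> nice"
 by (induction I rule: infinite_finite_induct) (auto intro: nice_const nice_add)

lemma nice_power: "f \<in> nice ==> (%z. f z ^ n) \<in> nice"
 by (induction n) (auto intro: nice_const nice_mult)

text \<open>The class is closed under partial derivatives, because those of \<^const>\<open>flat\<close> are again
 combinations of members of the family; hence all its members are smooth.\<close>

lemma nice_has_grad_ex:
 "f \<in> nice ==> \<exists>fx\<in>nice. \<exists>fy\<in>nice. \<forall>z. has_grad f (fx z) (fy z) z"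
proof (induction rule: nice.induct)
 case (nice_const c)
 show ?case using has_grad_const nice.nice_const[of 0] by (intro bexI[of _ "%z. 0"]) auto
next
 case nice_fst
 show ?case using has_grad_fst nice.nice_const by (intro bexI[of _ "%z. 1"] bexI[of _ "%z. 0"]) auto
next
 case nice_snd
 show ?case using has_grad_snd nice.nice_const by (intro bexI[of _ "%z. 1"] bexI[of _ "%z. 0"]) auto
next
 case (nice_add f g)
 then obtain fx fy gx gy where *: "fx \<in> nice" "fy \<in> nice" "gx \<in> nice" "gy \<in> nice"
  "\<And>z. has_grad f (fx z) (fy z) z" "\<And>z. has_grad g (gx z) (gy z) z" by blast
 have "\<forall>z. has_grad (%z. f z + g z) (fx z + gx z) (fy z + gy z) z"
  using has_grad_add *(5,6) by blast
 then show ?case using * nice.nice_add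
  by (intro bexI[of _ "%z. fx z + gx z"] bexI[of _ "%z. fy z + gy z"]) auto
next
 case (nice_mult f g)
 then obtain fx fy gx gy where *: "fx \<in> nice" "fy \<in> nice" "gx \<in> nice" "gy \<in> nice"
  "\<And>z. has_grad f (fx z) (fy z) z" "\<And>z. has_grad g (gx z) (gy z) z" by blast
 have "\<forall>z. has_grad (%z. f z * g z) (f z * gx z + fx z * g z) (f z * gy z + fy z * g z) z"
  using has_grad_mult *(5,6) by blast
 then show ?case using * nice_mult.hyps nice.nice_mult nice.nice_add
  by (intro bexI[of _ "%z. f z * gx z + fx z * g z"] bexI[of _ "%z. f z * gy z + fy z * g z"]) auto
next
 case (nice_inverse f)
 then obtain fx fy where *: "fx \<in> nice" "fy \<in> nice" "\<And>z. has_grad f (fx z) (fy z) z" by blast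
 let ?i = "%z. (-1) * (inverse (f z) * inverse (f z))"
 have i: "?i \<in> nice"
  using nice_inverse.hyps by (intro nice_cmul nice.nice_mult nice.nice_inverse) auto
 have "has_grad (%z. inverse (f z)) (?i z * fx z) (?i z * fy z) z" for z
 proof -
  have "(inverse has_real_derivative ?i z) (at (f z))"
   using nice_inverse.hyps(2)[of z] by (auto intro!: derivative_eq_intros)
  then show ?thesis by (rule has_grad_compose[OF *(3)])
 qed
 then show ?case
  by (intro bexI[of _ "%z. ?i z * fx z"] bexI[of _ "%z. ?i z * fy z"] allI
    nice.nice_mult[OF i] *)
next
 case (nice_flat f m)
 then obtain fx fy where *: "fx \<in> nice" "fy \<in> nice" "\<And>z. has_grad f (fx z) (fy z) z" by blast
 let ?i = "%z. flat (m + 2) (f z) - real m * flat (m + 1) (f z)"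
 have i: "?i \<in> nice"
  using nice_flat.hyps by (intro nice_diff nice_cmul nice.nice_flat)
 have "has_grad (%z. flat m (f z)) (?i z * fx z) (?i z * fy z) z" for z
  by (rule has_grad_compose[OF *(3) flat_deriv])
 then show ?case
  by (intro bexI[of _ "%z. ?i z * fx z"] bexI[of _ "%z. ?i z * fy z"] allI
    nice.nice_mult[OF i] *)
qed

lemma nice_dir_deriv_basis:
 assumes "f \<in> nice"
 shows nice_dx: "dx f \<in> nice" and nice_dy: "dy f \<in> nice"
  and nice_has_grad: "has_grad f (dx f z) (dy f z) z"
proof -
 obtain fx fy where *: "fx \<in> nice" "fy \<in> nice" "\<And>z. has_grad f (fx z) (fy z) z"
  using nice_has_grad_ex[OF assms] by blast
 then have "dx f = fx" "dy f = fy"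
  using has_grad_dir_fst[OF *(3)] has_grad_dir_snd[OF *(3)] by auto
 with * show "dx f \<in> nice" "dy f \<in> nice"
  "has_grad f (dx f z) (dy f z) z" by auto
qed

lemma nice_dir_deriv: "f \<in> nice ==> e \<in> Basis ==> dd e f \<in> nice"
 unfolding Basis_point by (auto intro: nice_dx nice_dy)

lemma nice_continuous: "f \<in> nice ==> continuous_on A f"
 by (meson has_grad_continuous continuous_at_imp_continuous_on nice_has_grad)

lemma nice_smooth:
 assumes "f \<in> nice" shows "smooth f"
proof -
 have *: "foldr dd es f \<in> nice" if "set es \<subseteq> Basis" for es
  using that assms by (induction es) (auto intro: nice_dir_deriv)
 have "g differentiable_on UNIV" if "g \<in> nice" for g
  using nice_has_grad[OF that] unfolding differentiable_on_def has_grad_def differentiable_def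
  by blast
 then show ?thesis unfolding smooth_def using * by blast
qed

lemma smooth_has_grad:
 assumes "smooth f"
 shows "has_grad f (dx f z) (dy f z) z"
proof -
 have "foldr dd [] f differentiable_on UNIV" using assms unfolding smooth_def
  by (elim allE[of _ "[]"]) simp
 then have "f differentiable at z" by (simp add: differentiable_on_def)
 then have 1: "(f has_derivative frechet_derivative f (at z)) (at z)"
  using frechet_derivative_works by blast
 then have l: "linear (frechet_derivative f (at z))" by (rule has_derivative_linear)
 have "frechet_derivative f (at z) h =
   dx f z * fst h + dy f z * snd h" for h
 proof -
  have "h = fst h *\<^sub>R (1, 0) + snd h *\<^sub>R (0, 1)" by (simp add: prod_eq_iff)
  then have "frechet_derivative f (at z) h = frechet_derivative f (at z) (fst h *\<^sub>R (1, 0) + snd h *\<^sub>R (0, 1))"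
   by simp
  also have "\<dots> = fst h * frechet_derivative f (at z) (1, 0) + snd h * frechet_derivative f (at z) (0, 1)"
   using l by (simp only: linear_add linear_scale real_scaleR_def)
  finally show ?thesis by (simp add: dir_deriv_def)
 qed
 then have "frechet_derivative f (at z) = (%h. dx f z * fst h + dy f z * snd h)"
  by blast
 then show ?thesis using 1 unfolding has_grad_def by simp
qed

lemma smooth_dir_deriv:
 assumes "smooth f" "e \<in> Basis" shows "smooth (dd e f)"
proof -
 have "foldr dd es (dd e f) differentiable_on UNIV" if "set es \<subseteq> Basis" for es
  using assms(1)[unfolded smooth_def, rule_format, of "es @ [e]"] that assms(2) by simp
 then show ?thesis unfolding smooth_def by blast
qed

lemma smooth_continuous: "smooth f ==> continuous_on A f"
 by (meson has_grad_continuous continuous_at_imp_continuous_on smooth_has_grad)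


section \<open>Polynomials in two variables\<close>

lemma polys_iff:
 "p \<in> polys m \<longleftrightarrow>
  (\<exists>c. \<forall>z. p z = (\<Sum>i\<le>m. \<Sum>j\<le>m - i. c i j * fst z ^ i * snd z ^ j))"
 unfolding polys_def by (auto simp: fun_eq_iff)

lemma polys_add: "p \<in> polys m ==> q \<in> polys m ==> (%z. p z + q z) \<in> polys m"
proof -
 assume "p \<in> polys m" "q \<in> polys m"
 then obtain c d where "\<forall>z. p z = (\<Sum>i\<le>m. \<Sum>j\<le>m - i. c i j * fst z ^ i * snd z ^ j)"
  "\<forall>z. q z = (\<Sum>i\<le>m. \<Sum>j\<le>m - i. d i j * fst z ^ i * snd z ^ j)" unfolding polys_iff by blast
 then show ?thesis unfolding polys_iff
  by (intro exI[of _ "%i j. c i j + d i j"]) (simp add: sum.distrib[symmetric] algebra_simps)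
qed

lemma polys_monomial:
 assumes "i + j \<le> m" shows "(%z. c * fst z ^ i * snd z ^ j) \<in> polys m"
 unfolding polys_iff
proof (intro exI allI)
 fix z :: point
 have "(\<Sum>a\<le>m. \<Sum>b\<le>m - a. (if a = i \<and> b = j then c else 0) * fst z ^ a * snd z ^ b)
   = (\<Sum>a\<le>m. if a = i then c * fst z ^ i * snd z ^ j else 0)"
 proof (rule sum.cong[OF refl])
  fix a assume "a \<in> {..m}"
  have "(\<Sum>b\<le>m - a. (if a = i \<and> b = j then c else 0) * fst z ^ a * snd z ^ b)
    = (\<Sum>b\<le>m - a. if b = j then (if a = i then c * fst z ^ i * snd z ^ j else 0) else 0)"
   by (rule sum.cong) auto
  also have "\<dots> = (if a = i then c * fst z ^ i * snd z ^ j else 0)"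
   using assms by (auto simp: sum.delta)
  finally show "(\<Sum>b\<le>m - a. (if a = i \<and> b = j then c else 0) * fst z ^ a * snd z ^ b)
    = (if a = i then c * fst z ^ i * snd z ^ j else 0)" .
 qed
 also have "\<dots> = c * fst z ^ i * snd z ^ j" using assms by (auto simp: sum.delta)
 finally show "c * fst z ^ i * snd z ^ j =
  (\<Sum>a\<le>m. \<Sum>b\<le>m - a. (if a = i \<and> b = j then c else 0) * fst z ^ a * snd z ^ b)" by simp
qed

lemma polys_const: "(%z. c) \<in> polys m"
 using polys_monomial[of 0 0 m c] by simp

lemma polys_induct [consumes 1, case_names mono add]:
 assumes "p \<in> polys m"
  and mono: "\<And>c i j. i + j \<le> m ==> P (%z. c * fst z ^ i * snd z ^ j)"
  and add: "\<And>p q. P p ==> P q ==> P (%z. p z + q z)"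
 shows "P p"
proof -
 have zero: "P (%z. 0)" using mono[of 0 0 0] by simp
 have sums: "P (%z. \<Sum>i\<in>I. f i z)" if "\<And>i. i \<in> I ==> P (f i)" for I and f :: "nat => point => real"
  using that by (induction I rule: infinite_finite_induct) (auto intro: zero add)
 obtain c where c: "\<forall>z. p z = (\<Sum>i\<le>m. \<Sum>j\<le>m - i. c i j * fst z ^ i * snd z ^ j)"
  using assms(1) unfolding polys_iff by blast
 have "P (%z. \<Sum>i\<le>m. \<Sum>j\<le>m - i. c i j * fst z ^ i * snd z ^ j)"
  by (intro sums mono) auto
 moreover have "(%z. \<Sum>i\<le>m. \<Sum>j\<le>m - i. c i j * fst z ^ i * snd z ^ j) = p" using c by auto
 ultimately show ?thesis by simp
qed

lemma polys_cmul: "p \<in> polys m ==> (%z. c * p z) \<in> polys m"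
proof (induction rule: polys_induct)
 case (mono d i j)
 then show ?case using polys_monomial[of i j m "c * d"] by (simp add: mult.assoc)
qed (simp add: polys_add distrib_left)

lemma polys_diff: "p \<in> polys m ==> q \<in> polys m ==> (%z. p z - q z) \<in> polys m"
 using polys_add[OF _ polys_cmul[of q m "-1"]] by simp

lemma polys_mono: "p \<in> polys m ==> m \<le> n ==> p \<in> polys n"
 by (induction rule: polys_induct) (auto intro: polys_monomial polys_add)

lemma polys_mult:
 assumes "p \<in> polys m" "q \<in> polys n" shows "(%z. p z * q z) \<in> polys (m + n)"
 using assms(1)
proof (induction rule: polys_induct)
 case m: (mono c i j)
 show ?case using assms(2)
 proof (induction rule: polys_induct)
  case (mono d a b)
  have "(%z. (c * d) * fst z ^ (i + a) * snd z ^ (j + b)) \<in> polys (m + n)"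
   using m mono by (intro polys_monomial) auto
  then show ?case by (simp add: power_add mult_ac)
 qed (simp add: polys_add distrib_left)
qed (simp add: polys_add distrib_right)

lemma polys_affine: "(%z. a * fst z + b * snd z + c) \<in> polys (Suc 0)"
 using polys_add[OF polys_add[OF polys_monomial[of 1 0 "Suc 0" a] polys_monomial[of 0 1 "Suc 0" b]]
   polys_const[of c]] by simp

lemma polys_nice: "p \<in> polys m ==> p \<in> nice"
 by (induction rule: polys_induct)
  (auto intro!: nice_mult nice_const nice_power nice_fst nice_snd nice_add)

lemma has_grad_monomial:
 "has_grad (%z. c * fst z ^ i * snd z ^ j)
  (c * real i * fst z ^ (i - 1) * snd z ^ j) (c * real j * fst z ^ i * snd z ^ (j - 1)) z"
 unfolding has_grad_def
 by (auto intro!: derivative_eq_intros simp: algebra_simps)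

lemma monomial_dx: "dx (%z. c * fst z ^ i * snd z ^ j)
  = (%z. (c * real i) * fst z ^ (i - 1) * snd z ^ j)"
 and monomial_dy: "dy (%z. c * fst z ^ i * snd z ^ j)
  = (%z. (c * real j) * fst z ^ i * snd z ^ (j - 1))"
 using has_grad_dir_fst[OF has_grad_monomial] has_grad_dir_snd[OF has_grad_monomial] by auto

lemma polys_has_grad:
 assumes "p \<in> polys m"
 shows "has_grad p (dx p z) (dy p z) z"
 by (rule nice_has_grad[OF polys_nice[OF assms]])

lemma dir_deriv_add:
 assumes "p \<in> polys m" "q \<in> polys n"
 shows dx_add: "dx (%z. p z + q z) = (%z. dx p z + dx q z)"
  and dy_add: "dy (%z. p z + q z) = (%z. dy p z + dy q z)"
 using has_grad_dir_fst[OF has_grad_add[OF polys_has_grad[OF assms(1)] polys_has_grad[OF assms(2)]]]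
  has_grad_dir_snd[OF has_grad_add[OF polys_has_grad[OF assms(1)] polys_has_grad[OF assms(2)]]]
 by auto

lemma polys_deriv:
 assumes "p \<in> polys m"
 shows polys_dx: "dx p \<in> polys (m - 1)"
  and polys_dy: "dy p \<in> polys (m - 1)"
  and polys_mixed: "dx (dy p) = dy (dx p)"
proof -
 have "p \<in> polys m \<and> dx p \<in> polys (m - 1) \<and> dy p \<in> polys (m - 1) \<and>
  dx (dy p) = dy (dx p)"
  using assms
 proof (induction rule: polys_induct)
  case (mono c i j)
  have "(%z. (c * real i) * fst z ^ (i - 1) * snd z ^ j) \<in> polys (m - 1)"
   using mono polys_monomial[of "i - 1" j "m - 1" "c * real i"] polys_const[of 0]
   by (cases "i = 0") auto
  moreover have "(%z. (c * real j) * fst z ^ i * snd z ^ (j - 1)) \<in> polys (m - 1)"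
   using mono polys_monomial[of i "j - 1" "m - 1" "c * real j"] polys_const[of 0]
   by (cases "j = 0") auto
  ultimately show ?case using polys_monomial[OF mono]
   unfolding monomial_dx monomial_dy by (simp add: mult_ac)
 next
  case (add p q)
  then have p: "p \<in> polys m" "dx p \<in> polys (m - 1)" "dy p \<in> polys (m - 1)"
   and q: "q \<in> polys m" "dx q \<in> polys (m - 1)" "dy q \<in> polys (m - 1)"
   by blast+
  show ?case
   unfolding dx_add[OF p(1) q(1)] dy_add[OF p(1) q(1)] dx_add[OF p(3) q(3)] dy_add[OF p(2) q(2)]
   using add p q by (simp add: polys_add)
 qed
 then show "dx p \<in> polys (m - 1)" "dy p \<in> polys (m - 1)"
  "dx (dy p) = dy (dx p)" by blast+
qed

lemma polys_dir_deriv: "p \<in> polys m ==> e \<in> Basis ==> dd e p \<in> polys (m - 1)"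
 unfolding Basis_point using polys_dx polys_dy by auto

lemma polys_antideriv_x:
 "p \<in> polys m ==> \<exists>A\<in>polys (m + 1). dx A = p"
proof (induction rule: polys_induct)
 case (mono c i j)
 then show ?case
  by (intro bexI[OF _ polys_monomial[of "i + 1" j "m + 1" "c / real (i + 1)"]])
   (auto simp only: monomial_dx, auto)
next
 case (add p q)
 then obtain A B where A: "A \<in> polys (m + 1)" "dx A = p"
  and B: "B \<in> polys (m + 1)" "dx B = q" by blast
 then show ?case using polys_add[OF A(1) B(1)] dx_add[OF A(1) B(1)]
  by (intro bexI[of _ "%z. A z + B z"]) auto
qed

lemma polys_antideriv_y:
 "p \<in> polys m ==> \<exists>A\<in>polys (m + 1). dy A = p"
proof (induction rule: polys_induct)
 case (mono c i j)
 then show ?case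
  by (intro bexI[OF _ polys_monomial[of i "j + 1" "m + 1" "c / real (j + 1)"]])
   (auto simp only: monomial_dy, auto)
next
 case (add p q)
 then obtain A B where A: "A \<in> polys (m + 1)" "dy A = p"
  and B: "B \<in> polys (m + 1)" "dy B = q" by blast
 then show ?case using polys_add[OF A(1) B(1)] dy_add[OF A(1) B(1)]
  by (intro bexI[of _ "%z. A z + B z"]) auto
qed

lemma polys_on_line:
 "p \<in> polys m ==> \<exists>q. \<forall>t. p (z + t *\<^sub>R d) = poly q t"
proof (induction rule: polys_induct)
 case (mono c i j)
 show ?case
  by (rule exI[of _ "smult c ([:fst z, fst d:] ^ i * [:snd z, snd d:] ^ j)"])
   (simp add: algebra_simps)
next
 case (add p q)
 then show ?case by (metis poly_add)
qed

lemma polys_line_zero: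
 assumes "p \<in> polys m" "infinite {t. p (z + t *\<^sub>R d) = 0}"
 shows "p (z + t *\<^sub>R d) = 0"
proof -
 obtain q where q: "\<And>t. p (z + t *\<^sub>R d) = poly q t" using polys_on_line[OF assms(1)] by metis
 then have "q = 0" using assms(2) poly_roots_finite[of q] by auto
 then show ?thesis using q by simp
qed

text \<open>Restriction to lines through an interior point of the zero set reduces this to the fact that
 a polynomial in one variable has finitely many zeros.\<close>

lemma polys_zero_open:
 assumes "p \<in> polys m" "open U" "z \<in> U" "\<And>w. w \<in> U ==> p w = 0"
 shows "p w = 0"
proof -
 obtain e where e: "e > 0" "ball z e \<subseteq> U" using assms openE by blast
 let ?r = "e / (norm (w - z) + 1)"
 have "?r > 0" using e by (simp add: add_nonneg_pos)
 have "p (z + t *\<^sub>R (w - z)) = 0" if "t \<in> {0<..<?r}" for t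
 proof -
  have "norm (t *\<^sub>R (w - z)) \<le> t * (norm (w - z) + 1)" using that by (auto simp: mult_left_mono)
  also have "\<dots> < e" using that e by (subst pos_less_divide_eq[symmetric]) (auto simp: add_nonneg_pos)
  finally have "z + t *\<^sub>R (w - z) \<in> ball z e" by (simp add: dist_norm)
  then show ?thesis using assms(4) e(2) by blast
 qed
 then have "{0<..<?r} \<subseteq> {t. p (z + t *\<^sub>R (w - z)) = 0}" by blast
 then have "infinite {t. p (z + t *\<^sub>R (w - z)) = 0}"
  using \<open>?r > 0\<close> infinite_Ioo infinite_super by blast
 from polys_line_zero[OF assms(1) this, of 1] show ?thesis by simp
qed

lemma polys_restrict_y: "p \<in> polys m ==> (%z. p (0, snd z)) \<in> polys m"
proof (induction rule: polys_induct)
 case (mono c i j)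
 then show ?case using polys_monomial[of 0 j m "c * 0 ^ i"] by simp
qed (simp add: polys_add)

text \<open>A gradient field with polynomial entries of degree \<open>m\<close> has a potential of degree \<open>m + 1\<close>:
 integrate the first entry in \<open>x\<close>; what is then missing in the second entry depends on \<open>y\<close> only.\<close>

lemma polys_potential:
 assumes u: "u \<in> polys m" and w: "w \<in> polys m"
  and closed: "dy u = dx w"
 shows "\<exists>p\<in>polys (m + 1). dx p = u \<and> dy p = w"
proof -
 obtain A where A: "A \<in> polys (m + 1)" "dx A = u" using polys_antideriv_x[OF u] by blast
 define r where "r = (%z. w z - dy A z)"
 have r: "r \<in> polys m" unfolding r_def using polys_dy[OF A(1)] w by (intro polys_diff) auto
 have rx: "dx r z = 0" for z
  using has_grad_dir_fst[OF has_grad_diff[OF polys_has_grad[OF w] polys_has_grad[OF polys_dy[OF A(1)]]], of z]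
  unfolding polys_mixed[OF A(1)] A(2) closed r_def by simp
 have "r (s, y) = r (0, y)" for s y
 proof -
  have "\<forall>s. ((%s. r (s, y)) has_real_derivative 0) (at s)"
   using has_grad_line_fst[OF polys_has_grad[OF r], of "(_, y)"] rx by simp
  then show ?thesis using DERIV_isconst_all by blast
 qed
 then have r0: "r (0, snd z) = r z" for z by (metis prod.collapse)
 obtain C where C: "C \<in> polys (m + 1)" "dy C = r" using polys_antideriv_y[OF r] by blast
 let ?C = "%z. C (0, snd z)"
 have C': "?C \<in> polys (m + 1)" by (rule polys_restrict_y[OF C(1)])
 have gC: "has_grad ?C 0 (r z) z" for z
 proof -
  have "((%t. C (0, t)) has_real_derivative r (0, snd z)) (at (snd z))"
   using has_grad_line_snd[OF polys_has_grad[OF C(1)], of "(0, snd z)"] C(2) by simp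
  from has_grad_compose[OF has_grad_snd this] r0 show ?thesis by simp
 qed
 have "has_grad (%z. A z + ?C z) (u z) (w z) z" for z
  using has_grad_add[OF polys_has_grad[OF A(1)] gC, of z] A(2) by (simp add: r_def)
 then have "dx (%z. A z + ?C z) = u \<and> dy (%z. A z + ?C z) = w"
  using has_grad_dir_fst has_grad_dir_snd by blast
 then show ?thesis using polys_add[OF A(1) C'] by blast
qed

section \<open>Fundamental theorem of calculus on boxes\<close>

text \<open>An exceptional set that the fundamental theorem of calculus tolerates on almost all horizontal
and vertical lines. Segments are thin even if they are axis-parallel.\<close>

definition thin :: "point set => bool" where
 "thin Z \<longleftrightarrow> (\<exists>N. finite N \<and> (\<forall>t. t \<notin> N --> finite {s. (s, t) \<in> Z} \<and> finite {s. (t, s) \<in> Z}))"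

lemma thin_empty: "thin {}"
 unfolding thin_def by auto

lemma thin_Un: "thin Y ==> thin Z ==> thin (Y \<union> Z)"
proof -
 assume "thin Y" "thin Z"
 then obtain N N' where "finite N" "\<forall>t. t \<notin> N --> finite {s. (s, t) \<in> Y} \<and> finite {s. (t, s) \<in> Y}"
  "finite N'" "\<forall>t. t \<notin> N' --> finite {s. (s, t) \<in> Z} \<and> finite {s. (t, s) \<in> Z}"
  unfolding thin_def by blast
 then show ?thesis unfolding thin_def
  by (intro exI[of _ "N \<union> N'"]) (auto simp: Collect_disj_eq)
qed

lemma thin_UN: "finite I ==> (\<And>i. i \<in> I ==> thin (Z i)) ==> thin (\<Union>i\<in>I. Z i)"
 by (induction I rule: finite_induct) (auto intro: thin_empty thin_Un)

lemma thin_segment: "thin (closed_segment a b)"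
 unfolding thin_def
proof (intro exI[of _ "{fst a, snd a}"] conjI allI impI)
 fix t assume t: "t \<notin> {fst a, snd a}"
 show "finite {s. (s, t) \<in> closed_segment a b}"
 proof (rule finite_subset)
  show "{s. (s, t) \<in> closed_segment a b} \<subseteq> {fst a + (t - snd a) / (snd b - snd a) * (fst b - fst a)}"
  proof safe
   fix s assume "(s, t) \<in> closed_segment a b"
   then obtain u where u: "s = (1 - u) * fst a + u * fst b" "t = (1 - u) * snd a + u * snd b"
    unfolding in_segment by (auto simp: prod_eq_iff)
   then have "t - snd a = u * (snd b - snd a)" "s = fst a + u * (fst b - fst a)"
    by (simp_all add: algebra_simps)
   then show "s = fst a + (t - snd a) / (snd b - snd a) * (fst b - fst a)"
    using t by (cases "snd b = snd a") auto
  qed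
 qed simp
 show "finite {s. (t, s) \<in> closed_segment a b}"
 proof (rule finite_subset)
  show "{s. (t, s) \<in> closed_segment a b} \<subseteq> {snd a + (t - fst a) / (fst b - fst a) * (snd b - snd a)}"
  proof safe
   fix s assume "(t, s) \<in> closed_segment a b"
   then obtain u where u: "t = (1 - u) * fst a + u * fst b" "s = (1 - u) * snd a + u * snd b"
    unfolding in_segment by (auto simp: prod_eq_iff)
   then have "t - fst a = u * (fst b - fst a)" "s = snd a + u * (snd b - snd a)"
    by (simp_all add: algebra_simps)
   then show "s = snd a + (t - fst a) / (fst b - fst a) * (snd b - snd a)"
    using t by (cases "fst b = fst a") auto
  qed
 qed simp
qed simp

lemma ftc_lebesgue_1d:
 fixes f g :: "real => real"
 assumes "a \<le> b" "finite S" "continuous_on {a..b} f"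
  and der: "\<And>s. s \<notin> S ==> (f has_real_derivative g s) (at s)"
  and g: "g \<in> borel_measurable borel" "\<And>s. \<bar>g s\<bar> \<le> M"
 shows "(LINT s|lborel. indicator {a..b} s *\<^sub>R g s) = f b - f a"
proof -
 have "(g has_integral (f b - f a)) {a..b}"
  using assms by (intro fundamental_theorem_of_calculus_strong[of S])
   (auto simp: has_real_derivative_iff_has_vector_derivative)
 moreover have "set_integrable lborel {a..b} g"
  unfolding set_integrable_def using g emeasure_bounded_finite[of "{a..b}"]
  by (intro integrableI_bounded_set_indicator[where B = M]) auto
 ultimately show ?thesis
  using set_borel_integral_eq_integral(2)[of "{a..b}" g]
  by (simp add: set_lebesgue_integral_def integral_unique)
qed

lemma integrable_on_box:
 fixes G :: "point => real"
 assumes "G \<in> borel_measurable borel" "\<And>z. \<bar>G z\<bar> \<le> M"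
 shows "integrable lborel (%z. indicator ({a..b} \<times> {c..d}) z *\<^sub>R G z)"
proof (rule integrableI_bounded_set_indicator[where B = M])
 have "bounded ({a..b} \<times> {c..d})" by (intro bounded_Times) auto
 then show "emeasure lborel ({a..b} \<times> {c..d}) < \<infinity>" by (rule emeasure_bounded_finite)
qed (use assms in \<open>auto intro!: borel_Times\<close>)

lemma box_ftc_x:
 fixes F G :: "point => real"
 assumes F: "continuous_on UNIV F" and G: "G \<in> borel_measurable borel" "\<And>z. \<bar>G z\<bar> \<le> M"
  and "thin Z" and ab: "a \<le> b"
  and der: "\<And>z. z \<notin> Z ==> ((%s. F (s, snd z)) has_real_derivative G z) (at (fst z))"
 shows "(LINT z|lborel. indicator ({a..b} \<times> {c..d}) z *\<^sub>R G z)
    = (LINT t|lborel. indicator {c..d} t *\<^sub>R (F (b, t) - F (a, t)))"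
proof -
 obtain N where N: "finite N" "\<And>t. t \<notin> N ==> finite {s. (s, t) \<in> Z}"
  using \<open>thin Z\<close> unfolding thin_def by blast
 let ?h = "%s t. indicator ({a..b} \<times> {c..d}) (s, t) *\<^sub>R G (s, t)"
 have int: "integrable (lborel \<Otimes>\<^sub>M lborel) (case_prod ?h)"
  using integrable_on_box[OF G, of a b c d] by (simp add: lborel_prod split_def)
 have "(LINT z|lborel. indicator ({a..b} \<times> {c..d}) z *\<^sub>R G z) = (LINT t|lborel. LINT s|lborel. ?h s t)"
  using lborel_pair.integral_snd[OF int] by (simp add: lborel_prod split_def)
 also have "\<dots> = (LINT t|lborel. indicator {c..d} t *\<^sub>R (F (b, t) - F (a, t)))"
 proof (rule integral_cong_AE)
  show "(%t. LINT s|lborel. ?h s t) \<in> borel_measurable lborel"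
   using lborel_pair.integrable_snd[OF int] by (rule borel_measurable_integrable)
  have "continuous_on UNIV (%t. F (b, t) - F (a, t))"
   by (intro continuous_intros continuous_on_compose2[OF F]) auto
  then show "(%t. indicator {c..d} t *\<^sub>R (F (b, t) - F (a, t))) \<in> borel_measurable lborel"
   by (intro borel_measurable_scaleR borel_measurable_indicator)
    (auto intro: borel_measurable_continuous_onI)
  have "AE t in lborel. t \<notin> N"
   using AE_not_in[OF finite_imp_null_set_lborel[OF N(1)]] .
  then show "AE t in lborel. (LINT s|lborel. ?h s t) = indicator {c..d} t *\<^sub>R (F (b, t) - F (a, t))"
  proof eventually_elim
   fix t assume t: "t \<notin> N"
   have "(LINT s|lborel. indicator {a..b} s *\<^sub>R G (s, t)) = F (b, t) - F (a, t)"
   proof (rule ftc_lebesgue_1d[OF ab N(2)[OF t]])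
    show "continuous_on {a..b} (%s. F (s, t))"
     by (intro continuous_on_compose2[OF F] continuous_intros) auto
    show "((%s. F (s, t)) has_real_derivative G (s, t)) (at s)" if "s \<notin> {s. (s, t) \<in> Z}" for s
     using der[of "(s, t)"] that by simp
    show "(%s. G (s, t)) \<in> borel_measurable borel" using G(1) by measurable
    show "\<bar>G (s, t)\<bar> \<le> M" for s by (rule G(2))
   qed
   moreover have "?h s t = indicator {c..d} t *\<^sub>R (indicator {a..b} s *\<^sub>R G (s, t))" for s
    by (auto simp: indicator_def)
   ultimately show "(LINT s|lborel. ?h s t) = indicator {c..d} t *\<^sub>R (F (b, t) - F (a, t))"
    by (simp only: integral_scaleR_right)
  qed
 qed
 finally show ?thesis .
qed

lemma integral_swap:
 fixes g :: "point => real"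
 assumes "g \<in> borel_measurable borel"
 shows "(LINT z|lborel. g (snd z, fst z)) = (LINT z|lborel. g z)"
proof -
 have "g \<in> borel_measurable (lborel \<Otimes>\<^sub>M lborel)" using assms by (simp add: lborel_prod)
 from lborel_pair.integral_product_swap[OF this] show ?thesis by (simp add: lborel_prod split_def)
qed

lemma box_ftc_y:
 fixes F G :: "point => real"
 assumes F: "continuous_on UNIV F" and G: "G \<in> borel_measurable borel" "\<And>z. \<bar>G z\<bar> \<le> M"
  and "thin Z" and ab: "c \<le> d"
  and der: "\<And>z. z \<notin> Z ==> ((%s. F (fst z, s)) has_real_derivative G z) (at (snd z))"
 shows "(LINT z|lborel. indicator ({a..b} \<times> {c..d}) z *\<^sub>R G z)
    = (LINT t|lborel. indicator {a..b} t *\<^sub>R (F (t, d) - F (t, c)))"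
proof -
 let ?s = "%z::point. (snd z, fst z)"
 have s: "continuous_on UNIV ?s" by (intro continuous_intros)
 have "thin (?s -` Z)" using \<open>thin Z\<close> unfolding thin_def by auto
 have Gs: "(%z. G (?s z)) \<in> borel_measurable borel"
  using measurable_compose[OF borel_measurable_continuous_onI[OF s] G(1)] by simp
 have "(LINT z|lborel. indicator ({a..b} \<times> {c..d}) z *\<^sub>R G z)
   = (LINT z|lborel. indicator ({c..d} \<times> {a..b}) z *\<^sub>R G (?s z))"
 proof (subst integral_swap[symmetric])
  show "(%z. indicator ({a..b} \<times> {c..d}) z *\<^sub>R G z) \<in> borel_measurable borel"
   using G(1) by (intro borel_measurable_scaleR borel_measurable_indicator borel_Times) auto
 qed (auto simp: indicator_def intro!: Bochner_Integration.integral_cong)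
 also have "\<dots> = (LINT t|lborel. indicator {a..b} t *\<^sub>R (F (?s (d, t)) - F (?s (c, t))))"
 proof (rule box_ftc_x[OF _ Gs G(2) \<open>thin (?s -` Z)\<close> ab])
  show "continuous_on UNIV (%z. F (?s z))"
   by (intro continuous_on_compose2[OF F s]) auto
  show "((%s. F (?s (s, snd z))) has_real_derivative G (?s z)) (at (fst z))" if "z \<notin> ?s -` Z" for z
   using der[of "?s z"] that by simp
 qed
 finally show ?thesis by simp
qed

text \<open>Integrals of directional derivatives vanish for functions of bounded support. The
 exceptional set accounts for the element boundaries.\<close>

lemma integral_line_deriv_zero:
 fixes F G :: "point => real"
 assumes e: "e \<in> Basis" and F: "continuous_on UNIV F"
  and G: "G \<in> borel_measurable borel" "\<And>z. \<bar>G z\<bar> \<le> M"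
  and Z: "thin Z"
  and der: "\<And>z. z \<notin> Z ==> ((%s. F (z + s *\<^sub>R e)) has_real_derivative G z) (at 0)"
  and B: "bounded B" "\<And>z. z \<notin> B ==> F z = 0" "\<And>z. z \<notin> B ==> G z = 0"
 shows "integrable lborel G" "(LINT z|lborel. G z) = 0"
proof -
 obtain R0 where R0: "\<And>z. z \<in> B ==> norm z \<le> R0" using B(1) bounded_iff by blast
 define R where "R = \<bar>R0\<bar> + 1"
 have R: "R > 0" "\<And>z. norm z \<ge> R ==> z \<notin> B" unfolding R_def using R0 by fastforce+
 have nf: "norm z \<ge> \<bar>fst z\<bar>" "norm z \<ge> \<bar>snd z\<bar>" for z :: point
  using norm_fst_le[of "fst z" "snd z"] norm_snd_le[of "snd z" "fst z"] by auto
 have G0: "G = (%z. indicator ({-R..R} \<times> {-R..R}) z *\<^sub>R G z)"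
 proof
  fix z
  show "G z = indicator ({-R..R} \<times> {-R..R}) z *\<^sub>R G z"
  proof (cases "z \<in> {-R..R} \<times> {-R..R}")
   case False
   then have "\<bar>fst z\<bar> \<ge> R \<or> \<bar>snd z\<bar> \<ge> R" by (auto simp: mem_Times_iff)
   then have "norm z \<ge> R" using nf[of z] by linarith
   then show ?thesis using B(3) R(2) by (simp add: indicator_def)
  qed simp
 qed
 show "integrable lborel G"
  using integrable_on_box[OF G, of "-R" R "-R" R] G0 by simp
 consider "e = (1, 0)" | "e = (0, 1)" using e by (auto simp: Basis_point)
 then have "(LINT z|lborel. indicator ({-R..R} \<times> {-R..R}) z *\<^sub>R G z) = 0"
 proof cases
  case 1
  have "F (R, t) = 0" "F (-R, t) = 0" for t
   using nf[of "(R, t)"] nf[of "(-R, t)"] R B(2) by auto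
  moreover have "((%s. F (s, snd z)) has_real_derivative G z) (at (fst z))" if "z \<notin> Z" for z
   using der[OF that] DERIV_shift[of "%s. F (s, snd z)" "G z" 0 "fst z"]
   by (simp add: 1 plus_prod_def add.commute)
  ultimately show ?thesis using R by (subst box_ftc_x[OF F G Z]) auto
 next
  case 2
  have "F (t, R) = 0" "F (t, -R) = 0" for t
   using nf[of "(t, R)"] nf[of "(t, -R)"] R B(2) by auto
  moreover have "((%s. F (fst z, s)) has_real_derivative G z) (at (snd z))" if "z \<notin> Z" for z
   using der[OF that] DERIV_shift[of "%s. F (fst z, s)" "G z" 0 "snd z"]
   by (simp add: 2 plus_prod_def add.commute)
  ultimately show ?thesis using R by (subst box_ftc_y[OF F G Z]) auto
 qed
 then show "(LINT z|lborel. G z) = 0" using G0 by simp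
qed

lemma has_grad_line_deriv:
 assumes "has_grad f a b z" "e \<in> Basis"
 shows "((%s. f (z + s *\<^sub>R e)) has_real_derivative dd e f z) (at 0)"
 using has_grad_line[of f a b z 0 e] assms(1) has_grad_dir[OF assms(1)] by simp

lemma smooth_line_deriv:
 assumes "smooth f" "e \<in> Basis"
 shows "((%s. f (z + s *\<^sub>R e)) has_real_derivative dd e f z) (at 0)"
 by (rule has_grad_line_deriv[OF smooth_has_grad[OF assms(1)] assms(2)])


section \<open>The fundamental lemma of the calculus of variations\<close>

definition box_bump :: "nat => point => point => point => real" where
 "box_bump n a b z =
   flat 0 (real n * (fst z - fst a)) * flat 0 (real n * (fst b - fst z)) *
   flat 0 (real n * (snd z - snd a)) * flat 0 (real n * (snd b - snd z))"

lemma flat0_le1: "flat 0 t \<le> 1"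
 by (simp add: flat_def)

lemma box_bump_nice: "box_bump n a b \<in> nice"
 unfolding box_bump_def
 by (intro nice_mult nice_flat nice_cmul nice_diff nice_fst nice_snd nice_const)

lemma box_bump_bounds: "0 \<le> box_bump n a b z" "box_bump n a b z \<le> 1"
 unfolding box_bump_def by (intro mult_nonneg_nonneg flat_nonneg)
  (intro mult_le_one mult_nonneg_nonneg flat_nonneg flat0_le1)

lemma mem_box_point: "z \<in> box a b \<longleftrightarrow> fst a < fst z \<and> fst z < fst b \<and> snd a < snd z \<and> snd z < snd (b::point)"
 by (auto simp: mem_box Basis_point inner_prod_def)

lemma mem_cbox_point: "z \<in> cbox a b \<longleftrightarrow> fst a \<le> fst z \<and> fst z \<le> fst b \<and> snd a \<le> snd z \<and> snd z \<le> snd (b::point)"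
 by (auto simp: mem_box Basis_point inner_prod_def)

lemma box_bump_support: "box_bump n a b z \<noteq> 0 ==> z \<in> box a b"
 unfolding box_bump_def mem_box_point by (auto simp: flat_def zero_less_mult_iff split: if_splits)

lemma flat0_limit: "(%n. flat 0 (real n * t)) \<longlonglongrightarrow> (if t > 0 then 1 else 0)"
proof (cases "t > 0")
 case True
 have "(%n. exp (- ((1 / t) / real n))) \<longlonglongrightarrow> exp (- 0)"
  by (intro tendsto_exp tendsto_minus lim_const_over_n)
 then have "(%n. exp (- (1 / (real n * t)))) \<longlonglongrightarrow> 1" by (simp add: mult.commute)
 moreover have "\<forall>\<^sub>F n in sequentially. exp (- (1 / (real n * t))) = flat 0 (real n * t)"
  using eventually_gt_at_top[of "0::nat"] by eventually_elim (use True in \<open>auto simp: flat_def\<close>)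
 ultimately show ?thesis using True by (auto intro: Lim_transform_eventually)
next
 case False
 then have "flat 0 (real n * t) = 0" for n by (simp add: flat_def mult_nonneg_nonpos zero_less_mult_iff)
 then show ?thesis using False by simp
qed

lemma box_bump_limit: "(%n. box_bump n a b z) \<longlonglongrightarrow> indicator (box a b) z"
proof -
 have "(%n. box_bump n a b z) \<longlonglongrightarrow>
   (if fst z - fst a > 0 then 1 else 0) * (if fst b - fst z > 0 then 1 else 0) *
   (if snd z - snd a > 0 then 1 else 0) * (if snd b - snd z > 0 then 1 else 0)"
  unfolding box_bump_def by (intro tendsto_mult flat0_limit)
 moreover have "(if fst z - fst a > 0 then 1 else 0) * (if fst b - fst z > 0 then 1 else 0) *
   (if snd z - snd a > 0 then 1 else 0) * (if snd b - snd z > 0 then 1 else 0)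
   = (indicator (box a b) z :: real)"
  by (auto simp: indicator_def mem_box_point)
 ultimately show ?thesis by simp
qed

lemma nice_test_function:
 assumes "f \<in> nice" "compact C" "C \<subseteq> Om" "\<And>z. f z \<noteq> 0 ==> z \<in> C"
 shows "f \<in> test_functions Om"
proof -
 have "closure {x. f x \<noteq> 0} \<subseteq> C" using assms by (intro closure_minimal compact_imp_closed) auto
 then show ?thesis unfolding test_functions_def using assms nice_smooth
  by (auto intro: compact_closure[THEN iffD2] bounded_subset[OF compact_imp_bounded])
qed

lemma box_bump_test:
 assumes "cbox a b \<subseteq> Om" shows "box_bump n a b \<in> test_functions Om"
 using box_bump_support box_subset_cbox
 by (intro nice_test_function[OF box_bump_nice compact_cbox assms]) blast

lemma AE_zero_of_box_integrals:
 fixes g :: "point => real"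
 assumes g: "integrable lborel g"
  and zero: "\<And>a b. (LINT z|lborel. indicator (box a b) z * g z) = 0"
 shows "AE z in lborel. g z = 0"
proof -
 have gm[measurable]: "g \<in> borel_measurable borel" using g by auto
 define M1 where "M1 = density lborel (%z. ennreal (g z))"
 define M2 where "M2 = density lborel (%z. ennreal (- g z))"
 have box1: "emeasure M1 (box a b) = ennreal (LINT z|lborel. max 0 (indicator (box a b) z * g z))" for a b
 proof -
  have i: "integrable lborel (%z. max 0 (indicator (box a b) z * g z))"
   using integrable_mult_indicator[OF _ g, of "box a b"]
   by (intro Bochner_Integration.integrable_bound[OF g]) (auto simp: indicator_def)
  have "emeasure M1 (box a b) = (\<integral>\<^sup>+ z. ennreal (max 0 (indicator (box a b) z * g z)) \<partial>lborel)"
   unfolding M1_def by (subst emeasure_density) (auto intro!: nn_integral_cong simp: indicator_def max_def ennreal_neg)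
  then show ?thesis using nn_integral_eq_integral[OF i] by simp
 qed
 have box2: "emeasure M2 (box a b) = ennreal (LINT z|lborel. max 0 (- (indicator (box a b) z * g z)))" for a b
 proof -
  have i: "integrable lborel (%z. max 0 (- (indicator (box a b) z * g z)))"
   using integrable_mult_indicator[OF _ g, of "box a b"]
   by (intro Bochner_Integration.integrable_bound[OF g]) (auto simp: indicator_def)
  have "emeasure M2 (box a b) = (\<integral>\<^sup>+ z. ennreal (max 0 (- (indicator (box a b) z * g z))) \<partial>lborel)"
   unfolding M2_def by (subst emeasure_density) (auto intro!: nn_integral_cong simp: indicator_def max_def ennreal_neg)
  then show ?thesis using nn_integral_eq_integral[OF i] by simp
 qed
 have eq: "emeasure M1 (box a b) = emeasure M2 (box a b)" for a b
 proof -
  let ?h = "%z. indicator (box a b) z * g z"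
  have h: "integrable lborel ?h" using integrable_mult_indicator[OF _ g, of "box a b"] by simp
  have "(LINT z|lborel. max 0 (?h z) - max 0 (- ?h z)) = (LINT z|lborel. ?h z)"
   by (rule Bochner_Integration.integral_cong) auto
  moreover have "(LINT z|lborel. max 0 (?h z) - max 0 (- ?h z))
    = (LINT z|lborel. max 0 (?h z)) - (LINT z|lborel. max 0 (- ?h z))"
   using h by (intro Bochner_Integration.integral_diff Bochner_Integration.integrable_bound[OF h])
    (auto simp: indicator_def)
  ultimately show ?thesis unfolding box1 box2 using zero by simp
 qed
 have "M1 = M2"
 proof (rule measure_eqI_generator_eq[where E = "range (%(a, b). box a b)" and \<Omega> = UNIV
    and A = "%n. box (- (real n *\<^sub>R One)) (real n *\<^sub>R One)"])
  show "Int_stable (range (%(a, b). box a b :: point set))"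
  proof (rule Int_stableI)
   fix A B assume "A \<in> range (%(a, b). box a b :: point set)" "B \<in> range (%(a, b). box a b :: point set)"
   then obtain a b c d where "A = box a b" "B = box c d" by (auto simp: image_iff)
   then have "A \<inter> B = (%(a, b). box a b) ((max (fst a) (fst c), max (snd a) (snd c)), (min (fst b) (fst d), min (snd b) (snd d)))"
    by (auto simp: mem_box_point)
   then show "A \<inter> B \<in> range (%(a, b). box a b :: point set)" by (rule image_eqI) simp
  qed
  show "emeasure M1 X = emeasure M2 X" if "X \<in> range (%(a, b). box a b)" for X
   using that eq by auto
  show "sets M1 = sigma_sets UNIV (range (%(a, b). box a b))"
   "sets M2 = sigma_sets UNIV (range (%(a, b). box a b))"
   unfolding M1_def M2_def by (simp_all add: borel_eq_box)
 qed (auto simp: UN_box_eq_UNIV box1)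
 then have "AE z in lborel. ennreal (g z) = ennreal (- g z)"
  unfolding M1_def M2_def by (subst (asm) sigma_finite_measure.density_unique_iff[OF sigma_finite_lborel]) auto
 then show ?thesis
 proof eventually_elim
  case (elim z)
  then show ?case
  proof (cases "0 \<le> g z")
   case True
   then have "ennreal (- g z) = 0" by (simp add: ennreal_neg)
   then show ?thesis using elim True by simp
  next
   case False
   then have "ennreal (g z) = 0" by (simp add: ennreal_neg)
   then have "ennreal (- g z) = 0" using elim by simp
   then show ?thesis using False by simp
  qed
 qed
qed

lemma AE_lebesgue_on_iff:
 assumes "U \<in> sets lebesgue"
 shows "(AE x in lebesgue_on U. P x) \<longleftrightarrow> (AE x in lebesgue. x \<in> U --> P x)"
 using assms by (intro AE_restrict_space_iff) auto

text \<open>A function orthogonal to all bumps has vanishing integral over every box inside the domain,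
 and boxes generate the Borel sets.\<close>

lemma fundamental_lemma:
 fixes g :: "point => real"
 assumes "open U" and g: "integrable (lebesgue_on U) g"
  and zero: "\<And>\<psi>. \<psi> \<in> test_functions U ==> (LINT x|lebesgue_on U. g x * \<psi> x) = 0"
 shows "AE x in lebesgue_on U. g x = 0"
proof -
 have U: "U \<in> sets lebesgue" using \<open>open U\<close> by (simp add: borel_open)
 have gU: "integrable lebesgue (%x. indicator U x * g x)"
  using g U by (subst (asm) integrable_restrict_space) auto
 obtain g' where g'm: "g' \<in> borel_measurable lborel" "AE x in lborel. indicator U x * g x = g' x"
  using completion_ex_borel_measurable_real[OF borel_measurable_integrable[OF gU]] by blast
 note g' = g'm(1) AE_completion[OF g'm(2)]
 have g'i: "integrable lborel g'"
 proof -
  have "g' \<in> borel_measurable lebesgue" using g'(1) by (rule measurable_completion)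
  then have "integrable lebesgue g'"
   using g'(2) by (intro integrable_cong_AE_imp[OF gU])
  then show ?thesis using integrable_completion[OF g'(1)] by simp
 qed
 have box: "(LINT z|lborel. indicator (box a b) z * g' z) = 0" if ab: "cbox a b \<subseteq> U" for a b
 proof -
  have "(LINT z|lborel. box_bump n a b z * g' z) = 0" for n
  proof -
   let ?\<psi> = "box_bump n a b"
   have m: "?\<psi> \<in> borel_measurable borel"
    by (rule borel_measurable_continuous_onI[OF nice_continuous[OF box_bump_nice]])
   have "(LINT z|lborel. ?\<psi> z * g' z) = (LINT z|lebesgue. ?\<psi> z * g' z)"
    using m g'(1) by (intro integral_completion[symmetric]) auto
   also have "\<dots> = (LINT z|lebesgue. indicator U z *\<^sub>R (g z * ?\<psi> z))"
   proof (rule integral_cong_AE)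
    show "(%z. ?\<psi> z * g' z) \<in> borel_measurable lebesgue"
     using m g'(1) by (intro measurable_completion) auto
    have "?\<psi> \<in> borel_measurable lebesgue" using m by (intro measurable_completion) auto
    then have "(%z. (indicator U z * g z) * ?\<psi> z) \<in> borel_measurable lebesgue"
     by (rule borel_measurable_times[OF borel_measurable_integrable[OF gU]])
    then show "(%z. indicator U z *\<^sub>R (g z * ?\<psi> z)) \<in> borel_measurable lebesgue"
     by (simp add: mult.assoc)
    show "AE z in lebesgue. ?\<psi> z * g' z = indicator U z *\<^sub>R (g z * ?\<psi> z)"
     using g'(2) by eventually_elim (simp add: mult_ac flip: mult.assoc)
   qed
   also have "\<dots> = (LINT x|lebesgue_on U. g x * ?\<psi> x)"
    using U by (subst integral_restrict_space) auto
   also have "\<dots> = 0" by (rule zero[OF box_bump_test[OF ab]])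
   finally show ?thesis .
  qed
  moreover have "(%n. LINT z|lborel. box_bump n a b z * g' z) \<longlonglongrightarrow> (LINT z|lborel. indicator (box a b) z * g' z)"
  proof (rule integral_dominated_convergence[where w = "%z. \<bar>g' z\<bar>"])
   show "(%z. box_bump n a b z * g' z) \<in> borel_measurable lborel" for n
    using g'(1) borel_measurable_continuous_onI[OF nice_continuous[OF box_bump_nice]] by auto
   show "(%z. indicator (box a b) z * g' z) \<in> borel_measurable lborel"
    using g'(1) by auto
   show "AE z in lborel. (%n. box_bump n a b z * g' z) \<longlonglongrightarrow> indicator (box a b) z * g' z"
    by (intro AE_I2 tendsto_mult box_bump_limit tendsto_const)
   show "AE z in lborel. norm (box_bump n a b z * g' z) \<le> \<bar>g' z\<bar>" for n
    using box_bump_bounds by (intro AE_I2) (simp add: abs_mult mult_left_le_one_le)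
  qed (use g'i in auto)
  ultimately show ?thesis by (simp add: LIMSEQ_const_iff)
 qed
 have inbox: "AE z in lborel. z \<in> box A B --> g' z = 0" if AB: "cbox A B \<subseteq> U" for A B
 proof -
  have "AE z in lborel. indicator (box A B) z * g' z = 0"
  proof (rule AE_zero_of_box_integrals)
   show "integrable lborel (%z. indicator (box A B) z * g' z)"
    using integrable_mult_indicator[OF _ g'i, of "box A B"] by simp
   fix a b
   let ?a = "(max (fst a) (fst A), max (snd a) (snd A))"
   let ?b = "(min (fst b) (fst B), min (snd b) (snd B))"
   have "box a b \<inter> box A B = box ?a ?b" by (auto simp: mem_box_point)
   then have "(LINT z|lborel. indicator (box a b) z * (indicator (box A B) z * g' z))
     = (LINT z|lborel. indicator (box ?a ?b) z * g' z)"
    by (simp only: indicator_inter_arith mult.assoc flip: \<open>box a b \<inter> box A B = box ?a ?b\<close>)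
   also have "\<dots> = 0"
   proof (rule box)
    show "cbox ?a ?b \<subseteq> U" using AB by (auto simp: mem_cbox_point)
   qed
   finally show "(LINT z|lborel. indicator (box a b) z * (indicator (box A B) z * g' z)) = 0" .
  qed
  then show ?thesis by eventually_elim (auto simp: indicator_def)
 qed
 obtain \<D> where \<D>: "countable \<D>" "\<D> \<subseteq> Pow U" "\<And>X. X \<in> \<D> ==> \<exists>a b. X = cbox a b" "\<Union>\<D> = U"
  using open_countable_Union_open_cbox[OF \<open>open U\<close>] by blast
 have "AE z in lborel. \<forall>X\<in>\<D>. z \<in> X --> g' z = 0"
  unfolding AE_ball_countable[OF \<D>(1)]
 proof
  fix X assume X: "X \<in> \<D>"
  then obtain a b where ab: "X = cbox a b" using \<D>(3) by blast
  have "cbox a b \<subseteq> U" using X ab \<D>(2) by blast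
  from inbox[OF this] have 1: "AE z in lborel. z \<in> box a b --> g' z = 0" .
  have "cbox a b - box a b \<in> null_sets lborel"
   using negligible_frontier_interval[of a b]
   by (intro null_setsI) (auto simp: emeasure_lborel_cbox_eq emeasure_lborel_box_eq emeasure_Diff box_subset_cbox)
  from AE_not_in[OF this] 1 show "AE z in lborel. z \<in> X --> g' z = 0"
   unfolding ab by eventually_elim auto
 qed
 then have "AE z in lborel. z \<in> U --> g' z = 0"
  using \<D>(4) by (auto elim: eventually_mono)
 then have "AE z in lebesgue. z \<in> U --> g' z = 0" by (rule AE_completion)
 then have "AE z in lebesgue. z \<in> U --> g z = 0"
  using g'(2) by eventually_elim (auto simp: indicator_def)
 then show ?thesis unfolding AE_lebesgue_on_iff[OF U] .
qed

section \<open>The space of square-integrable functions\<close>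

lemma psd_discriminant:
 fixes a b c :: real
 assumes "\<And>t. 0 \<le> a + 2 * b * t + c * t\<^sup>2" "0 \<le> c"
 shows "b\<^sup>2 \<le> a * c"
proof (cases "c = 0")
 case True
 have "b = 0"
 proof (rule ccontr)
  assume "b \<noteq> 0"
  have "0 \<le> a + 2 * b * (- (a + 1) / (2 * b))" using assms(1)[of "- (a + 1) / (2 * b)"] True by simp
  also have "\<dots> = -1" using \<open>b \<noteq> 0\<close> by (simp add: field_simps)
  finally show False by simp
 qed
 then show ?thesis using True by simp
next
 case False
 then have c: "c > 0" using assms(2) by simp
 have "0 \<le> a + 2 * b * (- b / c) + c * (- b / c)\<^sup>2" by (rule assms(1))
 also have "\<dots> = a - b\<^sup>2 / c" using c by (simp add: power2_eq_square field_simps)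
 finally show ?thesis using c by (simp add: field_simps)
qed

lemma lebesgue_measurable_AE:
 assumes f: "f \<in> borel_measurable lebesgue" and eq: "AE x in lebesgue. f x = g x"
 shows "g \<in> borel_measurable lebesgue"
proof (rule measurableI)
 fix A :: "'b::topological_space set" assume A: "A \<in> sets borel"
 show "g -` A \<inter> space lebesgue \<in> sets lebesgue"
 proof (rule completion.in_sets_AE[where A = "f -` A \<inter> space lebesgue"])
  show "AE x in lebesgue. (x \<in> f -` A \<inter> space lebesgue) = (x \<in> g -` A \<inter> space lebesgue)"
   using eq by eventually_elim auto
  show "f -` A \<inter> space lebesgue \<in> sets lebesgue" by (rule measurable_sets[OF f A])
 qed simp
qed simp

locale bounded_domain =
 fixes Om :: "point set"
 assumes open_dom: "open Om" and bounded_dom: "bounded Om"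
begin

abbreviation "wd \<equiv> weak_deriv Om"
abbreviation "ip \<equiv> L2_inner Om"
abbreviation "nrm \<equiv> L2_norm Om"
abbreviation "tests \<equiv> test_functions Om"

lemma dom_lebesgue: "Om \<in> sets lebesgue"
 using open_dom by (simp add: borel_open)

lemma finite_measure_dom: "finite_measure (lebesgue_on Om)"
proof (rule finite_measureI)
 have "Om \<in> lmeasurable" using bounded_dom dom_lebesgue by (rule bounded_set_imp_lmeasurable)
 then show "emeasure (lebesgue_on Om) (space (lebesgue_on Om)) \<noteq> \<infinity>"
  using dom_lebesgue by (simp add: emeasure_restrict_space space_restrict_space fmeasurable_def less_top)
qed

lemma AE_dom_iff: "(AE x in lebesgue_on Om. P x) \<longleftrightarrow> (AE x in lebesgue. x \<in> Om --> P x)"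
 by (rule AE_lebesgue_on_iff[OF dom_lebesgue])

lemma AE_dom_I: "(\<And>x. x \<in> Om ==> P x) ==> AE x in lebesgue_on Om. P x"
 by (auto simp: AE_dom_iff)

lemma ae_eq_refl: "ae_eq Om f f"
 by (simp add: ae_eq_def)

lemma ae_eq_sym: "ae_eq Om f g ==> ae_eq Om g f"
 unfolding ae_eq_def by (erule eventually_mono) simp

lemma ae_eq_trans: "ae_eq Om f g ==> ae_eq Om g h ==> ae_eq Om f h"
 unfolding ae_eq_def by (erule (1) eventually_elim2) simp

lemma ae_eq_map2: "ae_eq Om f g ==> ae_eq Om f' g' ==> ae_eq Om (%x. H (f x) (f' x)) (%x. H (g x) (g' x))"
 unfolding ae_eq_def by (erule (1) eventually_elim2) simp

lemma ae_eq_map: "ae_eq Om f g ==> ae_eq Om (%x. H (f x)) (%x. H (g x))"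
 unfolding ae_eq_def by (erule eventually_mono) simp

lemma ae_eq_diff:
 "ae_eq Om f f' ==> ae_eq Om g g' ==> ae_eq Om (%x. f x - g x :: real) (%x. f' x - g' x)"
 unfolding ae_eq_def by (erule (1) eventually_elim2) simp

lemma measurable_dom: "f \<in> borel_measurable borel ==> f \<in> borel_measurable (lebesgue_on Om)"
 for f :: "point => real"
 by (intro measurable_restrict_space1 measurable_completion) auto

lemma measurable_dom_cong:
 fixes f g :: "point => real"
 assumes "ae_eq Om f g" "f \<in> borel_measurable (lebesgue_on Om)"
 shows "g \<in> borel_measurable (lebesgue_on Om)"
proof -
 have "(%x. if x \<in> Om then f x else 0) \<in> borel_measurable lebesgue"
  using assms(2) borel_measurable_if[OF dom_lebesgue] dom_lebesgue by blast
 then have "(%x. if x \<in> Om then g x else 0) \<in> borel_measurable lebesgue"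
 proof (rule lebesgue_measurable_AE)
  show "AE x in lebesgue. (if x \<in> Om then f x else 0) = (if x \<in> Om then g x else 0)"
   using assms(1) unfolding ae_eq_def AE_dom_iff by eventually_elim auto
 qed
 then show ?thesis using borel_measurable_if[OF dom_lebesgue] dom_lebesgue by blast
qed

lemma L2_cong: "ae_eq Om f g ==> f \<in> L2 Om ==> g \<in> L2 Om"
proof -
 assume *: "ae_eq Om f g" "f \<in> L2 Om"
 have m: "g \<in> borel_measurable (lebesgue_on Om)" using measurable_dom_cong[OF *(1)] *(2) by (simp add: L2_def)
 have "integrable (lebesgue_on Om) (%x. (g x)\<^sup>2)"
 proof (rule integrable_cong_AE_imp)
  show "integrable (lebesgue_on Om) (%x. (f x)\<^sup>2)" using *(2) by (simp add: L2_def)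
  show "AE x in lebesgue_on Om. (f x)\<^sup>2 = (g x)\<^sup>2"
   using *(1) unfolding ae_eq_def by eventually_elim simp
 qed (use m in auto)
 with m show ?thesis by (simp add: L2_def)
qed

lemma L2_measurable: "f \<in> L2 Om ==> f \<in> borel_measurable (lebesgue_on Om)"
 by (simp add: L2_def)

lemma L2_mult_integrable:
 assumes "f \<in> L2 Om" "g \<in> L2 Om" shows "integrable (lebesgue_on Om) (%x. f x * g x)"
proof (rule Bochner_Integration.integrable_bound)
 show "integrable (lebesgue_on Om) (%x. (f x)\<^sup>2 + (g x)\<^sup>2)" using assms by (auto simp: L2_def)
 have "\<bar>a * b\<bar> \<le> a\<^sup>2 + b\<^sup>2" for a b :: real
 proof -
  have "2 * (\<bar>a\<bar> * \<bar>b\<bar>) \<le> a\<^sup>2 + b\<^sup>2" using sum_squares_bound[of "\<bar>a\<bar>" "\<bar>b\<bar>"] by (simp add: mult.assoc)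
  moreover have "0 \<le> \<bar>a\<bar> * \<bar>b\<bar>" by simp
  ultimately show ?thesis unfolding abs_mult by linarith
 qed
 then show "AE x in lebesgue_on Om. norm (f x * g x) \<le> norm ((f x)\<^sup>2 + (g x)\<^sup>2)"
  by (intro AE_I2) simp
qed (use assms in \<open>auto simp: L2_def\<close>)

lemma L2_add: "f \<in> L2 Om ==> g \<in> L2 Om ==> (%x. f x + g x) \<in> L2 Om"
 using L2_mult_integrable[of f g] by (auto simp: L2_def power2_sum mult.assoc)

lemma L2_cmul: "f \<in> L2 Om ==> (%x. c * f x) \<in> L2 Om"
 by (auto simp: L2_def power_mult_distrib)

lemma L2_diff: "f \<in> L2 Om ==> g \<in> L2 Om ==> (%x. f x - g x) \<in> L2 Om"
 using L2_add[OF _ L2_cmul[of g "-1"]] by simp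

lemma L2_bounded:
 fixes f :: "point => real"
 assumes "f \<in> borel_measurable (lebesgue_on Om)" "\<And>x. x \<in> Om ==> \<bar>f x\<bar> \<le> M" shows "f \<in> L2 Om"
proof -
 interpret finite_measure "lebesgue_on Om" by (rule finite_measure_dom)
 have "integrable (lebesgue_on Om) (%x. (f x)\<^sup>2)"
 proof (rule integrable_const_bound[of _ "M\<^sup>2"])
  show "AE x in lebesgue_on Om. norm ((f x)\<^sup>2) \<le> M\<^sup>2"
   using assms(2) by (intro AE_dom_I) (force simp: abs_le_square_iff[symmetric])
 qed (use assms(1) in auto)
 then show ?thesis using assms(1) by (simp add: L2_def)
qed

lemma L2_const: "(%x. c) \<in> L2 Om"
 by (rule L2_bounded[of _ "\<bar>c\<bar>"]) auto

lemma L2_integrable: "f \<in> L2 Om ==> integrable (lebesgue_on Om) f"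
 using L2_mult_integrable[OF _ L2_const[of 1], of f] by simp

lemma bounded_on_dom:
 fixes f :: "point => real"
 assumes "continuous_on UNIV f" shows "\<exists>M. \<forall>x\<in>Om. \<bar>f x\<bar> \<le> M"
proof -
 have "compact (f ` closure Om)"
  using assms bounded_dom by (intro compact_continuous_image continuous_on_subset[OF assms]) auto
 then obtain M where "\<forall>y\<in>f ` closure Om. norm y \<le> M" using compact_imp_bounded bounded_iff by blast
 then show ?thesis using closure_subset[of Om] by (intro exI[of _ M]) auto
qed

lemma L2_continuous: "continuous_on UNIV f ==> f \<in> L2 Om"
proof -
 assume f: "continuous_on UNIV f"
 obtain M where "\<And>x. x \<in> Om ==> \<bar>f x\<bar> \<le> M" using bounded_on_dom[OF f] by blast
 then show ?thesis using L2_bounded measurable_dom[OF borel_measurable_continuous_onI[OF f]] by blast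
qed

lemma L2_inner_commute: "ip f g = ip g f"
 by (simp add: L2_inner_def mult.commute)

lemma L2_inner_cong: "ae_eq Om f f' ==> ae_eq Om g g' ==> f \<in> L2 Om ==> g \<in> L2 Om ==>
  ip f g = ip f' g'"
 unfolding L2_inner_def
proof (rule integral_cong_AE)
 assume *: "ae_eq Om f f'" "ae_eq Om g g'" "f \<in> L2 Om" "g \<in> L2 Om"
 show "(%x. f x * g x) \<in> borel_measurable (lebesgue_on Om)"
  "(%x. f' x * g' x) \<in> borel_measurable (lebesgue_on Om)"
  using L2_cong[OF *(1,3)] L2_cong[OF *(2,4)] *(3,4)
  by (auto intro!: borel_measurable_times dest!: L2_measurable)
 show "AE x in lebesgue_on Om. f x * g x = f' x * g' x"
  using *(1,2) unfolding ae_eq_def by eventually_elim simp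
qed

lemma L2_inner_add_left: "f \<in> L2 Om ==> g \<in> L2 Om ==> h \<in> L2 Om ==>
  ip (%x. f x + g x) h = ip f h + ip g h"
 unfolding L2_inner_def using L2_mult_integrable by (simp add: distrib_right)

lemma L2_inner_cmul_left: "ip (%x. c * f x) h = c * ip f h"
 unfolding L2_inner_def by (simp add: mult.assoc)

lemma L2_inner_diff_left: "f \<in> L2 Om ==> g \<in> L2 Om ==> h \<in> L2 Om ==>
  ip (%x. f x - g x) h = ip f h - ip g h"
 unfolding L2_inner_def using L2_mult_integrable by (simp add: left_diff_distrib)

lemma L2_inner_self_nonneg: "0 \<le> ip f f"
 unfolding L2_inner_def by (intro integral_nonneg_AE) auto

lemma L2_norm_sq: "(nrm f)\<^sup>2 = ip f f"
 unfolding L2_norm_def using L2_inner_self_nonneg by simp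

lemma L2_norm_nonneg: "0 \<le> nrm f"
 unfolding L2_norm_def by (simp add: L2_inner_self_nonneg)

lemma L2_norm_cong: "ae_eq Om f f' ==> f \<in> L2 Om ==> nrm f = nrm f'"
 unfolding L2_norm_def using L2_inner_cong[of f f' f f'] by simp

lemma L2_Cauchy_Schwarz:
 assumes "f \<in> L2 Om" "g \<in> L2 Om" shows "\<bar>ip f g\<bar> \<le> nrm f * nrm g"
proof -
 have "0 \<le> ip f f + 2 * ip f g * t + ip g g * t\<^sup>2" for t
 proof -
  let ?h = "%x. f x + t * g x"
  have tg: "(%x. t * g x) \<in> L2 Om" by (rule L2_cmul[OF assms(2)])
  have h: "?h \<in> L2 Om" by (rule L2_add[OF assms(1) tg])
  have split: "ip ?h k = ip f k + t * ip g k" if "k \<in> L2 Om" for k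
   by (simp only: L2_inner_add_left[OF assms(1) tg that] L2_inner_cmul_left)
  have "ip ?h ?h = ip ?h f + t * ip ?h g"
   using split[OF h] L2_inner_commute[of f ?h] L2_inner_commute[of g ?h] by simp
  also have "\<dots> = ip f f + 2 * ip f g * t + ip g g * t\<^sup>2"
   using split[OF assms(1)] split[OF assms(2)] L2_inner_commute[of g f]
   by (simp add: power2_eq_square algebra_simps)
  finally have "ip ?h ?h = ip f f + 2 * ip f g * t + ip g g * t\<^sup>2" .
  then show ?thesis using L2_inner_self_nonneg[of ?h] by simp
 qed
 then have "(ip f g)\<^sup>2 \<le> ip f f * ip g g"
  by (rule psd_discriminant) (rule L2_inner_self_nonneg)
 then show ?thesis
  using mult_nonneg_nonneg[OF L2_norm_nonneg[of f] L2_norm_nonneg[of g]]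
   power2_le_imp_le[of "\<bar>ip f g\<bar>" "nrm f * nrm g"]
  by (simp add: power_mult_distrib L2_norm_sq)
qed

lemma L2_norm_sq_add:
 assumes "f \<in> L2 Om" "g \<in> L2 Om"
 shows "(nrm (%x. f x + g x))\<^sup>2 \<le> 2 * (nrm f)\<^sup>2 + 2 * (nrm g)\<^sup>2"
 unfolding L2_norm_sq L2_inner_def
proof -
 have "(LINT x|lebesgue_on Om. (f x + g x) * (f x + g x)) \<le> (LINT x|lebesgue_on Om. 2 * (f x * f x) + 2 * (g x * g x))"
 proof (rule integral_mono)
  show "(f x + g x) * (f x + g x) \<le> 2 * (f x * f x) + 2 * (g x * g x)" for x
   using sum_squares_bound[of "f x" "g x"] by (simp add: algebra_simps power2_eq_square)
 qed (use assms L2_mult_integrable L2_add in auto)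
 then show "(LINT x|lebesgue_on Om. (f x + g x) * (f x + g x)) \<le>
   2 * (LINT x|lebesgue_on Om. f x * f x) + 2 * (LINT x|lebesgue_on Om. g x * g x)"
  using assms L2_mult_integrable by simp
qed

lemma L2_norm_zero: "f \<in> L2 Om ==> ip f f = 0 ==> ae_eq Om f (%x. 0)"
 unfolding L2_inner_def ae_eq_def using L2_mult_integrable[of f f]
 by (subst (asm) integral_nonneg_eq_0_iff_AE) auto

lemma L2_inner_zero: "ip (%x. 0) g = 0"
 by (simp add: L2_inner_def)


section \<open>Weak derivatives\<close>

lemma test_smooth: "\<psi> \<in> test_functions U ==> smooth \<psi>"
 by (simp add: test_functions_def)

lemma test_L2: "\<psi> \<in> test_functions U ==> \<psi> \<in> L2 Om"
 by (intro L2_continuous smooth_continuous test_smooth)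

lemma test_deriv_L2: "\<psi> \<in> test_functions U ==> e \<in> Basis ==> dd e \<psi> \<in> L2 Om"
 by (intro L2_continuous smooth_continuous smooth_dir_deriv test_smooth)

end

lemma dir_deriv_zero_open:
 assumes "open U" "z \<in> U" "\<And>w. w \<in> U ==> f w = 0" shows "dd e f z = 0"
 using has_grad_dir[OF has_grad_local[OF has_grad_const assms(1,2)], of 0 f e] assms(3) by simp

lemma test_support:
 assumes "\<psi> \<in> test_functions U"
 shows "\<exists>C. compact C \<and> C \<subseteq> U \<and> (\<forall>z. z \<notin> C --> \<psi> z = 0 \<and> (\<forall>e. dd e \<psi> z = 0))"
proof -
 let ?C = "closure {x. \<psi> x \<noteq> 0}"
 have 1: "compact ?C" "?C \<subseteq> U" using assms by (auto simp: test_functions_def)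
 have 2: "\<psi> z = 0" if "z \<notin> ?C" for z
  using that subsetD[OF closure_subset[of "{x. \<psi> x \<noteq> 0}"], of z] by (cases "\<psi> z = 0") auto
 have 3: "dd e \<psi> z = 0" if "z \<notin> ?C" for z e
 proof (rule dir_deriv_zero_open)
  show "open (- ?C)" "z \<in> - ?C" using that by auto
  show "\<psi> w = 0" if "w \<in> - ?C" for w by (rule 2[OF ComplD[OF that]])
 qed
 show ?thesis by (intro exI[of _ ?C] conjI allI impI) (fact 1(1), fact 1(2), erule 2, erule 3)
qed

lemma test_functionI:
 assumes "smooth f" "compact C" "C \<subseteq> U" "{x. f x \<noteq> 0} \<subseteq> C"
 shows "f \<in> test_functions U"
proof -
 have "closure {x. f x \<noteq> 0} \<subseteq> C" using assms by (intro closure_minimal compact_imp_closed)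
 moreover from this have "compact (closure {x. f x \<noteq> 0})"
  using compact_Int_closed[OF assms(2) closed_closure[of "{x. f x \<noteq> 0}"]] by (simp add: Int_absorb1)
 ultimately show ?thesis using assms(1,3) by (simp add: test_functions_def)
qed

lemma test_deriv_test:
 assumes "\<psi> \<in> test_functions U" "e \<in> Basis" shows "dd e \<psi> \<in> test_functions U"
proof -
 obtain C where C: "compact C" "C \<subseteq> U" "\<forall>z. z \<notin> C --> \<psi> z = 0 \<and> (\<forall>e. dd e \<psi> z = 0)"
  using test_support[OF assms(1)] by blast
 have "{x. dd e \<psi> x \<noteq> 0} \<subseteq> C" using C(3) by blast
 moreover have "smooth (dd e \<psi>)"
  using assms by (intro smooth_dir_deriv) (simp add: test_functions_def)
 ultimately show ?thesis using test_functionI C(1,2) by blast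
qed

lemma foldr_dir_deriv_linear:
 assumes "smooth f" "smooth g" "set es \<subseteq> Basis"
 shows "foldr dd es (%x. a * f x + b * g x) =
  (%x. a * foldr dd es f x + b * foldr dd es g x)"
 using assms(3)
proof (induction es)
 case (Cons e es)
 have s: "smooth (foldr dd es h)" if "smooth h" for h
  using Cons.prems that by (induction es) (auto intro: smooth_dir_deriv)
 have "dd e (%x. a * foldr dd es f x + b * foldr dd es g x) z
   = a * dd e (foldr dd es f) z + b * dd e (foldr dd es g) z" for z
 proof -
  note g = smooth_has_grad[OF s[OF assms(1)], of z] smooth_has_grad[OF s[OF assms(2)], of z]
  show ?thesis
   unfolding has_grad_dir[OF has_grad_add[OF has_grad_cmul[OF g(1)] has_grad_cmul[OF g(2)]], of e]
    has_grad_dir[OF g(1), of e] has_grad_dir[OF g(2), of e] by (simp add: algebra_simps)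
 qed
 then show ?case using Cons by auto
qed simp

lemma test_linear:
 assumes "\<phi> \<in> test_functions U" "\<psi> \<in> test_functions U"
 shows "(%x. a * \<phi> x + b * \<psi> x) \<in> test_functions U"
proof -
 let ?f = "%x. a * \<phi> x + b * \<psi> x"
 have "foldr dd es ?f differentiable_on UNIV" if "set es \<subseteq> Basis" for es
  using assms that unfolding test_functions_def smooth_def
  by (subst foldr_dir_deriv_linear) (auto simp: smooth_def intro!: differentiable_on_add differentiable_on_mult)
 then have "smooth ?f" by (simp add: smooth_def)
 moreover have "{x. ?f x \<noteq> 0} \<subseteq> closure {x. \<phi> x \<noteq> 0} \<union> closure {x. \<psi> x \<noteq> 0}"
 proof (rule subsetI)
  fix x assume "x \<in> {x. ?f x \<noteq> 0}"
  then have "\<phi> x \<noteq> 0 \<or> \<psi> x \<noteq> 0" by auto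
  then have "x \<in> {x. \<phi> x \<noteq> 0} \<union> {x. \<psi> x \<noteq> 0}" by blast
  then show "x \<in> closure {x. \<phi> x \<noteq> 0} \<union> closure {x. \<psi> x \<noteq> 0}"
   using closure_subset[of "{x. \<phi> x \<noteq> 0}"] closure_subset[of "{x. \<psi> x \<noteq> 0}"] by blast
 qed
 moreover have "compact (closure {x. \<phi> x \<noteq> 0} \<union> closure {x. \<psi> x \<noteq> 0})"
  "closure {x. \<phi> x \<noteq> 0} \<union> closure {x. \<psi> x \<noteq> 0} \<subseteq> U"
  using assms by (auto simp: test_functions_def intro: compact_Un)
 ultimately show ?thesis by (intro test_functionI)
qed

lemma test_mono: "U \<subseteq> V ==> test_functions U \<subseteq> test_functions V"
 by (auto simp: test_functions_def)

lemma test_zero: "(%x. 0) \<in> test_functions U"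
 using nice_test_function[OF nice_const[of 0] compact_empty, of U] by auto

lemma line_deriv_mult:
 fixes f g :: "point => real"
 assumes "((%s. f (z + s *\<^sub>R e)) has_real_derivative a) (at 0)"
  "((%s. g (z + s *\<^sub>R e)) has_real_derivative b) (at 0)"
 shows "((%s. f (z + s *\<^sub>R e) * g (z + s *\<^sub>R e)) has_real_derivative (f z * b + a * g z)) (at (0::real))"
 using DERIV_mult[OF assms] by (simp add: algebra_simps)

lemma compact_bound:
 fixes f :: "point => real"
 assumes "compact S" "continuous_on S f" shows "\<exists>M. \<forall>z\<in>S. \<bar>f z\<bar> \<le> M"
 using compact_imp_bounded[OF compact_continuous_image[OF assms(2,1)]] unfolding bounded_iff by simp

text \<open>Integration by parts over the plane when one factor is smooth and the product has bounded
 support.\<close>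

lemma integration_by_parts:
 assumes e: "e \<in> Basis" and F: "continuous_on UNIV F" and G: "G \<in> borel_measurable borel"
  and Z: "thin Z" and \<psi>: "smooth \<psi>"
  and B: "bounded B" "\<And>z. z \<notin> B ==> F z * \<psi> z = 0" "\<And>z. z \<notin> B ==> F z * dd e \<psi> z = 0"
   "\<And>z. z \<notin> B ==> G z * \<psi> z = 0"
  and bd: "\<And>z. z \<in> B ==> \<bar>G z\<bar> \<le> M"
  and der: "\<And>z. z \<notin> Z ==> z \<in> U ==> ((%s. F (z + s *\<^sub>R e)) has_real_derivative G z) (at 0)"
  and U: "\<And>z. z \<notin> U ==> \<exists>V. open V \<and> z \<in> V \<and> (\<forall>w\<in>V. F w * \<psi> w = 0 \<and> F w * dd e \<psi> w + G w * \<psi> w = 0)"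
 shows "integrable lborel (%z. F z * dd e \<psi> z + G z * \<psi> z)"
  "(LINT z|lborel. F z * dd e \<psi> z + G z * \<psi> z) = 0"
proof -
 have c: "continuous_on A \<psi>" "continuous_on A (dd e \<psi>)" for A
  using smooth_continuous \<psi> smooth_dir_deriv[OF \<psi> e] by auto
 have cb: "compact (closure B)" using B(1) by simp
 have "\<exists>M. \<forall>z\<in>closure B. \<bar>F z * dd e \<psi> z\<bar> \<le> M"
  using cb by (intro compact_bound continuous_intros c continuous_on_subset[OF F]) auto
 then obtain M1 where M1: "\<And>z. z \<in> closure B ==> \<bar>F z * dd e \<psi> z\<bar> \<le> M1" by blast
 obtain M2 where M2: "\<And>z. z \<in> closure B ==> \<bar>\<psi> z\<bar> \<le> M2" using compact_bound[OF cb c(1)] by blast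
 have cl: "B \<subseteq> closure B" by (rule closure_subset)
 have bd': "\<bar>F z * dd e \<psi> z + G z * \<psi> z\<bar> \<le> \<bar>M1\<bar> + \<bar>M\<bar> * \<bar>M2\<bar>" for z
 proof (cases "z \<in> B")
  case True
  then have "\<bar>G z * \<psi> z\<bar> \<le> \<bar>M\<bar> * \<bar>M2\<bar>" unfolding abs_mult
   using order_trans[OF bd[OF True] abs_ge_self[of M]]
    order_trans[OF M2[OF subsetD[OF cl True]] abs_ge_self[of M2]] by (intro mult_mono) auto
  moreover have "\<bar>F z * dd e \<psi> z\<bar> \<le> \<bar>M1\<bar>" using M1[OF subsetD[OF cl True]] by simp
  ultimately show ?thesis by linarith
 next
  case False
  then show ?thesis unfolding B(3)[OF False] B(4)[OF False] by simp
 qed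
 have m: "(%z. F z * dd e \<psi> z + G z * \<psi> z) \<in> borel_measurable borel"
  using G by (intro borel_measurable_add borel_measurable_times)
   (auto intro: borel_measurable_continuous_onI F c)
 have d: "((%s. F (z + s *\<^sub>R e) * \<psi> (z + s *\<^sub>R e)) has_real_derivative
   F z * dd e \<psi> z + G z * \<psi> z) (at 0)" if z: "z \<notin> Z" for z
 proof (cases "z \<in> U")
  case True
  show ?thesis
   using line_deriv_mult[OF der[OF z True] smooth_line_deriv[OF \<psi> e]] by simp
 next
  case False
  obtain V where V0: "open V" "z \<in> V" "\<forall>w\<in>V. F w * \<psi> w = 0 \<and> F w * dd e \<psi> w + G w * \<psi> w = 0"
   using U[OF False] by (elim exE conjE)
  have V: "open V" "z \<in> V" "\<And>w. w \<in> V ==> F w * \<psi> w = 0" "F z * dd e \<psi> z + G z * \<psi> z = 0"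
   using V0(1,2) bspec[OF V0(3)] by auto
  have op: "open ((%s::real. z + s *\<^sub>R e) -` V)"
   using V(1) by (intro open_vimage continuous_intros)
  have z0: "((%s. 0) has_real_derivative F z * dd e \<psi> z + G z * \<psi> z) (at (0::real))"
   using V(4) by simp
  show ?thesis
  proof (rule has_field_derivative_transform_within_open[OF z0 op])
   show "0 = F (z + s *\<^sub>R e) * \<psi> (z + s *\<^sub>R e)" if "s \<in> (%s. z + s *\<^sub>R e) -` V" for s
    using V(3)[of "z + s *\<^sub>R e"] that by simp
  qed (use V(2) in simp)
 qed
 show "integrable lborel (%z. F z * dd e \<psi> z + G z * \<psi> z)"
  "(LINT z|lborel. F z * dd e \<psi> z + G z * \<psi> z) = 0"
  by (rule integral_line_deriv_zero[of e "%z. F z * \<psi> z", OF e _ m bd' Z d B(1)],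
   (intro continuous_intros c F | simp add: B)+)+
qed

context bounded_domain begin

lemma integral_dom_lborel:
 fixes f :: "point => real"
 assumes "f \<in> borel_measurable borel" "\<And>x. x \<notin> Om ==> f x = 0"
 shows "(LINT x|lebesgue_on Om. f x) = (LINT x|lborel. f x)"
proof -
 have "(LINT x|lebesgue_on Om. f x) = (LINT x|lebesgue. indicator Om x *\<^sub>R f x)"
  using dom_lebesgue by (intro integral_restrict_space) auto
 also have "(%x. indicator Om x *\<^sub>R f x) = f"
 proof
  fix x show "indicator Om x *\<^sub>R f x = f x" using assms(2)[of x] by (cases "x \<in> Om") auto
 qed
 finally show ?thesis using integral_completion[of f lborel] assms(1) by simp
qed

text \<open>Integration by parts over the support of a test function, where the thin set does no harm.\<close>

lemma has_weak_derivI: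
 assumes e: "e \<in> Basis" and F: "continuous_on UNIV F" and G: "G \<in> borel_measurable borel"
  and bd: "\<And>z. z \<in> Om ==> \<bar>G z\<bar> \<le> M" and Z: "thin Z"
  and der: "\<And>z. z \<in> Om ==> z \<notin> Z ==> ((%s. F (z + s *\<^sub>R e)) has_real_derivative G z) (at 0)"
 shows "has_weak_deriv Om e F G"
 unfolding has_weak_deriv_def
proof (intro conjI ballI)
 show "F \<in> L2 Om" by (rule L2_continuous[OF F])
 show GL: "G \<in> L2 Om" by (rule L2_bounded[OF measurable_dom[OF G] bd])
 fix \<psi> assume \<psi>: "\<psi> \<in> tests"
 obtain C where C: "compact C" "C \<subseteq> Om" "\<And>z. z \<notin> C ==> \<psi> z = 0" "\<And>z e. z \<notin> C ==> dd e \<psi> z = 0"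
  using test_support[OF \<psi>] by blast
 have s: "smooth \<psi>" by (rule test_smooth[OF \<psi>])
 have mF: "F \<in> borel_measurable borel" "\<psi> \<in> borel_measurable borel" "dd e \<psi> \<in> borel_measurable borel"
  by (auto intro!: borel_measurable_continuous_onI F smooth_continuous s smooth_dir_deriv e)
 have "(LINT z|lborel. F z * dd e \<psi> z + G z * \<psi> z) = 0"
 proof (rule integration_by_parts(2)[OF e F G Z s compact_imp_bounded[OF C(1)], where M = M and U = Om])
  show "\<exists>V. open V \<and> z \<in> V \<and> (\<forall>w\<in>V. F w * \<psi> w = 0 \<and> F w * dd e \<psi> w + G w * \<psi> w = 0)"
   if "z \<notin> Om" for z
   using that C by (intro exI[of _ "- C"]) (auto simp: compact_imp_closed open_Compl)
 qed (use C bd der in auto)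
 then have "(LINT z|lebesgue_on Om. F z * dd e \<psi> z + G z * \<psi> z) = 0"
 proof (subst integral_dom_lborel)
  show "F z * dd e \<psi> z + G z * \<psi> z = 0" if "z \<notin> Om" for z
  proof -
   have "z \<notin> C" using that C(2) by blast
   then show ?thesis using C(3)[of z] C(4)[of z e] by simp
  qed
 qed (use mF G in auto)
 moreover have "(LINT z|lebesgue_on Om. F z * dd e \<psi> z + G z * \<psi> z)
   = ip F (dd e \<psi>) + ip G \<psi>"
  unfolding L2_inner_def
  using L2_mult_integrable[OF L2_continuous[OF F] test_deriv_L2[OF \<psi> e]] L2_mult_integrable[OF GL test_L2[OF \<psi>]]
  by simp
 ultimately show "ip F (dd e \<psi>) = - ip G \<psi>" by simp
qed

lemma smooth_has_weak_deriv:
 assumes "smooth f" "e \<in> Basis" shows "has_weak_deriv Om e f (dd e f)"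
proof -
 have c: "continuous_on UNIV (dd e f)" by (intro smooth_continuous smooth_dir_deriv assms)
 obtain M where "\<And>x. x \<in> Om ==> \<bar>dd e f x\<bar> \<le> M" using bounded_on_dom[OF c] by blast
 then show ?thesis
  using smooth_line_deriv[OF assms]
  by (intro has_weak_derivI[OF assms(2) smooth_continuous[OF assms(1)] borel_measurable_continuous_onI[OF c] _ thin_empty])
qed

lemma weak_deriv_unique:
 assumes "has_weak_deriv Om e f g" "has_weak_deriv Om e f g'"
 shows "ae_eq Om g g'"
proof -
 have L: "g \<in> L2 Om" "g' \<in> L2 Om" using assms by (auto simp: has_weak_deriv_def)
 have "AE x in lebesgue_on Om. g x - g' x = 0"
 proof (rule fundamental_lemma[OF open_dom L2_integrable[OF L2_diff[OF L]]])
  fix \<psi> assume \<psi>: "\<psi> \<in> tests"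
  have "ip (%x. g x - g' x) \<psi> = ip g \<psi> - ip g' \<psi>"
   by (rule L2_inner_diff_left[OF L test_L2[OF \<psi>]])
  also have "\<dots> = 0" using assms \<psi> unfolding has_weak_deriv_def by auto
  finally show "(LINT x|lebesgue_on Om. (g x - g' x) * \<psi> x) = 0" by (simp add: L2_inner_def)
 qed
 then show ?thesis unfolding ae_eq_def by eventually_elim simp
qed

lemma weak_deriv_has: "has_weak_deriv Om e f g ==> has_weak_deriv Om e f (wd e f)"
 unfolding weak_deriv_def by (rule someI[of "%g. has_weak_deriv Om e f g"])

lemma weak_deriv_eq: "has_weak_deriv Om e f g ==> ae_eq Om (wd e f) g"
 by (rule weak_deriv_unique[OF weak_deriv_has])

lemma has_weak_deriv_cong:
 assumes "ae_eq Om f f'" "ae_eq Om g g'" "has_weak_deriv Om e f g"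
 shows "has_weak_deriv Om e f' g'"
 unfolding has_weak_deriv_def
proof (intro conjI ballI)
 have fg: "f \<in> L2 Om" "g \<in> L2 Om" using assms(3) by (auto simp: has_weak_deriv_def)
 then show "f' \<in> L2 Om" "g' \<in> L2 Om" using L2_cong assms by auto
 fix \<psi> assume \<psi>: "\<psi> \<in> tests"
 have i: "ip f (dd e \<psi>) = - ip g \<psi>" using assms(3) \<psi> by (auto simp: has_weak_deriv_def)
 have c: "ae_eq Om f f' ==> f \<in> L2 Om ==> h \<in> borel_measurable borel ==> ip f h = ip f' h" for f f' h
  unfolding L2_inner_def
 proof (rule integral_cong_AE)
  assume a: "ae_eq Om f f'" "f \<in> L2 Om" "h \<in> borel_measurable borel"
  show "(%x. f x * h x) \<in> borel_measurable (lebesgue_on Om)"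
   by (intro borel_measurable_times L2_measurable[OF a(2)] measurable_dom[OF a(3)])
  show "(%x. f' x * h x) \<in> borel_measurable (lebesgue_on Om)"
   by (intro borel_measurable_times L2_measurable[OF L2_cong[OF a(1,2)]] measurable_dom[OF a(3)])
  show "AE x in lebesgue_on Om. f x * h x = f' x * h x"
   using a(1) unfolding ae_eq_def by eventually_elim simp
 qed
 have "frechet_derivative \<psi> (at x) e = dd (1,0) \<psi> x * fst e + dd (0,1) \<psi> x * snd e" for x
  using has_grad_dir[OF smooth_has_grad[OF test_smooth[OF \<psi>]], of e] by (simp add: dir_deriv_def)
 then have "dd e \<psi> = (%x. dd (1,0) \<psi> x * fst e + dd (0,1) \<psi> x * snd e)"
  by (auto simp: dir_deriv_def)
 then have m: "dd e \<psi> \<in> borel_measurable borel" "\<psi> \<in> borel_measurable borel"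
 proof -
  have s: "smooth \<psi>" by (rule test_smooth[OF \<psi>])
  show "\<psi> \<in> borel_measurable borel" by (intro borel_measurable_continuous_onI smooth_continuous s)
  show "dd e \<psi> \<in> borel_measurable borel"
   by (subst \<open>dd e \<psi> = _\<close>, intro borel_measurable_add borel_measurable_times borel_measurable_const
     borel_measurable_continuous_onI smooth_continuous smooth_dir_deriv s) (simp_all add: Basis_point)
 qed
 show "ip f' (dd e \<psi>) = - ip g' \<psi>"
  using c[OF assms(1) fg(1) m(1)] c[OF assms(2) fg(2) m(2)] i by simp
qed

lemma weak_deriv_cong: "ae_eq Om f f' ==> wd e f = wd e f'"
proof -
 assume f: "ae_eq Om f f'"
 have "has_weak_deriv Om e f = has_weak_deriv Om e f'"
  using has_weak_deriv_cong[OF f ae_eq_refl] has_weak_deriv_cong[OF ae_eq_sym[OF f] ae_eq_refl] by blast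
 then show ?thesis unfolding weak_deriv_def by simp
qed

lemma has_weak_deriv_linear:
 assumes e: "e \<in> Basis" and 1: "has_weak_deriv Om e f f'" and 2: "has_weak_deriv Om e g g'"
 shows "has_weak_deriv Om e (%x. a * f x + b * g x) (%x. a * f' x + b * g' x)"
proof -
 have L: "f \<in> L2 Om" "g \<in> L2 Om" "f' \<in> L2 Om" "g' \<in> L2 Om" using 1 2 by (auto simp: has_weak_deriv_def)
 then show ?thesis using 1 2 unfolding has_weak_deriv_def
  by (auto simp: L2_inner_add_left L2_inner_cmul_left test_L2 test_deriv_L2[OF _ e] L2_add L2_cmul)
qed

lemma H1_has: "f \<in> H1 Om ==> e \<in> Basis ==> has_weak_deriv Om e f (wd e f)"
 unfolding H1_def using weak_deriv_has by blast

lemma H1_L2: "f \<in> H1 Om ==> f \<in> L2 Om"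
 by (simp add: H1_def)

lemma H1_weak_L2: "f \<in> H1 Om ==> e \<in> Basis ==> wd e f \<in> L2 Om"
 using H1_has unfolding has_weak_deriv_def by blast

lemma H1I: "(\<And>e. e \<in> Basis ==> has_weak_deriv Om e f (g e)) ==> f \<in> H1 Om"
 unfolding H1_def has_weak_deriv_def using SOME_Basis by blast

lemma H1_linear: "f \<in> H1 Om ==> g \<in> H1 Om ==> (%x. a * f x + b * g x) \<in> H1 Om"
 by (rule H1I) (rule has_weak_deriv_linear[OF _ H1_has H1_has])

lemma weak_deriv_linear:
 "f \<in> H1 Om ==> g \<in> H1 Om ==> e \<in> Basis ==>
  ae_eq Om (wd e (%x. a * f x + b * g x)) (%x. a * wd e f x + b * wd e g x)"
 by (rule weak_deriv_eq[OF has_weak_deriv_linear[OF _ H1_has H1_has]])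

lemma H1_cong: "ae_eq Om f g ==> f \<in> H1 Om ==> g \<in> H1 Om"
 by (rule H1I) (rule has_weak_deriv_cong[OF _ ae_eq_refl H1_has])

lemma smooth_H1: "smooth f ==> f \<in> H1 Om"
 by (rule H1I) (rule smooth_has_weak_deriv)

lemma smooth_weak_deriv: "smooth f ==> e \<in> Basis ==> ae_eq Om (wd e f) (dd e f)"
 by (rule weak_deriv_eq[OF smooth_has_weak_deriv])

lemma H2_H1: "f \<in> H2 Om ==> f \<in> H1 Om"
 by (simp add: H2_def)

lemma H2_linear: "f \<in> H2 Om ==> g \<in> H2 Om ==> (%x. a * f x + b * g x) \<in> H2 Om"
proof -
 assume fg: "f \<in> H2 Om" "g \<in> H2 Om"
 have "wd e (%x. a * f x + b * g x) \<in> H1 Om" if e: "e \<in> Basis" for e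
  by (rule H1_cong[OF ae_eq_sym[OF weak_deriv_linear[OF H2_H1[OF fg(1)] H2_H1[OF fg(2)] e]]])
   (use fg e in \<open>auto simp: H2_def intro: H1_linear\<close>)
 then show ?thesis using fg by (auto simp: H2_def intro: H1_linear)
qed

lemma smooth_H2: "smooth f ==> f \<in> H2 Om"
 unfolding H2_def
 by (auto intro: smooth_H1 H1_cong[OF ae_eq_sym[OF smooth_weak_deriv]] smooth_dir_deriv)

text \<open>Squared norms are used throughout: the inequality \<open>(a + b)\<^sup>2 \<le> 2 a\<^sup>2 + 2 b\<^sup>2\<close> is
 all that the closure of the test functions being a subspace requires.\<close>

lemma H1_norm_sq: "(H1_norm Om f)\<^sup>2 = (nrm f)\<^sup>2 + (\<Sum>e\<in>Basis. (nrm (wd e f))\<^sup>2)"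
 unfolding H1_norm_def by (intro real_sqrt_pow2 add_nonneg_nonneg sum_nonneg) auto

lemma H2_norm_sq: "(H2_norm Om f)\<^sup>2 = (nrm f)\<^sup>2 + (\<Sum>e\<in>Basis. (H1_norm Om (wd e f))\<^sup>2)"
 unfolding H2_norm_def by (intro real_sqrt_pow2 add_nonneg_nonneg sum_nonneg) auto

lemma H1_norm_nonneg: "0 \<le> H1_norm Om f"
 unfolding H1_norm_def by (intro real_sqrt_ge_zero add_nonneg_nonneg sum_nonneg) auto

lemma H2_norm_nonneg: "0 \<le> H2_norm Om f"
 unfolding H2_norm_def by (intro real_sqrt_ge_zero add_nonneg_nonneg sum_nonneg) auto

lemma H1_norm_cong: "ae_eq Om f g ==> f \<in> L2 Om ==> H1_norm Om f = H1_norm Om g"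
 unfolding H1_norm_def using L2_norm_cong[of f g] weak_deriv_cong[of f g] by simp

lemma L2_le_H1: "nrm f \<le> H1_norm Om f"
 by (rule power2_le_imp_le[OF _ H1_norm_nonneg]) (auto simp: H1_norm_sq sum_nonneg)

lemma weak_le_H1: "e \<in> Basis ==> nrm (wd e f) \<le> H1_norm Om f"
proof (rule power2_le_imp_le[OF _ H1_norm_nonneg])
 assume e: "e \<in> Basis"
 have "(nrm (wd e f))\<^sup>2 \<le> (\<Sum>e\<in>Basis. (nrm (wd e f))\<^sup>2)"
  using e by (intro member_le_sum) auto
 then show "(nrm (wd e f))\<^sup>2 \<le> (H1_norm Om f)\<^sup>2"
  unfolding H1_norm_sq using zero_le_power2[of "nrm f"] by linarith
qed

lemma H1_le_H2: "H1_norm Om f \<le> H2_norm Om f"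
proof (rule power2_le_imp_le[OF _ H2_norm_nonneg])
 have "(\<Sum>e\<in>Basis. (nrm (wd e f))\<^sup>2) \<le> (\<Sum>e\<in>Basis. (H1_norm Om (wd e f))\<^sup>2)"
  using L2_le_H1 L2_norm_nonneg by (intro sum_mono power_mono)
 then show "(H1_norm Om f)\<^sup>2 \<le> (H2_norm Om f)\<^sup>2" unfolding H1_norm_sq H2_norm_sq by simp
qed

lemma weak_le_H2: "e \<in> Basis ==> H1_norm Om (wd e f) \<le> H2_norm Om f"
proof (rule power2_le_imp_le[OF _ H2_norm_nonneg])
 assume e: "e \<in> Basis"
 have "(H1_norm Om (wd e f))\<^sup>2 \<le> (\<Sum>e\<in>Basis. (H1_norm Om (wd e f))\<^sup>2)"
  using e by (intro member_le_sum) auto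
 then show "(H1_norm Om (wd e f))\<^sup>2 \<le> (H2_norm Om f)\<^sup>2"
  unfolding H2_norm_sq using zero_le_power2[of "nrm f"] by linarith
qed

lemma L2_norm_sq_linear:
 assumes "f \<in> L2 Om" "g \<in> L2 Om"
 shows "(nrm (%x. a * f x + b * g x))\<^sup>2 \<le> 2 * a\<^sup>2 * (nrm f)\<^sup>2 + 2 * b\<^sup>2 * (nrm g)\<^sup>2"
proof -
 have "(nrm (%x. a * f x))\<^sup>2 = a\<^sup>2 * (nrm f)\<^sup>2" for a f
  unfolding L2_norm_sq L2_inner_def by (subst integral_mult_right_zero[symmetric]) (simp add: power2_eq_square mult_ac)
 then show ?thesis using L2_norm_sq_add[OF L2_cmul[OF assms(1), of a] L2_cmul[OF assms(2), of b]] by simp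
qed

lemma H1_norm_sq_linear:
 assumes "f \<in> H1 Om" "g \<in> H1 Om"
 shows "(H1_norm Om (%x. a * f x + b * g x))\<^sup>2 \<le> 2 * a\<^sup>2 * (H1_norm Om f)\<^sup>2 + 2 * b\<^sup>2 * (H1_norm Om g)\<^sup>2"
proof -
 have "(\<Sum>e\<in>Basis. (nrm (wd e (%x. a * f x + b * g x)))\<^sup>2)
   \<le> (\<Sum>e\<in>Basis. 2 * a\<^sup>2 * (nrm (wd e f))\<^sup>2 + 2 * b\<^sup>2 * (nrm (wd e g))\<^sup>2)"
 proof (rule sum_mono)
  fix e :: point assume e: "e \<in> Basis"
  have "nrm (wd e (%x. a * f x + b * g x)) = nrm (%x. a * wd e f x + b * wd e g x)"
   using assms e by (intro L2_norm_cong weak_deriv_linear H1_weak_L2 H1_linear)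
  then show "(nrm (wd e (%x. a * f x + b * g x)))\<^sup>2
    \<le> 2 * a\<^sup>2 * (nrm (wd e f))\<^sup>2 + 2 * b\<^sup>2 * (nrm (wd e g))\<^sup>2"
   using L2_norm_sq_linear[OF H1_weak_L2[OF assms(1) e] H1_weak_L2[OF assms(2) e]] by simp
 qed
 then show ?thesis unfolding H1_norm_sq
  using L2_norm_sq_linear[OF H1_L2[OF assms(1)] H1_L2[OF assms(2)], of a b]
  by (simp add: sum.distrib sum_distrib_left distrib_left)
qed

lemma H2_norm_sq_linear:
 assumes "f \<in> H2 Om" "g \<in> H2 Om"
 shows "(H2_norm Om (%x. a * f x + b * g x))\<^sup>2 \<le> 2 * a\<^sup>2 * (H2_norm Om f)\<^sup>2 + 2 * b\<^sup>2 * (H2_norm Om g)\<^sup>2"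
proof -
 have h: "f \<in> H1 Om" "g \<in> H1 Om" "\<And>e. e \<in> Basis ==> wd e f \<in> H1 Om" "\<And>e. e \<in> Basis ==> wd e g \<in> H1 Om"
  using assms by (auto simp: H2_def)
 have "(\<Sum>e\<in>Basis. (H1_norm Om (wd e (%x. a * f x + b * g x)))\<^sup>2)
   \<le> (\<Sum>e\<in>Basis. 2 * a\<^sup>2 * (H1_norm Om (wd e f))\<^sup>2 + 2 * b\<^sup>2 * (H1_norm Om (wd e g))\<^sup>2)"
 proof (rule sum_mono)
  fix e :: point assume e: "e \<in> Basis"
  have "H1_norm Om (wd e (%x. a * f x + b * g x)) = H1_norm Om (%x. a * wd e f x + b * wd e g x)"
   using h e by (intro H1_norm_cong weak_deriv_linear H1_weak_L2 H1_linear)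
  then show "(H1_norm Om (wd e (%x. a * f x + b * g x)))\<^sup>2
    \<le> 2 * a\<^sup>2 * (H1_norm Om (wd e f))\<^sup>2 + 2 * b\<^sup>2 * (H1_norm Om (wd e g))\<^sup>2"
   using H1_norm_sq_linear[OF h(3)[OF e] h(4)[OF e]] by simp
 qed
 then show ?thesis unfolding H2_norm_sq
  using L2_norm_sq_linear[OF H1_L2[OF h(1)] H1_L2[OF h(2)], of a b]
  by (simp add: sum.distrib sum_distrib_left distrib_left)
qed

lemma H1_0_H1: "f \<in> H1_0 Om ==> f \<in> H1 Om"
 by (simp add: H1_0_def)

lemma H1_0_approx:
 assumes "f \<in> H1_0 Om" "\<epsilon> > 0"
 shows "\<exists>\<psi>\<in>tests. (H1_norm Om (%x. f x - \<psi> x))\<^sup>2 < \<epsilon>"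
proof -
 obtain \<psi> where "\<psi> \<in> tests" "H1_norm Om (%x. f x - \<psi> x) < sqrt \<epsilon>"
  using assms unfolding H1_0_def by (auto dest: spec[of _ "sqrt \<epsilon>"])
 moreover from this have "(H1_norm Om (%x. f x - \<psi> x))\<^sup>2 < (sqrt \<epsilon>)\<^sup>2"
  using H1_norm_nonneg by (intro power_strict_mono) auto
 ultimately show ?thesis using assms(2) by (intro bexI[of _ \<psi>]) simp_all
qed

lemma H1_0I:
 assumes "f \<in> H1 Om" "\<And>\<epsilon>. \<epsilon> > 0 ==> \<exists>\<psi>\<in>tests. (H1_norm Om (%x. f x - \<psi> x))\<^sup>2 < \<epsilon>"
 shows "f \<in> H1_0 Om"
 unfolding H1_0_def
proof safe
 fix \<epsilon> :: real assume "\<epsilon> > 0"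
 then obtain \<psi> where "\<psi> \<in> tests" "(H1_norm Om (%x. f x - \<psi> x))\<^sup>2 < \<epsilon>\<^sup>2" using assms(2)[of "\<epsilon>\<^sup>2"] by auto
 then show "\<exists>\<psi>\<in>tests. H1_norm Om (%x. f x - \<psi> x) < \<epsilon>"
  using \<open>\<epsilon> > 0\<close> power2_less_imp_less[of _ \<epsilon>] by auto
qed (rule assms(1))

lemma H2_0_approx:
 assumes "f \<in> H2_0 Om" "\<epsilon> > 0"
 shows "\<exists>\<psi>\<in>tests. (H2_norm Om (%x. f x - \<psi> x))\<^sup>2 < \<epsilon>"
proof -
 obtain \<psi> where "\<psi> \<in> tests" "H2_norm Om (%x. f x - \<psi> x) < sqrt \<epsilon>"
  using assms unfolding H2_0_def by (auto dest: spec[of _ "sqrt \<epsilon>"])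
 moreover from this have "(H2_norm Om (%x. f x - \<psi> x))\<^sup>2 < (sqrt \<epsilon>)\<^sup>2"
  using H2_norm_nonneg by (intro power_strict_mono) auto
 ultimately show ?thesis using assms(2) by (intro bexI[of _ \<psi>]) simp_all
qed

lemma H2_0I:
 assumes "f \<in> H2 Om" "\<And>\<epsilon>. \<epsilon> > 0 ==> \<exists>\<psi>\<in>tests. (H2_norm Om (%x. f x - \<psi> x))\<^sup>2 < \<epsilon>"
 shows "f \<in> H2_0 Om"
 unfolding H2_0_def
proof safe
 fix \<epsilon> :: real assume "\<epsilon> > 0"
 then obtain \<psi> where "\<psi> \<in> tests" "(H2_norm Om (%x. f x - \<psi> x))\<^sup>2 < \<epsilon>\<^sup>2" using assms(2)[of "\<epsilon>\<^sup>2"] by auto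
 then show "\<exists>\<psi>\<in>tests. H2_norm Om (%x. f x - \<psi> x) < \<epsilon>"
  using \<open>\<epsilon> > 0\<close> power2_less_imp_less[of _ \<epsilon>] by auto
qed (rule assms(1))

lemma test_diff_linear:
 "(%x. (a * f x + b * g x) - (a * \<phi> x + b * \<psi> x)) = (%x. a * (f x - \<phi> x) + b * (g x - (\<psi> x :: real)))"
 by (auto simp: algebra_simps)

lemma smooth_diff_H1: "f \<in> H1 Om ==> smooth g ==> (%x. f x - g x) \<in> H1 Om"
 using H1_linear[OF _ smooth_H1, of f g 1 "-1"] by simp

lemma smooth_diff_H2: "f \<in> H2 Om ==> smooth g ==> (%x. f x - g x) \<in> H2 Om"
 using H2_linear[OF _ smooth_H2, of f g 1 "-1"] by simp

lemma approx_linear: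
 fixes N :: "(point => real) => real"
 assumes f: "\<And>\<epsilon>. \<epsilon> > 0 ==> \<exists>\<psi>\<in>tests. (N (%x. f x - \<psi> x))\<^sup>2 < \<epsilon>"
  and g: "\<And>\<epsilon>. \<epsilon> > 0 ==> \<exists>\<psi>\<in>tests. (N (%x. g x - \<psi> x))\<^sup>2 < \<epsilon>"
  and N: "\<And>\<phi> \<psi>. \<phi> \<in> tests ==> \<psi> \<in> tests ==>
   (N (%x. a * (f x - \<phi> x) + b * (g x - \<psi> x)))\<^sup>2 \<le> 2 * a\<^sup>2 * (N (%x. f x - \<phi> x))\<^sup>2 + 2 * b\<^sup>2 * (N (%x. g x - \<psi> x))\<^sup>2"
  and "\<epsilon> > 0"
 shows "\<exists>\<psi>\<in>tests. (N (%x. (a * f x + b * g x) - \<psi> x))\<^sup>2 < \<epsilon>"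
proof -
 let ?\<delta> = "\<epsilon> / (4 * (a\<^sup>2 + b\<^sup>2 + 1))"
 have p: "0 < 4 * (a\<^sup>2 + b\<^sup>2 + 1)" by (simp add: add_nonneg_pos)
 then have "?\<delta> > 0" using \<open>\<epsilon> > 0\<close> by simp
 then obtain \<phi> \<psi> where t: "\<phi> \<in> tests" "\<psi> \<in> tests"
  "(N (%x. f x - \<phi> x))\<^sup>2 < ?\<delta>" "(N (%x. g x - \<psi> x))\<^sup>2 < ?\<delta>" using f g by blast
 have "(N (%x. a * (f x - \<phi> x) + b * (g x - \<psi> x)))\<^sup>2 \<le> 2 * a\<^sup>2 * (N (%x. f x - \<phi> x))\<^sup>2 + 2 * b\<^sup>2 * (N (%x. g x - \<psi> x))\<^sup>2"
  by (rule N[OF t(1,2)])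
 also have "\<dots> \<le> 2 * a\<^sup>2 * ?\<delta> + 2 * b\<^sup>2 * ?\<delta>"
  using t(3,4) by (intro add_mono mult_left_mono) auto
 also have "\<dots> < (4 * (a\<^sup>2 + b\<^sup>2 + 1)) * ?\<delta>"
  using \<open>?\<delta> > 0\<close> unfolding distrib_right[symmetric] by (intro mult_strict_right_mono) (auto simp: add_nonneg_pos add.assoc intro!: add_increasing)
 also have "\<dots> = \<epsilon>" using p by simp
 finally show ?thesis using test_linear[OF t(1,2), of a b] by (intro bexI) (auto simp: test_diff_linear)
qed

lemma H1_0_linear:
 assumes "f \<in> H1_0 Om" "g \<in> H1_0 Om" shows "(%x. a * f x + b * g x) \<in> H1_0 Om"
proof (rule H1_0I)
 have h: "f \<in> H1 Om" "g \<in> H1 Om" using assms H1_0_H1 by auto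
 then show "(%x. a * f x + b * g x) \<in> H1 Om" by (rule H1_linear)
 fix \<epsilon> :: real assume "\<epsilon> > 0"
 show "\<exists>\<psi>\<in>tests. (H1_norm Om (%x. (a * f x + b * g x) - \<psi> x))\<^sup>2 < \<epsilon>"
 proof (rule approx_linear[OF _ _ _ \<open>\<epsilon> > 0\<close>])
  show "\<exists>\<psi>\<in>tests. (H1_norm Om (%x. f x - \<psi> x))\<^sup>2 < \<epsilon>" if "\<epsilon> > 0" for \<epsilon>
   using H1_0_approx[OF assms(1) that] by blast
  show "\<exists>\<psi>\<in>tests. (H1_norm Om (%x. g x - \<psi> x))\<^sup>2 < \<epsilon>" if "\<epsilon> > 0" for \<epsilon>
   using H1_0_approx[OF assms(2) that] by blast
 qed (intro H1_norm_sq_linear smooth_diff_H1 h test_smooth)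
qed

lemma H2_0_linear:
 assumes "f \<in> H2_0 Om" "g \<in> H2_0 Om" shows "(%x. a * f x + b * g x) \<in> H2_0 Om"
proof (rule H2_0I)
 have h: "f \<in> H2 Om" "g \<in> H2 Om" using assms by (auto simp: H2_0_def)
 then show "(%x. a * f x + b * g x) \<in> H2 Om" by (rule H2_linear)
 fix \<epsilon> :: real assume "\<epsilon> > 0"
 show "\<exists>\<psi>\<in>tests. (H2_norm Om (%x. (a * f x + b * g x) - \<psi> x))\<^sup>2 < \<epsilon>"
 proof (rule approx_linear[OF _ _ _ \<open>\<epsilon> > 0\<close>])
  show "\<exists>\<psi>\<in>tests. (H2_norm Om (%x. f x - \<psi> x))\<^sup>2 < \<epsilon>" if "\<epsilon> > 0" for \<epsilon>
   using H2_0_approx[OF assms(1) that] by blast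
  show "\<exists>\<psi>\<in>tests. (H2_norm Om (%x. g x - \<psi> x))\<^sup>2 < \<epsilon>" if "\<epsilon> > 0" for \<epsilon>
   using H2_0_approx[OF assms(2) that] by blast
 qed (intro H2_norm_sq_linear smooth_diff_H2 h test_smooth)
qed

lemma H1_0_zero: "(%x. 0) \<in> H1_0 Om"
proof (rule H1_0I)
 have s: "smooth (%x. 0)" by (rule nice_smooth[OF nice_const])
 show "(%x. 0) \<in> H1 Om" by (rule smooth_H1[OF s])
 have "dd e (%x. 0) = (%x. 0)" for e
  by (rule ext) (simp add: has_grad_dir[OF has_grad_const])
 then have "nrm (wd e (%x. 0)) = 0" if "e \<in> Basis" for e
  using L2_norm_cong[OF ae_eq_sym[OF smooth_weak_deriv[OF s that]]] L2_const[of 0] by (simp add: L2_norm_def L2_inner_def)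
 then have "(H1_norm Om (%x. 0 - 0))\<^sup>2 = 0" unfolding H1_norm_sq by (simp add: L2_norm_def L2_inner_def)
 then show "\<exists>\<psi>\<in>tests. (H1_norm Om (%x. 0 - \<psi> x))\<^sup>2 < \<epsilon>" if "\<epsilon> > 0" for \<epsilon>
  using that by (intro bexI[OF _ test_zero]) simp
qed

lemma test_H2_0: assumes "\<phi> \<in> tests" shows "\<phi> \<in> H2_0 Om"
proof (rule H2_0I)
 show "\<phi> \<in> H2 Om" by (rule smooth_H2[OF test_smooth[OF assms]])
 have s: "smooth (%x. 0)" by (rule nice_smooth[OF nice_const])
 have d: "dd e (%x. 0) = (%x. 0)" for e
  by (rule ext) (simp add: has_grad_dir[OF has_grad_const])
 have w: "ae_eq Om (wd e (%x. 0)) (%x. 0)" if "e \<in> Basis" for e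
  using smooth_weak_deriv[OF s that] d by simp
 have L0: "nrm (%x. 0) = 0" by (simp add: L2_norm_def L2_inner_def)
 have H0: "H1_norm Om (%x. 0) = 0"
  unfolding H1_norm_def using L2_norm_cong[OF ae_eq_sym[OF w]] L2_const[of 0] L0 by simp
 have "H1_norm Om (wd e (%x. 0)) = 0" if "e \<in> Basis" for e
  using H1_norm_cong[OF ae_eq_sym[OF w[OF that]]] L2_const[of 0] H0 by simp
 then have "(H2_norm Om (%x. \<phi> x - \<phi> x))\<^sup>2 = 0" unfolding H2_norm_sq by (simp add: L0)
 then show "\<exists>\<psi>\<in>tests. (H2_norm Om (%x. \<phi> x - \<psi> x))\<^sup>2 < \<epsilon>" if "\<epsilon> > 0" for \<epsilon>
  using that by (intro bexI[OF _ assms]) simp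
qed

lemma H2_0_H1_0: assumes "f \<in> H2_0 Om" shows "f \<in> H1_0 Om"
proof (rule H1_0I)
 show "f \<in> H1 Om" using assms by (auto simp: H2_0_def H2_def)
 fix \<epsilon> :: real assume "\<epsilon> > 0"
 then obtain \<psi> where \<psi>: "\<psi> \<in> tests" "(H2_norm Om (%x. f x - \<psi> x))\<^sup>2 < \<epsilon>" using H2_0_approx[OF assms] by blast
 moreover have "(H1_norm Om (%x. f x - \<psi> x))\<^sup>2 \<le> (H2_norm Om (%x. f x - \<psi> x))\<^sup>2"
  using H1_le_H2 H1_norm_nonneg by (intro power_mono)
 ultimately show "\<exists>\<psi>\<in>tests. (H1_norm Om (%x. f x - \<psi> x))\<^sup>2 < \<epsilon>" by force
qed

text \<open>If test functions approximate \<open>f\<close> in the second-order norm, then their derivatives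
 approximate the derivatives of \<open>f\<close> in the first-order norm.\<close>

lemma H2_0_weak_deriv: assumes "f \<in> H2_0 Om" "e \<in> Basis" shows "wd e f \<in> H1_0 Om"
proof (rule H1_0I)
 have f: "f \<in> H2 Om" using assms by (simp add: H2_0_def)
 then show w: "wd e f \<in> H1 Om" using assms by (simp add: H2_def)
 fix \<epsilon> :: real assume "\<epsilon> > 0"
 then obtain \<psi> where \<psi>: "\<psi> \<in> tests" "(H2_norm Om (%x. f x - \<psi> x))\<^sup>2 < \<epsilon>" using H2_0_approx[OF assms(1)] by blast
 have s: "smooth \<psi>" by (rule test_smooth[OF \<psi>(1)])
 have "ae_eq Om (wd e (%x. f x - \<psi> x)) (%x. wd e f x - wd e \<psi> x)"
  using weak_deriv_linear[OF H2_H1[OF f] smooth_H1[OF s] assms(2), of 1 "-1"] by simp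
 then have "ae_eq Om (wd e (%x. f x - \<psi> x)) (%x. wd e f x - dd e \<psi> x)"
  by (rule ae_eq_trans) (intro ae_eq_diff ae_eq_refl smooth_weak_deriv[OF s assms(2)])
 then have "H1_norm Om (%x. wd e f x - dd e \<psi> x) = H1_norm Om (wd e (%x. f x - \<psi> x))"
  by (intro H1_norm_cong[symmetric] H1_weak_L2 assms smooth_diff_H1 H2_H1 f s)
 also have "\<dots> \<le> H2_norm Om (%x. f x - \<psi> x)" by (rule weak_le_H2[OF assms(2)])
 finally have "(H1_norm Om (%x. wd e f x - dd e \<psi> x))\<^sup>2 \<le> (H2_norm Om (%x. f x - \<psi> x))\<^sup>2"
  using H1_norm_nonneg by (intro power_mono)
 then show "\<exists>\<psi>\<in>tests. (H1_norm Om (%x. wd e f x - \<psi> x))\<^sup>2 < \<epsilon>"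
  using \<psi>(2) by (intro bexI[OF _ test_deriv_test[OF \<psi>(1) assms(2)]]) simp
qed

text \<open>By density: for a test function in place of \<open>f\<close> there is no boundary term, whatever the other factor
is, and both sides are continuous in \<open>f\<close>.\<close>

lemma H1_0_integration_by_parts:
 assumes f: "f \<in> H1_0 Om" and \<eta>: "smooth \<eta>" and e: "e \<in> Basis"
 shows "ip f (dd e \<eta>) = - ip (wd e f) \<eta>"
proof -
 have L: "\<eta> \<in> L2 Om" "dd e \<eta> \<in> L2 Om"
  by (intro L2_continuous smooth_continuous smooth_dir_deriv \<eta> e)+
 have fH: "f \<in> H1 Om" by (rule H1_0_H1[OF f])
 have test: "ip \<psi> (dd e \<eta>) + ip (dd e \<psi>) \<eta> = 0" if \<psi>: "\<psi> \<in> tests" for \<psi>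
 proof -
  obtain C where C: "compact C" "C \<subseteq> Om" "\<And>z. z \<notin> C ==> \<psi> z = 0" "\<And>z e. z \<notin> C ==> dd e \<psi> z = 0"
   using test_support[OF \<psi>] by blast
  have s: "smooth \<psi>" by (rule test_smooth[OF \<psi>])
  have c: "continuous_on A \<psi>" "continuous_on A (dd e \<psi>)" "continuous_on A \<eta>" "continuous_on A (dd e \<eta>)" for A
   by (intro smooth_continuous smooth_dir_deriv \<eta> s e)+
  obtain M where M: "\<And>z. z \<in> Om ==> \<bar>dd e \<psi> z\<bar> \<le> M" using bounded_on_dom[OF c(2)] by blast
  have "(LINT z|lborel. \<psi> z * dd e \<eta> z + dd e \<psi> z * \<eta> z) = 0"
   using C M
   by (intro integration_by_parts(2)[OF e c(1) borel_measurable_continuous_onI[OF c(2)] thin_empty \<eta> compact_imp_bounded[OF C(1)],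
      where M = M and U = UNIV] smooth_line_deriv[OF s e]) auto
  then have "(LINT z|lebesgue_on Om. \<psi> z * dd e \<eta> z + dd e \<psi> z * \<eta> z) = 0"
  proof (subst integral_dom_lborel)
   show "\<psi> z * dd e \<eta> z + dd e \<psi> z * \<eta> z = 0" if "z \<notin> Om" for z
   proof -
    have "z \<notin> C" using that C(2) by blast
    then show ?thesis using C(3)[of z] C(4)[of z e] by simp
   qed
  qed (auto intro!: borel_measurable_continuous_onI continuous_intros c)
  then show ?thesis unfolding L2_inner_def
   using L2_mult_integrable[OF test_L2[OF \<psi>] L(2)] L2_mult_integrable[OF test_deriv_L2[OF \<psi> e] L(1)] by simp
 qed
 let ?D = "ip f (dd e \<eta>) + ip (wd e f) \<eta>"
 let ?K = "nrm (dd e \<eta>) + nrm \<eta>"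
 have "?D\<^sup>2 \<le> \<epsilon>" if "\<epsilon> > 0" for \<epsilon>
 proof -
  let ?\<delta> = "\<epsilon> / (?K\<^sup>2 + 1)"
  have "?\<delta> > 0" using that by (simp add: add_nonneg_pos)
  then obtain \<psi> where \<psi>: "\<psi> \<in> tests" "(H1_norm Om (%x. f x - \<psi> x))\<^sup>2 < ?\<delta>" using H1_0_approx[OF f] by blast
  let ?h = "%x. f x - \<psi> x" let ?n = "H1_norm Om ?h"
  have s: "smooth \<psi>" by (rule test_smooth[OF \<psi>(1)])
  have h: "?h \<in> H1 Om" by (rule smooth_diff_H1[OF fH s])
  have w: "ae_eq Om (wd e ?h) (%x. wd e f x - dd e \<psi> x)"
   using ae_eq_trans[OF weak_deriv_linear[OF fH smooth_H1[OF s] e, of 1 "-1"]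
    ae_eq_map2[OF ae_eq_refl smooth_weak_deriv[OF s e], of "%a b. 1 * a + -1 * b"]] by simp
  have "ip ?h (dd e \<eta>) = ip f (dd e \<eta>) - ip \<psi> (dd e \<eta>)"
   by (intro L2_inner_diff_left H1_L2 fH test_L2[OF \<psi>(1)] L)
  moreover have "ip (wd e ?h) \<eta> = ip (wd e f) \<eta> - ip (dd e \<psi>) \<eta>"
   using L2_inner_cong[OF w ae_eq_refl H1_weak_L2[OF h e] L(1)]
   by (simp add: L2_inner_diff_left[OF H1_weak_L2[OF fH e] test_deriv_L2[OF \<psi>(1) e] L(1)])
  ultimately have "?D = ip ?h (dd e \<eta>) + ip (wd e ?h) \<eta>"
   using test[OF \<psi>(1)] by linarith
  also have "\<bar>\<dots>\<bar> \<le> nrm ?h * nrm (dd e \<eta>) + nrm (wd e ?h) * nrm \<eta>"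
   using L2_Cauchy_Schwarz[OF H1_L2[OF h] L(2)] L2_Cauchy_Schwarz[OF H1_weak_L2[OF h e] L(1)] by linarith
  also have "\<dots> \<le> ?n * nrm (dd e \<eta>) + ?n * nrm \<eta>"
   using L2_le_H1 weak_le_H1[OF e] L2_norm_nonneg by (intro add_mono mult_right_mono)
  also have "\<dots> = ?n * ?K" by (simp add: distrib_left)
  finally have "\<bar>?D\<bar>\<^sup>2 \<le> (?n * ?K)\<^sup>2" by (intro power_mono) auto
  then have "?D\<^sup>2 \<le> ?n\<^sup>2 * ?K\<^sup>2" by (simp add: power_mult_distrib)
  also have "\<dots> \<le> ?\<delta> * ?K\<^sup>2" using \<psi>(2) by (intro mult_right_mono) auto
  also have "\<dots> \<le> ?\<delta> * (?K\<^sup>2 + 1)" using \<open>?\<delta> > 0\<close> by (intro mult_left_mono) auto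
  also have "\<dots> = \<epsilon>"
  proof -
   have "?K\<^sup>2 + 1 \<noteq> 0" using zero_le_power2[of ?K] by linarith
   then show ?thesis by simp
  qed
  finally show ?thesis .
 qed
 then have "?D\<^sup>2 \<le> 0" using field_le_epsilon[of "?D\<^sup>2" 0] by auto
 then show ?thesis by simp
qed

text \<open>Test functions supported in the open set cannot tell the weak derivative from the classical one.\<close>

lemma weak_deriv_local:
 assumes f: "f \<in> H1 Om" and U: "open U" "U \<subseteq> Om" and eq: "AE x in lebesgue. x \<in> U --> f x = p x"
  and p: "smooth p" and e: "e \<in> Basis"
 shows "AE x in lebesgue. x \<in> U --> wd e f x = dd e p x"
proof -
 let ?g = "wd e f"
 have Um: "U \<in> sets lebesgue" using U by (simp add: borel_open)
 have pL: "p \<in> L2 Om" "dd e p \<in> L2 Om" by (intro L2_continuous smooth_continuous smooth_dir_deriv p e)+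
 have gL: "?g \<in> L2 Om" by (rule H1_weak_L2[OF f e])
 have restrict: "(LINT x|lebesgue_on U. h x) = (LINT x|lebesgue_on Om. h x)" if "\<And>x. x \<in> Om - U ==> h x = 0" for h :: "point => real"
 proof -
  have "(%x. indicator U x *\<^sub>R h x) = (%x. indicator Om x *\<^sub>R h x)"
  proof
   fix x show "indicator U x *\<^sub>R h x = indicator Om x *\<^sub>R h x"
    using that[of x] U(2) by (auto simp: indicator_def)
  qed
  then show ?thesis using Um dom_lebesgue by (simp add: integral_restrict_space)
 qed
 have "AE x in lebesgue_on U. ?g x - dd e p x = 0"
 proof (rule fundamental_lemma[OF U(1)])
  have "integrable lebesgue (%x. indicator U x *\<^sub>R (indicator Om x *\<^sub>R (?g x - dd e p x)))"
  proof (rule integrable_mult_indicator)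
   show "integrable lebesgue (%x. indicator Om x *\<^sub>R (?g x - dd e p x))"
    using L2_integrable[OF L2_diff[OF gL pL(2)]] dom_lebesgue by (subst (asm) integrable_restrict_space) auto
  qed (use Um in auto)
  moreover have "(%x. indicator U x *\<^sub>R (indicator Om x *\<^sub>R (?g x - dd e p x)))
    = (%x. indicator U x *\<^sub>R (?g x - dd e p x))" using U(2) by (auto simp: indicator_def fun_eq_iff)
  ultimately show "integrable (lebesgue_on U) (%x. ?g x - dd e p x)"
   using Um by (simp add: integrable_restrict_space)
  fix \<psi> assume "\<psi> \<in> test_functions U"
  then have \<psi>: "\<psi> \<in> tests" using test_mono[OF U(2)] by blast
  obtain C where C: "C \<subseteq> U" "\<And>z. z \<notin> C ==> \<psi> z = 0" "\<And>z e. z \<notin> C ==> dd e \<psi> z = 0"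
   using test_support[OF \<open>\<psi> \<in> test_functions U\<close>] by blast
  have "(LINT x|lebesgue_on U. (?g x - dd e p x) * \<psi> x) = ip (%x. ?g x - dd e p x) \<psi>"
   unfolding L2_inner_def
  proof (rule restrict)
   show "(?g x - dd e p x) * \<psi> x = 0" if "x \<in> Om - U" for x
    using that C(1) C(2)[of x] by auto
  qed
  also have "\<dots> = ip ?g \<psi> - ip (dd e p) \<psi>"
   by (rule L2_inner_diff_left[OF gL pL(2) test_L2[OF \<psi>]])
  also have "\<dots> = ip p (dd e \<psi>) - ip f (dd e \<psi>)"
   using H1_has[OF f e] smooth_has_weak_deriv[OF p e] \<psi> unfolding has_weak_deriv_def by simp
  also have "ip f (dd e \<psi>) = ip p (dd e \<psi>)"
   unfolding L2_inner_def
  proof (rule integral_cong_AE)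
   show "AE x in lebesgue_on Om. f x * dd e \<psi> x = p x * dd e \<psi> x"
    unfolding AE_dom_iff using eq
   proof eventually_elim
    case (elim x)
    then show ?case using C(1) C(3)[of x e] by (cases "x \<in> U") auto
   qed
  qed (use L2_measurable[OF H1_L2[OF f]] L2_measurable[OF pL(1)] L2_measurable[OF test_deriv_L2[OF \<psi> e]] in auto)
  finally show "(LINT x|lebesgue_on U. (?g x - dd e p x) * \<psi> x) = 0" by simp
 qed
 then show ?thesis unfolding AE_lebesgue_on_iff[OF Um] by eventually_elim simp
qed

end

section \<open>Polygons and triangulations\<close>

fun polygonal_path :: "point list => nat => real => point" where
 "polygonal_path vs 0 = linepath (vs ! 0) (vs ! 1)"
| "polygonal_path vs (Suc i) = polygonal_path vs i +++ linepath (vs ! Suc i) (vs ! Suc (Suc i))"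

text \<open>The sides are traversed one after the other; consecutive sides meet only at their common vertex, so
the joined path is injective.\<close>

lemma polygon_simple_path:
 assumes "simple_closed_polygon vs"
 shows "\<exists>g. simple_path g \<and> pathfinish g = pathstart g \<and>
  path_image g = (\<Union>i<length vs. polygon_side vs i)"
proof -
 let ?n = "length vs"
 have n: "3 \<le> ?n" and d: "distinct vs"
  and sides: "\<And>i j. i < ?n ==> j < ?n ==> i \<noteq> j ==> polygon_side vs i \<inter> polygon_side vs j =
    {vs ! i, vs ! (Suc i mod ?n)} \<inter> {vs ! j, vs ! (Suc j mod ?n)}"
  using assms unfolding simple_closed_polygon_def Let_def by blast+
 have neq: "vs ! i \<noteq> vs ! j" if "i < ?n" "j < ?n" "i \<noteq> j" for i j
  using d that by (simp add: nth_eq_iff_index_eq)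
 have ps: "polygon_side vs i = closed_segment (vs ! i) (vs ! Suc i)" if "Suc i < ?n" for i
  using that by (simp add: polygon_side_def)
 have P: "arc (polygonal_path vs i) \<and> pathstart (polygonal_path vs i) = vs ! 0 \<and>
  pathfinish (polygonal_path vs i) = vs ! Suc i \<and>
  path_image (polygonal_path vs i) = (\<Union>j\<le>i. polygon_side vs j)" if "Suc i < ?n" for i
  using that
 proof (induction i)
  case 0
  have "vs ! 0 \<noteq> vs ! 1" by (rule neq) (use n in auto)
  then show ?case using 0 ps[of 0] by auto
 next
  case (Suc i)
  then have IH: "arc (polygonal_path vs i)" "pathstart (polygonal_path vs i) = vs ! 0"
   "pathfinish (polygonal_path vs i) = vs ! Suc i"
   "path_image (polygonal_path vs i) = (\<Union>j\<le>i. polygon_side vs j)" by auto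
  have "polygon_side vs j \<inter> polygon_side vs (Suc i) \<subseteq> {vs ! Suc i}" if "j \<le> i" for j
  proof -
   have eq: "polygon_side vs j \<inter> polygon_side vs (Suc i) = {vs ! j, vs ! Suc j} \<inter> {vs ! Suc i, vs ! Suc (Suc i)}"
    using sides[of j "Suc i"] that Suc.prems by simp
   have "vs ! j \<noteq> vs ! Suc i" "vs ! j \<noteq> vs ! Suc (Suc i)" "vs ! Suc j \<noteq> vs ! Suc (Suc i)"
    by (rule neq; use that Suc.prems in simp)+
   then show ?thesis unfolding eq by auto
  qed
  then have "path_image (polygonal_path vs i) \<inter> path_image (linepath (vs ! Suc i) (vs ! Suc (Suc i))) \<subseteq> {vs ! Suc i}"
   using ps[of "Suc i"] Suc.prems unfolding IH by auto
  then have "arc (polygonal_path vs (Suc i))"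
   using neq[of "Suc i" "Suc (Suc i)"] Suc.prems IH unfolding polygonal_path.simps
   by (intro arc_join) (simp_all add: arc_linepath)
  moreover have "path_image (polygonal_path vs (Suc i)) = (\<Union>j\<le>Suc i. polygon_side vs j)"
   using IH ps[of "Suc i"] Suc.prems by (auto simp: path_image_join atMost_Suc)
  ultimately show ?case using IH by simp
 qed
 obtain m where m: "?n = Suc (Suc m)" using n that[of "?n - 2"] by simp
 let ?P = "polygonal_path vs m" and ?Q = "linepath (vs ! Suc m) (vs ! 0)"
 have Pm: "arc ?P" "pathstart ?P = vs ! 0" "pathfinish ?P = vs ! Suc m"
  "path_image ?P = (\<Union>j\<le>m. polygon_side vs j)" using P[of m] m by simp_all
 have last: "polygon_side vs (Suc m) = closed_segment (vs ! Suc m) (vs ! 0)"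
  using m by (simp add: polygon_side_def)
 have "polygon_side vs j \<inter> polygon_side vs (Suc m) \<subseteq> {vs ! 0, vs ! Suc m}" if "j \<le> m" for j
 proof -
  have eq: "polygon_side vs j \<inter> polygon_side vs (Suc m) = {vs ! j, vs ! Suc j} \<inter> {vs ! Suc m, vs ! 0}"
   using sides[of j "Suc m"] that m by simp
  show ?thesis unfolding eq by auto
 qed
 then have "path_image ?P \<inter> path_image ?Q \<subseteq> {vs ! 0, vs ! Suc m}"
  using last unfolding Pm by auto
 then have "simple_path (?P +++ ?Q)"
  using Pm neq[of "Suc m" 0] m by (intro simple_path_join_loop) (simp_all add: arc_linepath)
 moreover have "path_image (?P +++ ?Q) = (\<Union>i<?n. polygon_side vs i)"
 proof -
  have "{..<?n} = insert (Suc m) {..m}" using m by auto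
  then show ?thesis using Pm last by (simp add: path_image_join Un_commute)
 qed
 ultimately show ?thesis using Pm by (intro exI[of _ "?P +++ ?Q"]) auto
qed

text \<open>By the Jordan curve theorem, a bounded open set whose frontier is a simple closed curve is
 the inside of that curve. In particular it has no slits.\<close>

lemma polygon_exterior:
 assumes "polygon Om vs"
 shows "connected (- closure Om)" "frontier Om \<subseteq> closure (- closure Om)"
proof -
 have Om: "open Om" "bounded Om" "Om \<noteq> {}" "frontier Om = (\<Union>i<length vs. polygon_side vs i)"
  using assms by (auto simp: polygon_def)
 obtain g where g: "simple_path g" "pathfinish g = pathstart g" "path_image g = frontier Om"
  using polygon_simple_path[of vs] assms Om(4) unfolding polygon_def by auto
 define f where "f = (%z::point. Complex (fst z) (snd z))"
 define f' where "f' = (%w. (Re w, Im w))"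
 have lin: "linear f" "linear f'" unfolding f_def f'_def
  by (auto intro!: linearI simp: complex_eq_iff)
 have inv: "f' (f z) = z" "f (f' w) = w" for z w by (simp_all add: f_def f'_def)
 have bij: "bij f" using inv by (intro bij_betw_byWitness[where f' = f']) auto
 then have inj: "inj f" by (rule bij_is_inj)
 have im: "f' ` (f ` S) = S" for S by (simp add: image_image inv)
 have cl: "closure (f ` S) = f ` closure S" for S using closure_injective_linear_image[OF lin(1) inj] by simp
 have op: "open (f ` Om)" using open_bijective_linear_image_eq[OF lin(1) bij] Om(1) by simp
 have fr: "frontier (f ` Om) = f ` frontier Om"
  using op Om(1) cl inj by (simp add: frontier_def interior_open image_set_diff)
 have sp: "simple_path (f \<circ> g)" "pathfinish (f \<circ> g) = pathstart (f \<circ> g)"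
  using g lin(1) inj by (auto simp: simple_path_linear_image_eq pathfinish_compose pathstart_compose)
 define I O' C where "I = inside (path_image (f \<circ> g))" and "O' = outside (path_image (f \<circ> g))" and "C = path_image (f \<circ> g)"
 have J: "connected I" "open O'" "connected O'" "\<not> bounded O'" "I \<inter> O' = {}" "I \<union> O' = - C"
  "frontier O' = C" "frontier I = C"
  using Jordan_inside_outside[OF sp] unfolding I_def O'_def C_def by auto
 have C: "C = frontier (f ` Om)" using g(3) fr unfolding C_def by (simp add: path_image_compose)
 have bd: "bounded (f ` Om)" using Om(2) lin(1) by (simp add: bounded_linear_image linear_conv_bounded_linear)
 have "\<not> O' \<subseteq> f ` Om" using J(4) bd bounded_subset by blast
 then have OOm: "O' \<inter> f ` Om = {}" using connected_Int_frontier[OF J(3), of "f ` Om"] J(6) C by blast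
 have "f ` Om \<inter> C = {}" using op C by (simp add: frontier_def interior_open)
 then have sub: "f ` Om \<subseteq> I" using J(6) OOm by blast
 have "I \<subseteq> f ` Om" using connected_Int_frontier[OF J(1), of "f ` Om"] J(6) C sub Om(3) by blast
 then have I: "I = f ` Om" using sub by blast
 have "closure (f ` Om) = f ` Om \<union> C" using op C by (auto simp: frontier_def interior_open closure_def)
 then have "- closure (f ` Om) = O'" using J(5,6) I by blast
 then have ext: "f ` (- closure Om) = O'" using bij by (simp add: cl bij_image_Compl_eq)
 then have ext': "- closure Om = f' ` O'" using im[of "- closure Om"] by simp
 have "continuous_on O' f'" using lin(2) by (simp add: linear_continuous_on linear_conv_bounded_linear)
 then show "connected (- closure Om)" unfolding ext' using J(3) by (rule connected_continuous_image)
 have "C \<subseteq> closure O'" using J(7) by (auto simp: frontier_def)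
 then have "f' ` C \<subseteq> f' ` closure O'" by blast
 also have "\<dots> \<subseteq> closure (f' ` O')" by (rule closure_linear_image_subset[OF lin(2)])
 finally show "frontier Om \<subseteq> closure (- closure Om)" unfolding ext' C fr im .
qed

text \<open>A closed triangle with named vertices. Rotating the names lets every statement about an edge be
proved for one edge only.\<close>

definition triangle :: "point set => point => point => point => bool" where
 "triangle K a b c \<longleftrightarrow> \<not> collinear {a, b, c} \<and> K = convex hull {a, b, c}"

lemma triangle_rotate: "triangle K a b c ==> triangle K b c a"
 unfolding triangle_def by (simp add: insert_commute)

lemma simplex_triangle: "2 simplex K ==> \<exists>a b c. triangle K a b c"
proof -
 assume "2 simplex K"
 then obtain S where S: "\<not> affine_dependent S" "int (card S) = 3" "K = convex hull S"
  unfolding simplex_def by auto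
 then have "card S = 3" by simp
 then obtain a b c where abc: "S = {a, b, c}" "a \<noteq> b" "a \<noteq> c" "b \<noteq> c" unfolding card_3_iff by blast
 then show ?thesis using S by (auto simp: triangle_def collinear_3_eq_affine_dependent)
qed

text \<open>What is used of a triangulated polygon. Two elements share only boundary points, and every
boundary point of the domain is a limit of exterior points; the latter excludes slits.\<close>

locale mesh_domain = bounded_domain +
 fixes T :: "point set set"
 assumes finite_mesh: "finite T"
  and triangles: "K \<in> T ==> \<exists>a b c. triangle K a b c"
  and cover: "\<Union>T = closure Om"
  and conforming: "K \<in> T ==> L \<in> T ==> K \<noteq> L ==> K \<inter> L \<subseteq> frontier K"
  and exterior_connected: "connected (- closure Om)"
  and frontier_exterior: "frontier Om \<subseteq> closure (- closure Om)"

lemma DIM_point: "DIM(point) = 2" by simp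

lemma polygon_mesh_domain:
 assumes "polygon Om vs" "mesh Om \<kappa> T"
 shows "mesh_domain Om T"
proof unfold_locales
 show "open Om" "bounded Om" using assms by (auto simp: polygon_def)
 show "finite T" "\<Union>T = closure Om" using assms by (auto simp: mesh_def)
 show "\<exists>a b c. triangle K a b c" if "K \<in> T" for K
  using assms that by (intro simplex_triangle) (auto simp: mesh_def)
 show "connected (- closure Om)" "frontier Om \<subseteq> closure (- closure Om)"
  using polygon_exterior[OF assms(1)] .
 fix K L assume KL: "K \<in> T" "L \<in> T" "K \<noteq> L"
 have s: "2 simplex K" using assms KL by (simp add: mesh_def)
 have "closed K" using simplex_triangle[OF s] by (auto simp: triangle_def compact_imp_closed finite_imp_compact_convex_hull)
 then have fr: "frontier K = K - interior K" by (simp add: frontier_def)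
 have "K \<inter> L = {} \<or> (\<exists>a. K \<inter> L = {a} \<and> a extreme_point_of K) \<or> (K \<inter> L) edge_of K"
 proof -
  have "K \<inter> L \<noteq> {} --> (\<exists>a. K \<inter> L = {a} \<and> a extreme_point_of K \<and> a extreme_point_of L) \<or>
    (K \<inter> L) edge_of K \<and> (K \<inter> L) edge_of L"
   using assms(2) KL unfolding mesh_def by simp
  then show ?thesis by (elim impCE) auto
 qed
 then show "K \<inter> L \<subseteq> frontier K"
 proof (elim disjE exE conjE)
  fix a assume a: "K \<inter> L = {a}" "a extreme_point_of K"
  have "a \<in> K" using a(1) by (metis IntD1 insertI1)
  then show ?thesis unfolding a(1) fr using extreme_point_not_in_interior[OF a(2)] by simp
 next
  assume e: "(K \<inter> L) edge_of K"
  have "aff_dim K = 2" using aff_dim_simplex[OF s] .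
  then have "K \<inter> L \<noteq> K" using e unfolding edge_of_def by force
  then have "(K \<inter> L) \<inter> interior K = {}" using e face_of_disjoint_interior unfolding edge_of_def by fast
  then show ?thesis unfolding fr by fast
 qed simp
qed

lemma triangle_compact: "triangle K a b c ==> compact K"
 by (simp add: triangle_def finite_imp_compact_convex_hull)

lemma triangle_convex: "triangle K a b c ==> convex K"
 by (simp add: triangle_def)

lemma triangle_interior: "triangle K a b c ==> interior K \<noteq> {}"
proof -
 assume t: "triangle K a b c"
 have "\<not> affine_dependent {a, b, c}" "card {a, b, c} = 3"
  using t by (auto simp: triangle_def collinear_3_eq_affine_dependent card_insert_if)
 then have "card {a, b, c} = Suc DIM(point)" by simp
 then show ?thesis using interior_convex_hull_eq_empty[of "{a, b, c}"] \<open>\<not> affine_dependent {a, b, c}\<close> t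
  by (simp add: triangle_def)
qed

lemma triangle_frontier:
 "triangle K a b c ==> frontier K = closed_segment a b \<union> closed_segment b c \<union> closed_segment c a"
 using frontier_of_triangle[OF DIM_point] by (simp add: triangle_def)

lemma triangle_extreme_point: "triangle K a b c ==> x extreme_point_of K \<longleftrightarrow> x \<in> {a, b, c}"
 unfolding triangle_def
 using extreme_point_of_convex_hull_affine_independent[of "{a, b, c}" x]
 by (auto simp: collinear_3_eq_affine_dependent)

lemma triangle_distinct: "triangle K a b c ==> a \<noteq> b \<and> b \<noteq> c \<and> c \<noteq> a"
 by (auto simp: triangle_def collinear_3_eq_affine_dependent)

lemma triangle_edge: "triangle K a b c ==> closed_segment a b edge_of K"
proof -
 assume t: "triangle K a b c"
 then have i: "\<not> affine_dependent {a, b, c}" by (auto simp: triangle_def collinear_3_eq_affine_dependent)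
 have "convex hull {a, b} face_of convex hull {a, b, c}"
  unfolding face_of_convex_hull_affine_independent[OF i]
  by (intro exI[of _ "{a, b}"]) auto
 moreover have "aff_dim (closed_segment a b) = 1"
  using triangle_distinct[OF t] unfolding segment_convex_hull aff_dim_convex_hull aff_dim_2 by simp
 ultimately show ?thesis using t unfolding edge_of_def triangle_def segment_convex_hull by simp
qed

lemma edge_subset_frontier:
 assumes "triangle K a b c" "E edge_of K" shows "E \<subseteq> frontier K"
proof -
 have "aff_dim K = 2"
  using aff_dim_nonempty_interior[OF triangle_interior[OF assms(1)]] by simp
 then have "E \<noteq> K" using assms(2) unfolding edge_of_def by force
 then have "E \<inter> interior K = {}" using assms(2) face_of_disjoint_interior unfolding edge_of_def by blast
 moreover have "E \<subseteq> K" using assms(2) by (simp add: edge_of_def face_of_imp_subset)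
 ultimately show ?thesis
  using compact_imp_closed[OF triangle_compact[OF assms(1)]] by (auto simp: frontier_def)
qed

context mesh_domain begin

lemma element_facts:
 assumes "K \<in> T"
 shows element_compact: "compact K" and element_closed: "closed K" and element_convex: "convex K"
  and element_interior: "interior K \<noteq> {}" and element_closure_interior: "closure (interior K) = K"
  and element_frontier: "frontier K = K - interior K"
  and element_lebesgue: "K \<in> sets lebesgue"
  and element_subset: "K \<subseteq> closure Om"
  and element_thin: "thin (frontier K)"
  and element_negligible: "negligible (frontier K)"
proof -
 obtain a b c where t: "triangle K a b c" using triangles[OF assms] by blast
 show c: "compact K" by (rule triangle_compact[OF t])
 then show cl: "closed K" by (rule compact_imp_closed)
 show cv: "convex K" by (rule triangle_convex[OF t])
 show i: "interior K \<noteq> {}" by (rule triangle_interior[OF t])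
 show "closure (interior K) = K" using convex_closure_interior[OF cv i] cl by simp
 show "frontier K = K - interior K" using cl by (simp add: frontier_def)
 show "K \<in> sets lebesgue" using cl by (simp add: borel_closed)
 show "K \<subseteq> closure Om" using cover assms by blast
 show "thin (frontier K)" unfolding triangle_frontier[OF t] by (intro thin_Un thin_segment)
 show "negligible (frontier K)" by (rule negligible_convex_frontier[OF cv])
qed

text \<open>An interior point of an element on the boundary of the domain would have exterior points nearby,
but elements lie in the closure of the domain.\<close>

lemma interior_subset_domain: "K \<in> T ==> interior K \<subseteq> Om"
proof
 fix z assume K: "K \<in> T" and z: "z \<in> interior K"
 have "z \<in> closure Om" using K z element_subset interior_subset by blast
 moreover have "z \<notin> frontier Om"
 proof
  assume "z \<in> frontier Om"
  then have "z \<in> closure (- closure Om)" using frontier_exterior by blast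
  then have "interior K \<inter> - closure Om \<noteq> {}"
   using z open_Int_closure_eq_empty[OF open_interior, of K "- closure Om"] by blast
  then show False using element_subset[OF K] interior_subset by blast
 qed
 ultimately show "z \<in> Om" using open_dom by (simp add: frontier_def interior_open)
qed

lemma interior_disjoint: "K \<in> T ==> L \<in> T ==> K \<noteq> L ==> interior K \<inter> L = {}"
 using conforming[of K L] element_frontier[of K] interior_subset by blast

definition skeleton :: "point set" where
 "skeleton = (\<Union>K\<in>T. frontier K)"

lemma skeleton_thin: "thin skeleton"
 unfolding skeleton_def by (intro thin_UN finite_mesh element_thin)

lemma skeleton_closed: "closed skeleton"
 unfolding skeleton_def by (intro closed_UN finite_mesh) auto

lemma closure_off_skeleton: "z \<in> closure Om ==> z \<notin> skeleton ==> \<exists>K\<in>T. z \<in> interior K"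
 using cover element_frontier unfolding skeleton_def by blast

lemma AE_skeleton: "AE x in lebesgue. x \<notin> skeleton"
proof -
 have "negligible skeleton"
  unfolding skeleton_def using finite_mesh element_negligible by (intro negligible_Union) auto
 then show ?thesis by (simp add: negligible_iff_null_sets AE_not_in)
qed

lemma AE_interior: "AE x in lebesgue. x \<in> Om --> (\<exists>K\<in>T. x \<in> interior K)"
 using AE_skeleton by eventually_elim (use closure_off_skeleton closure_subset[of Om] in blast)

lemma ae_eq_element: "K \<in> T ==> ae_eq K f g \<longleftrightarrow> (AE x in lebesgue. x \<in> interior K --> f x = g x)"
proof -
 assume K: "K \<in> T"
 have "(AE x in lebesgue. x \<in> K --> f x = g x) \<longleftrightarrow> (AE x in lebesgue. x \<in> interior K --> f x = g x)"
 proof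
  assume "AE x in lebesgue. x \<in> K --> f x = g x"
  then show "AE x in lebesgue. x \<in> interior K --> f x = g x"
   by eventually_elim (use interior_subset in blast)
 next
  assume "AE x in lebesgue. x \<in> interior K --> f x = g x"
  then show "AE x in lebesgue. x \<in> K --> f x = g x" using AE_skeleton
   by eventually_elim (use K element_frontier[OF K] in \<open>auto simp: skeleton_def\<close>)
 qed
 then show ?thesis unfolding ae_eq_def AE_lebesgue_on_iff[OF element_lebesgue[OF K]] .
qed

lemma ae_eq_dom_element: "ae_eq Om f g ==> K \<in> T ==> ae_eq K f g"
proof -
 assume fg: "ae_eq Om f g" and K: "K \<in> T"
 show ?thesis using fg[unfolded ae_eq_def AE_dom_iff] unfolding ae_eq_element[OF K]
  by eventually_elim (use interior_subset_domain[OF K] in blast)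
qed

lemma ae_eq_domI: "(\<And>K. K \<in> T ==> ae_eq K f g) ==> ae_eq Om f g"
proof -
 assume "\<And>K. K \<in> T ==> ae_eq K f g"
 then have "\<forall>K\<in>T. AE x in lebesgue. x \<in> interior K --> f x = g x" using ae_eq_element by blast
 then have "AE x in lebesgue. \<forall>K\<in>T. x \<in> interior K --> f x = g x"
  by (subst AE_ball_countable) (use finite_mesh in \<open>auto simp: countable_finite\<close>)
 then show ?thesis using AE_interior unfolding ae_eq_def AE_dom_iff
  by eventually_elim blast
qed

lemma ae_eq_element_open:
 assumes K: "K \<in> T" and c: "continuous_on UNIV p" "continuous_on UNIV (q :: point => real)"
  and eq: "ae_eq K p q" and z: "z \<in> interior K"
 shows "p z = q z"
proof (rule ccontr)
 assume ne: "p z \<noteq> q z"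
 let ?U = "interior K \<inter> {x. p x \<noteq> q x}"
 have op: "open ?U" using c by (intro open_Int open_Collect_neq) auto
 have "AE x in lebesgue. x \<notin> ?U" using eq unfolding ae_eq_element[OF K] by eventually_elim auto
 then have "?U \<in> null_sets lebesgue"
  using completion.AE_iff_null_sets[of "%x. x \<notin> ?U" lborel] by (simp add: Int_def)
 then have "negligible ?U" by (simp add: negligible_iff_null_sets)
 moreover have "?U \<noteq> {}" using ne z by blast
 ultimately show False using open_not_negligible[OF op] by blast
qed

text \<open>An element has interior points, so a polynomial is determined by its values almost everywhere on
the element. Thus restrictions are well defined.\<close>

lemma polys_cong_element:
 assumes K: "K \<in> T" and p: "p \<in> polys m" and q: "q \<in> polys n" and eq: "ae_eq K p q"
 shows "p = q"
proof -
 obtain z where z: "z \<in> interior K" using element_interior[OF K] by blast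
 have d: "(%w. p w - q w) \<in> polys (max m n)"
  using p q by (intro polys_diff) (auto elim: polys_mono)
 have "p w = q w" if "w \<in> interior K" for w
  using ae_eq_element_open[OF K _ _ eq that] p q polys_nice nice_continuous by blast
 then have "p w - q w = 0" for w
  using polys_zero_open[OF d open_interior z] by simp
 then show ?thesis by auto
qed

lemma restr_eq:
 assumes K: "K \<in> T" and p: "p \<in> polys m" and eq: "ae_eq K f p"
 shows "restr K f = p"
 unfolding restr_def
proof (rule the_equality)
 show "p \<in> (\<Union>m. polys m) \<and> ae_eq K f p" using p eq by blast
 fix q assume q: "q \<in> (\<Union>m. polys m) \<and> ae_eq K f q"
 then obtain n where n: "q \<in> polys n" by blast
 have "ae_eq K q p" using conjunct2[OF q] eq unfolding ae_eq_def by eventually_elim simp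
 then show "q = p" by (rule polys_cong_element[OF K n p])
qed

lemma pw_poly_restr:
 assumes "pw_poly T m f" "K \<in> T"
 shows restr_polys: "restr K f \<in> polys m" and restr_ae: "ae_eq K f (restr K f)"
proof -
 obtain p where "p \<in> polys m" "ae_eq K f p" using assms unfolding pw_poly_def by blast
 then show "restr K f \<in> polys m" "ae_eq K f (restr K f)" using restr_eq[OF assms(2)] by auto
qed

end

section \<open>A smooth step function\<close>

definition step :: "real => real" where
 "step t = flat 0 t * inverse (flat 0 t + flat 0 (1 - t))"

lemma step_denominator: "flat 0 t + flat 0 (1 - t) > 0"
proof -
 have "t > 0 \<or> 1 - t > 0" by linarith
 then show ?thesis using flat_nonneg[of 0 t] flat_nonneg[of 0 "1 - t"]
  by (auto simp: flat_def add_pos_nonneg add_nonneg_pos)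
qed

lemma step_0: "t \<le> 0 ==> step t = 0"
 by (simp add: step_def flat_def)

lemma step_1: "t \<ge> 1 ==> step t = 1"
 using step_denominator[of t] by (simp add: step_def flat_def)

lemma nice_step:
 assumes "f \<in> nice" shows "(%z. step (f z)) \<in> nice"
 unfolding step_def
proof (intro nice_mult nice_flat nice_inverse nice_add nice_diff nice_const assms)
 show "flat 0 (f z) + flat 0 (1 - f z) \<noteq> 0" for z using step_denominator[of "f z"] by simp
qed

section \<open>Functions in the closure of the test functions have zero traces\<close>

text \<open>The value of a function near a point, up to null sets.\<close>

definition ae_lim :: "(point => real) => point => real => bool" where
 "ae_lim f z w \<longleftrightarrow> (\<forall>\<epsilon>>0. \<exists>r>0. AE x in lebesgue. dist x z < r --> \<bar>f x - w\<bar> \<le> \<epsilon>)"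

context bounded_domain begin

lemma L2_inner_lebesgue: "ip f g = (LINT x|lebesgue. indicator Om x * f x * g x)"
 unfolding L2_inner_def using dom_lebesgue by (subst integral_restrict_space) (auto simp: mult.assoc)

lemma L2_mult_integrable_lebesgue:
 "f \<in> L2 Om ==> g \<in> L2 Om ==> integrable lebesgue (%x. indicator Om x * f x * g x)"
 using L2_mult_integrable[of f g] dom_lebesgue by (subst (asm) integrable_restrict_space) (auto simp: mult.assoc)

text \<open>Second-order Taylor expansion of a bump under translation makes its moments against \<open>f\<close>
 differentiable in the translation parameter.\<close>

lemma translated_moment_deriv:
 assumes f: "f \<in> L2 Om" and b: "b \<in> nice" and e: "e \<in> Basis" and A: "\<forall>z. \<bar>dd e (dd e b) z\<bar> \<le> A"
 shows "((%s. ip f (%x. b (x - s *\<^sub>R e))) has_real_derivative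
  - ip f (%x. dd e b (x - s *\<^sub>R e))) (at s)"
proof -
 let ?\<Phi> = "%s. ip f (%x. b (x - s *\<^sub>R e))"
 let ?g = "ip f (%x. dd e b (x - s *\<^sub>R e))"
 let ?I = "LINT x|lebesgue_on Om. \<bar>f x\<bar>"
 have taylor: "\<bar>b (y + h *\<^sub>R e) - b y - h * dd e b y\<bar> \<le> A * h\<^sup>2" for y h
 proof -
  define d where "d = (%m h. (dd e ^^ m) b (y + h *\<^sub>R e))"
  have n: "(dd e ^^ m) b \<in> nice" for m by (induction m) (simp_all add: b nice_dir_deriv e)
  have "DERIV (d m) h :> d (Suc m) h" for m h
  proof -
   note g = nice_has_grad[OF n[of m]]
   show ?thesis using has_grad_line[OF g[of "y + h *\<^sub>R e"]] has_grad_dir[OF g, of e] by (simp add: d_def)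
  qed
  then obtain \<xi> where "d 0 h = (\<Sum>m<2. d m 0 / fact m * h ^ m) + d 2 \<xi> / fact 2 * h ^ 2"
   using Maclaurin_all_le[of d "d 0" h 2] by blast
  then have E: "b (y + h *\<^sub>R e) - b y - h * dd e b y = dd e (dd e b) (y + \<xi> *\<^sub>R e) / 2 * h\<^sup>2"
   by (simp add: d_def numeral_2_eq_2)
  show ?thesis unfolding E abs_mult abs_power2
   by (rule mult_right_mono) (use A[rule_format, of "y + \<xi> *\<^sub>R e"] in simp_all)
 qed
 have tL: "(%x. g (x - s *\<^sub>R e)) \<in> L2 Om" if "g \<in> nice" for g s
  by (intro L2_continuous continuous_on_compose2[OF nice_continuous[OF that]] continuous_intros) auto
 have i: "integrable (lebesgue_on Om) (%x. \<bar>f x\<bar>)" using L2_integrable[OF f] by simp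
 have quad: "\<bar>?\<Phi> (s + h) - ?\<Phi> s - h * (- ?g)\<bar> \<le> A * ?I * h\<^sup>2" for h
 proof -
  let ?r = "%x. b (x - (s + h) *\<^sub>R e) - b (x - s *\<^sub>R e) - (- h) * dd e b (x - s *\<^sub>R e)"
  note m = L2_mult_integrable[OF f tL[OF b]] L2_mult_integrable[OF f tL[OF nice_dir_deriv[OF b e]]]
  have E: "?\<Phi> (s + h) - ?\<Phi> s - h * (- ?g) = (LINT x|lebesgue_on Om. f x * ?r x)"
   unfolding L2_inner_def using m(1)[of "s + h"] m(1)[of s] m(2)[of s]
   by (simp add: algebra_simps)
  have "\<bar>LINT x|lebesgue_on Om. f x * ?r x\<bar> \<le> (LINT x|lebesgue_on Om. \<bar>f x * ?r x\<bar>)" by (rule integral_abs_bound)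
  also have "\<dots> \<le> (LINT x|lebesgue_on Om. A * h\<^sup>2 * \<bar>f x\<bar>)"
  proof (rule integral_mono)
   show "integrable (lebesgue_on Om) (%x. \<bar>f x * ?r x\<bar>)"
    using L2_diff[OF L2_diff[OF tL[OF b, of "s + h"] tL[OF b, of s]] L2_cmul[OF tL[OF nice_dir_deriv[OF b e], of s], of "- h"]]
    by (rule integrable_abs[OF L2_mult_integrable[OF f]])
   show "\<bar>f x * ?r x\<bar> \<le> A * h\<^sup>2 * \<bar>f x\<bar>" for x
   proof -
    have y: "x - (s + h) *\<^sub>R e = x - s *\<^sub>R e + (- h) *\<^sub>R e" by (simp add: algebra_simps)
    show ?thesis unfolding abs_mult y
     using mult_left_mono[OF taylor[of "x - s *\<^sub>R e" "- h"] abs_ge_zero[of "f x"]] by (simp only: power2_minus mult_ac)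
   qed
  qed (use i in simp)
  finally show ?thesis unfolding E by (simp add: mult_ac)
 qed
 show ?thesis unfolding DERIV_def
 proof (rule LIM_zero_cancel, rule Lim_null_comparison)
  show "\<forall>\<^sub>F h in at 0. norm ((?\<Phi> (s + h) - ?\<Phi> s) / h - - ?g) \<le> A * ?I * \<bar>h\<bar>"
  proof (rule eventually_at_filter[THEN iffD2], rule always_eventually, intro allI impI)
   fix h :: real assume h: "h \<noteq> 0"
   have "(?\<Phi> (s + h) - ?\<Phi> s) / h - - ?g = (?\<Phi> (s + h) - ?\<Phi> s - h * (- ?g)) / h" using h by (simp add: field_simps)
   also have "norm \<dots> \<le> A * ?I * h\<^sup>2 / \<bar>h\<bar>" using divide_right_mono[OF quad[of h] abs_ge_zero[of h]] by simp
   also have "\<dots> = A * ?I * \<bar>h\<bar>" using h by (simp add: power2_eq_square abs_if)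
   finally show "norm ((?\<Phi> (s + h) - ?\<Phi> s) / h - - ?g) \<le> A * ?I * \<bar>h\<bar>" .
  qed
  show "((%h. A * ?I * \<bar>h\<bar>) \<longlongrightarrow> 0) (at (0::real))" by (auto intro!: tendsto_eq_intros)
 qed
qed

text \<open>The central estimate. If \<open>\<bar>\<partial>\<^sub>e f\<bar> \<le> M\<close>, then the values of (the extension by zero of) \<open>f\<close>
 at two points at distance \<open>t\<close> in direction \<open>e\<close> differ by at most \<open>M t\<close>: slide a small bump of mass
 \<open>W\<close> from the first point to the second. Integration by parts, which needs no boundary term,
 bounds the rate of change of its moment against \<open>f\<close> by \<open>M W\<close>.\<close>

lemma jump_estimate:
 assumes f: "f \<in> H1_0 Om" and e: "e \<in> Basis" and M: "0 \<le> M"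
  and bd: "AE x in lebesgue_on Om. \<bar>wd e f x\<bar> \<le> M"
  and t: "0 \<le> t" and l0: "ae_lim (%x. indicator Om x * f x) z0 w0"
  and l1: "ae_lim (%x. indicator Om x * f x) (z0 + t *\<^sub>R e) w1"
 shows "\<bar>w0 - w1\<bar> \<le> M * t"
proof (rule field_le_epsilon)
 fix \<epsilon> :: real assume "\<epsilon> > 0"
 then have \<epsilon>: "\<epsilon> / 2 > 0" by simp
 obtain r0 where r0: "r0 > 0" "AE x in lebesgue. dist x z0 < r0 --> \<bar>indicator Om x * f x - w0\<bar> \<le> \<epsilon> / 2"
  using l0 \<epsilon> unfolding ae_lim_def by blast
 obtain r1 where r1: "r1 > 0" "AE x in lebesgue. dist x (z0 + t *\<^sub>R e) < r1 --> \<bar>indicator Om x * f x - w1\<bar> \<le> \<epsilon> / 2"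
  using l1 \<epsilon> unfolding ae_lim_def by blast
 define \<delta> where "\<delta> = min r0 r1 / 2"
 have \<delta>: "\<delta> > 0" "2 * \<delta> \<le> r0" "2 * \<delta> \<le> r1" using r0(1) r1(1) by (auto simp: \<delta>_def)
 define b where "b = (%s. box_bump 1 (z0 + s *\<^sub>R e - (\<delta>, \<delta>)) (z0 + s *\<^sub>R e + (\<delta>, \<delta>)))"
 have bn: "b s \<in> nice" for s unfolding b_def by (rule box_bump_nice)
 have b0: "0 \<le> b s z" for s z unfolding b_def by (rule box_bump_bounds)
 have bs: "b s = (%x. b 0 (x - s *\<^sub>R e))" for s by (rule ext) (simp add: b_def box_bump_def algebra_simps)
 have db: "dd e (b s) x = dd e (b 0) (x - s *\<^sub>R e)" for s x
  using smooth_line_deriv[OF nice_smooth[OF bn[of s]] e, of x] smooth_line_deriv[OF nice_smooth[OF bn[of 0]] e, of "x - s *\<^sub>R e"]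
  unfolding bs[of s] by (auto simp: algebra_simps intro: DERIV_unique)
 have ball: "dist x (z0 + s *\<^sub>R e) < 2 * \<delta>" if "b s x \<noteq> 0" for s x
 proof -
  have "x \<in> box (z0 + s *\<^sub>R e - (\<delta>, \<delta>)) (z0 + s *\<^sub>R e + (\<delta>, \<delta>))" by (rule box_bump_support) (use that in \<open>simp add: b_def\<close>)
  then have "\<bar>fst (x - (z0 + s *\<^sub>R e))\<bar> + \<bar>snd (x - (z0 + s *\<^sub>R e))\<bar> < 2 * \<delta>" unfolding mem_box_point by auto
  then show ?thesis using norm_Pair_le[of "fst (x - (z0 + s *\<^sub>R e))" "snd (x - (z0 + s *\<^sub>R e))"]
   by (simp only: dist_norm prod.collapse real_norm_def)
 qed
 have bc: "continuous_on X (b s)" for X s by (rule nice_continuous[OF bn])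
 have off: "b s x = 0" if "x \<notin> cball (z0 + s *\<^sub>R e) (2 * \<delta>)" for s x
  using that ball[of s x] by (cases "b s x = 0") (auto simp: dist_commute)
 have i: "integrable lborel (b s)" for s
 proof -
  have "integrable lborel (%x. indicator (cball (z0 + s *\<^sub>R e) (2 * \<delta>)) x *\<^sub>R b s x)"
   by (rule borel_integrable_compact[OF compact_cball bc])
  moreover have "(%x. indicator (cball (z0 + s *\<^sub>R e) (2 * \<delta>)) x *\<^sub>R b s x) = b s"
  proof
   show "indicator (cball (z0 + s *\<^sub>R e) (2 * \<delta>)) x *\<^sub>R b s x = b s x" for x
    using off[of x s] by (cases "x \<in> cball (z0 + s *\<^sub>R e) (2 * \<delta>)") simp_all
  qed
  ultimately show ?thesis by (simp only:)
 qed
 have il: "integrable lebesgue (b s)" "(LINT z|lebesgue. b s z) = (LINT z|lborel. b s z)" for s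
  using i[of s] integrable_completion[of "b s" lborel] integral_completion[of "b s" lborel] by auto
 define W where "W = (LINT z|lborel. b 0 z)"
 have Ws: "(LINT z|lborel. b s z) = W" for s
 proof -
  have "W = (LINT z|distr lborel borel ((+) (- s *\<^sub>R e)). b 0 z)" by (simp add: W_def lborel_distr_plus)
  also have "\<dots> = (LINT z|lborel. b 0 (- s *\<^sub>R e + z))"
   by (rule integral_distr) (auto intro: borel_measurable_continuous_onI bc)
  finally show ?thesis unfolding bs[of s] by (simp add: algebra_simps)
 qed
 have "W > 0"
 proof -
  have "W \<noteq> 0"
  proof
   assume "W = 0"
   then have "AE z in lborel. b 0 z = 0" using integral_nonneg_eq_0_iff_AE[OF i[of 0]] b0 by (auto simp: W_def)
   then have "AE z in lebesgue. b 0 z = 0" by (rule AE_completion)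
   then have "negligible {z. b 0 z \<noteq> 0}"
    using completion.AE_iff_null_sets[of "%x. b 0 x = 0" lborel] by (auto simp: negligible_iff_null_sets intro!: borel_open open_Collect_neq bc)
   moreover have "open {z. b 0 z \<noteq> 0}" by (intro open_Collect_neq bc continuous_intros)
   moreover have "z0 \<in> {z. b 0 z \<noteq> 0}" using \<delta>(1) by (simp add: b_def box_bump_def flat_def)
   ultimately show False using open_not_negligible by blast
  qed
  moreover have "W \<ge> 0" unfolding W_def by (intro integral_nonneg_AE) (simp add: b0)
  ultimately show ?thesis by simp
 qed
 have fL: "f \<in> L2 Om" "wd e f \<in> L2 Om" using H1_0_H1[OF f] H1_L2 H1_weak_L2[OF _ e] by auto
 have bL: "b s \<in> L2 Om" for s by (rule L2_continuous[OF bc])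
 have rate: "\<bar>ip (wd e f) (b s)\<bar> \<le> M * W" for s
 proof -
  have "\<bar>ip (wd e f) (b s)\<bar> \<le> (LINT x|lebesgue. \<bar>indicator Om x * wd e f x * b s x\<bar>)"
   unfolding L2_inner_lebesgue by (rule integral_abs_bound)
  also have "\<dots> \<le> (LINT x|lebesgue. M * b s x)"
  proof (rule integral_mono_AE)
   show "AE x in lebesgue. \<bar>indicator Om x * wd e f x * b s x\<bar> \<le> M * b s x"
    using bd unfolding AE_dom_iff
   proof eventually_elim
    case (elim x)
    then show ?case using b0[of s x] M by (auto simp: indicator_def abs_mult intro!: mult_right_mono)
   qed
  qed (use L2_mult_integrable_lebesgue[OF fL(2) bL] il(1) in simp_all)
  finally show ?thesis using il(2) Ws by simp
 qed
 have near: "\<bar>ip f (b s) - w * W\<bar> \<le> \<epsilon> / 2 * W"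
  if ae: "AE x in lebesgue. dist x (z0 + s *\<^sub>R e) < r --> \<bar>indicator Om x * f x - w\<bar> \<le> \<epsilon> / 2" and r: "2 * \<delta> \<le> r" for s w r
 proof -
  note if' = L2_mult_integrable_lebesgue[OF fL(1) bL[of s]]
  have "ip f (b s) - w * W = (LINT x|lebesgue. indicator Om x * f x * b s x - w * b s x)"
   using il[of s] if' Ws[of s] unfolding L2_inner_lebesgue by simp
  also have "\<bar>\<dots>\<bar> \<le> (LINT x|lebesgue. \<bar>indicator Om x * f x * b s x - w * b s x\<bar>)" by (rule integral_abs_bound)
  also have "\<dots> \<le> (LINT x|lebesgue. \<epsilon> / 2 * b s x)"
  proof (rule integral_mono_AE)
   show "AE x in lebesgue. \<bar>indicator Om x * f x * b s x - w * b s x\<bar> \<le> \<epsilon> / 2 * b s x"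
    using ae
   proof eventually_elim
    case (elim x)
    show ?case
    proof (cases "b s x = 0")
     case False
     then have "\<bar>indicator Om x * f x - w\<bar> \<le> \<epsilon> / 2" using elim ball[OF False] r by simp
     then have "\<bar>indicator Om x * f x - w\<bar> * b s x \<le> \<epsilon> / 2 * b s x" by (rule mult_right_mono[OF _ b0])
     then show ?thesis using b0[of s x] by (simp add: left_diff_distrib[symmetric] abs_mult)
    qed simp
   qed
  qed (use il if' in auto)
  also have "\<dots> = \<epsilon> / 2 * W" using il(2)[of s] Ws[of s] by simp
  finally show ?thesis .
 qed
 have d1: "dd e (b 0) z = 0" if "z \<in> - cball z0 (2 * \<delta>)" for z
  by (rule dir_deriv_zero_open[OF _ that]) (use off[of _ 0] in auto)
 have d2: "dd e (dd e (b 0)) z = 0" if "z \<in> - cball z0 (2 * \<delta>)" for z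
  by (rule dir_deriv_zero_open[OF _ that d1]) auto
 obtain A where A: "\<forall>z\<in>cball z0 (2 * \<delta>). \<bar>dd e (dd e (b 0)) z\<bar> \<le> A"
  using compact_bound[OF compact_cball nice_continuous[OF nice_dir_deriv[OF nice_dir_deriv[OF bn e] e]]] by blast
 have bd2: "\<bar>dd e (dd e (b 0)) z\<bar> \<le> \<bar>A\<bar>" for z
  using bspec[OF A, of z] d2[of z] by (cases "z \<in> cball z0 (2 * \<delta>)") auto
 have d3: "((%s. ip f (b s)) has_real_derivative - ip f (dd e (b s))) (at s)" for s
  using translated_moment_deriv[OF fL(1) bn e allI[OF bd2], of s] by (simp only: bs[symmetric] db[symmetric])
 have der: "((%s. ip f (b s)) has_real_derivative ip (wd e f) (b s)) (at s)" for s
  using d3[of s] H1_0_integration_by_parts[OF f nice_smooth[OF bn[of s]] e] by simp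
 have main: "\<bar>ip f (b t) - ip f (b 0)\<bar> \<le> M * W * \<bar>t - 0\<bar>"
 proof (rule field_differentiable_bound[OF convex_UNIV, of "%s. ip f (b s)", unfolded real_norm_def])
  show "((%s. ip f (b s)) has_field_derivative ip (wd e f) (b s)) (at s within UNIV)" for s by (rule der)
 qed (use rate in simp_all)
 have "\<bar>ip f (b 0) - w0 * W\<bar> \<le> \<epsilon> / 2 * W" by (rule near[OF _ \<delta>(2)]) (use r0(2) in simp)
 then have *: "\<bar>w0 * W - w1 * W\<bar> \<le> M * W * t + \<epsilon> / 2 * W + \<epsilon> / 2 * W"
  using main near[OF r1(2) \<delta>(3)] t unfolding diff_0_right abs_of_nonneg[OF t] by linarith
 have "\<bar>w0 - w1\<bar> * W = \<bar>w0 * W - w1 * W\<bar>" using \<open>W > 0\<close> by (simp add: left_diff_distrib[symmetric] abs_mult)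
 also have "\<dots> \<le> M * W * t + \<epsilon> / 2 * W + \<epsilon> / 2 * W"
  by (rule *)
 also have "\<dots> = (M * t + \<epsilon>) * W" by (simp add: algebra_simps)
 finally show "\<bar>w0 - w1\<bar> \<le> M * t + \<epsilon>" using \<open>W > 0\<close> by (rule mult_right_le_imp_le)
qed

end

context mesh_domain begin

lemma weak_deriv_element:
 assumes f: "f \<in> H1 Om" and p: "pw_poly T m f" and K: "K \<in> T" and e: "e \<in> Basis"
 shows "ae_eq K (wd e f) (dd e (restr K f))"
 unfolding ae_eq_element[OF K]
proof (rule weak_deriv_local[OF f open_interior interior_subset_domain[OF K] _ _ e])
 show "AE x in lebesgue. x \<in> interior K --> f x = restr K f x"
  using restr_ae[OF p K] unfolding ae_eq_element[OF K] .
 show "smooth (restr K f)" by (rule nice_smooth[OF polys_nice[OF restr_polys[OF p K]]])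
qed

text \<open>Weak derivatives are local and elements have negligible boundary, so the weak derivative is
computed elementwise.\<close>

lemma weak_deriv_pw_poly:
 assumes f: "f \<in> H1 Om" and p: "pw_poly T m f" and e: "e \<in> Basis"
 shows "pw_poly T (m - 1) (wd e f)"
  and "K \<in> T ==> restr K (wd e f) = dd e (restr K f)"
proof -
 show "pw_poly T (m - 1) (wd e f)"
  unfolding pw_poly_def using weak_deriv_element[OF f p _ e] polys_dir_deriv[OF restr_polys[OF p] e] by auto
 show "K \<in> T ==> restr K (wd e f) = dd e (restr K f)"
  by (rule restr_eq[OF _ polys_dir_deriv[OF restr_polys[OF p] e] weak_deriv_element[OF f p _ e]])
qed

definition element_at :: "point => point set" where
 "element_at z = (SOME K. K \<in> T \<and> z \<in> K)"

text \<open>The extension by zero of a piecewise polynomial. On common boundaries an arbitrary element is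
chosen; the choice does not matter once the traces are known to agree.\<close>

definition hat :: "(point => real) => point => real" where
 "hat f z = (if z \<in> closure Om then restr (element_at z) f z else 0)"

lemma element_at: "z \<in> closure Om ==> element_at z \<in> T \<and> z \<in> element_at z"
proof -
 assume "z \<in> closure Om"
 then have "\<exists>K. K \<in> T \<and> z \<in> K" unfolding cover[symmetric] by blast
 then show ?thesis unfolding element_at_def by (rule someI_ex)
qed

lemma element_at_interior: "K \<in> T ==> z \<in> interior K ==> element_at z = K"
proof (rule ccontr)
 assume K: "K \<in> T" "z \<in> interior K" and ne: "element_at z \<noteq> K"
 have z: "z \<in> K" using K(2) interior_subset by (rule subsetD[rotated])
 then have "element_at z \<in> T" "z \<in> element_at z" using element_at[OF subsetD[OF element_subset[OF K(1)] z]] by auto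
 with interior_disjoint[OF K(1) _ ne[symmetric]] K(2) show False by (metis IntI emptyE)
qed

lemma hat_interior: "K \<in> T ==> z \<in> interior K ==> hat f z = restr K f z"
 unfolding hat_def using element_at_interior subsetD[OF element_subset subsetD[OF interior_subset]] by simp

lemma ae_lim_hat:
 assumes p: "pw_poly T m f" and z: "z \<notin> skeleton"
 shows "ae_lim (%x. indicator Om x * f x) z (hat f z)"
proof (cases "z \<in> closure Om")
 case True
 then obtain K where K: "K \<in> T" "z \<in> interior K" using closure_off_skeleton z by blast
 obtain r where r: "r > 0" "ball z r \<subseteq> interior K" using openE[OF open_interior K(2)] by blast
 show ?thesis unfolding ae_lim_def
 proof (intro allI impI)
  fix \<epsilon> :: real assume "\<epsilon> > 0"
  have "isCont (restr K f) z" by (rule has_grad_continuous[OF polys_has_grad[OF restr_polys[OF p K(1)]]])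
  then obtain d where d: "d > 0" "\<And>x. dist x z < d ==> dist (restr K f x) (restr K f z) < \<epsilon>"
   using \<open>\<epsilon> > 0\<close> unfolding continuous_at_eps_delta by blast
  have "AE x in lebesgue. dist x z < min r d --> \<bar>indicator Om x * f x - hat f z\<bar> \<le> \<epsilon>"
   using restr_ae[OF p K(1)] unfolding ae_eq_element[OF K(1)]
  proof eventually_elim
   case (elim x)
   show ?case
   proof
    assume x: "dist x z < min r d"
    then have xK: "x \<in> interior K" using r(2) by (auto simp: dist_commute subset_iff)
    then have "x \<in> Om" using interior_subset_domain[OF K(1)] by blast
    then show "\<bar>indicator Om x * f x - hat f z\<bar> \<le> \<epsilon>"
     using elim xK d(2)[of x] x hat_interior[OF K] by (simp add: dist_real_def)
   qed
  qed
  then show "\<exists>r>0. AE x in lebesgue. dist x z < r --> \<bar>indicator Om x * f x - hat f z\<bar> \<le> \<epsilon>"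
   using r(1) d(1) by (intro exI[of _ "min r d"]) auto
 qed
next
 case False
 then obtain r where r: "r > 0" "ball z r \<subseteq> - closure Om" using openE[of "- closure Om" z] by auto
 have "\<bar>indicator Om x * f x - hat f z\<bar> \<le> \<epsilon>" if "dist x z < r" "\<epsilon> > 0" for x \<epsilon>
 proof -
  have "x \<notin> Om" using r(2) that closure_subset[of Om] by (auto simp: dist_commute subset_iff)
  then show ?thesis using False that by (simp add: hat_def)
 qed
 then show ?thesis unfolding ae_lim_def using r(1) by (intro allI impI exI[of _ r]) (auto intro!: AE_I2)
qed

lemma hat_jump:
 assumes f: "f \<in> H1_0 Om" and p: "pw_poly T m f" and e: "e \<in> Basis" and M: "0 \<le> M"
  and bd: "AE x in lebesgue_on Om. \<bar>wd e f x\<bar> \<le> M"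
  and z: "z \<notin> skeleton" "z + t *\<^sub>R e \<notin> skeleton"
 shows "\<bar>hat f z - hat f (z + t *\<^sub>R e)\<bar> \<le> M * \<bar>t\<bar>"
proof (cases "t \<ge> 0")
 case True
 then show ?thesis using jump_estimate[OF f e M bd True ae_lim_hat[OF p z(1)] ae_lim_hat[OF p z(2)]] by simp
next
 case False
 have "ae_lim (%x. indicator Om x * f x) ((z + t *\<^sub>R e) + (- t) *\<^sub>R e) (hat f z)"
  using ae_lim_hat[OF p z(1)] by simp
 from jump_estimate[OF f e M bd _ ae_lim_hat[OF p z(2)] this] show ?thesis using False by (simp add: abs_minus_commute)
qed

lemma skeleton_dense: "e > 0 ==> \<exists>w. w \<notin> skeleton \<and> dist w z < e"
proof (rule ccontr)
 assume "e > 0" "\<not> (\<exists>w. w \<notin> skeleton \<and> dist w z < e)"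
 then have "ball z e \<subseteq> skeleton" by (auto simp: dist_commute)
 moreover have "negligible skeleton"
  unfolding skeleton_def using finite_mesh element_negligible by (intro negligible_Union) auto
 ultimately have "negligible (ball z e)" using negligible_subset by blast
 then show False using \<open>e > 0\<close> open_not_negligible[of "ball z e"] by auto
qed

lemma hat_local:
 assumes p: "pw_poly T m f" and z: "z \<notin> skeleton" and "\<epsilon> > 0"
 shows "\<exists>d>0. \<forall>w. dist w z < d --> w \<notin> skeleton \<and> \<bar>hat f w - hat f z\<bar> < \<epsilon>"
proof -
 obtain r where r: "r > 0" "ball z r \<subseteq> - skeleton" using openE[of "- skeleton" z] skeleton_closed z by auto
 show ?thesis
 proof (cases "z \<in> closure Om")
  case True
  then obtain K where K: "K \<in> T" "z \<in> interior K" using closure_off_skeleton z by blast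
  obtain r' where r': "r' > 0" "ball z r' \<subseteq> interior K" using openE[OF open_interior K(2)] by blast
  have "isCont (restr K f) z"
   by (rule has_grad_continuous[OF polys_has_grad[OF restr_polys[OF p K(1)]]])
  then obtain d where d: "d > 0" "\<And>x. dist x z < d ==> dist (restr K f x) (restr K f z) < \<epsilon>"
   using \<open>\<epsilon> > 0\<close> unfolding continuous_at_eps_delta by blast
  show ?thesis
  proof (intro exI[of _ "min r (min r' d)"] conjI allI impI)
   fix w assume w: "dist w z < min r (min r' d)"
   then show "w \<notin> skeleton" using r(2) by (auto simp: dist_commute subset_iff)
   have "w \<in> interior K" using w r'(2) by (auto simp: dist_commute subset_iff)
   then show "\<bar>hat f w - hat f z\<bar> < \<epsilon>" using d(2)[of w] w hat_interior[OF K] hat_interior[OF K(1)]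
    by (simp add: dist_real_def)
  qed (use r r' d in auto)
 next
  case False
  then obtain r' where r': "r' > 0" "ball z r' \<subseteq> - closure Om" using openE[of "- closure Om" z] by auto
  show ?thesis
  proof (intro exI[of _ "min r r'"] conjI allI impI)
   fix w assume w: "dist w z < min r r'"
   then show "w \<notin> skeleton" using r(2) by (auto simp: dist_commute subset_iff)
   have "w \<notin> closure Om" using w r'(2) by (auto simp: dist_commute subset_iff)
   then show "\<bar>hat f w - hat f z\<bar> < \<epsilon>" using False \<open>\<epsilon> > 0\<close> by (simp add: hat_def)
  qed (use r r' in auto)
 qed
qed

lemma hat_lipschitz_off_skeleton:
 assumes f: "f \<in> H1_0 Om" and p: "pw_poly T m f" and M: "0 \<le> M"
  and bd: "\<forall>e\<in>Basis. AE x in lebesgue_on Om. \<bar>wd e f x\<bar> \<le> M"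
  and z: "z \<notin> skeleton" "w \<notin> skeleton"
 shows "\<bar>hat f z - hat f w\<bar> \<le> M * (\<bar>fst z - fst w\<bar> + \<bar>snd z - snd w\<bar>)"
proof (rule field_le_epsilon)
 fix \<epsilon> :: real assume "\<epsilon> > 0"
 define \<epsilon>' where "\<epsilon>' = \<epsilon> / 3"
 have \<epsilon>': "\<epsilon>' > 0" using \<open>\<epsilon> > 0\<close> by (simp add: \<epsilon>'_def)
 obtain d1 where d1: "d1 > 0" "\<And>v. dist v z < d1 ==> v \<notin> skeleton \<and> \<bar>hat f v - hat f z\<bar> < \<epsilon>'"
  using hat_local[OF p z(1) \<epsilon>'] by blast
 obtain d2 where d2: "d2 > 0" "\<And>v. dist v w < d2 ==> v \<notin> skeleton \<and> \<bar>hat f v - hat f w\<bar> < \<epsilon>'"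
  using hat_local[OF p z(2) \<epsilon>'] by blast
 define \<rho> where "\<rho> = min (min d1 d2) (\<epsilon> / (6 * (M + 1)))"
 have \<rho>: "\<rho> > 0" "\<rho> \<le> d1" "\<rho> \<le> d2" "\<rho> \<le> \<epsilon> / (6 * (M + 1))" using d1(1) d2(1) \<open>\<epsilon> > 0\<close> M by (auto simp: \<rho>_def)
 \<comment> \<open>Two axis-parallel steps, with the corner moved slightly so that it avoids the skeleton.\<close>
 obtain m where m: "m \<notin> skeleton" "dist m (fst w, snd z) < \<rho>" using skeleton_dense[OF \<rho>(1)] by blast
 have m1: "\<bar>fst m - fst w\<bar> < \<rho>" "\<bar>snd m - snd z\<bar> < \<rho>"
  using dist_fst_le[of m "(fst w, snd z)"] dist_snd_le[of m "(fst w, snd z)"] m(2) by (auto simp: dist_real_def)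
 let ?z = "(fst z, snd m)" and ?w = "(fst m, snd w)"
 have "dist ?z z = \<bar>snd m - snd z\<bar>" "dist ?w w = \<bar>fst m - fst w\<bar>" by (auto simp: dist_prod_def dist_real_def)
 then have z': "?z \<notin> skeleton" "\<bar>hat f ?z - hat f z\<bar> < \<epsilon>'" and w': "?w \<notin> skeleton" "\<bar>hat f ?w - hat f w\<bar> < \<epsilon>'"
  using d1(2)[of ?z] d2(2)[of ?w] m1 \<rho> by auto
 have "?z + (fst m - fst z) *\<^sub>R (1, 0) = m" by (simp add: prod_eq_iff)
 then have 1: "\<bar>hat f ?z - hat f m\<bar> \<le> M * \<bar>fst m - fst z\<bar>"
  using hat_jump[OF f p _ M bspec[OF bd] z'(1), of "(1, 0)" "fst m - fst z"] m(1) by (simp add: Basis_point)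
 have "?w + (snd m - snd w) *\<^sub>R (0, 1) = m" by (simp add: prod_eq_iff)
 then have 2: "\<bar>hat f ?w - hat f m\<bar> \<le> M * \<bar>snd m - snd w\<bar>"
  using hat_jump[OF f p _ M bspec[OF bd] w'(1), of "(0, 1)" "snd m - snd w"] m(1) by (simp add: Basis_point)
 have "M * \<bar>fst m - fst z\<bar> \<le> M * (\<bar>fst z - fst w\<bar> + \<rho>)" "M * \<bar>snd m - snd w\<bar> \<le> M * (\<bar>snd z - snd w\<bar> + \<rho>)"
  using m1 M by (auto intro!: mult_left_mono)
 moreover have "2 * (M * \<rho>) \<le> \<epsilon> / 3"
 proof -
  have "M * \<rho> \<le> (M + 1) * (\<epsilon> / (6 * (M + 1)))" using \<rho> M by (intro mult_mono) auto
  also have "\<dots> = \<epsilon> / 6" using M by (simp add: field_simps)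
  finally show ?thesis by simp
 qed
 moreover have "\<bar>hat f z - hat f w\<bar> \<le> \<bar>hat f ?z - hat f z\<bar> + \<bar>hat f ?z - hat f m\<bar> + \<bar>hat f ?w - hat f m\<bar> + \<bar>hat f ?w - hat f w\<bar>"
  by linarith
 moreover have "M * (\<bar>fst z - fst w\<bar> + \<rho>) + M * (\<bar>snd z - snd w\<bar> + \<rho>)
   = M * (\<bar>fst z - fst w\<bar> + \<bar>snd z - snd w\<bar>) + 2 * (M * \<rho>)" by (simp add: algebra_simps)
 moreover have "\<epsilon> = 3 * \<epsilon>'" by (simp add: \<epsilon>'_def)
 ultimately show "\<bar>hat f z - hat f w\<bar> \<le> M * (\<bar>fst z - fst w\<bar> + \<bar>snd z - snd w\<bar>) + \<epsilon>"
  using 1 2 z'(2) w'(2)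
  by linarith
qed

text \<open>A value that the extended function takes in the limit at a point of the skeleton is unique, by
 the Lipschitz estimate. Hence the element polynomials agree on common edges and vanish on the
 boundary.\<close>

lemma hat_limit_values:
 assumes f: "f \<in> H1_0 Om" and p: "pw_poly T m f" and M: "0 \<le> M"
  and bd: "\<forall>e\<in>Basis. AE x in lebesgue_on Om. \<bar>wd e f x\<bar> \<le> M"
  and z: "\<And>\<epsilon>. \<epsilon> > 0 ==> \<exists>w. w \<notin> skeleton \<and> dist w z < \<epsilon> \<and> \<bar>hat f w - v\<bar> < \<epsilon>"
  and z': "\<And>\<epsilon>. \<epsilon> > 0 ==> \<exists>w. w \<notin> skeleton \<and> dist w z' < \<epsilon> \<and> \<bar>hat f w - v'\<bar> < \<epsilon>"
 shows "\<bar>v - v'\<bar> \<le> M * (\<bar>fst z - fst z'\<bar> + \<bar>snd z - snd z'\<bar>)"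
proof (rule field_le_epsilon)
 fix \<epsilon> :: real assume "\<epsilon> > 0"
 define \<rho> where "\<rho> = min (\<epsilon> / 4) (\<epsilon> / (8 * (M + 1)))"
 have \<rho>: "\<rho> > 0" "\<rho> \<le> \<epsilon> / 4" "\<rho> \<le> \<epsilon> / (8 * (M + 1))"
 proof -
  show "\<rho> \<le> \<epsilon> / 4" "\<rho> \<le> \<epsilon> / (8 * (M + 1))" unfolding \<rho>_def by (rule min.cobounded1, rule min.cobounded2)
  show "\<rho> > 0" using \<open>\<epsilon> > 0\<close> M by (simp add: \<rho>_def)
 qed
 obtain w where w: "w \<notin> skeleton" "dist w z < \<rho>" "\<bar>hat f w - v\<bar> < \<rho>" using z[OF \<rho>(1)] by blast
 obtain w' where w': "w' \<notin> skeleton" "dist w' z' < \<rho>" "\<bar>hat f w' - v'\<bar> < \<rho>" using z'[OF \<rho>(1)] by blast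
 have "\<bar>fst w - fst z\<bar> < \<rho>" "\<bar>snd w - snd z\<bar> < \<rho>" "\<bar>fst w' - fst z'\<bar> < \<rho>" "\<bar>snd w' - snd z'\<bar> < \<rho>"
  using dist_fst_le[of w z] dist_snd_le[of w z] dist_fst_le[of w' z'] dist_snd_le[of w' z'] w w'
  by (auto simp: dist_real_def)
 then have "\<bar>fst w - fst w'\<bar> + \<bar>snd w - snd w'\<bar> \<le> \<bar>fst z - fst z'\<bar> + \<bar>snd z - snd z'\<bar> + 4 * \<rho>" by linarith
 then have mono: "M * (\<bar>fst w - fst w'\<bar> + \<bar>snd w - snd w'\<bar>) \<le> M * (\<bar>fst z - fst z'\<bar> + \<bar>snd z - snd z'\<bar> + 4 * \<rho>)"
  using M by (rule mult_left_mono)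
 have small: "4 * (M * \<rho>) \<le> \<epsilon> / 2"
 proof -
  have "M * \<rho> \<le> (M + 1) * (\<epsilon> / (8 * (M + 1)))" using \<rho> M by (intro mult_mono) auto
  also have "\<dots> = \<epsilon> / 8" using M by (simp add: field_simps)
  finally show ?thesis by simp
 qed
 have lip: "\<bar>hat f w - hat f w'\<bar> \<le> M * (\<bar>fst w - fst w'\<bar> + \<bar>snd w - snd w'\<bar>)"
  by (rule hat_lipschitz_off_skeleton[OF f p M bd w(1) w'(1)])
 show "\<bar>v - v'\<bar> \<le> M * (\<bar>fst z - fst z'\<bar> + \<bar>snd z - snd z'\<bar>) + \<epsilon>"
 proof -
  have "\<bar>v - v'\<bar> \<le> \<bar>hat f w - v\<bar> + \<bar>hat f w - hat f w'\<bar> + \<bar>hat f w' - v'\<bar>" by linarith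
  then have "\<bar>v - v'\<bar> \<le> 2 * \<rho> + \<bar>hat f w - hat f w'\<bar>" using w(3) w'(3) by linarith
  also have "\<dots> \<le> 2 * \<rho> + M * (\<bar>fst z - fst z'\<bar> + \<bar>snd z - snd z'\<bar> + 4 * \<rho>)"
   by (intro add_left_mono order_trans[OF lip mono])
  also have "\<dots> = M * (\<bar>fst z - fst z'\<bar> + \<bar>snd z - snd z'\<bar>) + (2 * \<rho> + 4 * (M * \<rho>))" by (simp add: algebra_simps)
  also have "\<dots> \<le> M * (\<bar>fst z - fst z'\<bar> + \<bar>snd z - snd z'\<bar>) + \<epsilon>" using small \<rho>(2) by linarith
  finally show ?thesis .
 qed
qed

lemma off_skeleton_interior: "K \<in> T ==> z \<in> interior K ==> z \<notin> skeleton"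
proof
 assume K: "K \<in> T" "z \<in> interior K" and "z \<in> skeleton"
 then obtain L where L: "L \<in> T" "z \<in> frontier L" unfolding skeleton_def by (elim UN_E)
 then have "z \<in> L" "z \<notin> interior L" using element_frontier[OF L(1)] by simp_all
 then show False using interior_disjoint[OF K(1) L(1)] K(2) by (metis IntI emptyE)
qed

lemma off_skeleton_exterior: "z \<notin> closure Om ==> z \<notin> skeleton"
proof
 assume z: "z \<notin> closure Om" and "z \<in> skeleton"
 then obtain L where L: "L \<in> T" "z \<in> frontier L" unfolding skeleton_def by (elim UN_E)
 then have "z \<in> L" using element_frontier[OF L(1)] by simp
 then show False using z subsetD[OF element_subset[OF L(1)]] by simp
qed

lemma hat_approx_element:
 assumes p: "pw_poly T m f" and K: "K \<in> T" "z \<in> K" and "\<epsilon> > 0"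
 shows "\<exists>w. w \<notin> skeleton \<and> dist w z < \<epsilon> \<and> \<bar>hat f w - restr K f z\<bar> < \<epsilon>"
proof -
 have "isCont (restr K f) z"
  by (rule has_grad_continuous[OF polys_has_grad[OF restr_polys[OF p K(1)]]])
 then obtain d where d: "d > 0" "\<And>x. dist x z < d ==> dist (restr K f x) (restr K f z) < \<epsilon>"
  using \<open>\<epsilon> > 0\<close> unfolding continuous_at_eps_delta by blast
 have "z \<in> closure (interior K)" using element_closure_interior[OF K(1)] K(2) by simp
 then obtain w where w: "w \<in> interior K" "dist w z < min \<epsilon> d"
  using d(1) \<open>\<epsilon> > 0\<close> unfolding closure_approachable by (metis min_less_iff_conj)
 then show ?thesis using d(2)[of w] off_skeleton_interior[OF K(1) w(1)] hat_interior[OF K(1) w(1)]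
  by (intro exI[of _ w]) (auto simp: dist_real_def)
qed

lemma hat_approx_exterior:
 assumes "z \<notin> Om" "\<epsilon> > 0"
 shows "\<exists>w. w \<notin> skeleton \<and> dist w z < \<epsilon> \<and> \<bar>hat f w - 0\<bar> < \<epsilon>"
proof -
 have "z \<in> closure (- closure Om)"
 proof (cases "z \<in> closure Om")
  case True
  then have "z \<in> frontier Om" using assms(1) open_dom by (simp add: frontier_def interior_open)
  then show ?thesis using frontier_exterior by blast
 next
  case False
  then show ?thesis using closure_subset[of "- closure Om"] by blast
 qed
 then obtain w where w: "w \<in> - closure Om" "dist w z < \<epsilon>" using assms(2) unfolding closure_approachable by blast
 then have "w \<notin> skeleton" "hat f w = 0" using off_skeleton_exterior by (auto simp: hat_def)
 then show ?thesis using w assms(2) by (intro exI[of _ w]) simp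
qed

lemma hat_trace:
 assumes f: "f \<in> H1_0 Om" and p: "pw_poly T m f" and M: "0 \<le> M"
  and bd: "\<forall>e\<in>Basis. AE x in lebesgue_on Om. \<bar>wd e f x\<bar> \<le> M"
 shows hat_eq: "K \<in> T ==> z \<in> K ==> hat f z = restr K f z"
  and hat_zero: "z \<notin> Om ==> hat f z = 0"
  and hat_lipschitz: "\<bar>hat f z - hat f w\<bar> \<le> M * (\<bar>fst z - fst w\<bar> + \<bar>snd z - snd w\<bar>)"
proof -
 note lv = hat_limit_values[OF f p M bd]
 have own: "\<exists>w. w \<notin> skeleton \<and> dist w z < \<epsilon> \<and> \<bar>hat f w - hat f z\<bar> < \<epsilon>" if "\<epsilon> > 0" for z \<epsilon>
 proof (cases "z \<in> closure Om")
  case True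
  then show ?thesis using hat_approx_element[OF p _ _ that, of "element_at z" z] element_at[OF True] by (simp add: hat_def)
 next
  case False
  then have "z \<notin> Om" using closure_subset[of Om] by blast
  then show ?thesis using hat_approx_exterior[OF _ that, of z f] False by (simp add: hat_def)
 qed
 show "\<bar>hat f z - hat f w\<bar> \<le> M * (\<bar>fst z - fst w\<bar> + \<bar>snd z - snd w\<bar>)" by (rule lv[OF own own])
 show "hat f z = restr K f z" if "K \<in> T" "z \<in> K" using lv[OF own hat_approx_element[OF p that], of z] by simp
 show "hat f z = 0" if "z \<notin> Om" using lv[OF own hat_approx_exterior[OF that], of z] by simp
qed

lemma weak_deriv_bound:
 assumes f: "f \<in> H1 Om" and p: "pw_poly T m f"
 shows "\<exists>M\<ge>0. \<forall>e\<in>Basis. AE x in lebesgue_on Om. \<bar>wd e f x\<bar> \<le> M"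
proof -
 have cl: "compact (closure Om)" using bounded_dom by simp
 have "\<exists>M. \<forall>z\<in>closure Om. \<bar>dd e (restr K f) z\<bar> \<le> M" if "K \<in> T" "e \<in> Basis" for K e
  by (rule compact_bound[OF cl nice_continuous[OF polys_nice[OF polys_dir_deriv[OF restr_polys[OF p that(1)] that(2)]]]])
 then obtain M where M: "\<And>K e z. K \<in> T ==> e \<in> Basis ==> z \<in> closure Om ==> \<bar>dd e (restr K f) z\<bar> \<le> M K e"
  by metis
 define N where "N = (\<Sum>K\<in>T. \<Sum>e\<in>Basis. \<bar>M K e\<bar>)"
 have N: "M K e \<le> N" if "K \<in> T" "e \<in> Basis" for K e
 proof -
  have "\<bar>M K e\<bar> \<le> (\<Sum>e\<in>Basis. \<bar>M K e\<bar>)" using that by (intro member_le_sum) auto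
  also have "\<dots> \<le> N" unfolding N_def using that finite_mesh by (intro member_le_sum) (auto intro: sum_nonneg)
  finally show ?thesis by simp
 qed
 have "AE x in lebesgue_on Om. \<bar>wd e f x\<bar> \<le> N" if e: "e \<in> Basis" for e
 proof -
  have "\<forall>K\<in>T. AE x in lebesgue. x \<in> interior K --> wd e f x = dd e (restr K f) x"
   using weak_deriv_element[OF f p _ e] ae_eq_element by blast
  then have "AE x in lebesgue. \<forall>K\<in>T. x \<in> interior K --> wd e f x = dd e (restr K f) x"
   by (subst AE_ball_countable) (use finite_mesh in \<open>auto simp: countable_finite\<close>)
  then show ?thesis using AE_interior unfolding AE_dom_iff
  proof eventually_elim
   case (elim x)
   show ?case
   proof
    assume x: "x \<in> Om"
    then obtain K where K: "K \<in> T" "x \<in> interior K" using elim by blast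
    then have "wd e f x = dd e (restr K f) x" using elim by blast
    moreover have "x \<in> closure Om" using x closure_subset by blast
    ultimately show "\<bar>wd e f x\<bar> \<le> N" using M[OF K(1) e] N[OF K(1) e] by fastforce
   qed
  qed
 qed
 moreover have "N \<ge> 0" unfolding N_def by (intro sum_nonneg) simp
 ultimately show ?thesis by blast
qed

lemma hat_ae: "pw_poly T m f ==> ae_eq Om f (hat f)"
proof (rule ae_eq_domI)
 fix K assume p: "pw_poly T m f" and K: "K \<in> T"
 show "ae_eq K f (hat f)" using restr_ae[OF p K] unfolding ae_eq_element[OF K]
  by eventually_elim (simp add: hat_interior[OF K])
qed

text \<open>A piecewise polynomial in the closure of the test functions with vanishing weak derivatives has
 Lipschitz constant 0 and hence vanishes.\<close>

lemma H1_0_zero_grad: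
 assumes f: "f \<in> H1_0 Om" and p: "pw_poly T m f"
  and z: "\<And>e. e \<in> Basis ==> ae_eq Om (wd e f) (%x. 0)"
 shows "ae_eq Om f (%x. 0)"
proof -
 have bd: "\<forall>e\<in>Basis. AE x in lebesgue_on Om. \<bar>wd e f x\<bar> \<le> 0"
 proof
  fix e :: point assume "e \<in> Basis"
  from z[OF this] show "AE x in lebesgue_on Om. \<bar>wd e f x\<bar> \<le> 0"
   unfolding ae_eq_def by eventually_elim simp
 qed
 have "Om \<noteq> UNIV" using bounded_dom not_bounded_UNIV[where 'a = point] by metis
 then obtain w where w: "w \<notin> Om" by auto
 have "hat f x = 0" for x
  using hat_lipschitz[OF f p order_refl bd, of x w] hat_zero[OF f p order_refl bd w] by simp
 then have "hat f = (%x. 0)" by (rule ext)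
 with hat_ae[OF p] show ?thesis by simp
qed

end

section \<open>Approximation by test functions\<close>

definition norm1 :: "point => real" where
 "norm1 z = \<bar>fst z\<bar> + \<bar>snd z\<bar>"

lemma norm1_le: "norm1 z \<le> 2 * norm z"
 using norm_fst_le[of "fst z" "snd z"] norm_snd_le[of "snd z" "fst z"] by (simp add: norm1_def)

lemma norm_le_norm1: "norm z \<le> norm1 z"
 using norm_Pair_le[of "fst z" "snd z"] by (simp add: norm1_def)

lemma gradient_bound:
 assumes g: "\<And>s. 0 \<le> s ==> s \<le> 1 ==> has_grad f (a s) (b s) (w + s *\<^sub>R (z - w)) \<and> \<bar>a s\<bar> \<le> B \<and> \<bar>b s\<bar> \<le> B"
 shows "\<bar>f z - f w\<bar> \<le> B * norm1 (z - w)"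
proof -
 let ?d = "z - w"
 have der: "((%s. f (w + s *\<^sub>R ?d)) has_real_derivative (a s * fst ?d + b s * snd ?d)) (at s)" if "0 \<le> s" "s \<le> 1" for s
  by (rule has_grad_line) (use g[OF that] in blast)
 obtain \<xi> where \<xi>: "0 < \<xi>" "\<xi> < 1"
  "f (w + 1 *\<^sub>R ?d) - f (w + 0 *\<^sub>R ?d) = (1 - 0) * (a \<xi> * fst ?d + b \<xi> * snd ?d)"
  using MVT2[of 0 1 "%s. f (w + s *\<^sub>R ?d)" "%s. a s * fst ?d + b s * snd ?d"] der by auto
 have "f z - f w = a \<xi> * fst ?d + b \<xi> * snd ?d" using \<xi>(3) by simp
 also have "\<bar>\<dots>\<bar> \<le> \<bar>a \<xi>\<bar> * \<bar>fst ?d\<bar> + \<bar>b \<xi>\<bar> * \<bar>snd ?d\<bar>" by (simp add: abs_mult[symmetric] abs_triangle_ineq)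
 also have "\<dots> \<le> B * \<bar>fst ?d\<bar> + B * \<bar>snd ?d\<bar>"
  using g[of \<xi>] \<xi> by (intro add_mono mult_right_mono) auto
 finally show ?thesis by (simp add: norm1_def distrib_left)
qed

lemma nice_compact_bound:
 assumes "g \<in> nice" "compact C" "\<And>z. z \<notin> C ==> g z = 0"
 shows "\<exists>A\<ge>0. \<forall>z. \<bar>g z\<bar> \<le> A"
proof -
 obtain A where A: "\<forall>z\<in>C. \<bar>g z\<bar> \<le> A" using compact_bound[OF assms(2) nice_continuous[OF assms(1)]] by blast
 have "\<bar>g z\<bar> \<le> \<bar>A\<bar>" for z using bspec[OF A, of z] assms(3)[of z] by (cases "z \<in> C") auto
 then show ?thesis by (intro exI[of _ "\<bar>A\<bar>"]) auto
qed

lemma dir_deriv_zero_off: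
 assumes "closed C" "\<And>z. z \<notin> C ==> g z = 0" "z \<notin> C" shows "dd e g z = 0"
proof (rule dir_deriv_zero_open)
 show "open (- C)" "z \<in> - C" using assms by auto
 show "g w = 0" if "w \<in> - C" for w by (rule assms(2)[OF ComplD[OF that]])
qed

lemma dir_deriv_cong_open:
 assumes "g \<in> nice" "open U" "z \<in> U" "\<And>w. w \<in> U ==> f w = g w"
 shows "dd e f z = dd e g z"
 unfolding has_grad_dir[OF nice_has_grad[OF assms(1)], of e]
 by (rule has_grad_dir[OF has_grad_local[OF nice_has_grad[OF assms(1)] assms(2,3)]]) (simp add: assms(4))

lemma dir_deriv_nice_add:
 "f \<in> nice ==> g \<in> nice ==> dd e (%z. f z + g z) = (%z. dd e f z + dd e g z)"
proof
 fix z assume fg: "f \<in> nice" "g \<in> nice"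
 show "dd e (%z. f z + g z) z = dd e f z + dd e g z"
  unfolding has_grad_dir[OF has_grad_add[OF nice_has_grad[OF fg(1)] nice_has_grad[OF fg(2)]], of e]
   has_grad_dir[OF nice_has_grad[OF fg(1)], of e] has_grad_dir[OF nice_has_grad[OF fg(2)], of e]
  by (simp add: algebra_simps)
qed

lemma dir_deriv_nice_diff:
 "f \<in> nice ==> g \<in> nice ==> dd e (%z. f z - g z) = (%z. dd e f z - dd e g z)"
proof
 fix z assume fg: "f \<in> nice" "g \<in> nice"
 show "dd e (%z. f z - g z) z = dd e f z - dd e g z"
  unfolding has_grad_dir[OF has_grad_diff[OF nice_has_grad[OF fg(1)] nice_has_grad[OF fg(2)]], of e]
   has_grad_dir[OF nice_has_grad[OF fg(1)], of e] has_grad_dir[OF nice_has_grad[OF fg(2)], of e]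
  by (simp add: algebra_simps)
qed

lemma dir_deriv_nice_mult:
 "f \<in> nice ==> g \<in> nice ==> dd e (%z. f z * g z) = (%z. dd e f z * g z + f z * dd e g z)"
proof
 fix z assume fg: "f \<in> nice" "g \<in> nice"
 show "dd e (%z. f z * g z) z = dd e f z * g z + f z * dd e g z"
  unfolding has_grad_dir[OF has_grad_mult[OF nice_has_grad[OF fg(1)] nice_has_grad[OF fg(2)]], of e]
   has_grad_dir[OF nice_has_grad[OF fg(1)], of e] has_grad_dir[OF nice_has_grad[OF fg(2)], of e]
  by (simp add: algebra_simps)
qed

lemma dir_deriv_const: "dd e (%z. c) = (%z. 0)"
 by (rule ext) (simp add: has_grad_dir[OF has_grad_const])

lemma dir_deriv_nice_sum:
 "(\<And>i. i \<in> I ==> f i \<in> nice) ==> dd e (%z. \<Sum>i\<in>I. f i z) = (%z. \<Sum>i\<in>I. dd e (f i) z)"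
proof (induction I rule: infinite_finite_induct)
 case (insert i I)
 then show ?case using dir_deriv_nice_add[of "f i" "%z. \<Sum>i\<in>I. f i z" e] by (simp add: nice_sum)
qed (simp_all add: dir_deriv_const)

text \<open>The pairs of factors, with repetitions, in the product rule for an iterated derivative.\<close>

primrec leibniz :: "point list => (point => real) => (point => real) => ((point => real) \<times> (point => real)) list" where
 "leibniz [] u v = [(u, v)]"
| "leibniz (e # es) u v = concat (map (%(p, q). [(dd e p, q), (p, dd e q)]) (leibniz es u v))"

abbreviation "derivs \<equiv> foldr dd"

lemma leibniz_factors:
 "(p, q) \<in> set (leibniz es u v) ==> \<exists>as bs. set as \<subseteq> set es \<and> set bs \<subseteq> set es \<and>
  length as + length bs = length es \<and> p = derivs as u \<and> q = derivs bs v"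
proof (induction es arbitrary: p q)
 case Nil
 then show ?case by (intro exI[of _ "[]"]) simp
next
 case (Cons e es)
 then obtain p' q' where pq: "(p', q') \<in> set (leibniz es u v)" "p = dd e p' \<and> q = q' \<or> p = p' \<and> q = dd e q'"
  by auto
 obtain as bs where ab: "set as \<subseteq> set es" "set bs \<subseteq> set es" "length as + length bs = length es" "p' = derivs as u" "q' = derivs bs v"
  using Cons.IH[OF pq(1)] by blast
 from pq(2) show ?case
 proof
  assume "p = dd e p' \<and> q = q'"
  then show ?thesis using ab by (intro exI[of _ "e # as"] exI[of _ bs]) auto
 next
  assume "p = p' \<and> q = dd e q'"
  then show ?thesis using ab by (intro exI[of _ as] exI[of _ "e # bs"]) auto
 qed
qed

lemma length_leibniz: "length (leibniz es u v) = 2 ^ length es"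
 by (induction es) (simp_all add: length_concat comp_def split_def sum_list_triv)

lemma nice_derivs: "f \<in> nice ==> set es \<subseteq> Basis ==> derivs es f \<in> nice"
 by (induction es) (simp_all add: nice_dir_deriv)

lemma derivs_mult:
 assumes u: "u \<in> nice" and v: "v \<in> nice" and es: "set es \<subseteq> Basis"
 shows "derivs es (%z. u z * v z) = (%z. \<Sum>(p, q)\<leftarrow>leibniz es u v. p z * q z)"
 using es
proof (induction es)
 case (Cons e es)
 have n: "p \<in> nice \<and> q \<in> nice" if "(p, q) \<in> set (leibniz es u v)" for p q
  using leibniz_factors[OF that] nice_derivs[OF u] nice_derivs[OF v] Cons.prems by (meson order_trans set_subset_Cons)
 have "(%z. \<Sum>(p, q)\<leftarrow>l. p z * q z) \<in> nice \<and> dd e (%z. \<Sum>(p, q)\<leftarrow>l. p z * q z)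
  = (%z. \<Sum>(p, q)\<leftarrow>concat (map (%(p, q). [(dd e p, q), (p, dd e q)]) l). p z * q z)"
  if "set l \<subseteq> set (leibniz es u v)" for l
  using that
 proof (induction l)
  case (Cons a l)
  obtain p q where a: "a = (p, q)" by (cases a)
  then have pq: "p \<in> nice" "q \<in> nice" using n Cons.prems by auto
  show ?case using Cons nice_mult[OF pq] by (simp add: a nice_add dir_deriv_nice_add dir_deriv_nice_mult[OF pq] add.assoc)
 qed (simp add: nice_const dir_deriv_const)
 then show ?case using Cons by simp
qed simp

lemma derivs_add_sum:
 assumes f: "f \<in> nice" and g: "\<And>i. i \<in> I ==> g i \<in> nice" and es: "set es \<subseteq> Basis"
 shows "derivs es (%z. f z + (\<Sum>i\<in>I. g i z)) = (%z. derivs es f z + (\<Sum>i\<in>I. derivs es (g i) z))"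
 using es
proof (induction es)
 case (Cons e es)
 then have n: "derivs es f \<in> nice" "\<And>i. i \<in> I ==> derivs es (g i) \<in> nice" using nice_derivs f g by auto
 show ?case using Cons dir_deriv_nice_add[OF n(1) nice_sum[of I "%i. derivs es (g i)", OF n(2)], of e]
   dir_deriv_nice_sum[of I "%i. derivs es (g i)" e, OF n(2)] by simp
qed simp

lemma derivs_zero: "derivs es (%z. 0) = (%z. 0)"
 by (induction es) (simp_all add: dir_deriv_const)

lemma derivs_cong_open:
 assumes "g \<in> nice" "open U" "set es \<subseteq> Basis" "\<And>w. w \<in> U ==> f w = g w" "z \<in> U"
 shows "derivs es f z = derivs es g z"
 using assms(3,5)
proof (induction es arbitrary: z)
 case (Cons e es)
 then show ?case using dir_deriv_cong_open[OF nice_derivs[OF assms(1)] assms(2)] by simp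
qed (use assms(4) in simp)

lemma derivs_zero_off:
 assumes "closed C" "\<And>z. z \<notin> C ==> g z = 0" "z \<notin> C" shows "derivs es g z = 0"
 using assms(3)
proof (induction es arbitrary: z)
 case (Cons e es)
 then show ?case using dir_deriv_zero_off[OF assms(1) Cons.IH Cons.prems] by simp
qed (use assms(2) in simp)

text \<open>Bumps on the integer grid that form a smooth partition of unity.\<close>

definition bump1 :: "real => real" where
 "bump1 t = step (t + 1) - step t"

definition bump :: "point => real" where
 "bump z = bump1 (fst z) * bump1 (snd z)"

definition shift :: "nat => int \<times> int => point => point" where
 "shift n c z = (real n * fst z - of_int (fst c), real n * snd z - of_int (snd c))"

definition cell :: "nat => int \<times> int => point set" where
 "cell n c = {z. \<bar>fst (shift n c z)\<bar> \<le> 1 \<and> \<bar>snd (shift n c z)\<bar> \<le> 1}"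

lemma bump1_zero: "\<bar>t\<bar> \<ge> 1 ==> bump1 t = 0"
 by (auto simp: bump1_def step_0 step_1 abs_if split: if_splits)

lemma bump_nice: "bump \<in> nice"
 unfolding bump_def bump1_def by (intro nice_mult nice_diff nice_step nice_add nice_fst nice_snd nice_const)

lemma bump_zero: "z \<notin> cbox (-1, -1) (1, 1) ==> bump z = 0"
 using bump1_zero[of "fst z"] bump1_zero[of "snd z"] unfolding mem_cbox_point bump_def by (auto simp: abs_le_iff not_le)

lemma bump1_sum: "\<bar>t\<bar> \<le> real N ==> (\<Sum>i\<in>{- int N..int N}. bump1 (t - of_int i)) = 1"
proof -
 have "(\<Sum>i\<in>{- int k..int k}. bump1 (t - of_int i)) = step (t + real k + 1) - step (t - real k)" for k
 proof (induction k)
  case 0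
  then show ?case by (simp add: bump1_def)
 next
  case (Suc k)
  have "{- int (Suc k)..int (Suc k)} = insert (- int (Suc k)) (insert (int (Suc k)) {- int k..int k})" by auto
  then have "(\<Sum>i\<in>{- int (Suc k)..int (Suc k)}. bump1 (t - of_int i))
    = bump1 (t + real (Suc k)) + (bump1 (t - real (Suc k)) + (\<Sum>i\<in>{- int k..int k}. bump1 (t - of_int i)))"
   by (simp add: diff_diff_eq2 add.commute add.left_commute)
  also have "\<dots> = step (t + real (Suc k) + 1) - step (t - real (Suc k))"
   unfolding Suc.IH unfolding bump1_def by (simp add: algebra_simps)
  finally show ?case .
 qed
 moreover assume "\<bar>t\<bar> \<le> real N"
 then have "step (t + real N + 1) = 1" "step (t - real N) = 0" by (auto intro!: step_0 step_1)
 ultimately show ?thesis by simp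
qed

definition grid :: "nat => (int \<times> int) set" where
 "grid N = {- int N..int N} \<times> {- int N..int N}"

lemma bump_partition:
 assumes "real n * \<bar>fst z\<bar> \<le> real N" "real n * \<bar>snd z\<bar> \<le> real N"
 shows "(\<Sum>c\<in>grid N. bump (shift n c z)) = 1"
proof -
 have "(\<Sum>c\<in>grid N. bump (shift n c z)) =
   (\<Sum>i\<in>{- int N..int N}. bump1 (real n * fst z - of_int i)) * (\<Sum>j\<in>{- int N..int N}. bump1 (real n * snd z - of_int j))"
  unfolding sum_product grid_def sum.cartesian_product bump_def shift_def by (rule sum.cong) auto
 also have "\<dots> = 1" using assms by (simp add: bump1_sum abs_mult)
 finally show ?thesis .
qed

lemma shift_has_grad:
 assumes "has_grad g a b (shift n c z)"
 shows "has_grad (%z. g (shift n c z)) (real n * a) (real n * b) z"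
proof -
 have "(shift n c has_derivative (%h. (real n * fst h, real n * snd h))) (at z)"
  unfolding shift_def by (auto intro!: derivative_eq_intros)
 from has_derivative_compose[OF this assms[unfolded has_grad_def]]
 show ?thesis unfolding has_grad_def by (simp add: algebra_simps)
qed

lemma nice_shift: "g \<in> nice ==> (%z. g (shift n c z)) \<in> nice"
proof (induction rule: nice.induct)
 case nice_fst
 show ?case unfolding shift_def fst_conv by (intro nice_diff nice_cmul nice.nice_fst nice_const)
next
 case nice_snd
 show ?case unfolding shift_def snd_conv by (intro nice_diff nice_cmul nice.nice_snd nice_const)
next
 case (nice_inverse f)
 show ?case by (rule nice.nice_inverse[OF nice_inverse.IH]) (rule nice_inverse.hyps(2))
qed (auto intro: nice.intros)

lemma dir_deriv_shift:
 assumes "g \<in> nice" shows "dd e (%z. g (shift n c z)) = (%z. real n * dd e g (shift n c z))"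
proof
 fix z
 show "dd e (%z. g (shift n c z)) z = real n * dd e g (shift n c z)"
  unfolding has_grad_dir[OF shift_has_grad[OF nice_has_grad[OF assms]], of e]
   has_grad_dir[OF nice_has_grad[OF assms], of e] by (simp add: algebra_simps)
qed

lemma derivs_bump_bound: "\<exists>A\<ge>0. \<forall>es z. set es \<subseteq> Basis --> length es \<le> r --> \<bar>derivs es bump z\<bar> \<le> A"
proof -
 let ?S = "{es. set es \<subseteq> (Basis :: point set) \<and> length es \<le> r}"
 have "\<forall>es\<in>?S. \<exists>A\<ge>0. \<forall>z. \<bar>derivs es bump z\<bar> \<le> A"
 proof
  fix es assume "es \<in> ?S"
  then have n: "derivs es bump \<in> nice" by (intro nice_derivs bump_nice) simp
  show "\<exists>A\<ge>0. \<forall>z. \<bar>derivs es bump z\<bar> \<le> A"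
   by (rule nice_compact_bound[OF n compact_cbox derivs_zero_off[OF closed_cbox bump_zero]])
 qed
 then obtain A where A: "\<forall>es\<in>?S. A es \<ge> 0 \<and> (\<forall>z. \<bar>derivs es bump z\<bar> \<le> A es)" by (rule bchoice[THEN exE])
 have "finite ?S" by (rule finite_lists_length_le) simp
 then have "\<bar>derivs es bump z\<bar> \<le> sum A ?S" if "es \<in> ?S" for es z
  using A that by (intro order_trans[OF _ member_le_sum[of es ?S A]]) auto
 moreover have "0 \<le> sum A ?S" using A by (intro sum_nonneg) blast
 ultimately show ?thesis by (intro exI[of _ "sum A ?S"]) simp
qed

lemma derivs_bump_shift:
 "set es \<subseteq> Basis ==> derivs es (%w. bump (shift n c w)) = (%z. real n ^ length es * derivs es bump (shift n c z))"
proof (induction es)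
 case (Cons e es)
 have n: "derivs es bump \<in> nice" by (rule nice_derivs[OF bump_nice]) (use Cons.prems in simp)
 show ?case using Cons dir_deriv_nice_mult[OF nice_const[of "real n ^ length es"] nice_shift[OF n, of n c], of e] dir_deriv_shift[OF n, of e n c]
  by (simp add: dir_deriv_const mult_ac)
qed simp

lemma cell_closed: "closed (cell n c)"
 unfolding cell_def shift_def by (intro closed_Collect_conj closed_Collect_le continuous_intros)

lemma shift_cell: "shift n c z \<in> cbox (-1, -1) (1, 1) \<longleftrightarrow> z \<in> cell n c"
 unfolding cell_def mem_cbox_point by (auto simp: abs_le_iff)

lemma active_cells: "\<exists>S. finite S \<and> card S \<le> 9 \<and> (\<forall>c. z \<in> cell n c --> c \<in> S)"
proof -
 let ?S = "%t. {\<lfloor>t\<rfloor> - 1..\<lfloor>t\<rfloor> + 1} :: int set"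
 let ?A = "?S (real n * fst z) \<times> ?S (real n * snd z)"
 have *: "i \<in> ?S t" if "\<bar>t - of_int i\<bar> \<le> 1" for t :: real and i
 proof -
  have "real_of_int i \<le> t + 1" "t - 1 \<le> real_of_int i" using that by linarith+
  then have "i \<le> \<lfloor>t\<rfloor> + 1" "\<lfloor>t\<rfloor> - 1 \<le> i" by linarith+
  then show ?thesis by simp
 qed
 have "card ?A \<le> 9" by (simp add: card_cartesian_product)
 moreover have "c \<in> ?A" if "z \<in> cell n c" for c
  using that *[of "real n * fst z" "fst c"] *[of "real n * snd z" "snd c"] unfolding cell_def shift_def by (simp add: mem_Times_iff)
 ultimately show ?thesis by (intro exI[of _ ?A]) simp
qed

lemma active_sum_bound:
 fixes a :: "int \<times> int => real"
 assumes "\<And>c. z \<notin> cell n c ==> a c = 0" "\<And>c. z \<in> cell n c ==> \<bar>a c\<bar> \<le> B" "0 \<le> B" "finite I"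
 shows "\<bar>\<Sum>c\<in>I. a c\<bar> \<le> 9 * B"
proof -
 obtain S where S: "finite S" "card S \<le> 9" "\<forall>c. z \<in> cell n c --> c \<in> S" using active_cells by blast
 have "(\<Sum>c\<in>I. a c) = (\<Sum>c\<in>I \<inter> S. a c)"
  using S(3) assms by (intro sum.mono_neutral_right) auto
 also have "\<bar>\<dots>\<bar> \<le> (\<Sum>c\<in>I \<inter> S. \<bar>a c\<bar>)" by (rule sum_abs)
 also have "\<dots> \<le> (\<Sum>c\<in>I \<inter> S. B)" using assms by (intro sum_mono) (metis abs_zero)
 also have "\<dots> = real (card (I \<inter> S)) * B" by simp
 also have "\<dots> \<le> 9 * B"
  using order_trans[OF card_mono[of S "I \<inter> S"] S(2)] S(1) assms(3) by (intro mult_right_mono) auto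
 finally show ?thesis .
qed

lemma cell_dist:
 assumes "z \<in> cell n c" "w \<in> cell n c" "n > 0" shows "norm1 (z - w) \<le> 4 / real n"
proof -
 have "\<bar>a - b\<bar> \<le> 2 / real n" if "\<bar>real n * a - k\<bar> \<le> 1" "\<bar>real n * b - k\<bar> \<le> 1" for a b k
 proof -
  have "\<bar>real n * a - real n * b\<bar> \<le> 2" using that by linarith
  moreover have "real n * \<bar>a - b\<bar> = \<bar>real n * a - real n * b\<bar>"
   by (simp add: right_diff_distrib[symmetric] abs_mult)
  ultimately have "real n * \<bar>a - b\<bar> \<le> 2" by simp
  then show ?thesis using assms(3) by (simp add: le_divide_eq mult.commute)
 qed
 from this[of "fst z" "of_int (fst c)" "fst w"] this[of "snd z" "of_int (snd c)" "snd w"]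
 show ?thesis using assms unfolding cell_def shift_def norm1_def by simp
qed

context mesh_domain begin

text \<open>The function \<open>F\<close> on the plane is given on the elements by the functions \<open>P\<close> and is zero outside
the domain; its continuity is a separate hypothesis.\<close>

definition compatible :: "(point => real) => (point set => point => real) => bool" where
 "compatible F P \<longleftrightarrow> (\<forall>K\<in>T. \<forall>z\<in>K. F z = P K z) \<and> (\<forall>z. z \<notin> Om --> F z = 0)"

lemma compatible_element: "compatible F P ==> K \<in> T ==> z \<in> K ==> F z = P K z"
 and compatible_zero: "compatible F P ==> z \<notin> Om ==> F z = 0"
 by (simp_all add: compatible_def)

definition centre :: "nat => int \<times> int => point" where
 "centre n c = (of_int (fst c) / real n, of_int (snd c) / real n)"

text \<open>On a cell inside the domain the approximation uses one of the element polynomials that occur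
 there; on all other cells it is 0. In either case it agrees with the given function at some point of
 the cell.\<close>

definition local_poly :: "(point set => point => real) => nat => int \<times> int => point => real" where
 "local_poly P n c = (if cell n c \<subseteq> Om then P (element_at (centre n c)) else (%z. 0))"

definition anchor :: "nat => int \<times> int => point" where
 "anchor n c = (if cell n c \<subseteq> Om then centre n c else (SOME w. w \<in> cell n c \<and> w \<notin> Om))"

lemma centre_cell: "n > 0 ==> centre n c \<in> cell n c"
 by (simp add: centre_def cell_def shift_def)

lemma anchor_cell: "n > 0 ==> anchor n c \<in> cell n c"
proof (cases "cell n c \<subseteq> Om")
 case False
 then have "\<exists>w. w \<in> cell n c \<and> w \<notin> Om" by auto
 from someI_ex[OF this] show ?thesis using False by (simp add: anchor_def)
qed (simp add: anchor_def centre_cell)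

lemma local_poly_anchor:
 assumes "compatible F P" "n > 0" shows "local_poly P n c (anchor n c) = F (anchor n c)"
proof (cases "cell n c \<subseteq> Om")
 case True
 then have "centre n c \<in> closure Om" using centre_cell[OF assms(2)] closure_subset by (metis subsetD)
 from element_at[OF this] show ?thesis
  using True compatible_element[OF assms(1), of "element_at (centre n c)" "centre n c"] by (simp add: anchor_def local_poly_def)
next
 case False
 then have "\<exists>w. w \<in> cell n c \<and> w \<notin> Om" by auto
 from someI_ex[OF this] have "anchor n c \<notin> Om" using False by (simp add: anchor_def)
 then show ?thesis using False compatible_zero[OF assms(1)] by (simp add: local_poly_def)
qed

lemma local_poly_polys:
 assumes "\<forall>K\<in>T. P K \<in> polys m" "n > 0" shows "local_poly P n c \<in> polys m"
proof (cases "cell n c \<subseteq> Om")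
 case True
 then have "centre n c \<in> closure Om" using centre_cell[OF assms(2)] closure_subset by (metis subsetD)
 from element_at[OF this] show ?thesis using True assms(1) by (simp add: local_poly_def)
qed (simp add: local_poly_def polys_const)

lemma local_poly_dir_deriv: "dd e (local_poly P n c) = local_poly (%K. dd e (P K)) n c"
 by (simp add: local_poly_def dir_deriv_const)

lemma local_poly_cases: "n > 0 ==> (\<exists>K\<in>T. local_poly P n c = P K) \<or> local_poly P n c = (%z. 0)"
proof (cases "cell n c \<subseteq> Om")
 case True
 assume "n > 0"
 then have "centre n c \<in> closure Om" using centre_cell True closure_subset by (metis subsetD)
 from element_at[OF this] show ?thesis using True by (auto simp: local_poly_def)
qed (simp add: local_poly_def)

lemma local_poly_eventually:
 assumes K: "K \<in> T" and z: "z \<in> interior K"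
 shows "\<exists>n0>0. \<forall>n\<ge>n0. \<forall>c. z \<in> cell n c --> local_poly P n c = P K"
proof -
 obtain r where r: "r > 0" "ball z r \<subseteq> interior K" using openE[OF open_interior z] by blast
 obtain n0 :: nat where n0: "real n0 > 4 / r" using reals_Archimedean2 by blast
 have "n0 > 0" using n0 r(1) by (cases n0) (auto simp: divide_less_0_iff)
 moreover have "local_poly P n c = P K" if n: "n \<ge> n0" and zc: "z \<in> cell n c" for n c
 proof -
  have n_pos: "n > 0" using n \<open>n0 > 0\<close> by simp
  have "4 / r < real n" using n0 n by linarith
  then have "4 / real n < r" using r(1) n_pos by (simp add: divide_less_eq mult.commute)
  have sub: "cell n c \<subseteq> interior K"
  proof
   fix w assume "w \<in> cell n c"
   have "norm (z - w) \<le> norm1 (z - w)" by (rule norm_le_norm1)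
   also have "\<dots> \<le> 4 / real n" by (rule cell_dist[OF zc \<open>w \<in> cell n c\<close> n_pos])
   finally have "w \<in> ball z r" using \<open>4 / real n < r\<close> by (simp add: dist_norm)
   then show "w \<in> interior K" using r(2) by (rule subsetD[rotated])
  qed
  then have "cell n c \<subseteq> Om" using interior_subset_domain[OF K] by (rule subset_trans)
  moreover have "element_at (centre n c) = K"
   by (rule element_at_interior[OF K subsetD[OF sub centre_cell[OF n_pos]]])
  ultimately show ?thesis by (simp add: local_poly_def)
 qed
 ultimately show ?thesis by blast
qed

lemma polys_lipschitz_bounded:
 assumes "p \<in> polys m" "bounded S" "convex S"
 shows "\<exists>L\<ge>0. \<forall>z\<in>S. \<forall>w\<in>S. \<bar>p z - p w\<bar> \<le> L * norm1 (z - w)"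
proof -
 have cb: "compact (closure S)" using assms(2) by simp
 have n: "dx p \<in> nice" "dy p \<in> nice"
  using nice_dx nice_dy polys_nice[OF assms(1)] by auto
 obtain A where A: "\<forall>z\<in>closure S. \<bar>dx p z\<bar> \<le> A" using compact_bound[OF cb nice_continuous[OF n(1)]] by blast
 obtain B where B: "\<forall>z\<in>closure S. \<bar>dy p z\<bar> \<le> B" using compact_bound[OF cb nice_continuous[OF n(2)]] by blast
 have "\<bar>p z - p w\<bar> \<le> (\<bar>A\<bar> + \<bar>B\<bar>) * norm1 (z - w)" if zw: "z \<in> S" "w \<in> S" for z w
 proof (rule gradient_bound)
  fix s :: real assume s: "0 \<le> s" "s \<le> 1"
  have "w + s *\<^sub>R (z - w) = (1 - s) *\<^sub>R w + s *\<^sub>R z" by (simp add: algebra_simps)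
  then have "w + s *\<^sub>R (z - w) \<in> S" using convexD_alt[OF assms(3) zw(2,1) s] by simp
  then have "w + s *\<^sub>R (z - w) \<in> closure S" by (rule subsetD[OF closure_subset])
  then have "\<bar>dx p (w + s *\<^sub>R (z - w))\<bar> \<le> A" "\<bar>dy p (w + s *\<^sub>R (z - w))\<bar> \<le> B"
   using bspec[OF A] bspec[OF B] by auto
  then show "has_grad p (dx p (w + s *\<^sub>R (z - w))) (dy p (w + s *\<^sub>R (z - w))) (w + s *\<^sub>R (z - w)) \<and>
    \<bar>dx p (w + s *\<^sub>R (z - w))\<bar> \<le> \<bar>A\<bar> + \<bar>B\<bar> \<and> \<bar>dy p (w + s *\<^sub>R (z - w))\<bar> \<le> \<bar>A\<bar> + \<bar>B\<bar>"
   using polys_has_grad[OF assms(1)] by auto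
 qed
 then show ?thesis by (intro exI[of _ "\<bar>A\<bar> + \<bar>B\<bar>"]) simp
qed

text \<open>A natural number, so that the grid of mesh size \<open>1 / n\<close> with \<open>n * radius\<close> cells in each direction
covers the domain.\<close>

definition radius :: nat where
 "radius = (SOME R. \<forall>z\<in>closure Om. norm z < real R)"

lemma radius: "z \<in> closure Om ==> norm z < real radius"
proof -
 obtain B where B: "\<forall>z\<in>closure Om. norm z \<le> B" using bounded_closure[OF bounded_dom] unfolding bounded_iff by blast
 obtain R :: nat where "B < real R" using reals_Archimedean2 by blast
 then have "\<exists>R. \<forall>z\<in>closure Om. norm z < real R" using B by (intro exI[of _ R]) force
 from someI_ex[OF this] show "z \<in> closure Om ==> norm z < real radius" by (simp add: radius_def)
qed

definition big_ball :: "point set" where "big_ball = cball 0 (real radius + 4)"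

lemma big_ball_facts: "bounded big_ball" "convex big_ball" by (simp_all add: big_ball_def)

lemma cell_big_ball: "z \<in> cell n c ==> z \<in> Om ==> w \<in> cell n c ==> n > 0 ==> w \<in> big_ball"
proof -
 assume *: "z \<in> cell n c" "z \<in> Om" "w \<in> cell n c" "n > 0"
 have "norm (z - w) \<le> norm1 (z - w)" by (rule norm_le_norm1)
 also have "\<dots> \<le> 4 / real n" by (rule cell_dist[OF *(1,3,4)])
 also have "\<dots> \<le> 4" using *(4) by (simp add: divide_le_eq)
 finally have "norm w \<le> norm z + 4" using norm_triangle_ineq4[of z "z - w"] by simp
 moreover have "norm z < real radius" using radius subsetD[OF closure_subset *(2)] by simp
 ultimately show ?thesis by (simp add: big_ball_def)
qed

lemma local_poly_lipschitz:
 assumes P: "\<forall>K\<in>T. P K \<in> polys m"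
 shows "\<exists>L\<ge>0. \<forall>n>0. \<forall>c. \<forall>z\<in>big_ball. \<forall>w\<in>big_ball. \<bar>local_poly P n c z - local_poly P n c w\<bar> \<le> L * norm1 (z - w)"
proof -
 have "\<forall>K\<in>T. \<exists>L\<ge>0. \<forall>z\<in>big_ball. \<forall>w\<in>big_ball. \<bar>P K z - P K w\<bar> \<le> L * norm1 (z - w)"
  by (intro ballI polys_lipschitz_bounded[OF bspec[OF P] big_ball_facts])
 then obtain L where L: "\<forall>K\<in>T. L K \<ge> 0 \<and> (\<forall>z\<in>big_ball. \<forall>w\<in>big_ball. \<bar>P K z - P K w\<bar> \<le> L K * norm1 (z - w))"
  by (rule bchoice[THEN exE]) blast
 have n1: "0 \<le> norm1 z" for z by (simp add: norm1_def)
 have le: "L K \<le> (\<Sum>K\<in>T. L K)" if "K \<in> T" for K using L that finite_mesh by (intro member_le_sum) auto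
 have nn: "0 \<le> (\<Sum>K\<in>T. L K)" using L by (intro sum_nonneg) auto
 have "\<bar>local_poly P n c z - local_poly P n c w\<bar> \<le> (\<Sum>K\<in>T. L K) * norm1 (z - w)" if "n > 0" "z \<in> big_ball" "w \<in> big_ball" for n c z w
  using local_poly_cases[OF that(1), of P c]
 proof (elim disjE bexE)
  fix K assume K: "K \<in> T" "local_poly P n c = P K"
  have "\<bar>P K z - P K w\<bar> \<le> L K * norm1 (z - w)" using L K(1) that by simp
  also have "\<dots> \<le> (\<Sum>K\<in>T. L K) * norm1 (z - w)" by (rule mult_right_mono[OF le[OF K(1)] n1])
  finally show ?thesis unfolding K(2) .
 qed (use nn n1 in simp)
 then show ?thesis using nn by (intro exI[of _ "\<Sum>K\<in>T. L K"]) simp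
qed

text \<open>Both functions are Lipschitz and agree at the anchor of the cell.\<close>

lemma local_poly_error:
 assumes F: "compatible F P" and P: "\<forall>K\<in>T. P K \<in> polys m"
  and L: "\<forall>z w. \<bar>F z - F w\<bar> \<le> L * norm1 (z - w)" "0 \<le> L"
 shows "\<exists>C\<ge>0. \<forall>n>0. \<forall>c. \<forall>z\<in>cell n c. \<forall>w\<in>cell n c. w \<in> Om --> \<bar>local_poly P n c z - F z\<bar> \<le> C / real n"
proof -
 obtain L' where L': "L' \<ge> 0" "\<forall>n>0. \<forall>c. \<forall>z\<in>big_ball. \<forall>w\<in>big_ball. \<bar>local_poly P n c z - local_poly P n c w\<bar> \<le> L' * norm1 (z - w)"
  using local_poly_lipschitz[OF P] by blast
 have "\<bar>local_poly P n c z - F z\<bar> \<le> 4 * (L + L') / real n" if n: "n > 0" and z: "z \<in> cell n c" and w: "w \<in> cell n c" "w \<in> Om" for n c z w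
 proof -
  let ?a = "anchor n c"
  have a: "?a \<in> cell n c" by (rule anchor_cell[OF n])
  have "\<bar>local_poly P n c z - local_poly P n c ?a\<bar> \<le> L' * norm1 (z - ?a)"
   by (rule L'(2)[rule_format, OF n cell_big_ball[OF w z n] cell_big_ball[OF w a n]])
  moreover have "\<bar>F ?a - F z\<bar> \<le> L * norm1 (z - ?a)" using L(1)[rule_format, of z ?a] by (simp add: abs_minus_commute)
  ultimately have "\<bar>local_poly P n c z - F z\<bar> \<le> (L + L') * norm1 (z - ?a)"
   unfolding local_poly_anchor[OF F n] distrib_right by linarith
  also have "\<dots> \<le> (L + L') * (4 / real n)" using cell_dist[OF z a n] L(2) L'(1) by (intro mult_left_mono) auto
  finally show ?thesis by (simp add: mult.commute)
 qed
 moreover have "0 \<le> 4 * (L + L')" using L(2) L'(1) by simp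
 ultimately show ?thesis by (intro exI[of _ "4 * (L + L')"]) simp
qed

text \<open>The difference vanishes at the anchor, and its gradient is of first order by the previous estimate.\<close>

lemma local_poly_error2:
 assumes F: "compatible F P" and P: "\<forall>K\<in>T. P K \<in> polys m"
  and grad: "\<And>z. has_grad F (G (1, 0) z) (G (0, 1) z) z"
  and G: "\<forall>e\<in>Basis. compatible (G e) (%K. dd e (P K))"
  and L: "\<forall>e\<in>Basis. \<forall>z w. \<bar>G e z - G e w\<bar> \<le> L * norm1 (z - w)" "0 \<le> L"
 shows "\<exists>C\<ge>0. \<forall>n>0. \<forall>c. \<forall>z\<in>cell n c. z \<in> Om --> \<bar>local_poly P n c z - F z\<bar> \<le> C / (real n)\<^sup>2"
proof -
 note b = axis_directions
 have P': "\<forall>K\<in>T. dd e (P K) \<in> polys (m - 1)" if "e \<in> Basis" for e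
  using polys_dir_deriv[OF bspec[OF P] that] by simp
 obtain C1 where C1: "C1 \<ge> 0" "\<forall>n>0. \<forall>c. \<forall>z\<in>cell n c. \<forall>w\<in>cell n c. w \<in> Om -->
   \<bar>local_poly (%K. dx (P K)) n c z - G (1, 0) z\<bar> \<le> C1 / real n"
  using local_poly_error[OF bspec[OF G b(1)] P'[OF b(1)] bspec[OF L(1) b(1)] L(2)] by blast
 obtain C2 where C2: "C2 \<ge> 0" "\<forall>n>0. \<forall>c. \<forall>z\<in>cell n c. \<forall>w\<in>cell n c. w \<in> Om -->
   \<bar>local_poly (%K. dy (P K)) n c z - G (0, 1) z\<bar> \<le> C2 / real n"
  using local_poly_error[OF bspec[OF G b(2)] P'[OF b(2)] bspec[OF L(1) b(2)] L(2)] by blast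
 have "\<bar>local_poly P n c z - F z\<bar> \<le> 4 * (C1 + C2) / (real n)\<^sup>2" if n: "n > 0" and z: "z \<in> cell n c" "z \<in> Om" for n c z
 proof -
  let ?a = "anchor n c" and ?p = "local_poly P n c"
  have a: "?a \<in> cell n c" by (rule anchor_cell[OF n])
  have pp: "?p \<in> polys m" by (rule local_poly_polys[OF P n])
  have conv: "convex (cell n c)"
  proof -
   have "cell n c = {z. real n * fst z \<in> {of_int (fst c) - 1..of_int (fst c) + 1}} \<inter> {z. real n * snd z \<in> {of_int (snd c) - 1..of_int (snd c) + 1}}"
    unfolding cell_def shift_def by auto
   also have "convex \<dots>"
   proof (intro convex_Int)
    show "convex {z::point. real n * fst z \<in> {of_int (fst c) - 1..of_int (fst c) + 1}}"
     using convex_linear_vimage[of "%z::point. real n * fst z" "{of_int (fst c) - 1..of_int (fst c) + 1}"]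
     by (auto simp: vimage_def linear_iff algebra_simps)
    show "convex {z::point. real n * snd z \<in> {of_int (snd c) - 1..of_int (snd c) + 1}}"
     using convex_linear_vimage[of "%z::point. real n * snd z" "{of_int (snd c) - 1..of_int (snd c) + 1}"]
     by (auto simp: vimage_def linear_iff algebra_simps)
   qed
   finally show ?thesis .
  qed
  have "\<bar>(?p z - F z) - (?p ?a - F ?a)\<bar> \<le> ((C1 + C2) / real n) * norm1 (z - ?a)"
  proof (rule gradient_bound[where f = "%z. ?p z - F z"])
   fix s :: real assume s: "0 \<le> s" "s \<le> 1"
   let ?y = "?a + s *\<^sub>R (z - ?a)"
   have "?y = (1 - s) *\<^sub>R ?a + s *\<^sub>R z" by (simp add: algebra_simps)
   then have y: "?y \<in> cell n c" using convexD_alt[OF conv a z(1) s] by simp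
   have "\<bar>dx ?p ?y - G (1, 0) ?y\<bar> \<le> C1 / real n" "\<bar>dy ?p ?y - G (0, 1) ?y\<bar> \<le> C2 / real n"
    unfolding local_poly_dir_deriv
    by (rule C1(2)[rule_format, OF n y z], rule C2(2)[rule_format, OF n y z])
   moreover have "C1 / real n \<le> (C1 + C2) / real n" "C2 / real n \<le> (C1 + C2) / real n"
    using C1(1) C2(1) by (simp_all add: divide_right_mono)
   ultimately show "has_grad (%z. ?p z - F z) (dx ?p ?y - G (1, 0) ?y) (dy ?p ?y - G (0, 1) ?y) ?y \<and>
    \<bar>dx ?p ?y - G (1, 0) ?y\<bar> \<le> (C1 + C2) / real n \<and> \<bar>dy ?p ?y - G (0, 1) ?y\<bar> \<le> (C1 + C2) / real n"
    using has_grad_diff[OF polys_has_grad[OF pp] grad] by auto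
  qed
  then have "\<bar>?p z - F z\<bar> \<le> ((C1 + C2) / real n) * norm1 (z - ?a)" using local_poly_anchor[OF F n] by simp
  also have "\<dots> \<le> ((C1 + C2) / real n) * (4 / real n)"
   using cell_dist[OF z(1) a n] C1(1) C2(1) by (intro mult_left_mono) auto
  finally show ?thesis by (simp add: power2_eq_square mult.commute)
 qed
 moreover have "0 \<le> 4 * (C1 + C2)" using C1(1) C2(1) by simp
 ultimately show ?thesis by (intro exI[of _ "4 * (C1 + C2)"]) simp
qed

definition approximant :: "(point set => point => real) => nat => point => real" where
 "approximant P n = (%z. \<Sum>c\<in>grid (n * radius). local_poly P n c z * bump (shift n c z))"

lemma finite_grid: "finite (grid N)" by (simp add: grid_def)

lemma approximant_nice:
 assumes "\<forall>K\<in>T. P K \<in> polys m" "n > 0" shows "approximant P n \<in> nice"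
 unfolding approximant_def
 by (intro nice_sum nice_mult polys_nice[OF local_poly_polys[OF assms]] nice_shift bump_nice)

lemma approximant_test:
 assumes P: "\<forall>K\<in>T. P K \<in> polys m" and n: "n > 0"
 shows "approximant P n \<in> tests"
proof -
 let ?A = "{c \<in> grid (n * radius). cell n c \<subseteq> Om}"
 have bc: "bounded (cell n c)" if "c \<in> ?A" for c using that bounded_subset[OF bounded_dom] by simp
 have cc: "compact (cell n c)" if "c \<in> ?A" for c using bc[OF that] cell_closed[of n c] by (simp add: compact_eq_bounded_closed)
 have C: "compact (\<Union>c\<in>?A. cell n c)" using finite_grid[of "n * radius"] cc by (intro compact_UN) simp_all
 have sub: "(\<Union>c\<in>?A. cell n c) \<subseteq> Om" by auto
 show ?thesis
 proof (rule nice_test_function[OF approximant_nice[OF P n] C sub])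
  fix z assume "approximant P n z \<noteq> 0"
  then obtain c where c: "c \<in> grid (n * radius)" "local_poly P n c z * bump (shift n c z) \<noteq> 0"
   unfolding approximant_def by (meson sum.neutral)
  have "z \<in> cell n c" using c(2) bump_zero[of "shift n c z"] shift_cell[of n c z] by auto
  moreover have "cell n c \<subseteq> Om" using c(2) by (auto simp: local_poly_def split: if_splits)
  ultimately show "z \<in> (\<Union>c\<in>?A. cell n c)" using c(1) by (intro UN_I[of c]) simp_all
 qed
qed

definition pw_deriv :: "point => (point set => point => real) => point => real" where
 "pw_deriv e P = (%z. \<Sum>K\<in>T. indicator (interior K) z * dd e (P K) z)"

lemma pw_deriv_interior: "K \<in> T ==> z \<in> interior K ==> pw_deriv e P z = dd e (P K) z"
proof -
 assume K: "K \<in> T" "z \<in> interior K"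
 have "indicator (interior L) z * dd e (P L) z = (if L = K then dd e (P K) z else 0)" if "L \<in> T" for L
 proof (cases "L = K")
  case False
  have "z \<notin> interior L"
   using interior_disjoint[OF that K(1) False] subsetD[OF interior_subset K(2)] by (metis IntI emptyE)
  then show ?thesis using False by simp
 qed (use K in simp)
 then have "pw_deriv e P z = (\<Sum>L\<in>T. if L = K then dd e (P K) z else 0)"
  unfolding pw_deriv_def by (rule sum.cong[OF refl])
 then show ?thesis using K(1) finite_mesh by simp
qed

lemma pw_deriv_measurable:
 assumes "\<forall>K\<in>T. P K \<in> polys m" "e \<in> Basis" shows "pw_deriv e P \<in> borel_measurable borel"
 unfolding pw_deriv_def
 by (intro borel_measurable_sum borel_measurable_times borel_measurable_indicator borel_open open_interior
   borel_measurable_continuous_onI nice_continuous nice_dir_deriv[OF _ assms(2)] polys_nice[OF bspec[OF assms(1)]])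

lemma pw_deriv_bounded:
 assumes P: "\<forall>K\<in>T. P K \<in> polys m" and e: "e \<in> Basis"
 shows "\<exists>M\<ge>0. (\<forall>K\<in>T. \<forall>z\<in>Om. \<bar>dd e (P K) z\<bar> \<le> M) \<and> (\<forall>z\<in>Om. \<bar>pw_deriv e P z\<bar> \<le> M)"
proof -
 have "\<forall>K\<in>T. \<exists>M. \<forall>z\<in>Om. \<bar>dd e (P K) z\<bar> \<le> M"
  by (intro ballI bounded_on_dom nice_continuous nice_dir_deriv[OF _ e] polys_nice[OF bspec[OF P]])
 then obtain M where M: "\<forall>K\<in>T. \<forall>z\<in>Om. \<bar>dd e (P K) z\<bar> \<le> M K" by (rule bchoice[THEN exE]) blast
 let ?M = "\<Sum>K\<in>T. \<bar>M K\<bar>"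
 have "\<bar>dd e (P K) z\<bar> \<le> ?M" if "K \<in> T" "z \<in> Om" for K z
 proof -
  have "\<bar>dd e (P K) z\<bar> \<le> \<bar>M K\<bar>" using M that by (meson abs_ge_self order_trans)
  also have "\<dots> \<le> ?M" using that finite_mesh by (intro member_le_sum) auto
  finally show ?thesis .
 qed
 moreover have "\<bar>pw_deriv e P z\<bar> \<le> ?M" if "z \<in> Om" for z
 proof -
  have "\<bar>pw_deriv e P z\<bar> \<le> (\<Sum>K\<in>T. \<bar>indicator (interior K) z * dd e (P K) z\<bar>)" unfolding pw_deriv_def by (rule sum_abs)
  also have "\<dots> \<le> ?M"
  proof (rule sum_mono)
   fix K assume K: "K \<in> T"
   have "\<bar>dd e (P K) z\<bar> \<le> \<bar>M K\<bar>" using M K that by (meson abs_ge_self order_trans)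
   then show "\<bar>indicator (interior K) z * dd e (P K) z\<bar> \<le> \<bar>M K\<bar>" by (simp add: indicator_def)
  qed
  finally show ?thesis .
 qed
 moreover have "0 \<le> ?M" by (intro sum_nonneg) simp
 ultimately show ?thesis by (intro exI[of _ ?M]) simp
qed

text \<open>The bumps sum to 1 near the domain, so the error is the sum of the local errors weighted by the bumps;
the product rule applies to each term.\<close>

lemma approximant_error:
 assumes P: "\<forall>K\<in>T. P K \<in> polys m" and n: "n > 0" and K: "K \<in> T" and z: "z \<in> interior K" and es: "set es \<subseteq> Basis"
 shows "derivs es (approximant P n) z - derivs es (P K) z = (\<Sum>c\<in>grid (n * radius).
  \<Sum>(p, q)\<leftarrow>leibniz es (%w. local_poly P n c w - P K w) (%w. bump (shift n c w)). p z * q z)"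
proof -
 let ?D = "%c w. local_poly P n c w - P K w" and ?\<beta> = "%c w. bump (shift n c w)"
 let ?I = "grid (n * radius)" and ?V = "ball 0 (real radius) :: point set"
 let ?E = "%w. P K w + (\<Sum>c\<in>?I. ?D c w * ?\<beta> c w)"
 have Pn: "P K \<in> nice" by (rule polys_nice[OF bspec[OF P K]])
 have Dn: "?D c \<in> nice" for c by (intro nice_diff polys_nice[OF local_poly_polys[OF P n]] Pn)
 have \<beta>n: "?\<beta> c \<in> nice" for c by (rule nice_shift[OF bump_nice])
 have Dm: "(%w. ?D c w * ?\<beta> c w) \<in> nice" for c by (rule nice_mult[OF Dn \<beta>n])
 have En: "?E \<in> nice" by (intro nice_add Pn nice_sum Dm)
 have eq: "approximant P n w = ?E w" if "w \<in> ?V" for w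
 proof -
  have "\<bar>fst w\<bar> \<le> real radius" "\<bar>snd w\<bar> \<le> real radius"
   using that norm_fst_le[of "fst w" "snd w"] norm_snd_le[of "snd w" "fst w"] by auto
  then have "(\<Sum>c\<in>?I. ?\<beta> c w) = 1" by (intro bump_partition) (simp_all add: mult_left_mono)
  moreover have "(\<Sum>c\<in>?I. ?D c w * ?\<beta> c w) = approximant P n w - P K w * (\<Sum>c\<in>?I. ?\<beta> c w)"
   unfolding approximant_def by (simp add: left_diff_distrib sum_subtractf sum_distrib_left)
  ultimately show ?thesis by simp
 qed
 have V: "open ?V" by simp
 have zV: "z \<in> ?V" using radius[OF subsetD[OF element_subset[OF K] subsetD[OF interior_subset z]]] by simp
 have "derivs es (approximant P n) z = derivs es ?E z" by (rule derivs_cong_open[OF En V es eq zV])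
 then show ?thesis unfolding derivs_add_sum[OF Pn Dm es] derivs_mult[OF Dn \<beta>n es] by simp
qed

text \<open>Almost every point lies inside an element and the domain has finite measure, so dominated convergence
applies.\<close>

lemma L2_dominated:
 assumes m: "\<And>n. a n \<in> borel_measurable (lebesgue_on Om)"
  and bd: "\<And>n K z. n > 0 ==> K \<in> T ==> z \<in> interior K ==> \<bar>a n z\<bar> \<le> C"
  and ev: "\<And>K z. K \<in> T ==> z \<in> interior K ==> \<exists>n0>0. \<forall>n\<ge>n0. a n z = 0"
 shows "(%n. (nrm (a (Suc n)))\<^sup>2) \<longlonglongrightarrow> 0"
proof -
 interpret finite_measure "lebesgue_on Om" by (rule finite_measure_dom)
 have ae: "AE z in lebesgue_on Om. \<exists>K\<in>T. z \<in> interior K" using AE_interior unfolding AE_dom_iff .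
 have "(%n. LINT z|lebesgue_on Om. a (Suc n) z * a (Suc n) z) \<longlonglongrightarrow> (LINT z|lebesgue_on Om. 0)"
 proof (rule integral_dominated_convergence[where w = "%z. C\<^sup>2"])
  show "AE z in lebesgue_on Om. (%n. a (Suc n) z * a (Suc n) z) \<longlonglongrightarrow> 0"
   using ae
  proof eventually_elim
   case (elim z)
   then obtain K where "K \<in> T" "z \<in> interior K" by blast
   then obtain n0 where "\<forall>n\<ge>n0. a n z = 0" using ev by blast
   then have "\<forall>\<^sub>F n in sequentially. a (Suc n) z * a (Suc n) z = 0"
    by (intro eventually_sequentiallyI[of n0]) simp
   then show ?case by (rule tendsto_eventually)
  qed
  show "AE z in lebesgue_on Om. norm (a (Suc n) z * a (Suc n) z) \<le> C\<^sup>2" for n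
   using ae
  proof eventually_elim
   case (elim z)
   then obtain K where K: "K \<in> T" "z \<in> interior K" by blast
   have "\<bar>a (Suc n) z\<bar> \<le> C" by (rule bd[OF _ K]) simp
   then have "\<bar>a (Suc n) z\<bar> * \<bar>a (Suc n) z\<bar> \<le> C * C" by (intro mult_mono) auto
   then show ?case by (simp add: abs_mult power2_eq_square)
  qed
  show "(%z. a (Suc n) z * a (Suc n) z) \<in> borel_measurable (lebesgue_on Om)" for n
   by (intro borel_measurable_times m)
 qed simp_all
 then show ?thesis unfolding L2_norm_sq L2_inner_def by simp
qed

lemma lipschitz_continuous:
 assumes "\<forall>z w. \<bar>F z - F w\<bar> \<le> L * norm1 (z - w)" "0 \<le> L" shows "continuous_on UNIV (F :: point => real)"
proof (rule continuous_on_iff[THEN iffD2], intro ballI allI impI)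
 fix z :: point and \<epsilon> :: real assume "\<epsilon> > 0"
 have "dist (F w) (F z) < \<epsilon>" if "dist w z < \<epsilon> / (2 * (L + 1))" for w
 proof -
  have "dist (F w) (F z) \<le> L * norm1 (w - z)" using assms(1) by (simp add: dist_real_def)
  also have "\<dots> \<le> L * (2 * norm (w - z))" using norm1_le assms(2) by (intro mult_left_mono)
  also have "\<dots> \<le> (L + 1) * (2 * norm (w - z))" by (intro mult_right_mono) auto
  also have "\<dots> < \<epsilon>" using that assms(2) by (simp add: dist_norm field_simps)
  finally show ?thesis .
 qed
 then show "\<exists>d>0. \<forall>w\<in>UNIV. dist w z < d --> dist (F w) (F z) < \<epsilon>"
  using \<open>\<epsilon> > 0\<close> assms(2) by (intro exI[of _ "\<epsilon> / (2 * (L + 1))"]) simp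
qed

lemma compatible_has_weak_deriv:
 assumes F: "compatible F P" and P: "\<forall>K\<in>T. P K \<in> polys m"
  and c: "continuous_on UNIV F" and e: "e \<in> Basis"
 shows "has_weak_deriv Om e F (pw_deriv e P)"
proof -
 obtain M where M: "\<forall>z\<in>Om. \<bar>pw_deriv e P z\<bar> \<le> M" using pw_deriv_bounded[OF P e] by blast
 show ?thesis
 proof (rule has_weak_derivI[OF e c pw_deriv_measurable[OF P e] _ skeleton_thin])
  show "\<bar>pw_deriv e P z\<bar> \<le> M" if "z \<in> Om" for z using M that by blast
  fix z assume z: "z \<in> Om" "z \<notin> skeleton"
  have "z \<in> closure Om" using subsetD[OF closure_subset z(1)] .
  then obtain K where K: "K \<in> T" "z \<in> interior K" using closure_off_skeleton z(2) by blast
  have "has_grad F (dx (P K) z) (dy (P K) z) z"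
  proof (rule has_grad_local[OF polys_has_grad[OF bspec[OF P K(1)]] open_interior K(2)])
   show "P K w = F w" if "w \<in> interior K" for w
    using compatible_element[OF F K(1) subsetD[OF interior_subset that]] by simp
  qed
  from has_grad_line_deriv[OF this e] has_grad_dir[OF this, of e] has_grad_dir[OF polys_has_grad[OF bspec[OF P K(1)]], of e z]
  show "((%s. F (z + s *\<^sub>R e)) has_real_derivative pw_deriv e P z) (at 0)"
   unfolding pw_deriv_interior[OF K] by simp
 qed
qed

text \<open>The local polynomials approximate the derivatives of order \<open>i \<le> r\<close> of the elementwise
 polynomials to order \<open>r - i\<close> in the mesh size \<open>1 / n\<close> of the grid.\<close>

definition local_order :: "nat => (point set => point => real) => real => bool" where
 "local_order r P C \<longleftrightarrow> 0 \<le> C \<and> (\<forall>n>0. \<forall>K\<in>T. \<forall>z\<in>interior K. \<forall>c. z \<in> cell n c --> (\<forall>as. set as \<subseteq> Basis --> length as \<le> r -->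
   \<bar>derivs as (%w. local_poly P n c w - P K w) z\<bar> * real n ^ (r - length as) \<le> C))"

text \<open>Each term of the product rule is bounded: the local error is of order \<open>r - i\<close> after \<open>i\<close>
derivatives, and every derivative of a bump costs one power of \<open>n\<close>. At a point inside an element
all cells that matter eventually carry the polynomial of that element, so the error is zero.\<close>

lemma approximant_convergence:
 assumes P: "\<forall>K\<in>T. P K \<in> polys m" and C: "local_order r P C" and es: "set es \<subseteq> Basis" "length es \<le> r"
  and g: "g \<in> borel_measurable borel" "\<And>K z. K \<in> T ==> z \<in> interior K ==> g z = derivs es (P K) z"
 shows "(%n. (nrm (%z. g z - derivs es (approximant P (Suc n)) z))\<^sup>2) \<longlonglongrightarrow> 0"
proof -
 obtain A where A: "A \<ge> 0" "\<forall>es z. set es \<subseteq> Basis --> length es \<le> r --> \<bar>derivs es bump z\<bar> \<le> A"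
  using derivs_bump_bound by blast
 have C0: "0 \<le> C" using C by (simp add: local_order_def)
 let ?B = "2 ^ length es * (C * A)"
 have B0: "0 \<le> ?B" using A(1) C0 by simp
 let ?l = "%n K c. leibniz es (%w. local_poly P n c w - P K w) (%w. bump (shift n c w))"
 let ?t = "%n K z c. \<Sum>(p, q)\<leftarrow>?l n K c. p z * q z"
 have factors: "\<exists>as bs. set as \<subseteq> Basis \<and> set bs \<subseteq> Basis \<and> length as + length bs \<le> r \<and>
   p = derivs as (%w. local_poly P n c w - P K w) \<and> q = derivs bs (%w. bump (shift n c w))" if pq: "(p, q) \<in> set (?l n K c)" for p q n K c
 proof -
  obtain as bs where "set as \<subseteq> set es" "set bs \<subseteq> set es" "length as + length bs = length es"
   "p = derivs as (%w. local_poly P n c w - P K w)" "q = derivs bs (%w. bump (shift n c w))"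
   using leibniz_factors[OF pq] by (elim exE conjE)
  then show ?thesis using es by (intro exI[of _ as] exI[of _ bs]) auto
 qed
 have off: "?t n K z c = 0" if "z \<notin> cell n c" for n K z c
 proof -
  have "p z * q z = 0" if pq: "(p, q) \<in> set (?l n K c)" for p q
  proof -
   have "bump (shift n c w) = 0" if "w \<notin> cell n c" for w using that bump_zero shift_cell by metis
   then have "derivs bs (%w. bump (shift n c w)) z = 0" for bs by (rule derivs_zero_off[OF cell_closed _ \<open>z \<notin> cell n c\<close>])
   then show ?thesis using factors[OF pq] by auto
  qed
  then have "map (%(p, q). p z * q z) (?l n K c) = map (%x. 0::real) (?l n K c)" by (intro map_cong refl) auto
  then show ?thesis by (simp only: sum_list_0)
 qed
 have bound: "\<bar>?t n K z c\<bar> \<le> ?B" if n: "n > 0" and K: "K \<in> T" "z \<in> interior K" and zc: "z \<in> cell n c" for n K z c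
 proof -
  have "\<bar>p z * q z\<bar> \<le> C * A" if pq: "(p, q) \<in> set (?l n K c)" for p q
  proof -
   obtain as bs where ab: "set as \<subseteq> Basis" "set bs \<subseteq> Basis" "length as + length bs \<le> r"
    "p = derivs as (%w. local_poly P n c w - P K w)" "q = derivs bs (%w. bump (shift n c w))"
    using factors[OF pq] by (elim exE conjE)
   have "\<bar>p z\<bar> * real n ^ length bs \<le> \<bar>p z\<bar> * real n ^ (r - length as)"
    using ab(3) n by (intro mult_left_mono power_increasing) auto
   also have "\<dots> \<le> C" unfolding ab(4) using C n K zc ab(1,3) unfolding local_order_def by simp
   finally have "\<bar>p z\<bar> * real n ^ length bs * \<bar>derivs bs bump (shift n c z)\<bar> \<le> C * A"
    using A ab(2,3) C0 by (intro mult_mono) auto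
   then show ?thesis unfolding ab(5) derivs_bump_shift[OF ab(2)] by (simp add: abs_mult mult.assoc)
  qed
  then have "(\<Sum>x\<leftarrow>?l n K c. \<bar>case x of (p, q) => p z * q z\<bar>) \<le> (\<Sum>x\<leftarrow>?l n K c. C * A)"
   by (intro sum_list_mono) auto
  also have "\<dots> = ?B" by (simp add: sum_list_triv length_leibniz)
  finally show ?thesis using sum_list_abs[of "map (%(p, q). p z * q z) (?l n K c)"] by (simp add: comp_def)
 qed
 have exact: "?t n K z c = 0" if "local_poly P n c = P K" for n K z c
 proof -
  have "p z * q z = 0" if pq: "(p, q) \<in> set (?l n K c)" for p q
   using factors[OF pq] \<open>local_poly P n c = P K\<close> by (auto simp: derivs_zero)
  then have "map (%(p, q). p z * q z) (?l n K c) = map (%x. 0::real) (?l n K c)" by (intro map_cong refl) auto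
  then show ?thesis by (simp only: sum_list_0)
 qed
 let ?a = "%n z. if n = 0 then 0 else g z - derivs es (approximant P n) z"
 have a: "?a n z = - (\<Sum>c\<in>grid (n * radius). ?t n K z c)" if "n > 0" "K \<in> T" "z \<in> interior K" for n K z
  using approximant_error[OF P that es(1)] g(2)[OF that(2,3)] that(1) by simp
 have "(%n. (nrm (?a (Suc n)))\<^sup>2) \<longlonglongrightarrow> 0"
 proof (rule L2_dominated[where C = "9 * ?B"])
  have "derivs es (approximant P n) \<in> borel_measurable borel" if "n > 0" for n
   by (rule borel_measurable_continuous_onI[OF nice_continuous[OF nice_derivs[OF approximant_nice[OF P that] es(1)]]])
  then show "?a n \<in> borel_measurable (lebesgue_on Om)" for n
   using g(1) by (cases "n = 0") (auto intro!: measurable_dom borel_measurable_diff)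
  fix K z assume K: "K \<in> T" "z \<in> interior K"
  show "\<bar>?a n z\<bar> \<le> 9 * ?B" if n: "n > 0" for n
   unfolding a[OF n K] abs_minus by (rule active_sum_bound[OF off bound[OF n K] B0 finite_grid])
  obtain n0 where n0: "n0 > 0" "\<forall>n\<ge>n0. \<forall>c. z \<in> cell n c --> local_poly P n c = P K"
   using local_poly_eventually[OF K] by blast
  have "?a n z = 0" if "n \<ge> n0" for n
  proof -
   have n: "n > 0" using that n0(1) by simp
   have "?t n K z c = 0" for c
    using off[of z n c K] exact[of n c K z] n0(2)[rule_format, OF that] by (cases "z \<in> cell n c") blast+
   then show ?thesis unfolding a[OF n K] by simp
  qed
  then show "\<exists>n0>0. \<forall>n\<ge>n0. ?a n z = 0" using n0(1) by blast
 qed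
 then show ?thesis by simp
qed

lemma compatible_local_order:
 assumes F: "compatible F P" and P: "\<forall>K\<in>T. P K \<in> polys m"
  and L: "\<forall>z w. \<bar>F z - F w\<bar> \<le> L * norm1 (z - w)" "0 \<le> L"
 shows "\<exists>C. local_order 1 P C"
proof -
 obtain C where C: "C \<ge> 0" "\<forall>n>0. \<forall>c. \<forall>z\<in>cell n c. \<forall>w\<in>cell n c. w \<in> Om --> \<bar>local_poly P n c z - F z\<bar> \<le> C / real n"
  using local_poly_error[OF F P L] by blast
 have "\<forall>e\<in>Basis. \<exists>M\<ge>0. \<forall>K\<in>T. \<forall>z\<in>Om. \<bar>dd e (P K) z\<bar> \<le> M" using pw_deriv_bounded[OF P] by blast
 then obtain M where M: "\<forall>e\<in>Basis. M e \<ge> 0 \<and> (\<forall>K\<in>T. \<forall>z\<in>Om. \<bar>dd e (P K) z\<bar> \<le> M e)" by (rule bchoice[THEN exE])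
 let ?M = "\<Sum>e\<in>(Basis :: point set). M e"
 have M0: "0 \<le> ?M" using M by (intro sum_nonneg) simp
 have "\<bar>derivs as (%w. local_poly P n c w - P K w) z\<bar> * real n ^ (1 - length as) \<le> C + 2 * ?M"
  if n: "n > 0" and K: "K \<in> T" "z \<in> interior K" and zc: "z \<in> cell n c" and as: "set as \<subseteq> Basis" "length as \<le> 1" for n c z K as
 proof -
  have zOm: "z \<in> Om" by (rule subsetD[OF interior_subset_domain[OF K(1)] K(2)])
  consider "as = []" | e where "as = [e]" "e \<in> Basis" using as by (cases as) auto
  then show ?thesis
  proof cases
   case 1
   have "F z = P K z" by (rule compatible_element[OF F K(1) subsetD[OF interior_subset K(2)]])
   then show ?thesis using C(2)[rule_format, OF n zc zc zOm] 1 n M0 by (simp add: le_divide_eq)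
  next
   case 2
   have bd: "\<bar>dd e (P L) z\<bar> \<le> ?M" if "L \<in> T" for L
    using M 2(2) that zOm by (intro order_trans[OF _ member_le_sum[of e Basis M]]) simp_all
   have "\<bar>dd e (local_poly P n c) z\<bar> \<le> ?M" using local_poly_cases[OF n, of P c] bd M0 by (auto simp: dir_deriv_const)
   then show ?thesis using bd[OF K(1)] C(1) 2(1)
     dir_deriv_nice_diff[OF polys_nice[OF local_poly_polys[OF P n, of c]] polys_nice[OF bspec[OF P K(1)]], of e] by simp
  qed
 qed
 moreover have "0 \<le> C + 2 * ?M" using C(1) M0 by simp
 ultimately show ?thesis unfolding local_order_def by (intro exI[of _ "C + 2 * ?M"]) simp
qed

text \<open>A derivative of the local error is the local error of the derivative, so positive orders follow
from the first-order statement for the gradient.\<close>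

lemma compatible_local_order2:
 assumes F: "compatible F P" and P: "\<forall>K\<in>T. P K \<in> polys m"
  and grad: "\<And>z. has_grad F (G (1, 0) z) (G (0, 1) z) z"
  and G: "\<forall>e\<in>Basis. compatible (G e) (%K. dd e (P K))"
  and L: "\<forall>e\<in>Basis. \<forall>z w. \<bar>G e z - G e w\<bar> \<le> L * norm1 (z - w)" "0 \<le> L"
 shows "\<exists>C. local_order 2 P C"
proof -
 have P': "\<forall>K\<in>T. dd d (P K) \<in> polys (m - 1)" if "d \<in> Basis" for d
  using polys_dir_deriv[OF bspec[OF P] that] by simp
 obtain C0 where C0: "C0 \<ge> 0" "\<forall>n>0. \<forall>c. \<forall>z\<in>cell n c. z \<in> Om --> \<bar>local_poly P n c z - F z\<bar> \<le> C0 / (real n)\<^sup>2"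
  using local_poly_error2[OF F P grad G L] by blast
 have "\<forall>d\<in>Basis. \<exists>C. local_order 1 (%K. dd d (P K)) C"
  using compatible_local_order[OF bspec[OF G] P' bspec[OF L(1)] L(2)] by blast
 then obtain C1 where C1: "\<forall>d\<in>Basis. local_order 1 (%K. dd d (P K)) (C1 d)" by (rule bchoice[THEN exE])
 let ?C = "\<Sum>d\<in>(Basis :: point set). C1 d"
 have nn: "0 \<le> C1 d" if "d \<in> Basis" for d using C1 that unfolding local_order_def by blast
 have C: "0 \<le> ?C" using nn by (intro sum_nonneg)
 have "\<bar>derivs as (%w. local_poly P n c w - P K w) z\<bar> * real n ^ (2 - length as) \<le> C0 + ?C"
  if n: "n > 0" and K: "K \<in> T" "z \<in> interior K" and zc: "z \<in> cell n c" and as: "set as \<subseteq> Basis" "length as \<le> 2" for n c z K as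
 proof (cases as rule: rev_cases)
  case Nil
  have "z \<in> Om" by (rule subsetD[OF interior_subset_domain[OF K(1)] K(2)])
  moreover have "F z = P K z" by (rule compatible_element[OF F K(1) subsetD[OF interior_subset K(2)]])
  ultimately show ?thesis using C0(2)[rule_format, OF n zc] Nil n C by (simp add: le_divide_eq)
 next
  case (snoc bs d)
  then have d: "d \<in> Basis" and bs: "set bs \<subseteq> Basis" "length bs \<le> 1" using as by auto
  have "derivs as (%w. local_poly P n c w - P K w) = derivs bs (%w. local_poly (%K. dd d (P K)) n c w - dd d (P K) w)"
   using snoc dir_deriv_nice_diff[OF polys_nice[OF local_poly_polys[OF P n, of c]] polys_nice[OF bspec[OF P K(1)]], of d]
   by (simp add: local_poly_dir_deriv)
  moreover have "\<bar>derivs bs (%w. local_poly (%K. dd d (P K)) n c w - dd d (P K) w) z\<bar> * real n ^ (1 - length bs) \<le> C1 d"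
   using bspec[OF C1 d] n K zc bs unfolding local_order_def by blast
  moreover have "C1 d \<le> ?C" using d nn by (intro member_le_sum) simp_all
  ultimately show ?thesis using snoc C0(1) by simp
 qed
 moreover have "0 \<le> C0 + ?C" using C C0(1) by simp
 ultimately show ?thesis unfolding local_order_def by (intro exI[of _ "C0 + ?C"]) simp
qed

theorem compatible_H1_0:
 assumes F: "compatible F P" and P: "\<forall>K\<in>T. P K \<in> polys m"
  and L: "\<forall>z w. \<bar>F z - F w\<bar> \<le> L * norm1 (z - w)" "0 \<le> L"
 shows "F \<in> H1_0 Om"
proof (rule H1_0I)
 have c: "continuous_on UNIV F" by (rule lipschitz_continuous[OF L])
 note wd = compatible_has_weak_deriv[OF F P c]
 obtain C where C: "local_order 1 P C" using compatible_local_order[OF F P L] by blast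
 have conv0: "(%n. (nrm (%z. F z - approximant P (Suc n) z))\<^sup>2) \<longlonglongrightarrow> 0"
  using approximant_convergence[OF P C, of "[]" F] borel_measurable_continuous_onI[OF c]
   compatible_element[OF F _ subsetD[OF interior_subset]] by simp
 have conv1: "(%n. (nrm (%z. pw_deriv e P z - dd e (approximant P (Suc n)) z))\<^sup>2) \<longlonglongrightarrow> 0" if "e \<in> Basis" for e
  using approximant_convergence[OF P C, of "[e]" "pw_deriv e P"] pw_deriv_measurable[OF P that] pw_deriv_interior that by simp
 show FH: "F \<in> H1 Om" by (rule H1I[OF wd])
 fix \<epsilon> :: real assume "\<epsilon> > 0"
 let ?A = "%n. approximant P (Suc n)"
 have s: "smooth (?A n)" for n by (rule nice_smooth[OF approximant_nice[OF P]]) auto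
 have "(H1_norm Om (%z. F z - ?A n z))\<^sup>2 = (nrm (%z. F z - ?A n z))\<^sup>2
   + (\<Sum>e\<in>Basis. (nrm (%z. pw_deriv e P z - dd e (?A n) z))\<^sup>2)" for n
 proof -
  have "nrm (wd e (%z. F z - ?A n z)) = nrm (%z. pw_deriv e P z - dd e (?A n) z)" if e: "e \<in> Basis" for e
  proof (rule L2_norm_cong)
   have "has_weak_deriv Om e (%z. 1 * F z + (-1) * ?A n z) (%z. 1 * pw_deriv e P z + (-1) * dd e (?A n) z)"
    by (intro has_weak_deriv_linear e wd smooth_has_weak_deriv s)
   then show "ae_eq Om (wd e (%z. F z - ?A n z)) (%z. pw_deriv e P z - dd e (?A n) z)"
    using weak_deriv_eq by simp
   show "wd e (%z. F z - ?A n z) \<in> L2 Om" by (rule H1_weak_L2[OF smooth_diff_H1[OF FH s] e])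
  qed
  then show ?thesis unfolding H1_norm_sq by simp
 qed
 moreover have "(%n. (nrm (%z. F z - ?A n z))\<^sup>2
   + (\<Sum>e\<in>Basis. (nrm (%z. pw_deriv e P z - dd e (?A n) z))\<^sup>2)) \<longlonglongrightarrow> 0 + (\<Sum>e\<in>(Basis::point set). 0)"
  by (intro tendsto_add tendsto_sum conv0 conv1)
 ultimately have "(%n. (H1_norm Om (%z. F z - ?A n z))\<^sup>2) \<longlonglongrightarrow> 0" by simp
 then have "\<forall>\<^sub>F n in sequentially. (H1_norm Om (%z. F z - ?A n z))\<^sup>2 < \<epsilon>" using \<open>\<epsilon> > 0\<close> by (rule order_tendstoD(2))
 then obtain n where "(H1_norm Om (%z. F z - ?A n z))\<^sup>2 < \<epsilon>" by (auto simp: eventually_sequentially)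
 then show "\<exists>\<psi>\<in>tests. (H1_norm Om (%z. F z - \<psi> z))\<^sup>2 < \<epsilon>"
  using approximant_test[OF P, of "Suc n"] by (intro bexI[of _ "?A n"]) auto
qed

theorem compatible_H2_0:
 assumes F: "compatible F P" and P: "\<forall>K\<in>T. P K \<in> polys m"
  and grad: "\<And>z. has_grad F (G (1, 0) z) (G (0, 1) z) z"
  and G: "\<forall>e\<in>Basis. compatible (G e) (%K. dd e (P K))"
  and L: "\<forall>e\<in>Basis. \<forall>z w. \<bar>G e z - G e w\<bar> \<le> L * norm1 (z - w)" "0 \<le> L"
  and L0: "\<forall>z w. \<bar>F z - F w\<bar> \<le> L0 * norm1 (z - w)" "0 \<le> L0"
 shows "F \<in> H2_0 Om" and "e \<in> Basis ==> ae_eq Om (wd e F) (G e)"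
proof -
 have P': "\<forall>K\<in>T. dd d (P K) \<in> polys (m - 1)" if "d \<in> Basis" for d
  using polys_dir_deriv[OF bspec[OF P] that] by simp
 have c: "continuous_on UNIV F" by (rule lipschitz_continuous[OF L0])
 have Gc: "continuous_on UNIV (G e)" if "e \<in> Basis" for e by (rule lipschitz_continuous[OF bspec[OF L(1) that] L(2)])
 have GP: "ae_eq Om (pw_deriv e P) (G e)" if "e \<in> Basis" for e
 proof (rule ae_eq_domI)
  fix K assume K: "K \<in> T"
  show "ae_eq K (pw_deriv e P) (G e)" unfolding ae_eq_element[OF K]
   by (rule AE_I2) (simp add: pw_deriv_interior[OF K] compatible_element[OF bspec[OF G that] K subsetD[OF interior_subset]])
 qed
 have wF: "has_weak_deriv Om e F (G e)" if "e \<in> Basis" for e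
  by (rule has_weak_deriv_cong[OF ae_eq_refl GP[OF that] compatible_has_weak_deriv[OF F P c that]])
 have wG: "has_weak_deriv Om e' (G e) (pw_deriv e' (%K. dd e (P K)))" if "e \<in> Basis" "e' \<in> Basis" for e e'
  by (rule compatible_has_weak_deriv[OF bspec[OF G that(1)] P'[OF that(1)] Gc[OF that(1)] that(2)])
 show wk: "ae_eq Om (wd e F) (G e)" if "e \<in> Basis" for e by (rule weak_deriv_eq[OF wF[OF that]])
 have FH1: "F \<in> H1 Om" by (rule H1I[OF wF])
 have GH1: "G e \<in> H1 Om" if "e \<in> Basis" for e by (rule H1I[OF wG[OF that]])
 have FH: "F \<in> H2 Om" unfolding H2_def using FH1 H1_cong[OF ae_eq_sym[OF wk] GH1] by simp
 obtain C where C: "local_order 2 P C" using compatible_local_order2[OF F P grad G L] by blast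
 have conv0: "(%n. (nrm (%z. F z - approximant P (Suc n) z))\<^sup>2) \<longlonglongrightarrow> 0"
  using approximant_convergence[OF P C, of "[]" F] borel_measurable_continuous_onI[OF c]
   compatible_element[OF F _ subsetD[OF interior_subset]] by simp
 have conv1: "(%n. (nrm (%z. pw_deriv e P z - dd e (approximant P (Suc n)) z))\<^sup>2) \<longlonglongrightarrow> 0" if "e \<in> Basis" for e
  using approximant_convergence[OF P C, of "[e]" "pw_deriv e P"] pw_deriv_measurable[OF P that] pw_deriv_interior that by simp
 have conv2: "(%n. (nrm (%z. pw_deriv e' (%K. dd e (P K)) z - dd e' (dd e (approximant P (Suc n))) z))\<^sup>2) \<longlonglongrightarrow> 0"
  if "e \<in> Basis" "e' \<in> Basis" for e e'
  using approximant_convergence[OF P C, of "[e', e]" "pw_deriv e' (%K. dd e (P K))"] pw_deriv_measurable[OF P'[OF that(1)] that(2)] pw_deriv_interior that by simp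
 show "F \<in> H2_0 Om"
 proof (rule H2_0I[OF FH])
  fix \<epsilon> :: real assume "\<epsilon> > 0"
  let ?A = "%n. approximant P (Suc n)"
  have s: "smooth (?A n)" for n by (rule nice_smooth[OF approximant_nice[OF P]]) auto
  let ?D = "%e e' n z. pw_deriv e' (%K. dd e (P K)) z - dd e' (dd e (?A n)) z"
  have eq: "(H2_norm Om (%z. F z - ?A n z))\<^sup>2 = (nrm (%z. F z - ?A n z))\<^sup>2
    + (\<Sum>e\<in>Basis. (nrm (%z. pw_deriv e P z - dd e (?A n) z))\<^sup>2
      + (\<Sum>e'\<in>Basis. (nrm (?D e e' n))\<^sup>2))" for n
  proof -
   have "(H1_norm Om (wd e (%z. F z - ?A n z)))\<^sup>2 = (nrm (%z. pw_deriv e P z - dd e (?A n) z))\<^sup>2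
      + (\<Sum>e'\<in>Basis. (nrm (?D e e' n))\<^sup>2)" if e: "e \<in> Basis" for e
   proof -
    let ?g = "%z. G e z - dd e (?A n) z"
    have sd: "smooth (dd e (?A n))" by (rule smooth_dir_deriv[OF s e])
    have "has_weak_deriv Om e (%z. 1 * F z + (-1) * ?A n z) (%z. 1 * G e z + (-1) * dd e (?A n) z)"
     by (intro has_weak_deriv_linear e wF smooth_has_weak_deriv s)
    then have ae: "ae_eq Om (wd e (%z. F z - ?A n z)) ?g" using weak_deriv_eq by simp
    have L2w: "wd e (%z. F z - ?A n z) \<in> L2 Om" by (rule H1_weak_L2[OF smooth_diff_H1[OF FH1 s] e])
    have gL: "?g \<in> L2 Om" by (rule L2_cong[OF ae L2w])
    have "nrm (wd e' ?g) = nrm (?D e e' n)" if e': "e' \<in> Basis" for e'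
    proof (rule L2_norm_cong)
     have "has_weak_deriv Om e' (%z. 1 * G e z + (-1) * dd e (?A n) z)
       (%z. 1 * pw_deriv e' (%K. dd e (P K)) z + (-1) * dd e' (dd e (?A n)) z)"
      by (intro has_weak_deriv_linear e e' wG smooth_has_weak_deriv sd)
     then show "ae_eq Om (wd e' ?g) (?D e e' n)" using weak_deriv_eq by simp
     show "wd e' ?g \<in> L2 Om" by (rule H1_weak_L2[OF smooth_diff_H1[OF GH1[OF e] sd] e'])
    qed
    moreover have "nrm ?g = nrm (%z. pw_deriv e P z - dd e (?A n) z)"
     by (rule L2_norm_cong[OF ae_eq_diff[OF ae_eq_sym[OF GP[OF e]] ae_eq_refl] gL])
    ultimately show ?thesis unfolding H1_norm_cong[OF ae L2w] H1_norm_sq by simp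
   qed
   then show ?thesis unfolding H2_norm_sq by simp
  qed
  have "(%n. (nrm (%z. F z - ?A n z))\<^sup>2
    + (\<Sum>e\<in>Basis. (nrm (%z. pw_deriv e P z - dd e (?A n) z))\<^sup>2
      + (\<Sum>e'\<in>Basis. (nrm (?D e e' n))\<^sup>2))) \<longlonglongrightarrow> 0 + (\<Sum>e\<in>(Basis::point set). 0 + (\<Sum>e'\<in>(Basis::point set). 0))"
   by (intro tendsto_add tendsto_sum conv0 conv1 conv2)
  then have "(%n. (H2_norm Om (%z. F z - ?A n z))\<^sup>2) \<longlonglongrightarrow> 0" unfolding eq by simp
  then have "\<forall>\<^sub>F n in sequentially. (H2_norm Om (%z. F z - ?A n z))\<^sup>2 < \<epsilon>" using \<open>\<epsilon> > 0\<close> by (rule order_tendstoD(2))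
  then obtain n where "(H2_norm Om (%z. F z - ?A n z))\<^sup>2 < \<epsilon>" by (auto simp: eventually_sequentially)
  then show "\<exists>\<psi>\<in>tests. (H2_norm Om (%z. F z - \<psi> z))\<^sup>2 < \<epsilon>"
   using approximant_test[OF P, of "Suc n"] by (intro bexI[of _ "?A n"]) auto
 qed
qed

end

context mesh_domain begin

section \<open>Functions that vanish on element boundaries\<close>

definition ext :: "point set => (point => real) => point => real" where
 "ext K p z = (if z \<in> K then p z else 0)"

text \<open>Polynomials that vanish on the boundaries of their elements fit together without further conditions.\<close>

definition glue :: "(point set => point => real) => point => real" where
 "glue p z = (\<Sum>K\<in>T. ext K (p K) z)"

lemma glue_compatible:
 assumes p: "\<forall>K\<in>T. \<forall>z\<in>frontier K. p K z = 0"
 shows "compatible (glue p) p"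
 unfolding compatible_def
proof (intro conjI ballI allI impI)
 fix K z assume K: "K \<in> T" "z \<in> K"
 have "ext L (p L) z = (if L = K then p K z else 0)" if L: "L \<in> T" for L
 proof (cases "L = K")
  case False
  have "p L z = 0" if "z \<in> L"
  proof -
   have "z \<in> frontier L" using conforming[OF L K(1) False] K(2) that by (metis IntI subsetD)
   then show ?thesis using p L by simp
  qed
  then show ?thesis using False by (simp add: ext_def)
 qed (use K in \<open>simp add: ext_def\<close>)
 then have "glue p z = (\<Sum>L\<in>T. if L = K then p K z else 0)" unfolding glue_def by (rule sum.cong[OF refl])
 then show "glue p z = p K z" using K finite_mesh by simp
next
 fix z assume z: "z \<notin> Om"
 have "ext K (p K) z = 0" if K: "K \<in> T" for K
 proof (cases "z \<in> K")
  case True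
  then have "z \<in> frontier K"
   unfolding element_frontier[OF K] using z subsetD[OF interior_subset_domain[OF K], of z] by auto
  then show ?thesis using p K by (simp add: ext_def)
 qed (simp add: ext_def)
 then show "glue p z = 0" unfolding glue_def by (simp add: sum.neutral)
qed

lemma norm1_scale: "norm1 (s *\<^sub>R z) = \<bar>s\<bar> * norm1 z"
 by (simp add: norm1_def abs_mult distrib_left)

lemma norm1_minus: "norm1 (z - w) = norm1 (w - z)"
 by (simp add: norm1_def abs_minus_commute)

lemma ext_lipschitz:
 assumes K: "K \<in> T" and p: "p \<in> polys m" and z0: "\<forall>z\<in>frontier K. p z = 0"
 shows "\<exists>L\<ge>0. \<forall>z w. \<bar>ext K p z - ext K p w\<bar> \<le> L * norm1 (z - w)"
proof -
 obtain L where L: "L \<ge> 0" "\<forall>z\<in>K. \<forall>w\<in>K. \<bar>p z - p w\<bar> \<le> L * norm1 (z - w)"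
  using polys_lipschitz_bounded[OF p compact_imp_bounded[OF element_compact[OF K]] element_convex[OF K]] by blast
 have out: "\<bar>p z\<bar> \<le> L * norm1 (z - w)" if zw: "z \<in> K" "w \<notin> K" for z w
 proof -
  have "closed_segment z w \<inter> frontier K \<noteq> {}"
  proof (rule connected_Int_frontier[OF connected_segment(1)])
   show "closed_segment z w \<inter> K \<noteq> {}" using zw(1) ends_in_segment(1)[of z w] by (metis IntI emptyE)
   show "closed_segment z w - K \<noteq> {}" using zw(2) ends_in_segment(2)[of w z] by (metis DiffI emptyE)
  qed
  then obtain y where y: "y \<in> closed_segment z w" "y \<in> frontier K" by (metis IntE ex_in_conv)
  then obtain s where s: "0 \<le> s" "s \<le> 1" "y = (1 - s) *\<^sub>R z + s *\<^sub>R w" unfolding in_segment by (elim conjE exE)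
  have yK: "y \<in> K" using y(2) element_frontier[OF K] by simp
  have "z - y = s *\<^sub>R (z - w)" unfolding s(3) by (simp add: algebra_simps)
  then have "norm1 (z - y) = s * norm1 (z - w)" using s(1) by (simp add: norm1_scale)
  also have "\<dots> \<le> 1 * norm1 (z - w)" using s(2) by (intro mult_right_mono) (simp_all add: norm1_def)
  finally have le: "norm1 (z - y) \<le> norm1 (z - w)" by simp
  have "\<bar>p z\<bar> = \<bar>p z - p y\<bar>" using z0 y(2) by simp
  also have "\<dots> \<le> L * norm1 (z - y)" using L(2) zw(1) yK by simp
  also have "\<dots> \<le> L * norm1 (z - w)" by (rule mult_left_mono[OF le L(1)])
  finally show ?thesis .
 qed
 have "\<bar>ext K p z - ext K p w\<bar> \<le> L * norm1 (z - w)" for z w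
 proof -
  consider "z \<in> K" "w \<in> K" | "z \<in> K" "w \<notin> K" | "z \<notin> K" "w \<in> K" | "z \<notin> K" "w \<notin> K" by auto
  then show ?thesis
  proof cases
   case 1 then show ?thesis using L(2) by (simp add: ext_def)
  next
   case 2 then show ?thesis using out[OF 2] by (simp add: ext_def)
  next
   case 3 then show ?thesis using out[OF 3(2,1)] norm1_minus[of z w] by (simp add: ext_def)
  next
   case 4 then show ?thesis using L(1) by (simp add: ext_def norm1_def)
  qed
 qed
 then show ?thesis using L(1) by (intro exI[of _ L]) simp
qed

lemma glue_lipschitz:
 assumes p: "\<forall>K\<in>T. p K \<in> polys m" "\<forall>K\<in>T. \<forall>z\<in>frontier K. p K z = 0"
 shows "\<exists>L\<ge>0. \<forall>z w. \<bar>glue p z - glue p w\<bar> \<le> L * norm1 (z - w)"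
proof -
 have "\<forall>K\<in>T. \<exists>L\<ge>0. \<forall>z w. \<bar>ext K (p K) z - ext K (p K) w\<bar> \<le> L * norm1 (z - w)"
  by (intro ballI ext_lipschitz) (use p in auto)
 then obtain L where L: "\<forall>K\<in>T. L K \<ge> 0 \<and> (\<forall>z w. \<bar>ext K (p K) z - ext K (p K) w\<bar> \<le> L K * norm1 (z - w))"
  by (rule bchoice[THEN exE])
 have "\<bar>glue p z - glue p w\<bar> \<le> (\<Sum>K\<in>T. L K) * norm1 (z - w)" for z w
 proof -
  have "glue p z - glue p w = (\<Sum>K\<in>T. ext K (p K) z - ext K (p K) w)" unfolding glue_def by (simp add: sum_subtractf)
  also have "\<bar>\<dots>\<bar> \<le> (\<Sum>K\<in>T. \<bar>ext K (p K) z - ext K (p K) w\<bar>)" by (rule sum_abs)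
  also have "\<dots> \<le> (\<Sum>K\<in>T. L K * norm1 (z - w))" using L by (intro sum_mono) simp
  finally show ?thesis by (simp add: sum_distrib_right)
 qed
 moreover have "0 \<le> (\<Sum>K\<in>T. L K)" using L by (intro sum_nonneg) simp
 ultimately show ?thesis by (intro exI[of _ "\<Sum>K\<in>T. L K"]) simp
qed

lemma glue_H1_0:
 assumes p: "\<forall>K\<in>T. p K \<in> polys m" "\<forall>K\<in>T. \<forall>z\<in>frontier K. p K z = 0"
 shows "glue p \<in> H1_0 Om"
proof -
 obtain L where L: "L \<ge> 0" "\<forall>z w. \<bar>glue p z - glue p w\<bar> \<le> L * norm1 (z - w)" using glue_lipschitz[OF p] by blast
 show ?thesis by (rule compatible_H1_0[OF glue_compatible[OF p(2)] p(1) L(2,1)])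
qed

lemma has_grad_off: "z \<notin> K ==> closed K ==> has_grad (ext K p) 0 0 z"
 by (rule has_grad_local[OF has_grad_const[of 0], of "- K"]) (auto simp: ext_def)

text \<open>The extension by zero is Lipschitz and of bounded support, so the integrals of its directional
derivatives vanish.\<close>

lemma integral_element_deriv_zero:
 assumes K: "K \<in> T" and p: "p \<in> polys m" and z0: "\<forall>z\<in>frontier K. p z = 0" and e: "e \<in> Basis"
 shows "(LINT x|lebesgue_on K. dd e p x) = 0"
proof -
 obtain L where L: "L \<ge> 0" "\<forall>z w. \<bar>ext K p z - ext K p w\<bar> \<le> L * norm1 (z - w)" using ext_lipschitz[OF K p z0] by blast
 have c: "continuous_on UNIV (ext K p)" by (rule lipschitz_continuous[OF L(2,1)])
 have dc: "continuous_on A (dd e p)" for A by (rule nice_continuous[OF nice_dir_deriv[OF polys_nice[OF p] e]])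
 let ?G = "%z. indicator (interior K) z * dd e p z"
 have m: "?G \<in> borel_measurable borel"
  by (intro borel_measurable_times borel_measurable_indicator borel_open open_interior borel_measurable_continuous_onI dc)
 obtain M where M: "\<forall>z\<in>K. \<bar>dd e p z\<bar> \<le> M" using compact_bound[OF element_compact[OF K] dc] by blast
 have "(LINT z|lborel. ?G z) = 0"
 proof (rule integral_line_deriv_zero(2)[OF e c m _ element_thin[OF K] _ compact_imp_bounded[OF element_compact[OF K]]])
  show "\<bar>?G z\<bar> \<le> \<bar>M\<bar>" for z
  proof (cases "z \<in> interior K")
   case True
   then have "\<bar>dd e p z\<bar> \<le> M" using M subsetD[OF interior_subset] by blast
   then show ?thesis using True by simp
  qed simp
  show "((%s. ext K p (z + s *\<^sub>R e)) has_real_derivative ?G z) (at 0)" if "z \<notin> frontier K" for z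
  proof (cases "z \<in> interior K")
   case True
   have "has_grad (ext K p) (dx p z) (dy p z) z"
    by (rule has_grad_local[OF polys_has_grad[OF p] open_interior True])
     (simp add: ext_def subsetD[OF interior_subset])
   from has_grad_line_deriv[OF this e] has_grad_dir[OF this, of e] has_grad_dir[OF polys_has_grad[OF p], of e z]
   show ?thesis using True by simp
  next
   case False
   then have "z \<notin> K" using that element_frontier[OF K] by simp
   then have g: "has_grad (ext K p) 0 0 z" using has_grad_off[OF _ element_closed[OF K]] by blast
   from has_grad_line_deriv[OF g e] has_grad_dir[OF g, of e] show ?thesis using False by simp
  qed
  show "ext K p z = 0" "?G z = 0" if "z \<notin> K" for z
   using that subsetD[OF interior_subset, of z K] by (auto simp: ext_def indicator_def)
 qed
 then have "(LINT z|lebesgue. ?G z) = 0" using m by (simp add: integral_completion)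
 moreover have "(LINT x|lebesgue_on K. dd e p x) = (LINT x|lebesgue. indicator K x *\<^sub>R dd e p x)"
  using element_lebesgue[OF K] by (intro integral_restrict_space) auto
 moreover have "(LINT x|lebesgue. indicator K x *\<^sub>R dd e p x) = (LINT z|lebesgue. ?G z)"
 proof (rule integral_cong_AE)
  show "AE x in lebesgue. indicator K x *\<^sub>R dd e p x = ?G x"
   using AE_skeleton
  proof eventually_elim
   case (elim x)
   then have "x \<notin> frontier K" using K by (auto simp: skeleton_def)
   then show ?case using element_frontier[OF K] subsetD[OF interior_subset, of x K] by (auto simp: indicator_def)
  qed
  show "?G \<in> borel_measurable lebesgue" using m by (intro measurable_completion) simp
  show "(%x. indicator K x *\<^sub>R dd e p x) \<in> borel_measurable lebesgue"
   using element_closed[OF K]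
   by (intro measurable_completion borel_measurable_scaleR borel_measurable_indicator)
    (auto intro: borel_measurable_continuous_onI dc)
 qed
 ultimately show ?thesis by simp
qed

section \<open>Potentials of divergence-free fields\<close>

lemma has_grad_zero_constant:
 assumes "open S" "connected S" "\<And>z. z \<in> S ==> has_grad f 0 0 z" "z \<in> S" "w \<in> S"
 shows "f z = f w"
 using has_derivative_zero_unique_connected[OF assms(1,2), of f, OF _ assms(4,5)] assms(3)
 unfolding has_grad_def by simp

lemma interval_lebesgue_henstock:
 fixes g :: "real => real"
 assumes "continuous_on UNIV g"
 shows "(LINT s|lborel. indicator {a..b} s *\<^sub>R g s) = integral {a..b} g"
proof -
 have "set_integrable lborel {a..b} g"
  by (rule borel_integrable_atLeastAtMost'[OF continuous_on_subset[OF assms]]) simp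
 from set_borel_integral_eq_integral(2)[OF this] show ?thesis by (simp add: set_lebesgue_integral_def)
qed

text \<open>For a divergence-free field that is the extension by zero of continuous piecewise polynomials,
 integration along horizontal lines gives a potential: the flux through every box vanishes. Outside
 the domain the potential is constant because the exterior is connected, and the constant is 0 far
 to the left.\<close>

lemma plane_potential:
 assumes u1: "compatible u1 P1" and u2: "compatible u2 P2"
  and P1: "\<forall>K\<in>T. P1 K \<in> polys m" and P2: "\<forall>K\<in>T. P2 K \<in> polys m"
  and c1: "continuous_on UNIV u1" and c2: "continuous_on UNIV u2"
  and div: "\<forall>K\<in>T. \<forall>z. dx (P1 K) z + dy (P2 K) z = 0"
 shows "\<exists>F. (\<forall>z. has_grad F (- u2 z) (u1 z) z) \<and> (\<forall>z. z \<notin> Om --> F z = 0)"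
proof -
 let ?R = "real radius"
 have zero: "u1 z = 0" "u2 z = 0" if "norm z \<ge> ?R" for z
 proof -
  have "z \<notin> Om" using radius[of z] that subsetD[OF closure_subset, of z Om] by fastforce
  then show "u1 z = 0" "u2 z = 0" using compatible_zero u1 u2 by auto
 qed
 have nf: "norm z \<ge> \<bar>fst z\<bar>" for z :: point using norm_fst_le[of "fst z" "snd z"] by simp
 define \<phi> where "\<phi> = (%x y. - integral {- ?R..x} (%s. u2 (s, y)))"
 have cx: "continuous_on A (%s. u2 (s, y))" for A y
  by (rule continuous_on_subset[of UNIV]) (auto intro!: continuous_on_compose2[OF c2] continuous_intros)
 have cy: "continuous_on A (%t. u1 (x, t))" for A x
  by (rule continuous_on_subset[of UNIV]) (auto intro!: continuous_on_compose2[OF c1] continuous_intros)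
 have \<phi>_eq: "\<phi> x y = - integral {a..x} (%s. u2 (s, y))" if "a \<le> - ?R" "a \<le> x" for a x y
 proof (cases "x \<ge> - ?R")
  case True
  have "integral {a..x} (%s. u2 (s, y)) = integral {a..- ?R} (%s. u2 (s, y)) + integral {- ?R..x} (%s. u2 (s, y))"
   using that True by (intro Henstock_Kurzweil_Integration.integral_combine[symmetric] integrable_continuous_interval cx) auto
  moreover have "integral {a..- ?R} (%s. u2 (s, y)) = integral {a..- ?R} (%s. 0)"
  proof (rule Henstock_Kurzweil_Integration.integral_cong)
   fix s assume "s \<in> {a..- ?R}"
   then show "u2 (s, y) = 0" using zero(2)[of "(s, y)"] nf[of "(s, y)"] by simp
  qed
  ultimately show ?thesis by (simp add: \<phi>_def)
 next
  case False
  have "integral {a..x} (%s. u2 (s, y)) = integral {a..x} (%s. 0)"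
  proof (rule Henstock_Kurzweil_Integration.integral_cong)
   fix s assume "s \<in> {a..x}"
   then show "u2 (s, y) = 0" using zero(2)[of "(s, y)"] nf[of "(s, y)"] False by simp
  qed
  then show ?thesis using False by (simp add: \<phi>_def)
 qed
 have dx: "((%x. \<phi> x y) has_real_derivative - u2 (x, y)) (at x)" for x y
 proof -
  define a where "a = min (- ?R) x - 1"
  have "((%x. integral {a..x} (%s. u2 (s, y))) has_real_derivative u2 (x, y)) (at x within {a..x + 1})"
   by (rule integral_has_real_derivative[OF cx]) (auto simp: a_def)
  then have "((%x. integral {a..x} (%s. u2 (s, y))) has_real_derivative u2 (x, y)) (at x within {a<..<x + 1})"
   by (rule DERIV_subset) auto
  then have "((%x. integral {a..x} (%s. u2 (s, y))) has_real_derivative u2 (x, y)) (at x)"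
   by (subst (asm) at_within_open) (auto simp: a_def)
  from DERIV_minus[OF this] show ?thesis
   by (rule has_field_derivative_transform_within_open[where S = "{a<..}"])
    (auto simp: a_def intro!: \<phi>_eq[symmetric])
 qed
 \<comment> \<open>The flux through the right side of a box that reaches to the far left, where the field is zero,
   balances the flux through its top and bottom.\<close>
 have flux: "integral {c..d} (%t. u1 (x, t)) = \<phi> x d - \<phi> x c" if cd: "c \<le> d" for x c d
 proof -
  define a where "a = min (- ?R) x - 1"
  have a: "a \<le> - ?R" "a \<le> x" by (auto simp: a_def)
  note b = axis_directions
  let ?G1 = "pw_deriv (1, 0) P1" and ?G2 = "pw_deriv (0, 1) P2"
  have off: "pw_deriv e P z = 0" if "z \<notin> Om" for e P z
   unfolding pw_deriv_def
  proof (rule sum.neutral, rule ballI)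
   fix K assume K: "K \<in> T"
   have "z \<notin> interior K" using that subsetD[OF interior_subset_domain[OF K], of z] by auto
   then show "indicator (interior K) z * dd e (P K) z = 0" by simp
  qed
  have bound: "\<exists>M. \<forall>z. \<bar>pw_deriv e P z\<bar> \<le> M" if Pe: "\<forall>K\<in>T. P K \<in> polys m" "e \<in> Basis" for P e
  proof -
   obtain M where M: "M \<ge> 0" "\<forall>z\<in>Om. \<bar>pw_deriv e P z\<bar> \<le> M" using pw_deriv_bounded[OF Pe] by blast
   have "\<bar>pw_deriv e P z\<bar> \<le> M" for z using M off[of z e P] by (cases "z \<in> Om") auto
   then show ?thesis by blast
  qed
  have gr: "has_grad u (pw_deriv (1, 0) P z) (pw_deriv (0, 1) P z) z"
   if u: "compatible u P" and P: "\<forall>K\<in>T. P K \<in> polys m" and z: "z \<notin> skeleton" for u P z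
  proof (cases "z \<in> closure Om")
   case True
   then obtain K where K: "K \<in> T" "z \<in> interior K" using closure_off_skeleton z by blast
   show ?thesis unfolding pw_deriv_interior[OF K]
    by (rule has_grad_local[OF polys_has_grad[OF bspec[OF P K(1)]] open_interior K(2)])
     (simp add: compatible_element[OF u K(1) subsetD[OF interior_subset]])
  next
   case False
   have z': "z \<notin> Om" using False subsetD[OF closure_subset, of z Om] by auto
   have "has_grad u 0 0 z"
   proof (rule has_grad_local[OF has_grad_const[of 0], of "- closure Om"])
    show "0 = u w" if "w \<in> - closure Om" for w
     using that compatible_zero[OF u, of w] subsetD[OF closure_subset, of w Om] by auto
   qed (use False in auto)
   then show ?thesis using off[OF z'] by simp
  qed
  obtain M1 where M1: "\<And>z. \<bar>?G1 z\<bar> \<le> M1" using bound[OF P1 b(1)] by blast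
  obtain M2 where M2: "\<And>z. \<bar>?G2 z\<bar> \<le> M2" using bound[OF P2 b(2)] by blast
  have "(LINT z|lborel. indicator ({a..x} \<times> {c..d}) z *\<^sub>R ?G1 z) = (LINT t|lborel. indicator {c..d} t *\<^sub>R (u1 (x, t) - u1 (a, t)))"
   by (rule box_ftc_x[OF c1 pw_deriv_measurable[OF P1 b(1)] M1 skeleton_thin a(2)])
    (rule has_grad_line_fst[OF gr[OF u1 P1]])
  moreover have "u1 (a, t) = 0" for t using zero(1)[of "(a, t)"] nf[of "(a, t)"] a by simp
  ultimately have 1: "(LINT z|lborel. indicator ({a..x} \<times> {c..d}) z *\<^sub>R ?G1 z) = integral {c..d} (%t. u1 (x, t))"
   using interval_lebesgue_henstock[OF cy, of c d x] by simp
  have "(LINT z|lborel. indicator ({a..x} \<times> {c..d}) z *\<^sub>R ?G2 z) = (LINT t|lborel. indicator {a..x} t *\<^sub>R (u2 (t, d) - u2 (t, c)))"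
   by (rule box_ftc_y[OF c2 pw_deriv_measurable[OF P2 b(2)] M2 skeleton_thin cd])
    (rule has_grad_line_snd[OF gr[OF u2 P2]])
  also have "\<dots> = integral {a..x} (%t. u2 (t, d) - u2 (t, c))"
   by (rule interval_lebesgue_henstock) (intro continuous_on_diff cx)
  also have "\<dots> = integral {a..x} (%t. u2 (t, d)) - integral {a..x} (%t. u2 (t, c))"
   by (intro Henstock_Kurzweil_Integration.integral_diff integrable_continuous_interval cx)
  also have "\<dots> = - (\<phi> x d - \<phi> x c)" using \<phi>_eq[OF a] by simp
  finally have 2: "(LINT z|lborel. indicator ({a..x} \<times> {c..d}) z *\<^sub>R ?G2 z) = - (\<phi> x d - \<phi> x c)" .
  have "?G1 z + ?G2 z = 0" for z
  proof -
   have "?G1 z + ?G2 z = (\<Sum>K\<in>T. indicator (interior K) z * (dx (P1 K) z + dy (P2 K) z))"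
    unfolding pw_deriv_def by (simp add: sum.distrib[symmetric] distrib_left)
   then show ?thesis using div by simp
  qed
  then have "?G1 = (%z. - ?G2 z)" by (simp add: eq_neg_iff_add_eq_0 fun_eq_iff)
  then have "(LINT z|lborel. indicator ({a..x} \<times> {c..d}) z *\<^sub>R ?G1 z) = - (LINT z|lborel. indicator ({a..x} \<times> {c..d}) z *\<^sub>R ?G2 z)"
   by simp
  then show ?thesis using 1 2 by simp
 qed
 have dy: "((%y. \<phi> x y) has_real_derivative u1 (x, y)) (at y)" for x y
 proof -
  have "((%y'. integral {y - 1..y'} (%t. u1 (x, t))) has_real_derivative u1 (x, y)) (at y within {y - 1..y + 1})"
   by (rule integral_has_real_derivative[OF cy]) auto
  then have "((%y'. integral {y - 1..y'} (%t. u1 (x, t))) has_real_derivative u1 (x, y)) (at y within {y - 1<..<y + 1})"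
   by (rule DERIV_subset) auto
  then have "((%y'. integral {y - 1..y'} (%t. u1 (x, t))) has_real_derivative u1 (x, y)) (at y)"
   by (subst (asm) at_within_open) auto
  then have "((%y'. \<phi> x y' - \<phi> x (y - 1)) has_real_derivative u1 (x, y)) (at y)"
   by (rule has_field_derivative_transform_within_open[where S = "{y - 1<..}"]) (auto simp: flux)
  from DERIV_add[OF this DERIV_const[of "\<phi> x (y - 1)"]] show ?thesis by simp
 qed
 let ?F = "%z. \<phi> (fst z) (snd z)"
 have grad: "has_grad ?F (- u2 z) (u1 z) z" for z
 proof -
  let ?fy = "%x y. u1 (x, y) *\<^sub>R (id_blinfun :: real \<Rightarrow>\<^sub>L real)"
  have "((%(x, y). \<phi> x y) has_derivative (%(tx, ty). - u2 (fst z, snd z) * tx + blinfun_apply (?fy (fst z) (snd z)) ty)) (at (fst z, snd z) within UNIV \<times> UNIV)"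
  proof (rule has_derivative_partialsI)
   show "((%x. \<phi> x (snd z)) has_derivative (*) (- u2 (fst z, snd z))) (at (fst z) within UNIV)"
    using dx[of "snd z" "fst z"] by (simp add: has_field_derivative_def)
   show "((%y. \<phi> x y) has_derivative blinfun_apply (?fy x y)) (at y within UNIV)" for x y
   proof -
    have "blinfun_apply (?fy x y) = (*) (u1 (x, y))" by (auto simp: blinfun.scaleR_left)
    then show ?thesis using dy[of x y] by (simp add: has_field_derivative_def)
   qed
   have "(%(x, y). ?fy x y) = (%z. u1 z *\<^sub>R id_blinfun)" by auto
   moreover have "continuous_on UNIV (%z. u1 z *\<^sub>R (id_blinfun :: real \<Rightarrow>\<^sub>L real))" by (intro continuous_intros c1)
   ultimately show "continuous (at (fst z, snd z) within UNIV \<times> UNIV) (%(x, y). ?fy x y)"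
    by (simp add: continuous_on_eq_continuous_within)
  qed auto
  then show ?thesis unfolding has_grad_def by (simp add: split_def blinfun.scaleR_left)
 qed
 have ext0: "?F z = 0" if "z \<in> - closure Om" for z
 proof -
  let ?w = "(- ?R - 1, 0)"
  have w: "?w \<in> - closure Om" using radius[of ?w] nf[of ?w] by auto
  have "?F z = ?F ?w"
  proof (rule has_grad_zero_constant[OF _ exterior_connected _ that w])
   show "has_grad ?F 0 0 y" if "y \<in> - closure Om" for y
   proof -
    have "y \<notin> Om" using that subsetD[OF closure_subset, of y Om] by auto
    then have "u1 y = 0" "u2 y = 0" using compatible_zero u1 u2 by auto
    then show ?thesis using grad[of y] by simp
   qed
  qed auto
  also have "\<dots> = 0" by (simp add: \<phi>_def)
  finally show ?thesis .
 qed
 have "?F z = 0" if z: "z \<notin> Om" for z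
 proof (cases "z \<in> closure Om")
  case True
  then have "z \<in> frontier Om" using z open_dom by (simp add: frontier_def interior_open)
  then have zc: "z \<in> closure (- closure Om)" using frontier_exterior by blast
  have "continuous_on UNIV ?F" using has_grad_continuous[OF grad] by (simp add: continuous_at_imp_continuous_on)
  then have "continuous_on (closure (- closure Om)) ?F" by (rule continuous_on_subset) simp
  then show ?thesis by (rule continuous_constant_on_closure[OF _ ext0 zc])
 next
  case False
  then show ?thesis using ext0[of z] by simp
 qed
 with grad show ?thesis by (intro exI[of _ ?F]) simp
qed

text \<open>On each element the plane potential has a polynomial gradient, so it is a polynomial of one degree
more; a constant is adjusted with the value at one interior point.\<close>

lemma divergence_free_potential:
 assumes v1: "v1 \<in> H1_0 Om" "pw_poly T m v1" and v2: "v2 \<in> H1_0 Om" "pw_poly T m v2"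
  and div: "\<forall>K\<in>T. \<forall>z. dx (restr K v1) z + dy (restr K v2) z = 0"
 shows "\<exists>F. F \<in> H2_0 Om \<and> pw_poly T (m + 1) F \<and>
  ae_eq Om (wd (1, 0) F) (%z. - v2 z) \<and> ae_eq Om (wd (0, 1) F) v1 \<and>
  (\<forall>K\<in>T. \<forall>L\<in>T. \<forall>z\<in>K \<inter> L. restr K F z = restr L F z)"
proof -
 obtain M1 where M1: "M1 \<ge> 0" "\<forall>e\<in>Basis. AE x in lebesgue_on Om. \<bar>wd e v1 x\<bar> \<le> M1"
  using weak_deriv_bound[OF H1_0_H1[OF v1(1)] v1(2)] by blast
 obtain M2 where M2: "M2 \<ge> 0" "\<forall>e\<in>Basis. AE x in lebesgue_on Om. \<bar>wd e v2 x\<bar> \<le> M2"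
  using weak_deriv_bound[OF H1_0_H1[OF v2(1)] v2(2)] by blast
 note t1 = hat_trace[OF v1 M1] and t2 = hat_trace[OF v2 M2]
 let ?u1 = "hat v1" and ?u2 = "hat v2"
 have co: "compatible ?u1 (%K. restr K v1)" "compatible ?u2 (%K. restr K v2)"
  using t1(1,2) t2(1,2) by (auto simp: compatible_def)
 have l1: "\<forall>z w. \<bar>?u1 z - ?u1 w\<bar> \<le> M1 * norm1 (z - w)" and l2: "\<forall>z w. \<bar>?u2 z - ?u2 w\<bar> \<le> M2 * norm1 (z - w)"
  using t1(3) t2(3) by (simp_all add: norm1_def)
 have c: "continuous_on UNIV ?u1" "continuous_on UNIV ?u2"
  by (rule lipschitz_continuous[OF l1 M1(1)], rule lipschitz_continuous[OF l2 M2(1)])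
 have P: "\<forall>K\<in>T. restr K v1 \<in> polys m" "\<forall>K\<in>T. restr K v2 \<in> polys m" using restr_polys v1(2) v2(2) by auto
 obtain F where F: "\<And>z. has_grad F (- ?u2 z) (?u1 z) z" "\<And>z. z \<notin> Om ==> F z = 0"
  using plane_potential[OF co P c div] by blast
 have Fc: "continuous_on A F" for A
  by (rule continuous_at_imp_continuous_on) (use has_grad_continuous[OF F(1)] in blast)
 have "\<forall>K\<in>T. \<exists>p. p \<in> polys (m + 1) \<and> dx p = (%z. - restr K v2 z) \<and> dy p = restr K v1 \<and> (\<forall>z\<in>K. F z = p z)"
 proof
  fix K assume K: "K \<in> T"
  let ?r1 = "restr K v1" and ?r2 = "restr K v2"
  have r: "?r1 \<in> polys m" "?r2 \<in> polys m" using P K by auto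
  have nr: "(%z. - ?r2 z) \<in> polys m" using polys_cmul[OF r(2), of "-1"] by simp
  have "dy (%z. - ?r2 z) = dx ?r1"
  proof
   fix z
   have "dy (%z. - ?r2 z) z = - dy ?r2 z"
    using has_grad_dir_snd[OF has_grad_cmul[OF polys_has_grad[OF r(2)], of "-1"], of z] by simp
   then show "dy (%z. - ?r2 z) z = dx ?r1 z" using spec[OF bspec[OF div K], of z] by linarith
  qed
  from polys_potential[OF nr r(1) this] obtain q where q: "q \<in> polys (m + 1)"
   "dx q = (%z. - ?r2 z)" "dy q = ?r1" by blast
  obtain z0 where z0: "z0 \<in> interior K" using element_interior[OF K] by blast
  let ?k = "F z0 - q z0"
  let ?p = "%z. q z + ?k"
  have p: "?p \<in> polys (m + 1)" by (intro polys_add q polys_const)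
  have gp: "has_grad ?p (- ?r2 z) (?r1 z) z" for z
   using has_grad_add[OF polys_has_grad[OF q(1), of z] has_grad_const[of ?k z]] q by simp
  have int: "F z - q z = ?k" if "z \<in> interior K" for z
  proof (rule has_grad_zero_constant[OF open_interior convex_connected[OF convex_interior[OF element_convex[OF K]]] _ that z0])
   show "has_grad (%z. F z - q z) 0 0 w" if "w \<in> interior K" for w
   proof -
    have "w \<in> K" by (rule subsetD[OF interior_subset that])
    then have "?u1 w = ?r1 w" "?u2 w = ?r2 w" using compatible_element[OF co(1) K] compatible_element[OF co(2) K] by auto
    then show ?thesis using has_grad_diff[OF F(1) polys_has_grad[OF q(1)], of w] q by simp
   qed
  qed
  have "F z - q z = ?k" if "z \<in> K" for z
  proof (rule continuous_constant_on_closure[OF _ int])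
   show "continuous_on (closure (interior K)) (%z. F z - q z)"
    by (intro continuous_intros Fc nice_continuous polys_nice[OF q(1)])
   show "z \<in> closure (interior K)" using that element_closure_interior[OF K] by simp
  qed
  then have "\<forall>z\<in>K. F z = ?p z" by (simp add: algebra_simps)
  moreover have "dx ?p = (%z. - ?r2 z)" "dy ?p = ?r1"
   using has_grad_dir_fst[OF gp] has_grad_dir_snd[OF gp] by auto
  ultimately show "\<exists>p. p \<in> polys (m + 1) \<and> dx p = (%z. - ?r2 z) \<and> dy p = ?r1 \<and> (\<forall>z\<in>K. F z = p z)"
   using p by (intro exI[of _ ?p]) simp
 qed
 then obtain p where p: "\<forall>K\<in>T. p K \<in> polys (m + 1) \<and> dx (p K) = (%z. - restr K v2 z) \<and> dy (p K) = restr K v1 \<and> (\<forall>z\<in>K. F z = p K z)"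
  by (rule bchoice[THEN exE])
 have pp: "\<forall>K\<in>T. p K \<in> polys (m + 1)" using p by simp
 have cF: "compatible F p" unfolding compatible_def using p F(2) by simp
 define G where "G = (%e z. - ?u2 z * fst e + ?u1 z * snd (e :: point))"
 have FG: "has_grad F (G (1, 0) z) (G (0, 1) z) z" for z using F(1)[of z] by (simp add: G_def)
 have cG: "\<forall>e\<in>Basis. compatible (G e) (%K. dd e (p K))"
  unfolding Basis_point using p compatible_element[OF co(1)] compatible_element[OF co(2)] compatible_zero[OF co(1)] compatible_zero[OF co(2)]
  by (simp add: compatible_def G_def)
 have LG: "\<forall>e\<in>Basis. \<forall>z w. \<bar>G e z - G e w\<bar> \<le> (M1 + M2) * norm1 (z - w)"
 proof -
  have "M1 * norm1 (z - w) \<le> (M1 + M2) * norm1 (z - w)" "M2 * norm1 (z - w) \<le> (M1 + M2) * norm1 (z - w)" for z w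
   using M1(1) M2(1) by (auto intro!: mult_right_mono simp: norm1_def)
  then have "\<bar>?u1 z - ?u1 w\<bar> \<le> (M1 + M2) * norm1 (z - w)" "\<bar>?u2 z - ?u2 w\<bar> \<le> (M1 + M2) * norm1 (z - w)" for z w
   using l1 l2 order_trans by blast+
  then show ?thesis unfolding Basis_point by (simp add: G_def abs_minus_commute)
 qed
 have M: "0 \<le> M1 + M2" using M1(1) M2(1) by simp
 have bnd: "\<exists>B\<ge>0. \<forall>z. \<bar>u z\<bar> \<le> B" if u: "continuous_on UNIV u" "\<And>z. z \<notin> Om ==> u z = 0" for u :: "point => real"
 proof -
  obtain B where B: "\<forall>z\<in>Om. \<bar>u z\<bar> \<le> B" using bounded_on_dom[OF u(1)] by blast
  have "\<bar>u z\<bar> \<le> \<bar>B\<bar>" for z using bspec[OF B, of z] u(2)[of z] by (cases "z \<in> Om") auto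
  then show ?thesis by (intro exI[of _ "\<bar>B\<bar>"]) simp
 qed
 obtain B1 where B1: "B1 \<ge> 0" "\<forall>z. \<bar>?u1 z\<bar> \<le> B1" using bnd[OF c(1) compatible_zero[OF co(1)]] by blast
 obtain B2 where B2: "B2 \<ge> 0" "\<forall>z. \<bar>?u2 z\<bar> \<le> B2" using bnd[OF c(2) compatible_zero[OF co(2)]] by blast
 have LF: "\<forall>z w. \<bar>F z - F w\<bar> \<le> (B1 + B2) * norm1 (z - w)"
 proof (intro allI gradient_bound)
  fix z w :: point and s :: real
  let ?y = "w + s *\<^sub>R (z - w)"
  show "has_grad F (- ?u2 ?y) (?u1 ?y) ?y \<and> \<bar>- ?u2 ?y\<bar> \<le> B1 + B2 \<and> \<bar>?u1 ?y\<bar> \<le> B1 + B2"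
   using F(1) B1 B2 by (auto intro: order_trans[OF spec[OF B1(2)]] order_trans[OF spec[OF B2(2)]])
 qed
 have B: "0 \<le> B1 + B2" using B1(1) B2(1) by simp
 have H: "F \<in> H2_0 Om" by (rule compatible_H2_0(1)[OF cF pp FG cG LG M LF B])
 have W: "ae_eq Om (wd e F) (G e)" if "e \<in> Basis" for e by (rule compatible_H2_0(2)[OF cF pp FG cG LG M LF B that])
 have "G (1, 0) = (%z. - ?u2 z)" "G (0, 1) = ?u1" by (auto simp: G_def)
 then have "ae_eq Om (wd (1, 0) F) (%z. - ?u2 z)" "ae_eq Om (wd (0, 1) F) ?u1"
  using W[of "(1, 0)"] W[of "(0, 1)"] by (simp_all add: Basis_point)
 moreover have "ae_eq Om (%z. - ?u2 z) (%z. - v2 z)" "ae_eq Om ?u1 v1"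
  using ae_eq_map[OF ae_eq_sym[OF hat_ae[OF v2(2)]], of uminus] ae_eq_sym[OF hat_ae[OF v1(2)]] by auto
 ultimately have W': "ae_eq Om (wd (1, 0) F) (%z. - v2 z)" "ae_eq Om (wd (0, 1) F) v1"
  using ae_eq_trans by blast+
 have ae: "ae_eq K F (p K)" if K: "K \<in> T" for K
  unfolding ae_eq_element[OF K]
  by (rule AE_I2) (simp add: compatible_element[OF cF K subsetD[OF interior_subset]])
 have pw: "pw_poly T (m + 1) F" unfolding pw_poly_def using ae pp by blast
 have rp: "restr K F = p K" if "K \<in> T" for K by (rule restr_eq[OF that bspec[OF pp that] ae[OF that]])
 have "\<forall>K\<in>T. \<forall>L\<in>T. \<forall>z\<in>K \<inter> L. restr K F z = restr L F z"
  using rp compatible_element[OF cF] by (metis IntD1 IntD2)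
 with H pw W' show ?thesis by blast
qed

end

section \<open>Barycentric coordinates\<close>

definition cross :: "point => point => real" where
 "cross u v = fst u * snd v - snd u * fst v"

text \<open>The barycentric coordinate of \<open>z\<close> belonging to \<open>a\<close>, as a quotient of signed areas.\<close>

definition bary :: "point => point => point => point => real" where
 "bary a b c z = cross (b - z) (c - z) / cross (b - a) (c - a)"

lemma cross_zero_collinear: "cross u v = 0 ==> u = 0 \<or> v = 0 \<or> (\<exists>r. v = r *\<^sub>R u)"
proof -
 assume *: "cross u v = 0"
 show ?thesis
 proof (cases "fst u = 0")
  case False
  then have "v = (fst v / fst u) *\<^sub>R u" using * by (intro prod_eqI) (auto simp: cross_def field_simps)
  then show ?thesis by blast
 next
  case True
  show ?thesis
  proof (cases "snd u = 0")
   case False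
   then have "v = (snd v / snd u) *\<^sub>R u" using * True by (intro prod_eqI) (auto simp: cross_def field_simps)
   then show ?thesis by blast
  next
   case 2: True
   with True have "u = 0" by (intro prod_eqI) simp_all
   then show ?thesis by blast
  qed
 qed
qed

lemma triangle_cross:
 assumes "triangle K a b c" shows "cross (b - a) (c - a) \<noteq> 0"
proof
 assume "cross (b - a) (c - a) = 0"
 then have "collinear {0, b - a, c - a}" unfolding collinear_lemma by (rule cross_zero_collinear)
 then have "collinear {b, a, c}" by (simp add: collinear_3[of b a c])
 then show False using assms by (simp add: triangle_def insert_commute)
qed

lemma cross_rotate: "cross (c - b) (a - b) = cross (b - a) (c - a)"
 by (simp add: cross_def algebra_simps)

lemma bary_combination:
 assumes "triangle K a b c" "u + v + w = 1"
 shows "bary a b c (u *\<^sub>R a + v *\<^sub>R b + w *\<^sub>R c) = u"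
proof -
 have u: "u = 1 - v - w" using assms(2) by simp
 have "cross (b - (u *\<^sub>R a + v *\<^sub>R b + w *\<^sub>R c)) (c - (u *\<^sub>R a + v *\<^sub>R b + w *\<^sub>R c)) = u * cross (b - a) (c - a)"
  unfolding u by (simp add: cross_def algebra_simps)
 then show ?thesis using triangle_cross[OF assms(1)] by (simp add: bary_def)
qed

lemma bary_has_grad:
 "has_grad (bary a b c) ((snd b - snd c) / cross (b - a) (c - a)) ((fst c - fst b) / cross (b - a) (c - a)) z"
proof -
 let ?D = "cross (b - a) (c - a)"
 have eq: "bary a b c = (%z. (snd b - snd c) / ?D * fst z + ((fst c - fst b) / ?D * snd z + cross b c / ?D))"
  by (rule ext) (simp add: bary_def cross_def algebra_simps flip: add_divide_distrib diff_divide_distrib)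
 show ?thesis unfolding eq
  using has_grad_add[OF has_grad_cmul[OF has_grad_fst, where c = "(snd b - snd c) / ?D"]
   has_grad_add[OF has_grad_cmul[OF has_grad_snd, where c = "(fst c - fst b) / ?D"] has_grad_const[where c = "cross b c / ?D"]]]
  by (simp only: mult_1_right mult_zero_right add_0_right add_0_left)
qed

lemma bary_polys: "bary a b c \<in> polys (Suc 0)"
proof -
 let ?D = "cross (b - a) (c - a)"
 have eq: "bary a b c = (%z. (snd b - snd c) / ?D * fst z + (fst c - fst b) / ?D * snd z + cross b c / ?D)"
  by (rule ext) (simp add: bary_def cross_def algebra_simps flip: add_divide_distrib diff_divide_distrib)
 show ?thesis unfolding eq by (rule polys_affine)
qed

lemma bary_sum:
 assumes "triangle K a b c"
 shows "bary a b c z + bary b c a z + bary c a b z = 1"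
proof -
 have "cross (b - z) (c - z) + cross (c - z) (a - z) + cross (a - z) (b - z) = cross (b - a) (c - a)"
  by (simp add: cross_def algebra_simps)
 then show ?thesis using triangle_cross[OF assms] cross_rotate[of c b a] cross_rotate[of a c b]
  by (simp add: bary_def flip: add_divide_distrib)
qed

lemma bary_reconstruct:
 assumes "triangle K a b c"
 shows "bary a b c z *\<^sub>R a + bary b c a z *\<^sub>R b + bary c a b z *\<^sub>R c = z"
proof -
 have D: "cross (b - a) (c - a) \<noteq> 0" by (rule triangle_cross[OF assms])
 have "cross (b - z) (c - z) *\<^sub>R a + cross (c - z) (a - z) *\<^sub>R b + cross (a - z) (b - z) *\<^sub>R c = cross (b - a) (c - a) *\<^sub>R z"
  by (intro prod_eqI) (simp_all add: cross_def algebra_simps)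
 then have "inverse (cross (b - a) (c - a)) *\<^sub>R (cross (b - z) (c - z) *\<^sub>R a + cross (c - z) (a - z) *\<^sub>R b + cross (a - z) (b - z) *\<^sub>R c) = z"
  using D by simp
 then show ?thesis using cross_rotate[of c b a] cross_rotate[of a c b]
  by (simp add: bary_def scaleR_add_right divide_inverse mult.commute)
qed

lemma bary_vertices:
 assumes t: "triangle K a b c"
 shows "bary a b c a = 1" "bary a b c b = 0" "bary a b c c = 0"
 using bary_combination[OF t, of 1 0 0] bary_combination[OF t, of 0 1 0] bary_combination[OF t, of 0 0 1] by simp_all

lemma bary_edge:
 assumes t: "triangle K a b c" and z: "z \<in> closed_segment b c" shows "bary a b c z = 0"
proof -
 obtain s where "z = (1 - s) *\<^sub>R b + s *\<^sub>R c" using z unfolding in_segment by blast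
 then show ?thesis using bary_combination[OF t, of 0 "1 - s" s] by simp
qed

lemma bary_frontier:
 assumes t: "triangle K a b c" and z: "z \<in> frontier K"
 shows "bary a b c z = 0 \<or> bary b c a z = 0 \<or> bary c a b z = 0"
 using z bary_edge[OF t, of z] bary_edge[OF triangle_rotate[OF t], of z] bary_edge[OF triangle_rotate[OF triangle_rotate[OF t]], of z]
 unfolding triangle_frontier[OF t] by blast

lemma bary_nonneg:
 assumes t: "triangle K a b c" and z: "z \<in> K" shows "0 \<le> bary a b c z"
proof -
 obtain u v w where "0 \<le> u" "u + v + w = 1" "z = u *\<^sub>R a + v *\<^sub>R b + w *\<^sub>R c"
  using t z unfolding triangle_def convex_hull_3 by blast
 then show ?thesis using bary_combination[OF t, of u v w] by simp
qed

section \<open>Divergences of bubble fields on one triangle\<close>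

definition bubble_divergences :: "nat => point set => (point => real) set" where
 "bubble_divergences k K = {q. \<exists>w1\<in>polys k. \<exists>w2\<in>polys k.
   (\<forall>z\<in>frontier K. w1 z = 0 \<and> w2 z = 0) \<and> (\<forall>z. dx w1 z + dy w2 z = q z)}"

lemma bubble_divergences_add:
 assumes "q \<in> bubble_divergences k K" "r \<in> bubble_divergences k K"
 shows "(%z. q z + r z) \<in> bubble_divergences k K"
proof -
 obtain w1 w2 where w: "w1 \<in> polys k" "w2 \<in> polys k" "\<forall>z\<in>frontier K. w1 z = 0 \<and> w2 z = 0"
  "\<forall>z. dx w1 z + dy w2 z = q z"
  using assms(1) unfolding bubble_divergences_def by blast
 obtain v1 v2 where v: "v1 \<in> polys k" "v2 \<in> polys k" "\<forall>z\<in>frontier K. v1 z = 0 \<and> v2 z = 0"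
  "\<forall>z. dx v1 z + dy v2 z = r z"
  using assms(2) unfolding bubble_divergences_def by blast
 have "dx (%z. w1 z + v1 z) z + dy (%z. w2 z + v2 z) z = q z + r z" for z
  using w(4)[rule_format, of z] v(4)[rule_format, of z] dx_add[OF w(1) v(1)] dy_add[OF w(2) v(2)] by simp
 then show ?thesis unfolding bubble_divergences_def using w v
  by (intro CollectI bexI[of _ "%z. w1 z + v1 z"] bexI[of _ "%z. w2 z + v2 z"] conjI polys_add) auto
qed

lemma dir_deriv_cmul: "p \<in> polys m ==> dd e (%z. c * p z) z = c * dd e p z"
proof -
 assume p: "p \<in> polys m"
 show ?thesis
  using has_grad_dir[OF has_grad_cmul[OF polys_has_grad[OF p, of z], of c], of e] has_grad_dir[OF polys_has_grad[OF p, of z], of e]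
  by (simp only: algebra_simps)
qed

lemma bubble_divergences_cmul:
 assumes "q \<in> bubble_divergences k K"
 shows "(%z. c * q z) \<in> bubble_divergences k K"
proof -
 obtain w1 w2 where w: "w1 \<in> polys k" "w2 \<in> polys k" "\<forall>z\<in>frontier K. w1 z = 0 \<and> w2 z = 0"
  "\<forall>z. dx w1 z + dy w2 z = q z"
  using assms(1) unfolding bubble_divergences_def by blast
 have "dx (%z. c * w1 z) z + dy (%z. c * w2 z) z = c * q z" for z
  using w(4)[rule_format, of z] by (simp add: dir_deriv_cmul[OF w(1)] dir_deriv_cmul[OF w(2)] flip: distrib_left)
 then show ?thesis unfolding bubble_divergences_def using w
  by (intro CollectI bexI[of _ "%z. c * w1 z"] bexI[of _ "%z. c * w2 z"] conjI polys_cmul) auto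
qed

lemma bubble_divergences_diff:
 assumes "q \<in> bubble_divergences k K" "r \<in> bubble_divergences k K"
 shows "(%z. q z - r z) \<in> bubble_divergences k K"
 using bubble_divergences_add[OF assms(1) bubble_divergences_cmul[OF assms(2), of "-1"]] by simp

lemma segment_deriv_zero:
 assumes p: "p \<in> polys m" and z0: "\<forall>z\<in>closed_segment a b. p z = 0" and x: "x \<in> closed_segment a b"
 shows "dx p x * fst (b - a) + dy p x * snd (b - a) = 0"
proof -
 have seg: "a + s *\<^sub>R (b - a) \<in> closed_segment a b" if "s \<in> {0..1}" for s
  using that unfolding in_segment by (intro exI[of _ s]) (simp add: algebra_simps)
 obtain t where t: "x = (1 - t) *\<^sub>R a + t *\<^sub>R b" using x unfolding in_segment by blast
 then have t: "x = a + t *\<^sub>R (b - a)" by (simp add: algebra_simps)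
 have "infinite {0..1::real}" by (simp add: infinite_Icc)
 moreover have "{0..1::real} \<subseteq> {s. p (a + s *\<^sub>R (b - a)) = 0}" using bspec[OF z0 seg] by blast
 ultimately have "infinite {s. p (a + s *\<^sub>R (b - a)) = 0}" using finite_subset by blast
 from polys_line_zero[OF p this] have "(%s. p (a + s *\<^sub>R (b - a))) = (%s. 0)" by auto
 moreover have "((%s. p (a + s *\<^sub>R (b - a))) has_real_derivative
   (dx p x * fst (b - a) + dy p x * snd (b - a))) (at t)"
  by (rule has_grad_line) (use t polys_has_grad[OF p] in simp)
 ultimately show ?thesis using DERIV_unique[OF DERIV_const] by metis
qed

text \<open>A polynomial that vanishes on the boundary vanishes on the lines of two edges through a vertex,
 which span the plane; so its gradient vanishes there.\<close>

lemma vertex_deriv_zero: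
 assumes t: "triangle K a b c" and p: "p \<in> polys m" and z0: "\<forall>z\<in>frontier K. p z = 0"
 shows "dd e p a = 0"
proof -
 let ?g1 = "dx p a" and ?g2 = "dy p a"
 have line: "?g1 * fst (d - a) + ?g2 * snd (d - a) = 0" if "closed_segment a d \<subseteq> frontier K" for d
  by (rule segment_deriv_zero[OF p]) (use that z0 in auto)
 have eqs: "?g1 * fst (b - a) + ?g2 * snd (b - a) = 0" "?g1 * fst (c - a) + ?g2 * snd (c - a) = 0"
  by (intro line; use triangle_frontier[OF t] closed_segment_commute[of c a] in blast)+
 have D: "cross (b - a) (c - a) \<noteq> 0" by (rule triangle_cross[OF t])
 have "?g1 * cross (b - a) (c - a) = (?g1 * fst (b - a) + ?g2 * snd (b - a)) * snd (c - a) - (?g1 * fst (c - a) + ?g2 * snd (c - a)) * snd (b - a)"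
  by (simp add: cross_def algebra_simps)
 then have 1: "?g1 = 0" using D unfolding eqs by simp
 have "?g2 * cross (b - a) (c - a) = (?g1 * fst (c - a) + ?g2 * snd (c - a)) * fst (b - a) - (?g1 * fst (b - a) + ?g2 * snd (b - a)) * fst (c - a)"
  by (simp add: cross_def algebra_simps)
 then have 2: "?g2 = 0" using D unfolding eqs by simp
 show ?thesis using has_grad_dir[OF polys_has_grad[OF p], of e a] 1 2 by simp
qed

lemma extreme_deriv_zero:
 assumes t: "triangle K a b c" and p: "p \<in> polys m" and z0: "\<forall>z\<in>frontier K. p z = 0"
  and x: "x extreme_point_of K"
 shows "dd e p x = 0"
 using x vertex_deriv_zero[OF t p z0, of e] vertex_deriv_zero[OF triangle_rotate[OF t] p z0, of e]
  vertex_deriv_zero[OF triangle_rotate[OF triangle_rotate[OF t]] p z0, of e]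
 unfolding triangle_extreme_point[OF t] by blast

lemma bubble_divergences_vertex:
 assumes t: "triangle K a b c" and q: "q \<in> bubble_divergences k K" and x: "x extreme_point_of K"
 shows "q x = 0"
proof -
 obtain w1 w2 where w: "w1 \<in> polys k" "w2 \<in> polys k" "\<forall>z\<in>frontier K. w1 z = 0 \<and> w2 z = 0"
  "\<forall>z. dx w1 z + dy w2 z = q z"
  using q unfolding bubble_divergences_def by blast
 have "\<forall>z\<in>frontier K. w1 z = 0" "\<forall>z\<in>frontier K. w2 z = 0" using w(3) by simp_all
 from extreme_deriv_zero[OF t w(1) this(1) x] extreme_deriv_zero[OF t w(2) this(2) x]
 show ?thesis using w(4)[rule_format, of x] by simp
qed

text \<open>Divided by factorials instead of multiplied by multinomial coefficients: the derivative of one of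
these is again one of these, without a numerical factor.\<close>

definition bernstein :: "point => point => point => nat => nat => nat => point => real" where
 "bernstein a b c i j l z = bary a b c z ^ i / fact i * (bary b c a z ^ j / fact j) * (bary c a b z ^ l / fact l)"

lemma bernstein_rotate: "bernstein b c a j l i = bernstein a b c i j l"
 by (rule ext) (simp add: bernstein_def mult_ac)

lemma polys_power: "p \<in> polys (Suc 0) ==> (%z. p z ^ n) \<in> polys n"
proof (induction n)
 case 0 then show ?case using polys_const by simp
next
 case (Suc n)
 then show ?case using polys_mult[of p "Suc 0" "%z. p z ^ n" n] by simp
qed

lemma bernstein_polys: "bernstein a b c i j l \<in> polys (i + j + l)"
proof -
 have p: "(%z. bary a b c z ^ i / fact i) \<in> polys i" for a b c i
  using polys_cmul[OF polys_power[OF bary_polys], of "1 / fact i"] by simp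
 have "(%z. bary a b c z ^ i / fact i * (bary b c a z ^ j / fact j) * (bary c a b z ^ l / fact l)) \<in> polys (i + j + l)"
  by (intro polys_mult p)
 then show ?thesis by (simp add: bernstein_def[abs_def])
qed

lemma power_fact_deriv:
 "((%t. t ^ Suc n / fact (Suc n)) has_real_derivative t ^ n / fact n) (at t)"
proof -
 have "real (Suc n) * t ^ n / fact (Suc n) = t ^ n / fact n"
  unfolding fact_Suc of_nat_mult by (rule mult_divide_mult_cancel_left) simp
 then show ?thesis using DERIV_cdivide[OF DERIV_pow[of "Suc n" t], of "fact (Suc n)"] by simp
qed

text \<open>In the direction from \<open>b\<close> to \<open>a\<close> the first barycentric coordinate has derivative 1, the
 second has derivative \<open>-1\<close> and the third is constant. Differentiating a Bernstein polynomial of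
 degree \<open>k\<close> that vanishes on the boundary gives the difference of two neighbours of degree
 \<open>k - 1\<close>.\<close>

lemma bernstein_neighbours:
 assumes t: "triangle K a b c" and k: "i + j + Suc l + 2 = k"
 shows "(%z. bernstein a b c i (Suc j) (Suc l) z - bernstein a b c (Suc i) j (Suc l) z) \<in> bubble_divergences k K"
proof -
 let ?B = "bernstein a b c (Suc i) (Suc j) (Suc l)"
 let ?D = "cross (b - a) (c - a)"
 let ?t = "a - b"
 have D: "?D \<noteq> 0" by (rule triangle_cross[OF t])
 have r: "cross (c - b) (a - b) = ?D" "cross (a - c) (b - c) = ?D"
  by (simp_all add: cross_def algebra_simps)
 have B: "?B \<in> polys k" using bernstein_polys[of a b c "Suc i" "Suc j" "Suc l"] k by (simp add: add.assoc)
 let ?x = "%z. bary a b c z" and ?y = "%z. bary b c a z" and ?z = "%z. bary c a b z"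
 have dB: "dx ?B z * fst ?t + dy ?B z * snd ?t =
  bernstein a b c i (Suc j) (Suc l) z - bernstein a b c (Suc i) j (Suc l) z" for z
 proof -
  let ?X = "?x z ^ Suc i / fact (Suc i)" and ?Y = "?y z ^ Suc j / fact (Suc j)" and ?Z = "?z z ^ Suc l / fact (Suc l)"
  let ?X' = "?x z ^ i / fact i" and ?Y' = "?y z ^ j / fact j" and ?Z' = "?z z ^ l / fact l"
  define x1 where "x1 = (snd b - snd c) / ?D"
  define x2 where "x2 = (fst c - fst b) / ?D"
  define y1 where "y1 = (snd c - snd a) / ?D"
  define y2 where "y2 = (fst a - fst c) / ?D"
  define z1 where "z1 = (snd a - snd b) / ?D"
  define z2 where "z2 = (fst b - fst a) / ?D"
  have gx: "has_grad ?x x1 x2 z" and gy: "has_grad ?y y1 y2 z" and gz: "has_grad ?z z1 z2 z"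
   using bary_has_grad[of a b c z] bary_has_grad[of b c a z] bary_has_grad[of c a b z]
   by (simp_all add: x1_def x2_def y1_def y2_def z1_def z2_def r)
  have g: "has_grad ?B
   ((?X * ?Y) * (?Z' * z1) + (?X * (?Y' * y1) + ?X' * x1 * ?Y) * ?Z)
   ((?X * ?Y) * (?Z' * z2) + (?X * (?Y' * y2) + ?X' * x2 * ?Y) * ?Z) z"
   using has_grad_mult[OF has_grad_mult[OF has_grad_compose[OF gx power_fact_deriv[of i]] has_grad_compose[OF gy power_fact_deriv[of j]]]
     has_grad_compose[OF gz power_fact_deriv[of l]]]
   by (simp only: bernstein_def[abs_def])
  have tx: "x1 * fst ?t + x2 * snd ?t = 1" and ty: "y1 * fst ?t + y2 * snd ?t = -1" and tz: "z1 * fst ?t + z2 * snd ?t = 0"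
   using D by (simp_all add: x1_def x2_def y1_def y2_def z1_def z2_def divide_simps) (simp_all add: cross_def algebra_simps)
  have "dx ?B z * fst ?t + dy ?B z * snd ?t
   = (?X * ?Y) * ?Z' * (z1 * fst ?t + z2 * snd ?t) + ?X * ?Y' * ?Z * (y1 * fst ?t + y2 * snd ?t) + ?X' * ?Y * ?Z * (x1 * fst ?t + x2 * snd ?t)"
   unfolding has_grad_dir_fst[OF g] has_grad_dir_snd[OF g] by (simp only: algebra_simps)
  also have "\<dots> = ?X' * ?Y * ?Z - ?X * ?Y' * ?Z" unfolding tx ty tz by simp
  finally show ?thesis by (simp only: bernstein_def)
 qed
 have zero: "?B z = 0" if "z \<in> frontier K" for z
  using bary_frontier[OF t that] by (auto simp: bernstein_def)
 show ?thesis unfolding bubble_divergences_def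
 proof (rule CollectI, rule bexI[of _ "%z. fst ?t * ?B z"], rule bexI[of _ "%z. snd ?t * ?B z"], intro conjI ballI allI)
  show "(%z. fst ?t * ?B z) \<in> polys k" "(%z. snd ?t * ?B z) \<in> polys k" by (intro polys_cmul B)+
  show "dx (%z. fst ?t * ?B z) z + dy (%z. snd ?t * ?B z) z =
   bernstein a b c i (Suc j) (Suc l) z - bernstein a b c (Suc i) j (Suc l) z" for z
   using dB[of z] by (simp only: dir_deriv_cmul[OF B] mult.commute)
 qed (use zero in auto)
qed

text \<open>As long as the third index is positive, degree can be moved freely between the other two.\<close>

lemma bernstein_transfer:
 assumes t: "triangle K a b c" and l: "l \<ge> 1" and k: "i + j + l + 1 = k" and ij: "i + j = i' + j'"
 shows "(%z. bernstein a b c i j l z - bernstein a b c i' j' l z) \<in> bubble_divergences k K"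
proof -
 obtain l' where l': "l = Suc l'" using l by (cases l) auto
 have to_end: "(%z. bernstein a b c i j l z - bernstein a b c (i + j) 0 l z) \<in> bubble_divergences k K"
  if "i + j + l + 1 = k" for i j
  using that
 proof (induction j arbitrary: i)
  case 0
  have "(%z. 0) \<in> bubble_divergences k K" unfolding bubble_divergences_def
   by (intro CollectI bexI[of _ "%z. 0"] polys_const conjI) (simp_all add: dir_deriv_const)
  then show ?case by simp
 next
  case (Suc j)
  have "(%z. bernstein a b c i (Suc j) l z - bernstein a b c (Suc i) j l z) \<in> bubble_divergences k K"
   unfolding l' by (rule bernstein_neighbours[OF t]) (use Suc.prems l' in simp)
  from bubble_divergences_add[OF this Suc.IH[of "Suc i"]] show ?case using Suc.prems by simp
 qed
 have "i' + j' + l + 1 = k" using k ij by simp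
 from bubble_divergences_diff[OF to_end[OF k] to_end[OF this]] show ?thesis using ij by simp
qed

text \<open>All Bernstein polynomials of degree \<open>k - 1\<close> other than the three powers of a single
 coordinate are equivalent modulo divergences of bubbles.\<close>

lemma bernstein_equivalent:
 assumes t: "triangle K a b c" and ijl: "i + j + l = Suc (Suc n)"
  and nv: "i \<noteq> Suc (Suc n)" "j \<noteq> Suc (Suc n)" "l \<noteq> Suc (Suc n)"
 shows "(%z. bernstein a b c i j l z - bernstein a b c n 1 1 z) \<in> bubble_divergences (n + 3) K"
proof -
 note t2 = triangle_rotate[OF t]
 note t3 = triangle_rotate[OF t2]
 have pos: "(%z. bernstein a b c i j l z - bernstein a b c n 1 1 z) \<in> bubble_divergences (n + 3) K"
  if l: "l \<ge> 1" and ijl: "i + j + l = Suc (Suc n)" and l': "l \<noteq> Suc (Suc n)" for i j l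
 proof -
  have 1: "(%z. bernstein a b c i j l z - bernstein a b c (i + j - 1) 1 l z) \<in> bubble_divergences (n + 3) K"
   by (rule bernstein_transfer[OF t l]) (use ijl l' in auto)
  have "(%z. bernstein c a b l (i + j - 1) 1 z - bernstein c a b 1 n 1 z) \<in> bubble_divergences (n + 3) K"
   by (rule bernstein_transfer[OF t3]) (use ijl l' in auto)
  then have 2: "(%z. bernstein a b c (i + j - 1) 1 l z - bernstein a b c n 1 1 z) \<in> bubble_divergences (n + 3) K"
   by (simp only: bernstein_rotate[of a b c _ _ _, symmetric] bernstein_rotate[of b c a, symmetric])
  from bubble_divergences_add[OF 1 2] show ?thesis by simp
 qed
 show ?thesis
 proof (cases "l \<ge> 1")
  case True
  then show ?thesis using pos ijl nv by simp
 next
  case False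
  then have l: "l = 0" by simp
  then have ij: "i \<ge> 1" "j \<ge> 1" using ijl nv by auto
  have "(%z. bernstein b c a j l i z - bernstein b c a (j - 1) 1 i z) \<in> bubble_divergences (n + 3) K"
   by (rule bernstein_transfer[OF t2]) (use ijl ij l in auto)
  then have "(%z. bernstein a b c i j l z - bernstein a b c i (j - 1) 1 z) \<in> bubble_divergences (n + 3) K"
   by (simp only: bernstein_rotate)
  moreover have "(%z. bernstein a b c i (j - 1) 1 z - bernstein a b c n 1 1 z) \<in> bubble_divergences (n + 3) K"
   by (rule pos) (use ijl ij l in auto)
  ultimately show ?thesis using bubble_divergences_add by fastforce
 qed
qed

text \<open>The constant 1 and both coordinate functions are linear combinations of the barycentric
coordinates. Replacing one of these factors after another makes a monomial homogeneous of degree \<open>n\<close>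
in the barycentric coordinates.\<close>

lemma bernstein_span:
 assumes t: "triangle K a b c"
  and add: "\<And>p q. p \<in> W ==> q \<in> W ==> (%z. p z + q z) \<in> W"
  and cmul: "\<And>r p. p \<in> W ==> (%z. r * p z) \<in> W"
  and gen: "\<And>i j l. i + j + l = n ==> bernstein a b c i j l \<in> W"
  and p: "p \<in> polys n"
 shows "p \<in> W"
proof -
 let ?x = "%z. bary a b c z" and ?y = "%z. bary b c a z" and ?z = "%z. bary c a b z"
 let ?M = "%i j l s t z. ?x z ^ i * ?y z ^ j * ?z z ^ l * (fst z ^ s * snd z ^ t)"
 have comb: "(%z. r1 * f1 z + r2 * f2 z + r3 * f3 z) \<in> W" if "f1 \<in> W" "f2 \<in> W" "f3 \<in> W" for r1 r2 r3 f1 f2 f3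
  by (intro add cmul that)
 have one: "?x z + ?y z + ?z z = 1" for z by (rule bary_sum[OF t])
 have f: "fst z = ?x z * fst a + ?y z * fst b + ?z z * fst c" and s: "snd z = ?x z * snd a + ?y z * snd b + ?z z * snd c" for z
  using arg_cong[OF bary_reconstruct[OF t, of z], of fst] arg_cong[OF bary_reconstruct[OF t, of z], of snd] by simp_all
 have "?M i j l s t \<in> W" if "i + j + l + d = n" "s + t \<le> d" for i j l s t d
  using that
 proof (induction d arbitrary: i j l s t)
  case 0
  have "(%z. (fact i * fact j * fact l) * bernstein a b c i j l z) \<in> W" by (rule cmul, rule gen) (use 0 in simp)
  then show ?case using 0 by (simp add: bernstein_def)
 next
  case (Suc d)
  have IH: "?M (Suc i) j l s t \<in> W" "?M i (Suc j) l s t \<in> W" "?M i j (Suc l) s t \<in> W" if "s + t \<le> d" for s t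
   by (intro Suc.IH; use Suc.prems that in simp)+
  show ?case
  proof (cases s)
   case (Suc s')
   have "(%z. fst a * ?M (Suc i) j l s' t z + fst b * ?M i (Suc j) l s' t z + fst c * ?M i j (Suc l) s' t z) \<in> W"
    by (intro comb IH) (use Suc Suc.prems in simp_all)
   moreover have "fst a * ?M (Suc i) j l s' t z + fst b * ?M i (Suc j) l s' t z + fst c * ?M i j (Suc l) s' t z = ?M i j l s t z" for z
   proof -
    have "?M i j l s t z = ?M i j l s' t z * fst z" using Suc by (simp add: mult_ac)
    also have "\<dots> = ?M i j l s' t z * (?x z * fst a + ?y z * fst b + ?z z * fst c)" by (simp only: f[of z, symmetric])
    finally show ?thesis by (simp only: algebra_simps power_Suc)
   qed
   ultimately show ?thesis by simp
  next
   case s0: 0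
   show ?thesis
   proof (cases t)
    case (Suc t')
    have "(%z. snd a * ?M (Suc i) j l s t' z + snd b * ?M i (Suc j) l s t' z + snd c * ?M i j (Suc l) s t' z) \<in> W"
     by (intro comb IH) (use Suc s0 Suc.prems in simp_all)
    moreover have "snd a * ?M (Suc i) j l s t' z + snd b * ?M i (Suc j) l s t' z + snd c * ?M i j (Suc l) s t' z = ?M i j l s t z" for z
    proof -
     have "?M i j l s t z = ?M i j l s t' z * snd z" using Suc by (simp add: mult_ac)
     also have "\<dots> = ?M i j l s t' z * (?x z * snd a + ?y z * snd b + ?z z * snd c)" by (simp only: s[of z, symmetric])
     finally show ?thesis by (simp only: algebra_simps power_Suc)
    qed
    ultimately show ?thesis by simp
   next
    case t0: 0
    have "(%z. 1 * ?M (Suc i) j l s t z + 1 * ?M i (Suc j) l s t z + 1 * ?M i j (Suc l) s t z) \<in> W"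
     by (intro comb IH) (use s0 t0 in simp_all)
    moreover have "1 * ?M (Suc i) j l s t z + 1 * ?M i (Suc j) l s t z + 1 * ?M i j (Suc l) s t z = ?M i j l s t z" for z
    proof -
     have "1 * ?M (Suc i) j l s t z + 1 * ?M i (Suc j) l s t z + 1 * ?M i j (Suc l) s t z = ?M i j l s t z * (?x z + ?y z + ?z z)"
      by (simp only: algebra_simps power_Suc mult_1_left)
     then show ?thesis by (simp only: one mult_1_right)
    qed
    ultimately show ?thesis by simp
   qed
  qed
 qed
 from this[of 0 0 0 n] have mono: "(%z. fst z ^ s * snd z ^ t) \<in> W" if "s + t \<le> n" for s t using that by simp
 show ?thesis using p
 proof (induction rule: polys_induct)
  case (mono r i j)
  then show ?case using cmul[OF \<open>\<And>s t. s + t \<le> n ==> (%z. fst z ^ s * snd z ^ t) \<in> W\<close>, of i j r] by (simp add: mult.assoc)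
 next
  case (add p q)
  then show ?case by (rule \<open>\<And>p q. p \<in> W ==> q \<in> W ==> (%z. p z + q z) \<in> W\<close>)
 qed
qed

text \<open>Modulo divergences of bubbles only the three vertex polynomials and one more are left. Divergences of
bubbles vanish at the vertices, where each vertex polynomial is the only one that does not.\<close>

lemma bubble_divergence_representation:
 assumes t: "triangle K a b c" and q: "q \<in> polys (Suc (Suc n))" and v: "q a = 0" "q b = 0" "q c = 0"
 shows "\<exists>r. (%z. q z - r * bernstein a b c n 1 1 z) \<in> bubble_divergences (n + 3) K"
proof -
 let ?N = "Suc (Suc n)"
 let ?B = "bernstein a b c" and ?S = "bubble_divergences (n + 3) K"
 let ?R = "%q r r1 r2 r3 z. q z - (r * ?B n 1 1 z + r1 * ?B ?N 0 0 z + r2 * ?B 0 ?N 0 z + r3 * ?B 0 0 ?N z)"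
 define W where "W = {q. \<exists>r r1 r2 r3. ?R q r r1 r2 r3 \<in> ?S}"
 have "q \<in> W"
 proof (rule bernstein_span[OF t _ _ _ q])
  fix p q assume "p \<in> W" "q \<in> W"
  then obtain r r1 r2 r3 s s1 s2 s3 where "?R p r r1 r2 r3 \<in> ?S" "?R q s s1 s2 s3 \<in> ?S" unfolding W_def by blast
  from bubble_divergences_add[OF this] have "?R (%z. p z + q z) (r + s) (r1 + s1) (r2 + s2) (r3 + s3) \<in> ?S"
   by (simp add: algebra_simps)
  then show "(%z. p z + q z) \<in> W" unfolding W_def by blast
 next
  fix d p assume "p \<in> W"
  then obtain r r1 r2 r3 where "?R p r r1 r2 r3 \<in> ?S" unfolding W_def by blast
  from bubble_divergences_cmul[OF this, of d] have "?R (%z. d * p z) (d * r) (d * r1) (d * r2) (d * r3) \<in> ?S"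
   by (simp add: algebra_simps)
  then show "(%z. d * p z) \<in> W" unfolding W_def by blast
 next
  fix i j l assume ijl: "i + j + l = ?N"
  have z: "(%z. 0) \<in> ?S" using bubble_divergences_diff[OF bernstein_equivalent[OF t, of n 1 1 n] bernstein_equivalent[OF t, of n 1 1 n]] by simp
  consider "i = ?N" "j = 0" "l = 0" | "i = 0" "j = ?N" "l = 0" | "i = 0" "j = 0" "l = ?N" | "i \<noteq> ?N" "j \<noteq> ?N" "l \<noteq> ?N"
   using ijl by fastforce
  then have "\<exists>r r1 r2 r3. ?R (?B i j l) r r1 r2 r3 \<in> ?S"
  proof cases
   case 1 show ?thesis by (rule exI[of _ 0], rule exI[of _ 1], rule exI[of _ 0], rule exI[of _ 0]) (use z 1 in simp)
  next
   case 2 show ?thesis by (rule exI[of _ 0], rule exI[of _ 0], rule exI[of _ 1], rule exI[of _ 0]) (use z 2 in simp)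
  next
   case 3 show ?thesis by (rule exI[of _ 0], rule exI[of _ 0], rule exI[of _ 0], rule exI[of _ 1]) (use z 3 in simp)
  next
   case 4 show ?thesis by (rule exI[of _ 1], rule exI[of _ 0], rule exI[of _ 0], rule exI[of _ 0])
     (use bernstein_equivalent[OF t ijl 4] in simp)
  qed
  then show "?B i j l \<in> W" unfolding W_def by blast
 qed
 then obtain r r1 r2 r3 where R: "?R q r r1 r2 r3 \<in> ?S" unfolding W_def by blast
 note t2 = triangle_rotate[OF t]
 note t3 = triangle_rotate[OF t2]
 have ex: "a extreme_point_of K" "b extreme_point_of K" "c extreme_point_of K" unfolding triangle_extreme_point[OF t] by simp_all
 note vals = bary_vertices[OF t] bary_vertices[OF t2] bary_vertices[OF t3]
 have "r1 = 0" using bubble_divergences_vertex[OF t R ex(1)] v by (simp add: bernstein_def vals)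
 moreover have "r2 = 0" using bubble_divergences_vertex[OF t R ex(2)] v by (simp add: bernstein_def vals)
 moreover have "r3 = 0" using bubble_divergences_vertex[OF t R ex(3)] v by (simp add: bernstein_def vals)
 ultimately show ?thesis using R by (intro exI[of _ r]) simp
qed

context mesh_domain begin

lemma integrable_element:
 assumes K: "K \<in> T" and f: "continuous_on UNIV f" shows "integrable (lebesgue_on K) (f :: point => real)"
proof -
 have "integrable lborel (%x. indicator K x *\<^sub>R f x)"
  by (rule borel_integrable_compact[OF element_compact[OF K] continuous_on_subset[OF f]]) simp
 then have "integrable lebesgue (%x. indicator K x *\<^sub>R f x)"
  using integrable_completion[OF borel_measurable_integrable] by blast
 then show ?thesis using element_lebesgue[OF K] by (subst integrable_restrict_space) auto
qed

text \<open>The remaining Bernstein polynomial is nonnegative and not zero, so its integral is positive, whereas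
divergences of bubbles have integral zero.\<close>

lemma local_surjectivity:
 assumes K: "K \<in> T" and k: "3 \<le> k" and q: "q \<in> polys (k - 1)"
  and vert: "\<forall>x. x extreme_point_of K --> q x = 0" and mean: "(LINT x|lebesgue_on K. q x) = 0"
 shows "q \<in> bubble_divergences k K"
proof -
 obtain a b c where t: "triangle K a b c" using triangles K by blast
 obtain n where n: "k = n + 3" using k by (metis add.commute le_Suc_ex)
 have q': "q \<in> polys (Suc (Suc n))" using q n by (simp add: numeral_3_eq_3)
 have v: "q a = 0" "q b = 0" "q c = 0" using vert unfolding triangle_extreme_point[OF t] by simp_all
 let ?B = "bernstein a b c n 1 1"
 obtain r where r: "(%z. q z - r * ?B z) \<in> bubble_divergences k K"
  using bubble_divergence_representation[OF t q' v] unfolding n by blast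
 obtain w1 w2 where w: "w1 \<in> polys k" "w2 \<in> polys k" "\<forall>z\<in>frontier K. w1 z = 0 \<and> w2 z = 0"
  "\<forall>z. dx w1 z + dy w2 z = q z - r * ?B z"
  using r unfolding bubble_divergences_def by blast
 have int: "integrable (lebesgue_on K) f" if "f \<in> nice" for f by (intro integrable_element[OF K] nice_continuous that)
 have B: "?B \<in> nice" by (rule polys_nice[OF bernstein_polys])
 have "(LINT x|lebesgue_on K. q x - r * ?B x) = (LINT x|lebesgue_on K. dx w1 x + dy w2 x)"
  using w(4) by simp
 also have "\<dots> = (LINT x|lebesgue_on K. dx w1 x) + (LINT x|lebesgue_on K. dy w2 x)"
  by (intro Bochner_Integration.integral_add int nice_dx nice_dy polys_nice[OF w(1)] polys_nice[OF w(2)])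
 also have "\<dots> = 0" using integral_element_deriv_zero[OF K w(1), of "(1, 0)"] integral_element_deriv_zero[OF K w(2), of "(0, 1)"] w(3)
  by (simp add: Basis_point)
 finally have "(LINT x|lebesgue_on K. q x) - (LINT x|lebesgue_on K. r * ?B x) = 0"
  using Bochner_Integration.integral_diff[OF int[OF polys_nice[OF q]] int[OF nice_cmul[OF B]]] by simp
 then have rB: "r * (LINT x|lebesgue_on K. ?B x) = 0" using mean by simp
 note t2 = triangle_rotate[OF t]
 note t3 = triangle_rotate[OF t2]
 have "(LINT x|lebesgue_on K. ?B x) \<noteq> 0"
 proof
  assume z: "(LINT x|lebesgue_on K. ?B x) = 0"
  have "AE x in lebesgue_on K. 0 \<le> ?B x"
   by (rule AE_I2) (simp add: bernstein_def bary_nonneg[OF t] bary_nonneg[OF t2] bary_nonneg[OF t3])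
  then have "AE x in lebesgue_on K. ?B x = 0" using integral_nonneg_eq_0_iff_AE[OF int[OF B]] z by blast
  then have "ae_eq K ?B (%x. 0)" by (simp add: ae_eq_def)
  then have "?B = (%x. 0)" by (rule polys_cong_element[OF K bernstein_polys polys_const])
  moreover have "?B ((1/3) *\<^sub>R a + (1/3) *\<^sub>R b + (1/3) *\<^sub>R c) > 0"
   using bary_combination[OF t, of "1/3" "1/3" "1/3"] bary_combination[OF t2, of "1/3" "1/3" "1/3"] bary_combination[OF t3, of "1/3" "1/3" "1/3"]
   by (simp add: bernstein_def add_ac)
  ultimately show False by simp
 qed
 then have "r = 0" using rB by simp
 then show ?thesis using r by simp
qed

end

section \<open>Representation of functionals on finite-dimensional spaces\<close>

text \<open>Spaces contain all representatives of their elements, so they are finite-dimensional only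
 modulo null functions, and their natural inner products are only semidefinite.\<close>

definition semi_inner :: "point set => (point => real) set => ((point => real) => (point => real) => real) => bool" where
 "semi_inner Om A B \<longleftrightarrow> fun_subspace A \<and>
   (\<forall>a\<in>A. ae_eq Om a (%x. 0) --> B a a = 0) \<and> (\<forall>a\<in>A. 0 \<le> B a a) \<and> (\<forall>a\<in>A. \<forall>b\<in>A. B a b = B b a) \<and>
   (\<forall>s t. \<forall>a\<in>A. \<forall>b\<in>A. \<forall>c\<in>A. B (%x. s * a x + t * b x) c = s * B a c + t * B b c)"

definition functional :: "(point => real) set => ((point => real) => (point => real) => real) => ((point => real) => real) => bool" where
 "functional A B l \<longleftrightarrow> (\<forall>s t. \<forall>a\<in>A. \<forall>b\<in>A. l (%x. s * a x + t * b x) = s * l a + t * l b) \<and>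
   (\<forall>a\<in>A. B a a = 0 --> l a = 0)"

definition spanned :: "point set => ('i => point => real) => 'i set => (point => real) => bool" where
 "spanned Om F I a \<longleftrightarrow> (\<exists>c. ae_eq Om a (%x. \<Sum>i\<in>I. c i * F i x))"

lemma fun_subspace_combination:
 fixes A :: "(point => real) set"
 assumes "fun_subspace A" "a \<in> A" "b \<in> A" shows "(%x. s * a x + t * b x) \<in> A"
proof -
 have "(%x. s *\<^sub>R a x) \<in> A" "(%x. t *\<^sub>R b x) \<in> A" using assms by (auto simp: fun_subspace_def)
 then have "(%x. s *\<^sub>R a x + t *\<^sub>R b x) \<in> A"
  using assms(1)[unfolded fun_subspace_def, THEN conjunct2, THEN conjunct1, rule_format] by blast
 then show ?thesis by simp
qed

lemma semi_inner_degenerate: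
 assumes B: "semi_inner Om A B" and a: "a \<in> A" "B a a = 0" and b: "b \<in> A"
 shows "B b a = 0"
proof -
 have sub: "fun_subspace A" using B by (simp add: semi_inner_def)
 have lin: "B (%x. s * f x + t * g x) h = s * B f h + t * B g h" if "f \<in> A" "g \<in> A" "h \<in> A" for s t f g h
  using B that by (simp add: semi_inner_def)
 have sym: "B f g = B g f" if "f \<in> A" "g \<in> A" for f g using B that by (simp add: semi_inner_def)
 have "0 \<le> B b b + 2 * B b a * t + 0 * t\<^sup>2" for t
 proof -
  let ?f = "%x. 1 * b x + t * a x"
  have f: "?f \<in> A" by (rule fun_subspace_combination[OF sub b a(1)])
  have "0 \<le> B ?f ?f" using B f by (simp add: semi_inner_def)
  also have "\<dots> = B b ?f + t * B a ?f" using lin[OF b a(1) f, of 1 t] by simp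
  also have "\<dots> = B ?f b + t * B ?f a" by (simp only: sym[OF b f] sym[OF a(1) f])
  also have "\<dots> = (B b b + t * B a b) + t * (B b a + t * B a a)"
   using lin[OF b a(1) b, of 1 t] lin[OF b a(1) a(1), of 1 t] by simp
  finally show ?thesis using a(2) sym[OF a(1) b] by (simp add: algebra_simps)
 qed
 from psd_discriminant[OF this] show ?thesis by simp
qed

text \<open>The induction is on the size of a spanning set. The members that need only the smaller set
 have codimension at most one; a complement \<open>g\<close> orthogonal to them is obtained by representing the
 functional \<open>B a\<^sub>0\<close> on them, and the representative is corrected by a multiple of \<open>g\<close>.\<close>

lemma riesz_representation:
 fixes F :: "'i => point => real"
 assumes "finite I" "semi_inner Om A B" "functional A B l" "\<forall>a\<in>A. spanned Om F I a"
 shows "\<exists>r\<in>A. \<forall>a\<in>A. B r a = l a"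
 using assms
proof (induction I arbitrary: A l rule: finite_induct)
 case (empty A l)
 have sub: "fun_subspace A" using empty by (simp add: semi_inner_def)
 then have z: "(%x. 0) \<in> A" by (simp add: fun_subspace_def)
 have "B (%x. 0) a = l a" if a: "a \<in> A" for a
 proof -
  have "ae_eq Om a (%x. 0)" using empty.prems(3) a by (simp add: spanned_def)
  then have "B a a = 0" using empty.prems(1) a by (simp add: semi_inner_def)
  then have "l a = 0" using empty.prems(2) a by (simp add: functional_def)
  have "B (%x. 0 * a x + 0 * a x) a = 0 * B a a + 0 * B a a"
   using empty.prems(1) a unfolding semi_inner_def by blast
  then show ?thesis using \<open>l a = 0\<close> by simp
 qed
 then show ?case using z by blast
next
 case (insert i I A l)
 note B = insert.prems(1) and l = insert.prems(2) and span = insert.prems(3)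
 have sub: "fun_subspace A" using B by (simp add: semi_inner_def)
 have lin: "B (%x. s * f x + t * g x) h = s * B f h + t * B g h" if "f \<in> A" "g \<in> A" "h \<in> A" for s t f g h
  using B that by (simp add: semi_inner_def)
 have sym: "B f g = B g f" if "f \<in> A" "g \<in> A" for f g using B that by (simp add: semi_inner_def)
 have linl: "l (%x. s * f x + t * g x) = s * l f + t * l g" if "f \<in> A" "g \<in> A" for s t f g
  using l that by (simp add: functional_def)
 define A' where "A' = {a \<in> A. spanned Om F I a}"
 have A': "a \<in> A" if "a \<in> A'" for a using that by (simp add: A'_def)
 have comb: "(%x. s * a x + t * b x) \<in> A'" if a: "a \<in> A'" and b: "b \<in> A'" for s t a b
 proof -
  obtain c where c: "ae_eq Om a (%x. \<Sum>i\<in>I. c i * F i x)" using a by (auto simp: A'_def spanned_def)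
  obtain d where d: "ae_eq Om b (%x. \<Sum>i\<in>I. d i * F i x)" using b by (auto simp: A'_def spanned_def)
  have "ae_eq Om (%x. s * a x + t * b x) (%x. \<Sum>i\<in>I. (s * c i + t * d i) * F i x)"
   using c d unfolding ae_eq_def
   by eventually_elim (simp add: sum_distrib_left algebra_simps sum.distrib)
  then show ?thesis using fun_subspace_combination[OF sub A'[OF a] A'[OF b]] unfolding A'_def spanned_def
   by (intro CollectI conjI exI[of _ "%i. s * c i + t * d i"])
 qed
 have zA': "(%x. 0) \<in> A'"
  using sub unfolding A'_def spanned_def fun_subspace_def
  by (intro CollectI conjI exI[of _ "%i. 0"]) (simp_all add: ae_eq_def)
 have sub': "fun_subspace A'"
  unfolding fun_subspace_def
 proof (intro conjI ballI allI)
  show "(%x. f x + g x) \<in> A'" if "f \<in> A'" "g \<in> A'" for f g using comb[OF that, of 1 1] by simp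
  show "(%x. c *\<^sub>R f x) \<in> A'" if "f \<in> A'" for f c using comb[OF that that, of c 0] by simp
 qed (rule zA')
 have B': "semi_inner Om A' B"
  using B A' sub' unfolding semi_inner_def by simp
 have l': "functional A' B l" using l A' unfolding functional_def by simp
 have span': "\<forall>a\<in>A'. spanned Om F I a" by (simp add: A'_def)
 obtain r where r: "r \<in> A'" "\<forall>a\<in>A'. B r a = l a" using insert.IH[OF B' l' span'] by blast
 show ?case
 proof (cases "A \<subseteq> A'")
  case True
  then have "A = A'" using A' by blast
  then show ?thesis using r by blast
 next
  case False
  then obtain a0 where a0: "a0 \<in> A" "a0 \<notin> A'" by blast
  obtain c0 where "ae_eq Om a0 (%x. \<Sum>j\<in>insert i I. c0 j * F j x)" using span a0 by (auto simp: spanned_def)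
  then have c0: "ae_eq Om a0 (%x. c0 i * F i x + (\<Sum>j\<in>I. c0 j * F j x))" using insert.hyps by simp
  have c0i: "c0 i \<noteq> 0"
  proof
   assume "c0 i = 0"
   then have "spanned Om F I a0" using c0 by (auto simp: spanned_def)
   then show False using a0 by (simp add: A'_def)
  qed
  have "functional A' B (B a0)"
   unfolding functional_def
  proof (intro conjI ballI allI impI)
   show "B a0 (%x. s * a x + t * b x) = s * B a0 a + t * B a0 b" if "a \<in> A'" "b \<in> A'" for s t a b
    using sym[OF a0(1) A'[OF comb[OF that, of s t]]] lin[OF A'[OF that(1)] A'[OF that(2)] a0(1), of s t]
     sym[OF a0(1) A'[OF that(1)]] sym[OF a0(1) A'[OF that(2)]] by simp
   show "B a0 a = 0" if "a \<in> A'" "B a a = 0" for a by (rule semi_inner_degenerate[OF B A'[OF that(1)] that(2) a0(1)])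
  qed
  from insert.IH[OF B' this span'] obtain s where s: "s \<in> A'" "\<forall>a\<in>A'. B s a = B a0 a" by blast
  define g where "g = (%x. 1 * a0 x + (-1) * s x)"
  have g: "g \<in> A" unfolding g_def by (rule fun_subspace_combination[OF sub a0(1) A'[OF s(1)]])
  have Bg: "B g a = 0" if "a \<in> A'" for a
   using lin[OF a0(1) A'[OF s(1)] A'[OF that], of 1 "-1"] s(2) that by (simp add: g_def)
  have Blg: "l g = 0" if "B g g = 0" using l g that by (simp add: functional_def)
  let ?k = "l g / B g g"
  let ?r = "%x. 1 * r x + ?k * g x"
  have rA: "r \<in> A" by (rule A'[OF r(1)])
  have rg: "B r g = 0" using Bg[OF r(1)] sym[OF rA g] by simp
  have kg: "?k * B g g = l g" using Blg by auto
  have "B ?r a = l a" if a: "a \<in> A" for a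
  proof -
   obtain d where "ae_eq Om a (%x. \<Sum>j\<in>insert i I. d j * F j x)" using span a by (auto simp: spanned_def)
   then have d: "ae_eq Om a (%x. d i * F i x + (\<Sum>j\<in>I. d j * F j x))" using insert.hyps by simp
   obtain e where e: "ae_eq Om s (%x. \<Sum>j\<in>I. e j * F j x)" using s(1) by (auto simp: A'_def spanned_def)
   define t where "t = d i / c0 i"
   define b where "b = (%x. 1 * a x + (- t) * g x)"
   have "b \<in> A" unfolding b_def by (rule fun_subspace_combination[OF sub a g])
   moreover have "ae_eq Om b (%x. \<Sum>j\<in>I. (d j - t * c0 j + t * e j) * F j x)"
    using d c0 e unfolding ae_eq_def
   proof eventually_elim
    case (elim x)
    have "t * c0 i = d i" using c0i by (simp add: t_def)
    then have ti: "t * (c0 i * F i x) = d i * F i x" by (simp flip: mult.assoc)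
    have "b x = d i * F i x - t * (c0 i * F i x) + ((\<Sum>j\<in>I. d j * F j x) - t * (\<Sum>j\<in>I. c0 j * F j x) + t * (\<Sum>j\<in>I. e j * F j x))"
     unfolding b_def g_def using elim by (simp add: algebra_simps)
    then show ?case unfolding ti by (simp add: sum_distrib_left algebra_simps sum.distrib sum_subtractf)
   qed
   ultimately have b: "b \<in> A'" unfolding A'_def spanned_def
    by (intro CollectI conjI exI[of _ "%j. d j - t * c0 j + t * e j"])
   have ab: "a = (%x. 1 * b x + t * g x)" by (simp add: b_def)
   have "B r a = B r b"
    using sym[OF rA a] lin[OF A'[OF b] g rA, of 1 t] rg sym[OF rA g] sym[OF rA A'[OF b]] unfolding ab by simp
   moreover have "B g a = t * B g g"
    using sym[OF g a] lin[OF A'[OF b] g g, of 1 t] Bg[OF b] sym[OF g A'[OF b]] unfolding ab by simp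
   moreover have "l a = l b + t * l g" using linl[OF A'[OF b] g, of 1 t] unfolding ab by simp
   moreover have "B r b = l b" using r(2) b by simp
   moreover have "B ?r a = B r a + ?k * B g a" using lin[OF rA g a, of 1 ?k] by simp
   ultimately have "B ?r a = l b + t * (?k * B g g)" by simp
   then show ?thesis unfolding kg using \<open>l a = l b + t * l g\<close> by simp
  qed
  moreover have "?r \<in> A" by (rule fun_subspace_combination[OF sub rA g])
  ultimately show ?thesis by blast
 qed
qed

context mesh_domain begin

definition local_monomial :: "point set \<times> nat \<times> nat => point => real" where
 "local_monomial s z = (if z \<in> interior (fst s) then fst z ^ fst (snd s) * snd z ^ snd (snd s) else 0)"

text \<open>This is where finite dimension enters: monomials cut off to single elements span.\<close>

lemma pw_poly_spanned:
 assumes f: "pw_poly T m f"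
 shows "spanned Om local_monomial (T \<times> {..m} \<times> {..m}) f"
proof -
 have "\<forall>K\<in>T. \<exists>c. \<forall>z. restr K f z = (\<Sum>i\<le>m. \<Sum>j\<le>m - i. c i j * fst z ^ i * snd z ^ j)"
  using restr_polys[OF f] unfolding polys_iff by blast
 then obtain c where c: "\<forall>K\<in>T. \<forall>z. restr K f z = (\<Sum>i\<le>m. \<Sum>j\<le>m - i. c K i j * fst z ^ i * snd z ^ j)"
  by (rule bchoice[THEN exE])
 define d where "d = (%(K, i, j). if j \<le> m - i then c K i j else 0)"
 have loc: "(\<Sum>s\<in>T \<times> {..m} \<times> {..m}. d s * local_monomial s z) = restr K f z" if K: "K \<in> T" and z: "z \<in> interior K" for K z
 proof -
  have inner: "(\<Sum>j\<le>m. d (L, i, j) * local_monomial (L, i, j) z) = (if L = K then \<Sum>j\<le>m - i. c K i j * fst z ^ i * snd z ^ j else 0)"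
   if L: "L \<in> T" and i: "i \<le> m" for L i
  proof (cases "L = K")
   case True
   have "(\<Sum>j\<le>m. d (L, i, j) * local_monomial (L, i, j) z) = (\<Sum>j\<le>m. if j \<le> m - i then c K i j * fst z ^ i * snd z ^ j else 0)"
    using True z by (intro sum.cong refl) (simp add: d_def local_monomial_def mult.assoc)
   also have "\<dots> = (\<Sum>j\<in>{j \<in> {..m}. j \<le> m - i}. c K i j * fst z ^ i * snd z ^ j)" by (rule sum.inter_filter[symmetric]) simp
   also have "{j \<in> {..m}. j \<le> m - i} = {..m - i}" by auto
   finally show ?thesis using True by simp
  next
   case False
   have "z \<notin> interior L" using interior_disjoint[OF K L] False z subsetD[OF interior_subset, of z L] by blast
   then show ?thesis using False by (simp add: local_monomial_def)
  qed
  have "(\<Sum>s\<in>T \<times> {..m} \<times> {..m}. d s * local_monomial s z) = (\<Sum>L\<in>T. \<Sum>i\<le>m. \<Sum>j\<le>m. d (L, i, j) * local_monomial (L, i, j) z)"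
   by (simp add: sum.cartesian_product split_def)
  also have "\<dots> = (\<Sum>L\<in>T. \<Sum>i\<le>m. if L = K then \<Sum>j\<le>m - i. c K i j * fst z ^ i * snd z ^ j else 0)"
   by (intro sum.cong refl inner) simp_all
  also have "\<dots> = (\<Sum>L\<in>T. if L = K then \<Sum>i\<le>m. \<Sum>j\<le>m - i. c K i j * fst z ^ i * snd z ^ j else 0)"
   by (intro sum.cong refl) simp
  also have "\<dots> = restr K f z" using c K finite_mesh by simp
  finally show ?thesis .
 qed
 have "ae_eq Om f (%z. \<Sum>s\<in>T \<times> {..m} \<times> {..m}. d s * local_monomial s z)"
 proof (rule ae_eq_domI)
  fix K assume K: "K \<in> T"
  show "ae_eq K f (%z. \<Sum>s\<in>T \<times> {..m} \<times> {..m}. d s * local_monomial s z)"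
   using restr_ae[OF f K] unfolding ae_eq_element[OF K]
   by eventually_elim (simp add: loc[OF K])
 qed
 then show ?thesis unfolding spanned_def by blast
qed

lemma riesz_pw_poly:
 assumes "semi_inner Om A B" "functional A B l" "\<forall>a\<in>A. pw_poly T m a"
 shows "\<exists>r\<in>A. \<forall>a\<in>A. B r a = l a"
proof (rule riesz_representation[OF _ assms(1,2)])
 show "\<forall>a\<in>A. spanned Om local_monomial (T \<times> {..m} \<times> {..m}) a" using assms(3) pw_poly_spanned by blast
qed (use finite_mesh in simp)

end

section \<open>Restrictions and vertex continuity\<close>

lemma fun_subspaceI:
 fixes S :: "(point => 'a::real_vector) set"
 assumes "(%x. 0) \<in> S" "\<And>s t f g. f \<in> S ==> g \<in> S ==> (%x. s *\<^sub>R f x + t *\<^sub>R g x) \<in> S"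
 shows "fun_subspace S"
 unfolding fun_subspace_def
proof (intro conjI ballI allI)
 show "(%x. f x + g x) \<in> S" if "f \<in> S" "g \<in> S" for f g using assms(2)[OF that, of 1 1] by simp
 show "(%x. c *\<^sub>R f x) \<in> S" if "f \<in> S" for f c using assms(2)[OF that that, of c 0] by simp
qed (rule assms(1))

lemma polys_linear: "p \<in> polys m ==> q \<in> polys m ==> (%z. s * p z + t * q z) \<in> polys m"
 by (intro polys_add polys_cmul)

lemma dir_deriv_linear:
 assumes "p \<in> polys m" "q \<in> polys m"
 shows "dd e (%z. s * p z + t * q z) = (%z. s * dd e p z + t * dd e q z)"
 using dir_deriv_nice_add[OF polys_nice[OF polys_cmul[OF assms(1)]] polys_nice[OF polys_cmul[OF assms(2)]]]
 by (simp add: dir_deriv_cmul[OF assms(1)] dir_deriv_cmul[OF assms(2)])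

lemma funpow_deriv_linear:
 assumes e: "e \<in> Basis" and p: "p \<in> polys m" and q: "q \<in> polys m"
 shows "(dd e ^^ j) p \<in> polys m \<and> (dd e ^^ j) q \<in> polys m \<and>
  (dd e ^^ j) (%z. s * p z + t * q z) = (%z. s * (dd e ^^ j) p z + t * (dd e ^^ j) q z)"
proof (induction j)
 case (Suc j)
 have up: "dd e f \<in> polys m" if "f \<in> polys m" for f
  by (rule polys_mono[OF polys_dir_deriv[OF that e]]) simp
 show ?case using Suc.IH up dir_deriv_linear[of "(dd e ^^ j) p" m "(dd e ^^ j) q" e s t] by simp
qed (use p q in simp)

lemma partial_linear:
 assumes "p \<in> polys m" "q \<in> polys m"
 shows "partial i j (%z. s * p z + t * q z) a = s * partial i j p a + t * partial i j q a"
proof -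
 note b = axis_directions
 note y = funpow_deriv_linear[OF b(2) assms, of j s t]
 show ?thesis using y funpow_deriv_linear[OF b(1), of "(dy ^^ j) p" m "(dy ^^ j) q" i s t]
  by (simp add: partial_def)
qed

lemma partial_0: "partial 0 0 p = p"
 by (simp add: partial_def)

lemma partial_dx:
 assumes p: "p \<in> polys m" shows "partial (Suc i) j p = partial i j (dx p)"
proof -
 have "(dy ^^ j) p \<in> polys m \<and>
  dx ((dy ^^ j) p) = (dy ^^ j) (dx p)"
 proof (induction j)
  case (Suc j)
  then show ?case using polys_mixed[of "(dy ^^ j) p" m]
   polys_mono[OF polys_dy[of "(dy ^^ j) p" m], of m] by simp
 qed (use p in simp)
 then show ?thesis by (simp add: partial_def funpow_swap1)
qed

lemma partial_dy':
 assumes p: "p \<in> polys m" shows "partial i (Suc j) p = partial i j (dy p)"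
 by (simp only: partial_def funpow_Suc_right o_apply)

text \<open>Mixed partials of polynomials commute, so every derivative of positive order is a derivative of one of
the first partials.\<close>

lemma partial_cases:
 assumes p: "p \<in> polys m" and q: "q \<in> polys m'" and 0: "p a = q a"
  and x: "\<And>i j. i + j \<le> r ==> partial i j (dx p) a = partial i j (dx q) a"
  and y: "\<And>i j. i + j \<le> r ==> partial i j (dy p) a = partial i j (dy q) a"
  and ij: "i + j \<le> Suc r"
 shows "partial i j p a = partial i j q a"
proof (cases i)
 case (Suc i')
 then show ?thesis using x[of i' j] ij partial_dx[OF p] partial_dx[OF q] by simp
next
 case i: 0
 show ?thesis
 proof (cases j)
  case (Suc j')
  then show ?thesis using y[of i j'] i ij partial_dy'[OF p] partial_dy'[OF q] by simp
 next
  case 0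
  then show ?thesis using i assms(3) by (simp add: partial_0)
 qed
qed

context mesh_domain begin

lemma restr_cong:
 assumes "ae_eq Om f g" "K \<in> T" shows "restr K f = restr K g"
proof -
 have fg: "ae_eq K f g" "ae_eq K g f" by (rule ae_eq_dom_element[OF _ assms(2)]; rule assms(1) ae_eq_sym[OF assms(1)])+
 have "ae_eq K f p \<longleftrightarrow> ae_eq K g p" for p
 proof
  assume "ae_eq K f p" then show "ae_eq K g p" using fg(2) unfolding ae_eq_def by eventually_elim simp
 next
  assume "ae_eq K g p" then show "ae_eq K f p" using fg(1) unfolding ae_eq_def by eventually_elim simp
 qed
 then show ?thesis by (simp add: restr_def)
qed

lemma restr_linear:
 assumes f: "pw_poly T m f" and g: "pw_poly T m g" and K: "K \<in> T"
 shows "restr K (%x. s * f x + t * g x) = (%z. s * restr K f z + t * restr K g z)"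
proof (rule restr_eq[OF K polys_linear[OF restr_polys[OF f K] restr_polys[OF g K]]])
 show "ae_eq K (%x. s * f x + t * g x) (%z. s * restr K f z + t * restr K g z)"
  using restr_ae[OF f K] restr_ae[OF g K] unfolding ae_eq_def by eventually_elim simp
qed

lemma pw_poly_linear:
 assumes f: "pw_poly T m f" and g: "pw_poly T m g"
 shows "pw_poly T m (%x. s * f x + t * g x)"
 unfolding pw_poly_def
proof (intro ballI)
 fix K assume K: "K \<in> T"
 have "ae_eq K (%x. s * f x + t * g x) (%z. s * restr K f z + t * restr K g z)"
  using restr_ae[OF f K] restr_ae[OF g K] unfolding ae_eq_def by eventually_elim simp
 then show "\<exists>p\<in>polys m. ae_eq K (%x. s * f x + t * g x) p"
  using polys_linear[OF restr_polys[OF f K] restr_polys[OF g K]] by (rule bexI)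
qed

text \<open>On piecewise polynomials, equality almost everywhere is an identity of polynomials on each
 element.\<close>

lemma ae_eq_restr_iff:
 assumes f: "pw_poly T m f" and g: "pw_poly T n g"
 shows "ae_eq Om f g \<longleftrightarrow> (\<forall>K\<in>T. restr K f = restr K g)"
proof
 show "\<forall>K\<in>T. restr K f = restr K g" if "ae_eq Om f g" using restr_cong[OF that] by simp
 assume r: "\<forall>K\<in>T. restr K f = restr K g"
 show "ae_eq Om f g"
 proof (rule ae_eq_domI)
  fix K assume K: "K \<in> T"
  show "ae_eq K f g" using restr_ae[OF f K] restr_ae[OF g K] unfolding ae_eq_def
   by eventually_elim (simp add: bspec[OF r K])
 qed
qed

lemma pw_poly_zero: "pw_poly T m (%x. 0)"
 unfolding pw_poly_def by (intro ballI bexI[OF _ polys_const[of 0]]) (simp add: ae_eq_def)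

lemma restr_zero: "K \<in> T ==> restr K (%x. 0) = (%x. 0)"
 by (rule restr_eq[OF _ polys_const]) (simp_all add: ae_eq_def)

lemma C_at_zero: "C_at r T (%x. 0) a"
 unfolding C_at_def by (simp add: restr_zero)

lemma C_at_linear:
 assumes f: "pw_poly T m f" "C_at r T f a" and g: "pw_poly T m g" "C_at r T g a"
 shows "C_at r T (%x. s * f x + t * g x) a"
 unfolding C_at_def
proof (intro ballI impI allI)
 fix K L i j assume KL: "K \<in> T" "L \<in> T" "a extreme_point_of K" "a extreme_point_of L" "i + j \<le> r"
 have "partial i j (restr K f) a = partial i j (restr L f) a" "partial i j (restr K g) a = partial i j (restr L g) a"
  by (rule f(2)[unfolded C_at_def, rule_format, OF KL], rule g(2)[unfolded C_at_def, rule_format, OF KL])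
 moreover have "partial i j (restr M (%x. s * f x + t * g x)) a = s * partial i j (restr M f) a + t * partial i j (restr M g) a" if M: "M \<in> T" for M
  by (subst restr_linear[OF f(1) g(1) M], rule partial_linear[OF restr_polys[OF f(1) M] restr_polys[OF g(1) M]])
 ultimately show "partial i j (restr K (%x. s * f x + t * g x)) a = partial i j (restr L (%x. s * f x + t * g x)) a"
  using KL(1,2) by presburger
qed

lemma vec_ae_eq_iff: "ae_eq Om u v \<longleftrightarrow> ae_eq Om (fst \<circ> u) (fst \<circ> v) \<and> ae_eq Om (snd \<circ> u) (snd \<circ> v)"
 for u v :: "point => point"
proof
 assume "ae_eq Om u v"
 then show "ae_eq Om (fst \<circ> u) (fst \<circ> v) \<and> ae_eq Om (snd \<circ> u) (snd \<circ> v)"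
  unfolding ae_eq_def by (intro conjI; eventually_elim; simp)
next
 assume "ae_eq Om (fst \<circ> u) (fst \<circ> v) \<and> ae_eq Om (snd \<circ> u) (snd \<circ> v)"
 then have "AE x in lebesgue_on Om. (fst \<circ> u) x = (fst \<circ> v) x" "AE x in lebesgue_on Om. (snd \<circ> u) x = (snd \<circ> v) x"
  by (simp_all add: ae_eq_def)
 then show "ae_eq Om u v" unfolding ae_eq_def
  by eventually_elim (simp add: prod_eq_iff)
qed

section \<open>The Dirichlet form, curl and divergence on vector fields\<close>

definition vec_H1 :: "(point => point) set" where
 "vec_H1 = {v. fst \<circ> v \<in> H1 Om \<and> snd \<circ> v \<in> H1 Om}"

lemma comp_linear:
 "fst \<circ> (%x. s *\<^sub>R u x + t *\<^sub>R v x) = (%x. s * (fst \<circ> u) x + t * (fst \<circ> v) x)"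
 "snd \<circ> (%x. s *\<^sub>R u x + t *\<^sub>R v x) = (%x. s * (snd \<circ> u) x + t * (snd \<circ> (v :: point => point)) x)"
 by auto

lemma comp_curl: "fst \<circ> curl Om \<phi> = wd (0, 1) \<phi>" "snd \<circ> curl Om \<phi> = (%x. - wd (1, 0) \<phi> x)"
 by (auto simp: curl_def)

lemma comp_zero: "fst \<circ> (%x. 0 :: point) = (%x. 0)" "snd \<circ> (%x. 0 :: point) = (%x. 0)"
 by auto

lemma curl_cong: "ae_eq Om f g ==> curl Om f = curl Om g"
 by (simp add: curl_def weak_deriv_cong[of f g])

lemma divergence_cong: "ae_eq Om u v ==> divergence Om u = divergence Om v"
 using vec_ae_eq_iff[of u v] by (simp add: divergence_def weak_deriv_cong[of "fst \<circ> u" "fst \<circ> v"] weak_deriv_cong[of "snd \<circ> u" "snd \<circ> v"])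

lemma curl_linear:
 assumes "f \<in> H1 Om" "g \<in> H1 Om"
 shows "ae_eq Om (curl Om (%x. s * f x + t * g x)) (%x. s *\<^sub>R curl Om f x + t *\<^sub>R curl Om g x)"
proof -
 note b = axis_directions
 show ?thesis
  using weak_deriv_linear[OF assms b(1), of s t] weak_deriv_linear[OF assms b(2), of s t] unfolding ae_eq_def
  by eventually_elim (simp add: curl_def)
qed

lemma divergence_linear:
 assumes "u \<in> vec_H1" "v \<in> vec_H1"
 shows "ae_eq Om (divergence Om (%x. s *\<^sub>R u x + t *\<^sub>R v x)) (%x. s * divergence Om u x + t * divergence Om v x)"
proof -
 note b = axis_directions
 have h: "fst \<circ> u \<in> H1 Om" "fst \<circ> v \<in> H1 Om" "snd \<circ> u \<in> H1 Om" "snd \<circ> v \<in> H1 Om" using assms by (simp_all add: vec_H1_def)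
 show ?thesis
  using weak_deriv_linear[OF h(1,2) b(1), of s t] weak_deriv_linear[OF h(3,4) b(2), of s t]
  unfolding ae_eq_def divergence_def comp_linear
  by eventually_elim (simp add: algebra_simps)
qed

lemma grad_inner_commute: "grad_inner Om u v = grad_inner Om v u"
 unfolding grad_inner_def by (intro sum.cong refl arg_cong2[where f = "(+)"] L2_inner_commute)

lemma grad_inner_cong: "ae_eq Om u u' ==> grad_inner Om u v = grad_inner Om u' v"
 using vec_ae_eq_iff[of u u']
 by (simp add: grad_inner_def weak_deriv_cong[of "fst \<circ> u" "fst \<circ> u'"] weak_deriv_cong[of "snd \<circ> u" "snd \<circ> u'"])

lemma grad_inner_cong_right: "ae_eq Om v v' ==> grad_inner Om u v = grad_inner Om u v'"
 using grad_inner_cong[of v v' u] by (simp only: grad_inner_commute[of u])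

lemma L2_inner_weak_deriv_linear:
 assumes f: "f \<in> H1 Om" and g: "g \<in> H1 Om" and h: "h \<in> L2 Om" and e: "e \<in> Basis"
 shows "ip (wd e (%x. s * f x + t * g x)) h
  = s * ip (wd e f) h + t * ip (wd e g) h"
proof -
 note w = H1_weak_L2[OF f e] H1_weak_L2[OF g e]
 have "ip (wd e (%x. s * f x + t * g x)) h = ip (%x. s * wd e f x + t * wd e g x) h"
  by (rule L2_inner_cong[OF weak_deriv_linear[OF f g e] ae_eq_refl H1_weak_L2[OF H1_linear[OF f g] e] h])
 then show ?thesis using L2_inner_add_left[OF L2_cmul[OF w(1), of s] L2_cmul[OF w(2), of t] h]
  by (simp add: L2_inner_cmul_left)
qed

lemma grad_inner_linear:
 assumes "u \<in> vec_H1" "v \<in> vec_H1" "w \<in> vec_H1"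
 shows "grad_inner Om (%x. s *\<^sub>R u x + t *\<^sub>R v x) w = s * grad_inner Om u w + t * grad_inner Om v w"
proof -
 have h: "fst \<circ> u \<in> H1 Om" "fst \<circ> v \<in> H1 Om" "fst \<circ> w \<in> H1 Om" "snd \<circ> u \<in> H1 Om" "snd \<circ> v \<in> H1 Om" "snd \<circ> w \<in> H1 Om"
  using assms by (simp_all add: vec_H1_def)
 have "grad_inner Om (%x. s *\<^sub>R u x + t *\<^sub>R v x) w =
  (\<Sum>e\<in>Basis. s * (ip (wd e (fst \<circ> u)) (wd e (fst \<circ> w)) + ip (wd e (snd \<circ> u)) (wd e (snd \<circ> w)))
   + t * (ip (wd e (fst \<circ> v)) (wd e (fst \<circ> w)) + ip (wd e (snd \<circ> v)) (wd e (snd \<circ> w))))"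
  unfolding grad_inner_def comp_linear
  by (intro sum.cong refl)
   (simp only: L2_inner_weak_deriv_linear[OF h(1,2) H1_weak_L2[OF h(3)]] L2_inner_weak_deriv_linear[OF h(4,5) H1_weak_L2[OF h(6)]],
    simp only: algebra_simps)
 then show ?thesis by (simp only: sum.distrib sum_distrib_left[symmetric] grad_inner_def)
qed

lemma grad_inner_nonneg: "0 \<le> grad_inner Om v v"
 unfolding grad_inner_def by (intro sum_nonneg add_nonneg_nonneg L2_inner_self_nonneg)

text \<open>A piecewise polynomial with vanishing gradient and zero boundary values is zero because its extension to the plane is constant.\<close>

lemma grad_inner_definite:
 assumes v: "fst \<circ> v \<in> H1_0 Om" "snd \<circ> v \<in> H1_0 Om" "pw_poly T m (fst \<circ> v)" "pw_poly T m (snd \<circ> v)"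
  and z: "grad_inner Om v v = 0"
 shows "ae_eq Om v (%x. 0)"
proof -
 have "ip (wd e (fst \<circ> v)) (wd e (fst \<circ> v)) + ip (wd e (snd \<circ> v)) (wd e (snd \<circ> v)) = 0"
  if "e \<in> Basis" for e
  using z that unfolding grad_inner_def
  by (subst (asm) sum_nonneg_eq_0_iff) (auto intro!: add_nonneg_nonneg L2_inner_self_nonneg)
 then have "ip (wd e (fst \<circ> v)) (wd e (fst \<circ> v)) = 0" "ip (wd e (snd \<circ> v)) (wd e (snd \<circ> v)) = 0"
  if "e \<in> Basis" for e
  using add_nonneg_eq_0_iff[OF L2_inner_self_nonneg L2_inner_self_nonneg] that by blast+
 then have "ae_eq Om (fst \<circ> v) (%x. 0)" "ae_eq Om (snd \<circ> v) (%x. 0)"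
  using H1_0_zero_grad[OF v(1,3) L2_norm_zero[OF H1_weak_L2[OF H1_0_H1[OF v(1)]]]]
   H1_0_zero_grad[OF v(2,4) L2_norm_zero[OF H1_weak_L2[OF H1_0_H1[OF v(2)]]]] by blast+
 then show ?thesis unfolding vec_ae_eq_iff[of v] comp_zero by blast
qed

lemma orthogonal_projection:
 assumes B: "semi_inner Om S B" and A: "A \<subseteq> S" "fun_subspace A" "\<forall>a\<in>A. pw_poly T m a" and s: "s \<in> S"
 shows "\<exists>r\<in>A. \<forall>a\<in>A. B (%x. s x - r x) a = 0"
proof -
 have inS: "a \<in> S" if "a \<in> A" for a using A(1) that by blast
 have BA: "semi_inner Om A B" using B A(2) inS unfolding semi_inner_def by simp
 have lin: "B (%x. p * f x + q * g x) h = p * B f h + q * B g h" if "f \<in> S" "g \<in> S" "h \<in> S" for p q f g h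
  using B that by (simp add: semi_inner_def)
 have sym: "B f g = B g f" if "f \<in> S" "g \<in> S" for f g using B that by (simp add: semi_inner_def)
 have "functional A B (B s)"
  unfolding functional_def
 proof (intro conjI ballI allI impI)
  fix p q a b assume ab: "a \<in> A" "b \<in> A"
  have "(%x. p * a x + q * b x) \<in> S" by (rule inS[OF fun_subspace_combination[OF A(2) ab]])
  then show "B s (%x. p * a x + q * b x) = p * B s a + q * B s b"
   using lin[OF inS[OF ab(1)] inS[OF ab(2)] s, of p q] by (simp add: sym[OF s] inS ab)
 next
  show "B s a = 0" if "a \<in> A" "B a a = 0" for a by (rule semi_inner_degenerate[OF B inS[OF that(1)] that(2) s])
 qed
 from riesz_pw_poly[OF BA this A(3)] obtain r where r: "r \<in> A" "\<forall>a\<in>A. B r a = B s a" by blast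
 have "B (%x. s x - r x) a = 0" if "a \<in> A" for a
  using lin[OF s inS[OF r(1)] inS[OF that], of 1 "-1"] r(2) that by simp
 then show ?thesis using r(1) by blast
qed

end

section \<open>Polynomials and edges of a triangle\<close>

text \<open>The tangential derivative vanishes because the polynomial does on the edge, and the normal one by
hypothesis; together they determine the gradient.\<close>

lemma edge_gradient_zero:
 assumes t: "triangle K a b c" and p: "p \<in> polys m" and z0: "\<forall>z\<in>frontier K. p z = 0"
  and normal: "\<forall>E n. E edge_of K --> norm n = 1 --> (\<forall>y\<in>E. \<forall>z\<in>E. n \<bullet> (y - z) = 0) --> (\<forall>x\<in>E. dd n p x = 0)"
  and x: "x \<in> closed_segment a b"
 shows "dx p x = 0 \<and> dy p x = 0"
proof -
 let ?d = "b - a" and ?E = "closed_segment a b"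
 let ?g1 = "dx p x" and ?g2 = "dy p x"
 define n where "n = (1 / norm ?d) *\<^sub>R (- snd ?d, fst ?d)"
 have d: "?d \<noteq> 0" using triangle_distinct[OF t] by auto
 have rot: "norm (- snd ?d, fst ?d) = norm ?d" by (simp only: norm_prod_def fst_conv snd_conv norm_minus_cancel add.commute)
 have n1: "norm n = 1" unfolding n_def norm_scaleR rot using d by simp
 have orth: "n \<bullet> (y - z) = 0" if yz: "y \<in> ?E" "z \<in> ?E" for y z
 proof -
  obtain s where s: "y = (1 - s) *\<^sub>R a + s *\<^sub>R b" using yz(1) unfolding in_segment by blast
  obtain r where r: "z = (1 - r) *\<^sub>R a + r *\<^sub>R b" using yz(2) unfolding in_segment by blast
  have yz': "y - z = (s - r) *\<^sub>R ?d" unfolding s r by (simp add: algebra_simps)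
  have "(- snd ?d, fst ?d) \<bullet> ?d = 0" unfolding inner_prod_def by (simp add: algebra_simps)
  then show ?thesis unfolding yz' n_def by (simp only: inner_scaleR_left inner_scaleR_right mult_zero_right)
 qed
 have "dd n p x = 0"
  using normal[rule_format, OF triangle_edge[OF t] n1 _ x] orth by blast
 then have gn: "?g1 * fst n + ?g2 * snd n = 0" using has_grad_dir[OF polys_has_grad[OF p], of n x] by simp
 have N: "norm ?d * fst n = - snd ?d" "norm ?d * snd n = fst ?d" using d by (simp_all add: n_def)
 have "?g2 * fst ?d - ?g1 * snd ?d = ?g2 * (norm ?d * snd n) + ?g1 * (norm ?d * fst n)" unfolding N by (simp add: algebra_simps)
 also have "\<dots> = norm ?d * (?g1 * fst n + ?g2 * snd n)" by (simp only: algebra_simps)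
 finally have nor: "?g2 * fst ?d - ?g1 * snd ?d = 0" unfolding gn by simp
 have tan: "?g1 * fst ?d + ?g2 * snd ?d = 0"
  by (rule segment_deriv_zero[OF p _ x]) (use z0 triangle_frontier[OF t] in blast)
 have pos: "fst ?d * fst ?d + snd ?d * snd ?d \<noteq> 0"
  using d by (simp only: sum_squares_eq_zero_iff prod_eq_iff fst_zero snd_zero not_False_eq_True)
 have "?g1 * (fst ?d * fst ?d + snd ?d * snd ?d) = (?g1 * fst ?d + ?g2 * snd ?d) * fst ?d - (?g2 * fst ?d - ?g1 * snd ?d) * snd ?d"
  by (simp only: algebra_simps)
 then have 1: "?g1 = 0" unfolding tan nor using pos by auto
 have "?g2 * (fst ?d * fst ?d + snd ?d * snd ?d) = (?g1 * fst ?d + ?g2 * snd ?d) * snd ?d + (?g2 * fst ?d - ?g1 * snd ?d) * fst ?d"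
  by (simp only: algebra_simps)
 then have 2: "?g2 = 0" unfolding tan nor using pos by auto
 from 1 2 show ?thesis by blast
qed

lemma frontier_gradient_zero:
 assumes t: "triangle K a b c" and p: "p \<in> polys m" and z0: "\<forall>z\<in>frontier K. p z = 0"
  and normal: "\<forall>E n. E edge_of K --> norm n = 1 --> (\<forall>y\<in>E. \<forall>z\<in>E. n \<bullet> (y - z) = 0) --> (\<forall>x\<in>E. dd n p x = 0)"
  and x: "x \<in> frontier K"
 shows "dx p x = 0 \<and> dy p x = 0"
 using x edge_gradient_zero[OF t p z0 normal, of x] edge_gradient_zero[OF triangle_rotate[OF t] p z0 normal, of x]
  edge_gradient_zero[OF triangle_rotate[OF triangle_rotate[OF t]] p z0 normal, of x]
 unfolding triangle_frontier[OF t] by blast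

lemma segment_constant:
 assumes p: "p \<in> polys m" and g: "\<forall>z\<in>closed_segment a b. dx p z = 0 \<and> dy p z = 0"
  and x: "x \<in> closed_segment a b"
 shows "p x = p a"
proof -
 have seg: "a + s *\<^sub>R (b - a) \<in> closed_segment a b" if "0 \<le> s" "s \<le> 1" for s
  using that unfolding in_segment by (intro exI[of _ s]) (simp add: algebra_simps)
 obtain t where t: "0 \<le> t" "t \<le> 1" "x = (1 - t) *\<^sub>R a + t *\<^sub>R b" using x unfolding in_segment by blast
 then have tx: "x = a + t *\<^sub>R (b - a)" by (simp add: algebra_simps)
 let ?f = "%s. p (a + s *\<^sub>R (b - a))"
 have der: "(?f has_real_derivative 0) (at s)" if "0 \<le> s" "s \<le> 1" for s
  using has_grad_line[OF polys_has_grad[OF p, of "a + s *\<^sub>R (b - a)"]] bspec[OF g seg[OF that]] by simp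
 have "?f t = ?f 0"
 proof (rule DERIV_isconst2[of 0 1])
  show "continuous_on {0..1} ?f" by (intro continuous_at_imp_continuous_on ballI DERIV_isCont[OF der]) auto
 qed (use der t in auto)
 then show ?thesis using tx by simp
qed

lemma frontier_constant:
 assumes t: "triangle K a b c" and p: "p \<in> polys m"
  and g: "\<forall>z\<in>frontier K. dx p z = 0 \<and> dy p z = 0"
  and x: "x \<in> frontier K"
 shows "p x = p a"
proof -
 have s: "closed_segment a b \<subseteq> frontier K" "closed_segment b c \<subseteq> frontier K" "closed_segment c a \<subseteq> frontier K"
  unfolding triangle_frontier[OF t] by blast+
 have 1: "p y = p a" if "y \<in> closed_segment a b" for y by (rule segment_constant[OF p _ that]) (use g s in blast)
 have 2: "p y = p b" if "y \<in> closed_segment b c" for y by (rule segment_constant[OF p _ that]) (use g s in blast)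
 have 3: "p y = p c" if "y \<in> closed_segment c a" for y by (rule segment_constant[OF p _ that]) (use g s in blast)
 have "p b = p a" "p c = p b" by (rule 1, simp, rule 2, simp)
 then show ?thesis using 1[of x] 2[of x] 3[of x] x unfolding triangle_frontier[OF t] by auto
qed

section \<open>The spaces of the complex\<close>

locale fe_spaces = mesh_domain +
 fixes vs :: "point list" and k :: nat
 assumes degree: "3 \<le> k"
begin

abbreviation "\<Sigma>0 \<equiv> Sigma_0 Om vs T k"
abbreviation "\<Sigma>I \<equiv> Sigma_I Om vs T k"
abbreviation "\<Sigma>E \<equiv> Sigma_E Om vs T k"
abbreviation "V0 \<equiv> V_0 Om vs T k"
abbreviation "VV0 \<equiv> vec_V_0 Om vs T k"
abbreviation "VI \<equiv> V_I Om vs T k"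
abbreviation "VE \<equiv> V_E Om vs T k"
abbreviation "Q0 \<equiv> Q_0 Om vs T k"
abbreviation "QI \<equiv> Q_I Om vs T k"
abbreviation "QE \<equiv> Q_E Om vs T k"
abbreviation "NC \<equiv> noncorner_vertices vs T"

lemma Sigma_0_iff: "\<phi> \<in> \<Sigma>0 \<longleftrightarrow> \<phi> \<in> H2_0 Om \<and> pw_poly T (k + 1) \<phi> \<and> (\<forall>a\<in>NC. C_at 2 T \<phi> a)"
 unfolding Sigma_0_def by blast

lemma V_0_iff: "v \<in> V0 \<longleftrightarrow> v \<in> H1_0 Om \<and> pw_poly T k v \<and> (\<forall>a\<in>NC. C_at 1 T v a)"
 unfolding V_0_def V_space_def using H1_0_H1 by blast

lemma vec_V_0_iff: "v \<in> VV0 \<longleftrightarrow> fst \<circ> v \<in> V0 \<and> snd \<circ> v \<in> V0"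
 unfolding vec_V_0_def by blast

lemma Q_0_iff: "q \<in> Q0 \<longleftrightarrow> q \<in> L2 Om \<and> pw_poly T (k - 1) q \<and> (\<forall>a\<in>NC. C_at 0 T q a) \<and> (LINT x|lebesgue_on Om. q x) = 0"
 unfolding Q_0_def Q_space_def L2_zero_mean_def by blast

text \<open>Vanishing values and normal derivatives on the edges amount to vanishing values and gradients on the
boundary, a condition without reference to edges.\<close>

lemma Sigma_I_iff: "\<phi> \<in> \<Sigma>I \<longleftrightarrow> \<phi> \<in> \<Sigma>0 \<and> (\<forall>K\<in>T. \<forall>x\<in>frontier K.
  restr K \<phi> x = 0 \<and> dx (restr K \<phi>) x = 0 \<and> dy (restr K \<phi>) x = 0)"
proof
 assume \<phi>: "\<phi> \<in> \<Sigma>I"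
 then have 0: "\<phi> \<in> \<Sigma>0" by (simp add: Sigma_I_def)
 have "restr K \<phi> x = 0 \<and> dx (restr K \<phi>) x = 0 \<and> dy (restr K \<phi>) x = 0"
  if K: "K \<in> T" and x: "x \<in> frontier K" for K x
 proof -
  obtain a b c where t: "triangle K a b c" using triangles[OF K] by blast
  have p: "restr K \<phi> \<in> polys (k + 1)" using restr_polys[OF _ K] 0 unfolding Sigma_0_iff by blast
  have z: "\<forall>z\<in>frontier K. restr K \<phi> z = 0"
   and n: "\<forall>E n. E edge_of K --> norm n = 1 --> (\<forall>y\<in>E. \<forall>z\<in>E. n \<bullet> (y - z) = 0) --> (\<forall>x\<in>E. dd n (restr K \<phi>) x = 0)"
   using \<phi> K unfolding Sigma_I_def by simp_all
  show ?thesis using frontier_gradient_zero[OF t p z n x] bspec[OF z x] by blast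
 qed
 with 0 show "\<phi> \<in> \<Sigma>0 \<and> (\<forall>K\<in>T. \<forall>x\<in>frontier K. restr K \<phi> x = 0 \<and> dx (restr K \<phi>) x = 0 \<and> dy (restr K \<phi>) x = 0)"
  by simp
next
 assume *: "\<phi> \<in> \<Sigma>0 \<and> (\<forall>K\<in>T. \<forall>x\<in>frontier K. restr K \<phi> x = 0 \<and> dx (restr K \<phi>) x = 0 \<and> dy (restr K \<phi>) x = 0)"
 show "\<phi> \<in> \<Sigma>I"
  unfolding Sigma_I_def
 proof (intro CollectI conjI ballI allI impI)
  fix K E n x assume K: "K \<in> T" and E: "E edge_of K" and x: "x \<in> E"
  obtain a b c where t: "triangle K a b c" using triangles[OF K] by blast
  have xf: "x \<in> frontier K" by (rule subsetD[OF edge_subset_frontier[OF t E] x])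
  have p: "restr K \<phi> \<in> polys (k + 1)" using restr_polys[OF _ K] * unfolding Sigma_0_iff by blast
  have "dx (restr K \<phi>) x = 0" "dy (restr K \<phi>) x = 0"
   using bspec[OF bspec[OF conjunct2[OF *] K] xf] by blast+
  then show "dd n (restr K \<phi>) x = 0" using has_grad_dir[OF polys_has_grad[OF p], of n x] by simp
 qed (use * in simp_all)
qed

lemma V_I_iff: "v \<in> VI \<longleftrightarrow> v \<in> VV0 \<and> (\<forall>K\<in>T. \<forall>x\<in>frontier K. restr K (fst \<circ> v) x = 0 \<and> restr K (snd \<circ> v) x = 0)"
 unfolding V_I_def by blast

lemma Q_I_iff: "q \<in> QI \<longleftrightarrow> q \<in> Q0 \<and> (\<forall>K\<in>T. (LINT x|lebesgue_on K. q x) = 0 \<and> (\<forall>a. a extreme_point_of K --> restr K q a = 0))"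
 unfolding Q_I_def by blast

lemma Sigma_0_H1: "\<phi> \<in> \<Sigma>0 ==> \<phi> \<in> H1 Om"
 unfolding Sigma_0_iff using H2_0_H1_0 H1_0_H1 by blast

lemma vec_V_0_H1: "v \<in> VV0 ==> v \<in> vec_H1"
 unfolding vec_V_0_iff V_0_iff vec_H1_def using H1_0_H1 by blast

lemma V_0_linear: "f \<in> V0 ==> g \<in> V0 ==> (%x. s * f x + t * g x) \<in> V0"
 unfolding V_0_iff by (intro conjI ballI H1_0_linear pw_poly_linear C_at_linear[of k]) simp_all

lemma vec_V_0_linear: "u \<in> VV0 ==> v \<in> VV0 ==> (%x. s *\<^sub>R u x + t *\<^sub>R v x) \<in> VV0"
 using V_0_linear[of "fst \<circ> u" "fst \<circ> v" s t] V_0_linear[of "snd \<circ> u" "snd \<circ> v" s t]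
 unfolding vec_V_0_iff comp_linear by blast

lemma Q_0_linear:
 assumes f: "f \<in> Q0" and g: "g \<in> Q0" shows "(%x. s * f x + t * g x) \<in> Q0"
proof -
 have i: "integrable (lebesgue_on Om) f" "integrable (lebesgue_on Om) g" using f g L2_integrable unfolding Q_0_iff by blast+
 have "(LINT x|lebesgue_on Om. s * f x + t * g x) = s * (LINT x|lebesgue_on Om. f x) + t * (LINT x|lebesgue_on Om. g x)"
  using i by (subst Bochner_Integration.integral_add) simp_all
 also have "\<dots> = 0" using f g unfolding Q_0_iff by simp
 finally show ?thesis using f g unfolding Q_0_iff
  by (intro conjI ballI L2_add L2_cmul pw_poly_linear C_at_linear[of "k - 1"]) simp_all
qed

lemma Sigma_0_linear: "f \<in> \<Sigma>0 ==> g \<in> \<Sigma>0 ==> (%x. s * f x + t * g x) \<in> \<Sigma>0"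
 unfolding Sigma_0_iff by (intro conjI ballI H2_0_linear pw_poly_linear C_at_linear[of "k + 1"]) simp_all

lemma zero_spaces: "(%x. 0) \<in> \<Sigma>0" "(%x. 0) \<in> V0" "(%x. 0) \<in> VV0" "(%x. 0) \<in> Q0"
proof -
 show "(%x. 0) \<in> \<Sigma>0" unfolding Sigma_0_iff using test_H2_0[OF test_zero] pw_poly_zero C_at_zero by blast
 show v: "(%x. 0) \<in> V0" unfolding V_0_iff using H1_0_zero pw_poly_zero C_at_zero by blast
 show "(%x. 0) \<in> VV0" unfolding vec_V_0_iff comp_zero using v by blast
 show "(%x. 0) \<in> Q0" unfolding Q_0_iff using L2_const[of 0] pw_poly_zero C_at_zero by simp
qed

lemma Sigma_I_linear:
 assumes f: "f \<in> \<Sigma>I" and g: "g \<in> \<Sigma>I" shows "(%x. s * f x + t * g x) \<in> \<Sigma>I"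
 unfolding Sigma_I_iff
proof (intro conjI ballI)
 show "(%x. s * f x + t * g x) \<in> \<Sigma>0" using f g Sigma_0_linear unfolding Sigma_I_iff by blast
 fix K x assume K: "K \<in> T" and x: "x \<in> frontier K"
 have pw: "pw_poly T (k + 1) f" "pw_poly T (k + 1) g" using f g unfolding Sigma_I_iff Sigma_0_iff by blast+
 note z = bspec[OF bspec[OF conjunct2[OF f[unfolded Sigma_I_iff]] K] x] bspec[OF bspec[OF conjunct2[OF g[unfolded Sigma_I_iff]] K] x]
 note r = restr_linear[OF pw K, of s t] and d = dir_deriv_linear[OF restr_polys[OF pw(1) K] restr_polys[OF pw(2) K]]
 show "restr K (%x. s * f x + t * g x) x = 0" "dx (restr K (%x. s * f x + t * g x)) x = 0"
  "dy (restr K (%x. s * f x + t * g x)) x = 0"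
  unfolding r d using z by simp_all
qed

lemma V_I_linear:
 assumes u: "u \<in> VI" and v: "v \<in> VI" shows "(%x. s *\<^sub>R u x + t *\<^sub>R v x) \<in> VI"
 unfolding V_I_iff comp_linear
proof (intro conjI ballI)
 show "(%x. s *\<^sub>R u x + t *\<^sub>R v x) \<in> VV0" using u v vec_V_0_linear unfolding V_I_iff by blast
 fix K x assume K: "K \<in> T" and x: "x \<in> frontier K"
 have pw: "pw_poly T k (fst \<circ> u)" "pw_poly T k (fst \<circ> v)" "pw_poly T k (snd \<circ> u)" "pw_poly T k (snd \<circ> v)"
  using u v unfolding V_I_iff vec_V_0_iff V_0_iff by blast+
 note z = bspec[OF bspec[OF conjunct2[OF u[unfolded V_I_iff]] K] x] bspec[OF bspec[OF conjunct2[OF v[unfolded V_I_iff]] K] x]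
 show "restr K (%x. s * (fst \<circ> u) x + t * (fst \<circ> v) x) x = 0" "restr K (%x. s * (snd \<circ> u) x + t * (snd \<circ> v) x) x = 0"
  unfolding restr_linear[OF pw(1,2) K] restr_linear[OF pw(3,4) K] using z by simp_all
qed

lemma integrable_pw_poly_element:
 assumes f: "pw_poly T m f" and K: "K \<in> T"
 shows "integrable (lebesgue_on K) (restr K f)"
 by (rule integrable_element[OF K nice_continuous[OF polys_nice[OF restr_polys[OF f K]]]])

lemma integral_restr:
 assumes f: "pw_poly T m f" and fL: "f \<in> L2 Om" and K: "K \<in> T"
 shows "(LINT x|lebesgue_on K. f x) = (LINT x|lebesgue_on K. restr K f x)"
proof -
 let ?r = "restr K f"
 have ae: "AE x in lebesgue. x \<in> interior K --> f x = ?r x" using restr_ae[OF f K] unfolding ae_eq_element[OF K] .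
 have ae': "AE x in lebesgue. indicator K x *\<^sub>R ?r x = indicator K x *\<^sub>R f x"
  using ae AE_skeleton
 proof eventually_elim
  case (elim x)
  then have "x \<notin> frontier K" using K by (auto simp: skeleton_def)
  then show ?case using elim element_frontier[OF K] by (auto simp: indicator_def)
 qed
 have "integrable lebesgue (%x. indicator K x *\<^sub>R ?r x)"
  using integrable_pw_poly_element[OF f K] element_lebesgue[OF K] by (subst (asm) integrable_restrict_space) auto
 then have m: "(%x. indicator K x *\<^sub>R ?r x) \<in> borel_measurable lebesgue" by (rule borel_measurable_integrable)
 have m': "(%x. indicator K x *\<^sub>R f x) \<in> borel_measurable lebesgue" by (rule lebesgue_measurable_AE[OF m ae'])
 have "(LINT x|lebesgue_on K. g x) = (LINT x|lebesgue. indicator K x *\<^sub>R g x)" for g :: "point => real"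
  using element_lebesgue[OF K] by (intro integral_restrict_space) auto
 then show ?thesis using integral_cong_AE[OF m m' ae'] by simp
qed

lemma Q_I_linear:
 assumes f: "f \<in> QI" and g: "g \<in> QI" shows "(%x. s * f x + t * g x) \<in> QI"
 unfolding Q_I_iff
proof (intro conjI ballI allI impI)
 show q: "(%x. s * f x + t * g x) \<in> Q0" using f g Q_0_linear unfolding Q_I_iff by blast
 fix K assume K: "K \<in> T"
 have pw: "pw_poly T (k - 1) f" "pw_poly T (k - 1) g" and L: "f \<in> L2 Om" "g \<in> L2 Om" using f g unfolding Q_I_iff Q_0_iff by blast+
 have pl: "pw_poly T (k - 1) (%x. s * f x + t * g x)" "(%x. s * f x + t * g x) \<in> L2 Om" using q unfolding Q_0_iff by blast+
 note z = bspec[OF conjunct2[OF f[unfolded Q_I_iff]] K] bspec[OF conjunct2[OF g[unfolded Q_I_iff]] K]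
 note r = restr_linear[OF pw K, of s t]
 have "(LINT x|lebesgue_on K. s * f x + t * g x) = (LINT x|lebesgue_on K. s * restr K f x + t * restr K g x)"
  using integral_restr[OF pl K] unfolding r .
 also have "\<dots> = s * (LINT x|lebesgue_on K. restr K f x) + t * (LINT x|lebesgue_on K. restr K g x)"
  using integrable_pw_poly_element[OF pw(1) K] integrable_pw_poly_element[OF pw(2) K]
  by (subst Bochner_Integration.integral_add) simp_all
 also have "\<dots> = 0" using z integral_restr[OF pw(1) L(1) K] integral_restr[OF pw(2) L(2) K] by simp
 finally show "(LINT x|lebesgue_on K. s * f x + t * g x) = 0" .
 show "restr K (%x. s * f x + t * g x) a = 0" if "a extreme_point_of K" for a
  unfolding r using z that by simp
qed

lemma zero_interior_spaces: "(%x. 0) \<in> \<Sigma>I" "(%x. 0) \<in> VI" "(%x. 0) \<in> QI"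
 unfolding Sigma_I_iff V_I_iff Q_I_iff comp_zero
 using zero_spaces by (simp_all add: restr_zero dir_deriv_const)

section \<open>Curl and divergence on the discrete spaces\<close>

lemma curl_restr:
 assumes \<phi>: "\<phi> \<in> \<Sigma>0"
 shows "pw_poly T k (fst \<circ> curl Om \<phi>)" "pw_poly T k (snd \<circ> curl Om \<phi>)"
  and "K \<in> T ==> restr K (fst \<circ> curl Om \<phi>) = dy (restr K \<phi>)"
  and "K \<in> T ==> restr K (snd \<circ> curl Om \<phi>) = (%z. - dx (restr K \<phi>) z)"
proof -
 note b = axis_directions
 have pw: "pw_poly T (k + 1) \<phi>" using \<phi> unfolding Sigma_0_iff by blast
 note h = Sigma_0_H1[OF \<phi>]
 note wx = weak_deriv_pw_poly[OF h pw b(1)] and wy = weak_deriv_pw_poly[OF h pw b(2)]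
 have wx1: "pw_poly T k (wd (1, 0) \<phi>)" using wx(1) by simp
 have neg: "(%x. - wd (1, 0) \<phi> x) = (%x. (-1) * wd (1, 0) \<phi> x + 0 * wd (1, 0) \<phi> x)" by simp
 show "pw_poly T k (fst \<circ> curl Om \<phi>)" using wy(1) by (simp add: comp_curl)
 show "pw_poly T k (snd \<circ> curl Om \<phi>)" unfolding comp_curl neg by (rule pw_poly_linear[OF wx1 wx1])
 show "restr K (fst \<circ> curl Om \<phi>) = dy (restr K \<phi>)" if "K \<in> T"
  using wy(2)[OF that] by (simp add: comp_curl)
 show "restr K (snd \<circ> curl Om \<phi>) = (%z. - dx (restr K \<phi>) z)" if "K \<in> T"
  unfolding comp_curl neg restr_linear[OF wx1 wx1 that] wx(2)[OF that] by simp
qed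

lemma divergence_restr:
 assumes v: "v \<in> VV0"
 shows "pw_poly T (k - 1) (divergence Om v)"
  and "K \<in> T ==> restr K (divergence Om v) =
   (%z. dx (restr K (fst \<circ> v)) z + dy (restr K (snd \<circ> v)) z)"
proof -
 note b = axis_directions
 have pw: "pw_poly T k (fst \<circ> v)" "pw_poly T k (snd \<circ> v)" using v unfolding vec_V_0_iff V_0_iff by blast+
 have h: "fst \<circ> v \<in> H1 Om" "snd \<circ> v \<in> H1 Om" using vec_V_0_H1[OF v] unfolding vec_H1_def by blast+
 note wx = weak_deriv_pw_poly[OF h(1) pw(1) b(1)] and wy = weak_deriv_pw_poly[OF h(2) pw(2) b(2)]
 show "pw_poly T (k - 1) (divergence Om v)"
  using pw_poly_linear[OF wx(1) wy(1), of 1 1] by (simp add: divergence_def)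
 show "restr K (divergence Om v) = (%z. dx (restr K (fst \<circ> v)) z + dy (restr K (snd \<circ> v)) z)" if K: "K \<in> T"
  using restr_linear[OF wx(1) wy(1) K, of 1 1] by (simp add: divergence_def wx(2)[OF K] wy(2)[OF K])
qed

lemma partials_of_restr:
 assumes C: "C_at (Suc r) T f a" and pw: "pw_poly T m f" and KL: "K \<in> T" "L \<in> T" "a extreme_point_of K" "a extreme_point_of L"
  and ij: "i + j \<le> r" and e: "e \<in> Basis"
 shows "partial i j (dd e (restr K f)) a = partial i j (dd e (restr L f)) a"
proof -
 have C': "partial i j (restr K f) a = partial i j (restr L f) a" if "i + j \<le> Suc r" for i j
  by (rule C[unfolded C_at_def, rule_format, OF KL that])
 note pK = restr_polys[OF pw KL(1)] and pL = restr_polys[OF pw KL(2)]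
 consider "e = (1, 0)" | "e = (0, 1)" using e unfolding Basis_point by blast
 then show ?thesis
 proof cases
  case 1
  then show ?thesis using C'[of "Suc i" j] ij partial_dx[OF pK, of i j] partial_dx[OF pL, of i j] by simp
 next
  case 2
  then show ?thesis using C'[of i "Suc j"] ij partial_dy'[OF pK, of i j] partial_dy'[OF pL, of i j] by simp
 qed
qed

text \<open>A function that is \<open>C\<^sup>2\<close> at a vertex has first derivatives that are \<open>C\<^sup>1\<close> there.\<close>

lemma curl_vec_V_0:
 assumes \<phi>: "\<phi> \<in> \<Sigma>0" shows "curl Om \<phi> \<in> VV0"
proof -
 note b = axis_directions
 have h: "\<phi> \<in> H2_0 Om" and pw: "pw_poly T (k + 1) \<phi>" and C: "\<forall>a\<in>NC. C_at 2 T \<phi> a" using \<phi> unfolding Sigma_0_iff by blast+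
 have "wd e \<phi> \<in> V0" if e: "e \<in> Basis" for e
  unfolding V_0_iff
 proof (intro conjI ballI)
  show "wd e \<phi> \<in> H1_0 Om" by (rule H2_0_weak_deriv[OF h e])
  show "pw_poly T k (wd e \<phi>)" using weak_deriv_pw_poly(1)[OF Sigma_0_H1[OF \<phi>] pw e] by simp
  fix a assume a: "a \<in> NC"
  have C2: "C_at (Suc 1) T \<phi> a" using bspec[OF C a] by (simp add: numeral_2_eq_2)
  show "C_at 1 T (wd e \<phi>) a" unfolding C_at_def
  proof (intro ballI impI allI)
   fix K L and i j :: nat assume KL: "K \<in> T" "L \<in> T" "a extreme_point_of K" "a extreme_point_of L" and ij: "i + j \<le> 1"
   show "partial i j (restr K (wd e \<phi>)) a = partial i j (restr L (wd e \<phi>)) a"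
    unfolding weak_deriv_pw_poly(2)[OF Sigma_0_H1[OF \<phi>] pw e KL(1)] weak_deriv_pw_poly(2)[OF Sigma_0_H1[OF \<phi>] pw e KL(2)]
    by (rule partials_of_restr[OF C2 pw KL ij e])
  qed
 qed
 note w = this[OF b(1)] this[OF b(2)]
 show ?thesis unfolding vec_V_0_iff comp_curl using w(2) V_0_linear[OF w(1) w(1), of "-1" 0] by simp
qed

text \<open>The mean is zero by integration by parts against the constant 1.\<close>

lemma divergence_Q_0:
 assumes v: "v \<in> VV0" shows "divergence Om v \<in> Q0"
 unfolding Q_0_iff
proof (intro conjI ballI)
 note b = axis_directions
 have h: "fst \<circ> v \<in> H1_0 Om" "snd \<circ> v \<in> H1_0 Om" and pw: "pw_poly T k (fst \<circ> v)" "pw_poly T k (snd \<circ> v)"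
  and C: "\<forall>a\<in>NC. C_at 1 T (fst \<circ> v) a" "\<forall>a\<in>NC. C_at 1 T (snd \<circ> v) a" using v unfolding vec_V_0_iff V_0_iff by blast+
 have L: "wd (1, 0) (fst \<circ> v) \<in> L2 Om" "wd (0, 1) (snd \<circ> v) \<in> L2 Om"
  using H1_weak_L2 H1_0_H1 h b by blast+
 show "divergence Om v \<in> L2 Om" unfolding divergence_def by (rule L2_add[OF L])
 show "pw_poly T (k - 1) (divergence Om v)" by (rule divergence_restr(1)[OF v])
 have mean: "(LINT x|lebesgue_on Om. wd e f x) = 0" if "f \<in> H1_0 Om" "e \<in> Basis" for f e
  using H1_0_integration_by_parts[OF that(1) nice_smooth[OF nice_const[of 1]] that(2)]
  by (simp add: dir_deriv_const L2_inner_def)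
 show "(LINT x|lebesgue_on Om. divergence Om v x) = 0" unfolding divergence_def
  using Bochner_Integration.integral_add[OF L2_integrable[OF L(1)] L2_integrable[OF L(2)]] mean[OF h(1) b(1)] mean[OF h(2) b(2)] by simp
 fix a assume a: "a \<in> NC"
 have C': "C_at (Suc 0) T (fst \<circ> v) a" "C_at (Suc 0) T (snd \<circ> v) a" using bspec[OF C(1) a] bspec[OF C(2) a] by simp_all
 show "C_at 0 T (divergence Om v) a" unfolding C_at_def
 proof (intro ballI impI allI)
  fix K L and i j :: nat assume KL: "K \<in> T" "L \<in> T" "a extreme_point_of K" "a extreme_point_of L" and "i + j \<le> 0"
  then have ij: "i = 0" "j = 0" by simp_all
  show "partial i j (restr K (divergence Om v)) a = partial i j (restr L (divergence Om v)) a"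
   unfolding divergence_restr(2)[OF v KL(1)] divergence_restr(2)[OF v KL(2)] ij partial_0
   using partials_of_restr[OF C'(1) pw(1) KL, of 0 0, OF _ b(1)] partials_of_restr[OF C'(2) pw(2) KL, of 0 0, OF _ b(2)]
   by (simp add: partial_0)
 qed
qed

lemma divergence_curl:
 assumes \<phi>: "\<phi> \<in> \<Sigma>0" shows "ae_eq Om (divergence Om (curl Om \<phi>)) (%x. 0)"
proof -
 note v = curl_vec_V_0[OF \<phi>]
 have pw: "pw_poly T (k + 1) \<phi>" using \<phi> unfolding Sigma_0_iff by blast
 have "restr K (divergence Om (curl Om \<phi>)) = restr K (%x. 0)" if K: "K \<in> T" for K
 proof -
  have p: "restr K \<phi> \<in> polys (k + 1)" by (rule restr_polys[OF pw K])
  have "dy (%z. - dx (restr K \<phi>) z) z = - dy (dx (restr K \<phi>)) z" for z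
   using dir_deriv_cmul[OF polys_dx[OF p], of "(0, 1)" "-1" z] by simp
  then show ?thesis
   unfolding divergence_restr(2)[OF v K] curl_restr(3)[OF \<phi> K] curl_restr(4)[OF \<phi> K] restr_zero[OF K] polys_mixed[OF p]
   by simp
 qed
 then show ?thesis using ae_eq_restr_iff[OF divergence_restr(1)[OF v] pw_poly_zero] by blast
qed

lemma curl_injective:
 assumes \<phi>: "\<phi> \<in> \<Sigma>0" and z: "ae_eq Om (curl Om \<phi>) (%x. 0)" shows "ae_eq Om \<phi> (%x. 0)"
proof (rule H1_0_zero_grad)
 show "\<phi> \<in> H1_0 Om" "pw_poly T (k + 1) \<phi>" using \<phi> H2_0_H1_0 unfolding Sigma_0_iff by blast+
 fix e :: point assume e: "e \<in> Basis"
 have y: "ae_eq Om (wd (0, 1) \<phi>) (%x. 0)" and x: "ae_eq Om (%x. - wd (1, 0) \<phi> x) (%x. 0)"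
  using z unfolding vec_ae_eq_iff[of "curl Om \<phi>"] comp_curl comp_zero by blast+
 have "ae_eq Om (wd (1, 0) \<phi>) (%x. 0)" using x by (simp add: ae_eq_def)
 with y e show "ae_eq Om (wd e \<phi>) (%x. 0)" unfolding Basis_point by blast
qed

text \<open>The potential is \<open>C\<^sup>2\<close> at noncorner vertices because its gradient is given by the field, which is
\<open>C\<^sup>1\<close> there, and its values agree on common points of elements.\<close>

lemma divergence_kernel:
 assumes v: "v \<in> VV0" and z: "ae_eq Om (divergence Om v) (%x. 0)"
 shows "\<exists>\<phi>\<in>\<Sigma>0. ae_eq Om (curl Om \<phi>) v"
proof -
 let ?v1 = "fst \<circ> v" and ?v2 = "snd \<circ> v"
 have h: "?v1 \<in> H1_0 Om" "?v2 \<in> H1_0 Om" and pw: "pw_poly T k ?v1" "pw_poly T k ?v2"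
  and C: "\<forall>a\<in>NC. C_at 1 T ?v1 a" "\<forall>a\<in>NC. C_at 1 T ?v2 a" using v unfolding vec_V_0_iff V_0_iff by blast+
 have "dx (restr K ?v1) z + dy (restr K ?v2) z = 0" if K: "K \<in> T" for K z
  using fun_cong[OF restr_cong[OF z K], of z] unfolding divergence_restr(2)[OF v K] restr_zero[OF K] .
 then have d: "\<forall>K\<in>T. \<forall>z. dx (restr K ?v1) z + dy (restr K ?v2) z = 0" by simp
 obtain F where F: "F \<in> H2_0 Om" "pw_poly T (k + 1) F" "ae_eq Om (wd (1, 0) F) (%z. - ?v2 z)"
  "ae_eq Om (wd (0, 1) F) ?v1" "\<forall>K\<in>T. \<forall>L\<in>T. \<forall>z\<in>K \<inter> L. restr K F z = restr L F z"
  using divergence_free_potential[OF h(1) pw(1) h(2) pw(2) d] by (elim exE conjE)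
 note b = axis_directions
 have FH1: "F \<in> H1 Om" using F(1) H2_0_H1_0 H1_0_H1 by blast
 have neg: "(%z. - ?v2 z) = (%z. (-1) * ?v2 z + 0 * ?v2 z)" by simp
 have rx: "dx (restr K F) = restr K (%z. - ?v2 z)" if K: "K \<in> T" for K
  using weak_deriv_pw_poly(2)[OF FH1 F(2) b(1) K] restr_cong[OF F(3) K] by simp
 have ry: "dy (restr K F) = restr K ?v1" if K: "K \<in> T" for K
  using weak_deriv_pw_poly(2)[OF FH1 F(2) b(2) K] restr_cong[OF F(4) K] by simp
 have "C_at 2 T F a" if a: "a \<in> NC" for a
  unfolding C_at_def
 proof (intro ballI impI allI)
  fix K L and i j :: nat assume KL: "K \<in> T" "L \<in> T" "a extreme_point_of K" "a extreme_point_of L" and ij: "i + j \<le> 2"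
  have C1: "C_at 1 T ?v1 a" and C2: "C_at 1 T (%z. - ?v2 z) a"
   using bspec[OF C(1) a] C_at_linear[OF pw(2) bspec[OF C(2) a] pw(2) bspec[OF C(2) a], of "-1" 0] by simp_all
  show "partial i j (restr K F) a = partial i j (restr L F) a"
  proof (rule partial_cases[where r = 1])
   show "restr K F \<in> polys (k + 1)" "restr L F \<in> polys (k + 1)" by (rule restr_polys[OF F(2)]; fact KL)+
   have "a \<in> K \<inter> L" using KL(3,4) unfolding extreme_point_of_def by blast
   then show "restr K F a = restr L F a" using F(5) KL(1,2) by blast
   show "partial i j (dx (restr K F)) a = partial i j (dx (restr L F)) a" if "i + j \<le> 1" for i j
    unfolding rx[OF KL(1)] rx[OF KL(2)] by (rule C2[unfolded C_at_def, rule_format, OF KL that])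
   show "partial i j (dy (restr K F)) a = partial i j (dy (restr L F)) a" if "i + j \<le> 1" for i j
    unfolding ry[OF KL(1)] ry[OF KL(2)] by (rule C1[unfolded C_at_def, rule_format, OF KL that])
   show "i + j \<le> Suc 1" using ij by simp
  qed
 qed
 then have "F \<in> \<Sigma>0" unfolding Sigma_0_iff using F(1,2) by blast
 moreover have "ae_eq Om (curl Om F) v"
  unfolding vec_ae_eq_iff[of "curl Om F"] comp_curl
  using F(4) ae_eq_map[OF F(3), of uminus] by (simp add: o_def)
 ultimately show ?thesis by blast
qed

end

context fe_spaces begin

section \<open>The interior sequence\<close>

lemma partial_zero_at_vertex:
 assumes t: "triangle K a b c" and q: "q \<in> polys m" and z0: "\<forall>z\<in>frontier K. q z = 0"
  and x: "x extreme_point_of K" and ij: "i + j \<le> 1"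
 shows "partial i j q x = 0"
proof -
 have "x \<in> K" "x \<notin> interior K" using x extreme_point_not_in_interior[OF x] unfolding extreme_point_of_def by blast+
 then have "x \<in> frontier K" using compact_imp_closed[OF triangle_compact[OF t]] by (simp add: frontier_def)
 then have 0: "q x = 0" using z0 by simp
 consider "i = 0" "j = 0" | "i = 1" "j = 0" | "i = 0" "j = 1" using ij by linarith
 then show ?thesis
 proof cases
  case 1 then show ?thesis using 0 by (simp add: partial_0)
 next
  case 2 then show ?thesis using extreme_deriv_zero[OF t q z0 x, of "(1, 0)"] by (simp add: partial_def)
 next
  case 3 then show ?thesis using extreme_deriv_zero[OF t q z0 x, of "(0, 1)"] by (simp add: partial_def)
 qed
qed

lemma glue_restr:
 assumes p: "\<forall>K\<in>T. p K \<in> polys m" "\<forall>K\<in>T. \<forall>z\<in>frontier K. p K z = 0"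
 shows "pw_poly T m (glue p)" and "K \<in> T ==> restr K (glue p) = p K"
proof -
 have ae: "ae_eq K (glue p) (p K)" if K: "K \<in> T" for K
  unfolding ae_eq_element[OF K]
  by (rule AE_I2) (simp add: compatible_element[OF glue_compatible[OF p(2)] K subsetD[OF interior_subset]])
 show "pw_poly T m (glue p)" unfolding pw_poly_def using ae p(1) by blast
 show "restr K (glue p) = p K" if K: "K \<in> T" by (rule restr_eq[OF K bspec[OF p(1) K] ae[OF K]])
qed

lemma curl_V_I:
 assumes \<phi>: "\<phi> \<in> \<Sigma>I" shows "curl Om \<phi> \<in> VI"
 unfolding V_I_iff
proof (intro conjI ballI)
 have \<phi>0: "\<phi> \<in> \<Sigma>0" using \<phi> unfolding Sigma_I_iff by blast
 show "curl Om \<phi> \<in> VV0" by (rule curl_vec_V_0[OF \<phi>0])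
 fix K x assume K: "K \<in> T" and x: "x \<in> frontier K"
 show "restr K (fst \<circ> curl Om \<phi>) x = 0" "restr K (snd \<circ> curl Om \<phi>) x = 0"
  unfolding curl_restr(3)[OF \<phi>0 K] curl_restr(4)[OF \<phi>0 K]
  using bspec[OF bspec[OF conjunct2[OF \<phi>[unfolded Sigma_I_iff]] K] x] by simp_all
qed

text \<open>The mean over an element is a boundary integral, and at a vertex even the gradient of a field that
vanishes on the boundary of the element is zero.\<close>

lemma divergence_Q_I:
 assumes v: "v \<in> VI" shows "divergence Om v \<in> QI"
 unfolding Q_I_iff
proof (intro conjI ballI allI impI)
 have v0: "v \<in> VV0" using v unfolding V_I_iff by blast
 show q: "divergence Om v \<in> Q0" by (rule divergence_Q_0[OF v0])
 fix K assume K: "K \<in> T"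
 obtain a b c where t: "triangle K a b c" using triangles[OF K] by blast
 let ?p1 = "restr K (fst \<circ> v)" and ?p2 = "restr K (snd \<circ> v)"
 have p: "?p1 \<in> polys k" "?p2 \<in> polys k" using v0 restr_polys[OF _ K] unfolding vec_V_0_iff V_0_iff by blast+
 have z: "\<forall>x\<in>frontier K. ?p1 x = 0" "\<forall>x\<in>frontier K. ?p2 x = 0"
  using bspec[OF conjunct2[OF v[unfolded V_I_iff]] K] by simp_all
 have q': "pw_poly T (k - 1) (divergence Om v)" "divergence Om v \<in> L2 Om" using q unfolding Q_0_iff by blast+
 have "(LINT x|lebesgue_on K. divergence Om v x) = (LINT x|lebesgue_on K. dx ?p1 x + dy ?p2 x)"
  using integral_restr[OF q' K] unfolding divergence_restr(2)[OF v0 K] .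
 also have "\<dots> = (LINT x|lebesgue_on K. dx ?p1 x) + (LINT x|lebesgue_on K. dy ?p2 x)"
  by (intro Bochner_Integration.integral_add integrable_element[OF K] nice_continuous nice_dx nice_dy polys_nice[OF p(1)] polys_nice[OF p(2)])
 also have "\<dots> = 0"
  using integral_element_deriv_zero[OF K p(1) z(1), of "(1, 0)"] integral_element_deriv_zero[OF K p(2) z(2), of "(0, 1)"]
  by (simp add: Basis_point)
 finally show "(LINT x|lebesgue_on K. divergence Om v x) = 0" .
 show "restr K (divergence Om v) x = 0" if "x extreme_point_of K" for x
  unfolding divergence_restr(2)[OF v0 K]
  using extreme_deriv_zero[OF t p(1) z(1) that] extreme_deriv_zero[OF t p(2) z(2) that] by simp
qed

text \<open>The gradient of the potential vanishes on the boundary of each element, so there the potential is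
constant. Subtracting these constants elementwise and gluing gives a second function with the same
gradient and zero boundary values, hence the same function; so the constants are zero.\<close>

lemma divergence_kernel_interior:
 assumes v: "v \<in> VI" and z: "ae_eq Om (divergence Om v) (%x. 0)"
 shows "\<exists>\<phi>\<in>\<Sigma>I. ae_eq Om (curl Om \<phi>) v"
proof -
 have v0: "v \<in> VV0" using v unfolding V_I_iff by blast
 obtain \<phi> where \<phi>: "\<phi> \<in> \<Sigma>0" "ae_eq Om (curl Om \<phi>) v" using divergence_kernel[OF v0 z] by blast
 have pw: "pw_poly T (k + 1) \<phi>" using \<phi>(1) unfolding Sigma_0_iff by blast
 have g: "dx (restr K \<phi>) x = 0 \<and> dy (restr K \<phi>) x = 0" if K: "K \<in> T" and x: "x \<in> frontier K" for K x
 proof -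
  have "restr K (fst \<circ> curl Om \<phi>) = restr K (fst \<circ> v)" "restr K (snd \<circ> curl Om \<phi>) = restr K (snd \<circ> v)"
   using \<phi>(2) restr_cong[OF _ K] unfolding vec_ae_eq_iff[of "curl Om \<phi>"] by blast+
  then have "dy (restr K \<phi>) x = restr K (fst \<circ> v) x" "- dx (restr K \<phi>) x = restr K (snd \<circ> v) x"
   unfolding curl_restr(3)[OF \<phi>(1) K] curl_restr(4)[OF \<phi>(1) K] by (simp_all add: fun_eq_iff)
  then show ?thesis using bspec[OF bspec[OF conjunct2[OF v[unfolded V_I_iff]] K] x] by simp
 qed
 have "\<forall>K\<in>T. \<exists>c. \<forall>x\<in>frontier K. restr K \<phi> x = c"
 proof
  fix K assume K: "K \<in> T"
  obtain a b c where t: "triangle K a b c" using triangles[OF K] by blast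
  show "\<exists>c. \<forall>x\<in>frontier K. restr K \<phi> x = c"
   using frontier_constant[OF t restr_polys[OF pw K]] g[OF K] by blast
 qed
 then obtain c where c: "\<forall>K\<in>T. \<forall>x\<in>frontier K. restr K \<phi> x = c K" by (rule bchoice[THEN exE])
 define p where "p = (%K z. restr K \<phi> z - c K)"
 have p: "\<forall>K\<in>T. p K \<in> polys (k + 1)" unfolding p_def using restr_polys[OF pw] by (intro ballI polys_diff polys_const)
 have p0: "\<forall>K\<in>T. \<forall>z\<in>frontier K. p K z = 0" using c by (simp add: p_def)
 note r = glue_restr[OF p p0]
 have h: "glue p \<in> H1_0 Om" "\<phi> \<in> H1_0 Om" using glue_H1_0[OF p p0] H2_0_H1_0 \<phi>(1) unfolding Sigma_0_iff by blast+
 let ?d = "%x. 1 * glue p x + (-1) * \<phi> x"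
 have d: "?d \<in> H1_0 Om" "pw_poly T (k + 1) ?d" by (rule H1_0_linear[OF h], rule pw_poly_linear[OF r(1) pw])
 \<comment> \<open>Elementwise, the two functions differ by a constant.\<close>
 have "ae_eq Om ?d (%x. 0)"
 proof (rule H1_0_zero_grad[OF d])
  fix e :: point assume e: "e \<in> Basis"
  note w = weak_deriv_pw_poly[OF H1_0_H1[OF d(1)] d(2) e]
  have "restr K ?d = (%z. - c K)" if K: "K \<in> T" for K
   unfolding restr_linear[OF r(1) pw K] r(2)[OF K] by (simp add: p_def)
  then show "ae_eq Om (wd e ?d) (%x. 0)"
   unfolding ae_eq_restr_iff[OF w(1) pw_poly_zero] using w(2) restr_zero by (simp add: dir_deriv_const)
 qed
 then have "ae_eq Om \<phi> (glue p)" unfolding ae_eq_def by eventually_elim simp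
 then have "restr K \<phi> = p K" if "K \<in> T" for K using restr_cong[OF _ that] r(2)[OF that] by simp
 then have "\<phi> \<in> \<Sigma>I" unfolding Sigma_I_iff using \<phi>(1) g p0 by simp
 then show ?thesis using \<phi>(2) by blast
qed

text \<open>The bubble fields of the elements are glued; all derivatives up to order 1 vanish at the vertices,
which gives the required smoothness there.\<close>

lemma divergence_surjective_interior:
 assumes q: "q \<in> QI" shows "\<exists>v\<in>VI. ae_eq Om (divergence Om v) q"
proof -
 have pw: "pw_poly T (k - 1) q" and L: "q \<in> L2 Om" using q unfolding Q_I_iff Q_0_iff by blast+
 have bubble: "restr K q \<in> bubble_divergences k K" if K: "K \<in> T" for K
 proof (rule local_surjectivity[OF K degree restr_polys[OF pw K]])
  note z = bspec[OF conjunct2[OF q[unfolded Q_I_iff]] K]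
  show "\<forall>x. x extreme_point_of K --> restr K q x = 0" using z by blast
  show "(LINT x|lebesgue_on K. restr K q x) = 0" using z integral_restr[OF pw L K] by simp
 qed
 have "\<forall>K\<in>T. \<exists>w. fst w \<in> polys k \<and> snd w \<in> polys k \<and> (\<forall>z\<in>frontier K. fst w z = 0 \<and> snd w z = 0) \<and>
   (\<forall>z. dx (fst w) z + dy (snd w) z = restr K q z)"
 proof
  fix K assume K: "K \<in> T"
  obtain a b where "a \<in> polys k" "b \<in> polys k" "\<forall>z\<in>frontier K. a z = 0 \<and> b z = 0"
   "\<forall>z. dx a z + dy b z = restr K q z"
   using bubble[OF K] unfolding bubble_divergences_def by blast
  then show "\<exists>w. fst w \<in> polys k \<and> snd w \<in> polys k \<and> (\<forall>z\<in>frontier K. fst w z = 0 \<and> snd w z = 0) \<and>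
   (\<forall>z. dx (fst w) z + dy (snd w) z = restr K q z)"
   by (intro exI[of _ "(a, b)"]) simp
 qed
 then obtain w where w: "\<forall>K\<in>T. fst (w K) \<in> polys k \<and> snd (w K) \<in> polys k \<and> (\<forall>z\<in>frontier K. fst (w K) z = 0 \<and> snd (w K) z = 0) \<and>
   (\<forall>z. dx (fst (w K)) z + dy (snd (w K)) z = restr K q z)"
  by (rule bchoice[THEN exE])
 define w1 where "w1 = (%K. fst (w K))"
 define w2 where "w2 = (%K. snd (w K))"
 have w1: "\<forall>K\<in>T. w1 K \<in> polys k" "\<forall>K\<in>T. \<forall>z\<in>frontier K. w1 K z = 0"
  and w2: "\<forall>K\<in>T. w2 K \<in> polys k" "\<forall>K\<in>T. \<forall>z\<in>frontier K. w2 K z = 0"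
  using w by (simp_all add: w1_def w2_def)
 have V: "glue p \<in> V0" if p: "\<forall>K\<in>T. p K \<in> polys k" "\<forall>K\<in>T. \<forall>z\<in>frontier K. p K z = 0" for p
  unfolding V_0_iff
 proof (intro conjI ballI)
  show "glue p \<in> H1_0 Om" by (rule glue_H1_0[OF p])
  show "pw_poly T k (glue p)" by (rule glue_restr(1)[OF p])
  fix x assume "x \<in> NC"
  have zero: "partial i j (p K) x = 0" if K: "K \<in> T" and x: "x extreme_point_of K" and ij: "i + j \<le> 1" for K i j
  proof -
   obtain a b c where t: "triangle K a b c" using triangles[OF K] by blast
   show ?thesis by (rule partial_zero_at_vertex[OF t bspec[OF p(1) K] bspec[OF p(2) K] x ij])
  qed
  show "C_at 1 T (glue p) x" unfolding C_at_def
  proof (intro ballI impI allI)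
   fix K L and i j :: nat assume KL: "K \<in> T" "L \<in> T" "x extreme_point_of K" "x extreme_point_of L" and ij: "i + j \<le> 1"
   show "partial i j (restr K (glue p)) x = partial i j (restr L (glue p)) x"
    unfolding glue_restr(2)[OF p KL(1)] glue_restr(2)[OF p KL(2)] using zero[OF KL(1,3) ij] zero[OF KL(2,4) ij] by simp
  qed
 qed
 define v where "v = (%z. (glue w1 z, glue w2 z))"
 have v: "fst \<circ> v = glue w1" "snd \<circ> v = glue w2" by (auto simp: v_def)
 have v0: "v \<in> VV0" unfolding vec_V_0_iff v using V[OF w1] V[OF w2] by blast
 have "v \<in> VI" unfolding V_I_iff v
 proof (intro conjI ballI)
  fix K x assume K: "K \<in> T" and x: "x \<in> frontier K"
  show "restr K (glue w1) x = 0" "restr K (glue w2) x = 0"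
   unfolding glue_restr(2)[OF w1 K] glue_restr(2)[OF w2 K] using w1 w2 K x by blast+
 qed (rule v0)
 moreover have "ae_eq Om (divergence Om v) q"
  unfolding ae_eq_restr_iff[OF divergence_restr(1)[OF v0] pw]
 proof
  fix K assume K: "K \<in> T"
  show "restr K (divergence Om v) = restr K q"
   unfolding divergence_restr(2)[OF v0 K] v glue_restr(2)[OF w1 K] glue_restr(2)[OF w2 K]
   using bspec[OF w K] by (simp add: w1_def w2_def)
 qed
 ultimately show ?thesis by blast
qed

section \<open>Orthogonal decompositions and the exterior sequence\<close>

definition curl_form :: "(point => real) => (point => real) => real" where
 "curl_form \<phi> \<psi> = grad_inner Om (curl Om \<phi>) (curl Om \<psi>)"

lemma Sigma_E_iff: "\<phi> \<in> \<Sigma>E \<longleftrightarrow> \<phi> \<in> \<Sigma>0 \<and> (\<forall>\<psi>\<in>\<Sigma>I. curl_form \<phi> \<psi> = 0)"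
 unfolding Sigma_E_def curl_form_def by blast

lemma Q_E_iff: "q \<in> QE \<longleftrightarrow> q \<in> Q0 \<and> (\<forall>r\<in>QI. ip q r = 0)"
 unfolding Q_E_def by blast

lemma V_E_iff: "v \<in> VE \<longleftrightarrow> v \<in> VV0 \<and> divergence Om v \<in> QE \<and> (\<forall>\<psi>\<in>\<Sigma>I. grad_inner Om v (curl Om \<psi>) = 0)"
 unfolding V_E_def by blast

lemma Sigma_I_0: "\<phi> \<in> \<Sigma>I ==> \<phi> \<in> \<Sigma>0"
 unfolding Sigma_I_iff by blast

lemma V_I_0: "v \<in> VI ==> v \<in> VV0"
 unfolding V_I_iff by blast

lemma Q_I_0: "q \<in> QI ==> q \<in> Q0"
 unfolding Q_I_iff by blast

lemma Q_0_L2: "q \<in> Q0 ==> q \<in> L2 Om"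
 unfolding Q_0_iff by blast

lemma grad_inner_zero: "v \<in> vec_H1 ==> grad_inner Om (%x. 0) v = 0"
 using grad_inner_linear[of v v v 0 0] by simp

lemma vec_V_0_definite:
 assumes "v \<in> VV0" "grad_inner Om v v = 0" shows "ae_eq Om v (%x. 0)"
 using assms grad_inner_definite[of v k] unfolding vec_V_0_iff V_0_iff by blast

lemma curl_form_linear:
 assumes "\<phi> \<in> \<Sigma>0" "\<psi> \<in> \<Sigma>0" and v: "v \<in> vec_H1"
 shows "grad_inner Om (curl Om (%x. s * \<phi> x + t * \<psi> x)) v = s * grad_inner Om (curl Om \<phi>) v + t * grad_inner Om (curl Om \<psi>) v"
proof -
 note c = vec_V_0_H1[OF curl_vec_V_0[OF assms(1)]] vec_V_0_H1[OF curl_vec_V_0[OF assms(2)]]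
 show ?thesis
  using grad_inner_cong[OF curl_linear[OF Sigma_0_H1[OF assms(1)] Sigma_0_H1[OF assms(2)], of s t], of v]
   grad_inner_linear[OF c v, of s t] by simp
qed

lemma curl_form_semi_inner: "semi_inner Om \<Sigma>0 curl_form"
 unfolding semi_inner_def curl_form_def
proof (intro conjI ballI allI impI)
 show "fun_subspace \<Sigma>0" by (rule fun_subspaceI) (simp_all add: zero_spaces Sigma_0_linear)
 show "0 \<le> grad_inner Om (curl Om a) (curl Om a)" for a by (rule grad_inner_nonneg)
 show "grad_inner Om (curl Om a) (curl Om b) = grad_inner Om (curl Om b) (curl Om a)" for a b by (rule grad_inner_commute)
 fix a assume a: "a \<in> \<Sigma>0"
 note ca = vec_V_0_H1[OF curl_vec_V_0[OF a]]
 show "grad_inner Om (curl Om (%x. s * a x + t * b x)) (curl Om c) = s * grad_inner Om (curl Om a) (curl Om c) + t * grad_inner Om (curl Om b) (curl Om c)"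
  if "b \<in> \<Sigma>0" "c \<in> \<Sigma>0" for s t b c by (rule curl_form_linear[OF a that(1) vec_V_0_H1[OF curl_vec_V_0[OF that(2)]]])
 assume "ae_eq Om a (%x. 0)"
 then have "curl Om a = curl Om (%x. 0 * a x + 0 * a x)" using curl_cong by simp
 then show "grad_inner Om (curl Om a) (curl Om a) = 0" using curl_form_linear[OF a a ca, of 0 0] by simp
qed

lemma L2_inner_semi_inner: "semi_inner Om Q0 (ip)"
 unfolding semi_inner_def
proof (intro conjI ballI allI impI)
 show "fun_subspace Q0" by (rule fun_subspaceI) (simp_all add: zero_spaces Q_0_linear)
 show "0 \<le> ip a a" for a by (rule L2_inner_self_nonneg)
 show "ip a b = ip b a" for a b by (rule L2_inner_commute)
 fix a assume a: "a \<in> Q0"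
 show "ip (%x. s * a x + t * b x) c = s * ip a c + t * ip b c" if "b \<in> Q0" "c \<in> Q0" for s t b c
  using L2_inner_add_left[OF L2_cmul[OF Q_0_L2[OF a]] L2_cmul[OF Q_0_L2[OF that(1)]] Q_0_L2[OF that(2)], of s t]
  by (simp add: L2_inner_cmul_left)
 assume "ae_eq Om a (%x. 0)"
 then show "ip a a = 0"
  using L2_inner_cong[OF _ ae_eq_refl Q_0_L2[OF a] Q_0_L2[OF a], of "%x. 0"] by (simp add: L2_inner_zero)
qed

lemma subspaces:
 "fun_subspace \<Sigma>0" "fun_subspace \<Sigma>I" "fun_subspace \<Sigma>E" "fun_subspace VV0" "fun_subspace VI" "fun_subspace VE"
 "fun_subspace Q0" "fun_subspace QI" "fun_subspace QE"
proof -
 show "fun_subspace \<Sigma>0" by (rule fun_subspaceI) (simp_all add: zero_spaces Sigma_0_linear)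
 show "fun_subspace VV0" by (rule fun_subspaceI) (simp_all add: zero_spaces vec_V_0_linear)
 show "fun_subspace Q0" by (rule fun_subspaceI) (simp_all add: zero_spaces Q_0_linear)
 show "fun_subspace \<Sigma>I" by (rule fun_subspaceI) (simp_all add: zero_interior_spaces Sigma_I_linear)
 show "fun_subspace VI" by (rule fun_subspaceI) (simp_all add: zero_interior_spaces V_I_linear)
 show "fun_subspace QI" by (rule fun_subspaceI) (simp_all add: zero_interior_spaces Q_I_linear)
 have linQ: "ip (%x. s * f x + t * g x) r = s * ip f r + t * ip g r" if "f \<in> Q0" "g \<in> Q0" "r \<in> Q0" for s t f g r
  using L2_inner_semi_inner that unfolding semi_inner_def by blast
 show QE: "fun_subspace QE"
 proof (rule fun_subspaceI)
  show "(%x. 0) \<in> QE" unfolding Q_E_iff by (simp add: zero_spaces L2_inner_zero)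
  show "(%x. s *\<^sub>R f x + t *\<^sub>R g x) \<in> QE" if "f \<in> QE" "g \<in> QE" for s t f g
   using that Q_0_linear linQ Q_I_0 unfolding Q_E_iff by simp
 qed
 show "fun_subspace \<Sigma>E"
 proof (rule fun_subspaceI)
  have "curl_form (%x. 0 * (0::real) + 0 * 0) \<psi> = 0" if "\<psi> \<in> \<Sigma>I" for \<psi>
   unfolding curl_form_def using curl_form_linear[OF zero_spaces(1) zero_spaces(1) vec_V_0_H1[OF curl_vec_V_0[OF Sigma_I_0[OF that]]], of 0 0] by simp
  then show "(%x. 0) \<in> \<Sigma>E" unfolding Sigma_E_iff by (simp add: zero_spaces)
  show "(%x. s *\<^sub>R f x + t *\<^sub>R g x) \<in> \<Sigma>E" if "f \<in> \<Sigma>E" "g \<in> \<Sigma>E" for s t f g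
   using that Sigma_0_linear curl_form_linear[OF _ _ vec_V_0_H1[OF curl_vec_V_0[OF Sigma_I_0]]] unfolding Sigma_E_iff curl_form_def by simp
 qed
 show "fun_subspace VE"
 proof (rule fun_subspaceI)
  have H: "curl Om \<psi> \<in> vec_H1" if "\<psi> \<in> \<Sigma>I" for \<psi> by (rule vec_V_0_H1[OF curl_vec_V_0[OF Sigma_I_0[OF that]]])
  have comb: "(%x. s *\<^sub>R u x + t *\<^sub>R v x) \<in> VE" if u: "u \<in> VV0" "divergence Om u \<in> QE \<or> s = 0" "\<forall>\<psi>\<in>\<Sigma>I. grad_inner Om u (curl Om \<psi>) = 0 \<or> s = 0"
   and v: "v \<in> VV0" "divergence Om v \<in> QE \<or> t = 0" "\<forall>\<psi>\<in>\<Sigma>I. grad_inner Om v (curl Om \<psi>) = 0 \<or> t = 0" for s t u v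
  proof -
   let ?w = "%x. s *\<^sub>R u x + t *\<^sub>R v x"
   have w: "?w \<in> VV0" by (rule vec_V_0_linear[OF u(1) v(1)])
   have q: "divergence Om u \<in> Q0" "divergence Om v \<in> Q0" by (rule divergence_Q_0[OF u(1)], rule divergence_Q_0[OF v(1)])
   have "ip (divergence Om ?w) r = 0" if r: "r \<in> QI" for r
   proof -
    have "ip (divergence Om ?w) r = ip (%x. s * divergence Om u x + t * divergence Om v x) r"
     by (rule L2_inner_cong[OF divergence_linear[OF vec_V_0_H1[OF u(1)] vec_V_0_H1[OF v(1)]] ae_eq_refl
        Q_0_L2[OF divergence_Q_0[OF w]] Q_0_L2[OF Q_I_0[OF r]]])
    also have "\<dots> = 0" using linQ[OF q Q_I_0[OF r], of s t] u(2) v(2) r unfolding Q_E_iff by auto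
    finally show ?thesis .
   qed
   moreover have "grad_inner Om ?w (curl Om \<psi>) = 0" if \<psi>: "\<psi> \<in> \<Sigma>I" for \<psi>
    using grad_inner_linear[OF vec_V_0_H1[OF u(1)] vec_V_0_H1[OF v(1)] H[OF \<psi>], of s t] bspec[OF u(3) \<psi>] bspec[OF v(3) \<psi>] by auto
   ultimately show ?thesis unfolding V_E_iff Q_E_iff using w divergence_Q_0[OF w] by blast
  qed
  show "(%x. s *\<^sub>R u x + t *\<^sub>R v x) \<in> VE" if "u \<in> VE" "v \<in> VE" for s t u v
   by (rule comb) (use that in \<open>simp_all add: V_E_iff\<close>)
  show "(%x. 0) \<in> VE" using comb[OF zero_spaces(3) _ _ zero_spaces(3), of 0 0] by simp
 qed
qed

lemma curl_ae_linear:
 assumes "A \<subseteq> \<Sigma>0" "\<And>\<phi>. \<phi> \<in> A ==> curl Om \<phi> \<in> B" shows "ae_linear Om A (curl Om) B"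
 unfolding ae_linear_def
proof (intro conjI ballI allI impI)
 have h: "f \<in> H1 Om" if "f \<in> A" for f using Sigma_0_H1 assms(1) that by blast
 show "ae_eq Om (curl Om f) (curl Om g)" if "ae_eq Om f g" for f g using curl_cong[OF that] by (simp add: ae_eq_def)
 show "ae_eq Om (curl Om (%x. f x + g x)) (%x. curl Om f x + curl Om g x)" if "f \<in> A" "g \<in> A" for f g
  using curl_linear[OF h[OF that(1)] h[OF that(2)], of 1 1] by simp
 show "ae_eq Om (curl Om (%x. c *\<^sub>R f x)) (%x. c *\<^sub>R curl Om f x)" if "f \<in> A" for c f
  using curl_linear[OF h[OF that] h[OF that], of c 0] by simp
qed (rule assms(2))

lemma divergence_ae_linear:
 assumes "A \<subseteq> VV0" "\<And>v. v \<in> A ==> divergence Om v \<in> B" shows "ae_linear Om A (divergence Om) B"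
 unfolding ae_linear_def
proof (intro conjI ballI allI impI)
 have h: "f \<in> vec_H1" if "f \<in> A" for f using vec_V_0_H1 assms(1) that by blast
 show "ae_eq Om (divergence Om f) (divergence Om g)" if "ae_eq Om f g" for f g using divergence_cong[OF that] by (simp add: ae_eq_def)
 show "ae_eq Om (divergence Om (%x. f x + g x)) (%x. divergence Om f x + divergence Om g x)" if "f \<in> A" "g \<in> A" for f g
  using divergence_linear[OF h[OF that(1)] h[OF that(2)], of 1 1] by simp
 show "ae_eq Om (divergence Om (%x. c *\<^sub>R f x)) (%x. c *\<^sub>R divergence Om f x)" if "f \<in> A" for c f
  using divergence_linear[OF h[OF that] h[OF that], of c 0] by simp
qed (rule assms(2))

text \<open>The parts of exactness that all three rows share; the kernel and the surjectivity are left to each.\<close>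

lemma row_exact:
 assumes A: "A \<subseteq> \<Sigma>0" "fun_subspace A" and B: "B \<subseteq> VV0" "fun_subspace B" and C: "fun_subspace C"
  and curl: "\<And>\<phi>. \<phi> \<in> A ==> curl Om \<phi> \<in> B" and div: "\<And>v. v \<in> B ==> divergence Om v \<in> C"
  and kernel: "\<And>v. v \<in> B ==> ae_eq Om (divergence Om v) (%x. 0) ==> \<exists>\<phi>\<in>A. ae_eq Om (curl Om \<phi>) v"
  and surj: "\<And>q. q \<in> C ==> \<exists>v\<in>B. ae_eq Om (divergence Om v) q"
 shows "short_exact Om A (curl Om) B (divergence Om) C"
 unfolding short_exact_def
proof (intro conjI ballI impI A(2) B(2) C)
 show "ae_linear Om A (curl Om) B" by (rule curl_ae_linear[OF A(1) curl])
 show "ae_linear Om B (divergence Om) C" by (rule divergence_ae_linear[OF B(1) div])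
 show "ae_eq Om a (%x. 0)" if "a \<in> A" "ae_eq Om (curl Om a) (%x. 0)" for a
  by (rule curl_injective[OF subsetD[OF A(1) that(1)] that(2)])
 show "ae_eq Om (divergence Om b) (%x. 0) \<longleftrightarrow> (\<exists>a\<in>A. ae_eq Om (curl Om a) b)" if b: "b \<in> B" for b
 proof
  show "\<exists>a\<in>A. ae_eq Om (curl Om a) b" if "ae_eq Om (divergence Om b) (%x. 0)" by (rule kernel[OF b that])
  assume "\<exists>a\<in>A. ae_eq Om (curl Om a) b"
  then obtain a where a: "a \<in> A" "ae_eq Om (curl Om a) b" by blast
  show "ae_eq Om (divergence Om b) (%x. 0)" using divergence_curl[OF subsetD[OF A(1) a(1)]] divergence_cong[OF a(2)] by simp
 qed
 show "\<exists>b\<in>B. ae_eq Om (divergence Om b) c" if "c \<in> C" for c by (rule surj[OF that])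
qed

lemma Sigma_decomposition: "direct_sum Om \<Sigma>0 \<Sigma>I \<Sigma>E"
 unfolding direct_sum_def
proof (intro conjI ballI impI subspaces)
 show sub: "\<Sigma>I \<subseteq> \<Sigma>0" using Sigma_I_0 by blast
 show "\<Sigma>E \<subseteq> \<Sigma>0" unfolding Sigma_E_def by blast
 have pw: "\<forall>a\<in>\<Sigma>I. pw_poly T (k + 1) a" using Sigma_I_0 unfolding Sigma_0_iff by blast
 fix s assume s: "s \<in> \<Sigma>0"
 obtain r where r: "r \<in> \<Sigma>I" "\<forall>a\<in>\<Sigma>I. curl_form (%x. s x - r x) a = 0"
  using orthogonal_projection[OF curl_form_semi_inner sub subspaces(2) pw s] by blast
 have "(%x. s x - r x) \<in> \<Sigma>0" using Sigma_0_linear[OF s Sigma_I_0[OF r(1)], of 1 "-1"] by simp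
 then have e: "(%x. s x - r x) \<in> \<Sigma>E" unfolding Sigma_E_iff using r(2) by blast
 show "\<exists>a\<in>\<Sigma>I. \<exists>b\<in>\<Sigma>E. ae_eq Om s (%x. a x + b x)"
  by (rule bexI[OF _ r(1)], rule bexI[OF _ e]) (simp add: ae_eq_def)
next
 fix a b assume a: "a \<in> \<Sigma>I" and b: "b \<in> \<Sigma>E" and ab: "ae_eq Om a b"
 have "curl_form b a = 0" using a b unfolding Sigma_E_iff by blast
 then have "grad_inner Om (curl Om a) (curl Om a) = 0" using curl_cong[OF ab] by (simp add: curl_form_def)
 then show "ae_eq Om a (%x. 0)"
  using curl_injective[OF Sigma_I_0[OF a]] vec_V_0_definite[OF curl_vec_V_0[OF Sigma_I_0[OF a]]] by blast
qed

lemma Q_decomposition: "direct_sum Om Q0 QI QE"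
 unfolding direct_sum_def
proof (intro conjI ballI impI subspaces)
 show sub: "QI \<subseteq> Q0" using Q_I_0 by blast
 show "QE \<subseteq> Q0" unfolding Q_E_def by blast
 have pw: "\<forall>a\<in>QI. pw_poly T (k - 1) a" using Q_I_0 unfolding Q_0_iff by blast
 fix s assume s: "s \<in> Q0"
 obtain r where r: "r \<in> QI" "\<forall>a\<in>QI. ip (%x. s x - r x) a = 0"
  using orthogonal_projection[OF L2_inner_semi_inner sub subspaces(8) pw s] by blast
 have "(%x. s x - r x) \<in> Q0" using Q_0_linear[OF s Q_I_0[OF r(1)], of 1 "-1"] by simp
 then have e: "(%x. s x - r x) \<in> QE" unfolding Q_E_iff using r(2) by blast
 show "\<exists>a\<in>QI. \<exists>b\<in>QE. ae_eq Om s (%x. a x + b x)"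
  by (rule bexI[OF _ r(1)], rule bexI[OF _ e]) (simp add: ae_eq_def)
next
 fix a b assume a: "a \<in> QI" and b: "b \<in> QE" and ab: "ae_eq Om a b"
 have "ip b a = 0" using a b unfolding Q_E_iff by blast
 then have "ip a a = 0"
  using L2_inner_cong[OF ab ae_eq_refl Q_0_L2[OF Q_I_0[OF a]] Q_0_L2[OF Q_I_0[OF a]]] by simp
 then show "ae_eq Om a (%x. 0)" by (rule L2_norm_zero[OF Q_0_L2[OF Q_I_0[OF a]]])
qed

text \<open>An interior function whose curl has zero Dirichlet norm has zero curl, so the functional on the right
respects the degeneracy of the form.\<close>

lemma curl_projection:
 assumes w: "w \<in> VV0" shows "\<exists>\<psi>\<in>\<Sigma>I. \<forall>\<eta>\<in>\<Sigma>I. grad_inner Om (curl Om \<psi>) (curl Om \<eta>) = grad_inner Om w (curl Om \<eta>)"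
proof -
 have B: "semi_inner Om \<Sigma>I curl_form"
  using curl_form_semi_inner subspaces(2) Sigma_I_0 unfolding semi_inner_def by simp
 have "functional \<Sigma>I curl_form (%\<eta>. grad_inner Om (curl Om \<eta>) w)"
  unfolding functional_def
 proof (intro conjI ballI allI impI)
  show "grad_inner Om (curl Om (%x. s * a x + t * b x)) w = s * grad_inner Om (curl Om a) w + t * grad_inner Om (curl Om b) w"
   if "a \<in> \<Sigma>I" "b \<in> \<Sigma>I" for s t a b by (rule curl_form_linear[OF Sigma_I_0[OF that(1)] Sigma_I_0[OF that(2)] vec_V_0_H1[OF w]])
  show "grad_inner Om (curl Om a) w = 0" if "a \<in> \<Sigma>I" "curl_form a a = 0" for a
  proof -
   have "ae_eq Om (curl Om a) (%x. 0)" by (rule vec_V_0_definite[OF curl_vec_V_0[OF Sigma_I_0[OF that(1)]] that(2)[unfolded curl_form_def]])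
   then show ?thesis using grad_inner_cong grad_inner_zero[OF vec_V_0_H1[OF w]] by metis
  qed
 qed
 moreover have "\<forall>a\<in>\<Sigma>I. pw_poly T (k + 1) a" using Sigma_I_0 unfolding Sigma_0_iff by blast
 ultimately obtain \<psi> where "\<psi> \<in> \<Sigma>I" "\<forall>\<eta>\<in>\<Sigma>I. curl_form \<psi> \<eta> = grad_inner Om (curl Om \<eta>) w"
  using riesz_pw_poly[OF B] by blast
 then show ?thesis unfolding curl_form_def grad_inner_commute[of w] by blast
qed

lemma Q_I_Q_E_zero:
 assumes "q \<in> QI" "\<And>r. r \<in> QI ==> ip q r = 0" shows "ae_eq Om q (%x. 0)"
 by (rule L2_norm_zero[OF Q_0_L2[OF Q_I_0[OF assms(1)]] assms(2)[OF assms(1)]])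

text \<open>The divergence is split first. The interior part of it is lifted by the interior sequence, and the
curl of an interior function corrects the rest without a change of the divergence. For uniqueness, a
field in both spaces has a divergence in both spaces, so it is the curl of an interior function, to
which it is orthogonal.\<close>

lemma V_decomposition: "direct_sum Om VV0 VI VE"
 unfolding direct_sum_def
proof (intro conjI ballI impI subspaces)
 show "VI \<subseteq> VV0" using V_I_0 by blast
 show "VE \<subseteq> VV0" unfolding V_E_def by blast
 fix v assume v: "v \<in> VV0"
 obtain qi qe where q: "qi \<in> QI" "qe \<in> QE" "ae_eq Om (divergence Om v) (%x. qi x + qe x)"
  using Q_decomposition divergence_Q_0[OF v] unfolding direct_sum_def by blast
 obtain v1 where v1: "v1 \<in> VI" "ae_eq Om (divergence Om v1) qi" using divergence_surjective_interior[OF q(1)] by blast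
 define w where "w = (%x. 1 *\<^sub>R v x + (-1) *\<^sub>R v1 x)"
 have w: "w \<in> VV0" unfolding w_def by (rule vec_V_0_linear[OF v V_I_0[OF v1(1)]])
 obtain \<psi> where \<psi>: "\<psi> \<in> \<Sigma>I" "\<forall>\<eta>\<in>\<Sigma>I. grad_inner Om (curl Om \<psi>) (curl Om \<eta>) = grad_inner Om w (curl Om \<eta>)"
  using curl_projection[OF w] by blast
 note c = curl_V_I[OF \<psi>(1)]
 define a where "a = (%x. 1 *\<^sub>R v1 x + 1 *\<^sub>R curl Om \<psi> x)"
 define b where "b = (%x. 1 *\<^sub>R w x + (-1) *\<^sub>R curl Om \<psi> x)"
 have a: "a \<in> VI" unfolding a_def by (rule V_I_linear[OF v1(1) c])
 have b0: "b \<in> VV0" unfolding b_def by (rule vec_V_0_linear[OF w V_I_0[OF c]])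
 have "ae_eq Om (divergence Om b) qe"
  using divergence_linear[OF vec_V_0_H1[OF w] vec_V_0_H1[OF V_I_0[OF c]], of 1 "-1"]
   divergence_linear[OF vec_V_0_H1[OF v] vec_V_0_H1[OF V_I_0[OF v1(1)]], of 1 "-1"]
   divergence_curl[OF Sigma_I_0[OF \<psi>(1)]] q(3) v1(2)
  unfolding b_def[symmetric] w_def[symmetric] ae_eq_def by eventually_elim simp
 then have "ip (divergence Om b) r = 0" if r: "r \<in> QI" for r
  using L2_inner_cong[OF _ ae_eq_refl Q_0_L2[OF divergence_Q_0[OF b0]] Q_0_L2[OF Q_I_0[OF r]]] q(2) r unfolding Q_E_iff by metis
 moreover have "grad_inner Om b (curl Om \<eta>) = 0" if \<eta>: "\<eta> \<in> \<Sigma>I" for \<eta>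
  using grad_inner_linear[OF vec_V_0_H1[OF w] vec_V_0_H1[OF V_I_0[OF c]] vec_V_0_H1[OF V_I_0[OF curl_V_I[OF \<eta>]]], of 1 "-1"]
   bspec[OF \<psi>(2) \<eta>] unfolding b_def[symmetric] by simp
 ultimately have b: "b \<in> VE" unfolding V_E_iff Q_E_iff using b0 divergence_Q_0[OF b0] by blast
 show "\<exists>a\<in>VI. \<exists>b\<in>VE. ae_eq Om v (%x. a x + b x)"
  by (rule bexI[OF _ a], rule bexI[OF _ b]) (simp add: ae_eq_def a_def b_def w_def)
next
 fix a b assume a: "a \<in> VI" and b: "b \<in> VE" and ab: "ae_eq Om a b"
 have "divergence Om a \<in> QE" using b divergence_cong[OF ab] unfolding V_E_iff by simp
 then have "ae_eq Om (divergence Om a) (%x. 0)"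
  using Q_I_Q_E_zero[OF divergence_Q_I[OF a]] unfolding Q_E_iff by blast
 then obtain \<psi> where \<psi>: "\<psi> \<in> \<Sigma>I" "ae_eq Om (curl Om \<psi>) a" using divergence_kernel_interior[OF a] by blast
 have "grad_inner Om a a = grad_inner Om b (curl Om \<psi>)"
  using grad_inner_cong[OF ab, of a] grad_inner_cong_right[OF \<psi>(2), of b] by simp
 also have "\<dots> = 0" using b \<psi>(1) unfolding V_E_iff by blast
 finally show "ae_eq Om a (%x. 0)" by (rule vec_V_0_definite[OF V_I_0[OF a]])
qed

theorem full_row:
 assumes surj: "\<And>q. q \<in> Q0 ==> \<exists>v\<in>VV0. ae_eq Om (divergence Om v) q"
 shows "short_exact Om \<Sigma>0 (curl Om) VV0 (divergence Om) Q0"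
 by (rule row_exact[OF _ subspaces(1) _ subspaces(4) subspaces(7) curl_vec_V_0 divergence_Q_0 divergence_kernel surj]) simp_all

theorem interior_row: "short_exact Om \<Sigma>I (curl Om) VI (divergence Om) QI"
 by (rule row_exact[OF _ subspaces(2) _ subspaces(5) subspaces(8) curl_V_I divergence_Q_I divergence_kernel_interior divergence_surjective_interior])
  (use Sigma_I_0 V_I_0 in blast)+

text \<open>Potentials of exterior fields are exterior by the very definition of the spaces.\<close>

theorem exterior_row:
 assumes surj: "\<And>q. q \<in> Q0 ==> \<exists>v\<in>VV0. ae_eq Om (divergence Om v) q"
 shows "short_exact Om \<Sigma>E (curl Om) VE (divergence Om) QE"
proof (rule row_exact[OF _ subspaces(3) _ subspaces(6) subspaces(9)])
 show "\<Sigma>E \<subseteq> \<Sigma>0" "VE \<subseteq> VV0" unfolding Sigma_E_def V_E_def by blast+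
 show "divergence Om v \<in> QE" if "v \<in> VE" for v using that unfolding V_E_iff by blast
 show "curl Om \<phi> \<in> VE" if \<phi>: "\<phi> \<in> \<Sigma>E" for \<phi>
 proof -
  have \<phi>0: "\<phi> \<in> \<Sigma>0" and o: "\<forall>\<psi>\<in>\<Sigma>I. grad_inner Om (curl Om \<phi>) (curl Om \<psi>) = 0"
   using \<phi> unfolding Sigma_E_iff curl_form_def by blast+
  note c = curl_vec_V_0[OF \<phi>0]
  have "ip (divergence Om (curl Om \<phi>)) r = 0" if "r \<in> QI" for r
   using L2_inner_cong[OF divergence_curl[OF \<phi>0] ae_eq_refl Q_0_L2[OF divergence_Q_0[OF c]] Q_0_L2[OF Q_I_0[OF that]]]
   by (simp add: L2_inner_zero)
  then show ?thesis unfolding V_E_iff Q_E_iff using c o divergence_Q_0[OF c] by blast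
 qed
 show "\<exists>\<phi>\<in>\<Sigma>E. ae_eq Om (curl Om \<phi>) v" if v: "v \<in> VE" and z: "ae_eq Om (divergence Om v) (%x. 0)" for v
 proof -
  have v0: "v \<in> VV0" using v unfolding V_E_iff by blast
  obtain \<phi> where \<phi>: "\<phi> \<in> \<Sigma>0" "ae_eq Om (curl Om \<phi>) v" using divergence_kernel[OF v0 z] by blast
  have "grad_inner Om (curl Om \<phi>) (curl Om \<psi>) = 0" if "\<psi> \<in> \<Sigma>I" for \<psi>
   using grad_inner_cong[OF \<phi>(2), of "curl Om \<psi>"] v that unfolding V_E_iff by simp
  then have "\<phi> \<in> \<Sigma>E" unfolding Sigma_E_iff curl_form_def using \<phi>(1) by blast
  then show ?thesis using \<phi>(2) by blast
 qed
 show "\<exists>v\<in>VE. ae_eq Om (divergence Om v) q" if q: "q \<in> QE" for q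
 proof -
  have q0: "q \<in> Q0" using q unfolding Q_E_iff by blast
  obtain v where v: "v \<in> VV0" "ae_eq Om (divergence Om v) q" using surj[OF q0] by blast
  obtain a b where ab: "a \<in> VI" "b \<in> VE" "ae_eq Om v (%x. a x + b x)" using V_decomposition v(1) unfolding direct_sum_def by blast
  have b0: "b \<in> VV0" and dbE: "divergence Om b \<in> QE" using ab(2) unfolding V_E_iff by blast+
  note qa = divergence_Q_I[OF ab(1)]
  have "ae_eq Om (divergence Om (%x. 1 *\<^sub>R a x + 1 *\<^sub>R b x)) (%x. 1 * divergence Om a x + 1 * divergence Om b x)"
   by (rule divergence_linear[OF vec_V_0_H1[OF V_I_0[OF ab(1)]] vec_V_0_H1[OF b0]])
  then have sum: "ae_eq Om (divergence Om v) (%x. divergence Om a x + divergence Om b x)"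
   using divergence_cong[OF ab(3)] by simp
  have da: "ae_eq Om (divergence Om a) (%x. 1 * q x + (-1) * divergence Om b x)"
   using sum v(2) unfolding ae_eq_def by eventually_elim simp
  have "ip (divergence Om a) r = 0" if r: "r \<in> QI" for r
  proof -
   have "(%x. 1 *\<^sub>R q x + (-1) *\<^sub>R divergence Om b x) \<in> QE"
    using fun_subspace_combination[OF subspaces(9) q dbE, of 1 "-1"] by simp
   then have "ip (%x. 1 * q x + (-1) * divergence Om b x) r = 0" using r unfolding Q_E_iff by simp
   then show ?thesis using L2_inner_cong[OF da ae_eq_refl Q_0_L2[OF Q_I_0[OF qa]] Q_0_L2[OF Q_I_0[OF r]]] by simp
  qed
  then have "ae_eq Om (divergence Om a) (%x. 0)" by (rule Q_I_Q_E_zero[OF qa])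
  then have "ae_eq Om (divergence Om b) q" using sum v(2) unfolding ae_eq_def by eventually_elim simp
  then show ?thesis using ab(2) by blast
 qed
qed

end

theorem theorem3p5:
  fixes \<Omega> :: "point set" and vs :: "point list" and T :: "point set set"
    and \<kappa> \<beta> :: real and k :: nat
  assumes "polygon \<Omega> vs" and "simply_connected \<Omega>"
    and "\<kappa> > 0" and "mesh \<Omega> \<kappa> T" and "corner_split \<Omega> T"
    and "k \<ge> 4"
    and "0 < \<beta>" and "\<beta> < 1"
    and inf_sup: "\<And>q. q \<in> Q_0 \<Omega> vs T k \<Longrightarrow>
      \<exists>v \<in> vec_V_0 \<Omega> vs T k. ae_eq \<Omega> (divergence \<Omega> v) q \<and>
        vec_H1_norm \<Omega> v \<le> inverse \<beta> * L2_norm \<Omega> q"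
  shows
    "short_exact \<Omega> (Sigma_0 \<Omega> vs T k) (curl \<Omega>) (vec_V_0 \<Omega> vs T k) (divergence \<Omega>) (Q_0 \<Omega> vs T k)
   \<and> short_exact \<Omega> (Sigma_I \<Omega> vs T k) (curl \<Omega>) (V_I \<Omega> vs T k) (divergence \<Omega>) (Q_I \<Omega> vs T k)
   \<and> short_exact \<Omega> (Sigma_E \<Omega> vs T k) (curl \<Omega>) (V_E \<Omega> vs T k) (divergence \<Omega>) (Q_E \<Omega> vs T k)
   \<and> direct_sum \<Omega> (Sigma_0 \<Omega> vs T k) (Sigma_I \<Omega> vs T k) (Sigma_E \<Omega> vs T k)
   \<and> direct_sum \<Omega> (vec_V_0 \<Omega> vs T k) (V_I \<Omega> vs T k) (V_E \<Omega> vs T k)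
   \<and> direct_sum \<Omega> (Q_0 \<Omega> vs T k) (Q_I \<Omega> vs T k) (Q_E \<Omega> vs T k)"
proof -
  interpret mesh_domain \<Omega> T by (rule polygon_mesh_domain[OF assms(1,4)])
  interpret fe_spaces \<Omega> T vs k by unfold_locales (use \<open>k \<ge> 4\<close> in simp)
  have surj: "\<exists>v \<in> vec_V_0 \<Omega> vs T k. ae_eq \<Omega> (divergence \<Omega> v) q" if "q \<in> Q_0 \<Omega> vs T k" for q
    using inf_sup[OF that] by blast
  show ?thesis
    using full_row[OF surj] interior_row exterior_row[OF surj] Sigma_decomposition V_decomposition Q_decomposition by blast
qed

end
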